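(* For each CSP template $T$, there is a signed graph $(H,\Pi)$ such that the decision problems $\textsc{ec-Hom}(H,\Pi)$ and $\textsc{Csp}(T)$ are polynomially equivalent. Moreover, $(H,\Pi)$ can be chosen so that $H$ is bipartite and $(H,\Pi)$ admits an ec-homomorphism to an alternating path.
   Context: A vocabulary is a finite set of pairs $(R_i,a_i)$ of relation names and arities. A relational structure $S$ over it consists of a finite domain $V(S)$ together with a relation $R_i\subseteq V(S)^{a_i}$ for each relation name. A homomorphism $S\to T$ between structures over the same vocabulary is a map $V(S)\to V(T)$ sending each tuple of each relation $R_i$ of $S$ to a tuple of $R_i$ in $T$. A CSP template is a fixed relational structure $T$; $\textsc{Csp}(T)$ is the decision problem: given a relational structure $S$ over the same vocabulary as $T$, does $S\to T$ hold? A signed graph $(G,\Sigma)$ is a finite undirected graph $G$ (loops allowed) in which every edge has a sign $+$ or $-$; $\Sigma\subseteq E(G)$ is the set of negative edges. Multiple edges of the same sign are not allowed, but two vertices may be joined by both a positive and a negative edge. An ec-homomorphism of $(G,\Sigma)$ to $(H,\Pi)$ is a map $\varphi:V(G)\to V(H)$ such that for every edge $e$ between $x$ and $y$ in $(G,\Sigma)$ there is an edge of the same sign between $\varphi(x)$ and $\varphi(y)$ in $(H,\Pi)$. For a fixed signed graph $(H,\Pi)$, $\textsc{ec-Hom}(H,\Pi)$ is the decision problem: given a signed graph $(G,\Sigma)$, is there an ec-homomorphism of $(G,\Sigma)$ to $(H,\Pi)$? An alternating path is a signed path whose consecutive edges alternate between negative and positive. Two decision problems are polynomially equivalent if each is polynomial-time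 (Turing) reducible to the other. *)

theory Defs
  imports "HOL-Computational_Algebra.Polynomial"
begin

section \<open>Relational structures\<close>

text \<open>
  A relation symbol is a pair \<open>(r, a)\<close> of a relation name and its arity. Names are natural
  numbers, so that instances can be written down as words. Arity \<open>0\<close> and the empty domain are allowed.
\<close>

type_synonym vocabulary = "(nat \<times> nat) set"

record 'a rel_structure =
  univ :: "'a set"
  rel :: "nat \<times> nat \<Rightarrow> 'a list set"

definition is_structure :: "vocabulary \<Rightarrow> 'a rel_structure \<Rightarrow> bool" where
  "is_structure \<tau> S \<longleftrightarrow> finite (univ S) \<and>
     (\<forall>(r, a)\<in>\<tau>. rel S (r, a) \<subseteq> {t. length t = a \<and> set t \<subseteq> univ S})"

definition structure_hom ::
    "vocabulary \<Rightarrow> 'a rel_structure \<Rightarrow> 'b rel_structure \<Rightarrow> ('a \<Rightarrow> 'b) \<Rightarrow> bool" where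
  "structure_hom \<tau> S T h \<longleftrightarrow> h ` univ S \<subseteq> univ T \<and>
     (\<forall>\<sigma>\<in>\<tau>. \<forall>t\<in>rel S \<sigma>. map h t \<in> rel T \<sigma>)"


section \<open>Signed graphs\<close>

text \<open>
  An edge is an unordered pair \<open>{x, y}\<close> (a loop if \<open>x = y\<close>) together with its sign. As the edges
  form a set, there is at most one edge of each sign between two vertices, but there may be
  one of each sign.
\<close>

datatype sign = Pos | Neg

record 'v signed_graph =
  verts :: "'v set"
  edges :: "('v set \<times> sign) set"

definition is_signed_graph :: "'v signed_graph \<Rightarrow> bool" where
  "is_signed_graph G \<longleftrightarrow> finite (verts G) \<and>
     (\<forall>(e, s)\<in>edges G. \<exists>x\<in>verts G. \<exists>y\<in>verts G. e = {x, y})"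

definition ec_hom :: "'v signed_graph \<Rightarrow> 'w signed_graph \<Rightarrow> ('v \<Rightarrow> 'w) \<Rightarrow> bool" where
  "ec_hom G H \<phi> \<longleftrightarrow> \<phi> ` verts G \<subseteq> verts H \<and>
     (\<forall>x y s. ({x, y}, s) \<in> edges G \<longrightarrow> ({\<phi> x, \<phi> y}, s) \<in> edges H)"

definition bipartite :: "'v signed_graph \<Rightarrow> bool" where
  "bipartite G \<longleftrightarrow> (\<exists>A B. A \<union> B = verts G \<and> A \<inter> B = {} \<and>
     (\<forall>(e, s)\<in>edges G. \<exists>x\<in>A. \<exists>y\<in>B. e = {x, y}))"

definition alternating_path :: "'v signed_graph \<Rightarrow> bool" where
  "alternating_path P \<longleftrightarrow> (\<exists>vs sg. vs \<noteq> [] \<and> distinct vs \<and> verts P = set vs \<and>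
     edges P = {({vs ! i, vs ! Suc i}, sg i) | i. Suc i < length vs} \<and>
     (\<forall>i. Suc (Suc i) < length vs \<longrightarrow> sg i \<noteq> sg (Suc i)))"


section \<open>Decision problems as languages\<close>

text \<open>
  Inputs are binary words; a word that does not encode an instance is a no-instance. Instances have
  domain (vertex set) \<open>{0, ..., n-1}\<close>, which covers every finite structure up to isomorphism.
  An instance is given by \<open>n\<close> followed by an enumeration of its tuples (edges), in any order and
  possibly with repetitions. All numbers are written in unary; as they are smaller than \<open>n\<close> or
  bounded in terms of the fixed vocabulary, the length of an encoding is polynomially related to the
  size of the instance. The problems below impose the side conditions under which an encoding
  determines the instance.
\<close>

type_synonym language = "bool list set"

definition encode_nats :: "nat list \<Rightarrow> bool list" where
  "encode_nats ns = concat (map (\<lambda>n. replicate n True @ [False]) ns)"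

definition encodes_structure :: "vocabulary \<Rightarrow> bool list \<Rightarrow> nat rel_structure \<Rightarrow> bool" where
  "encodes_structure \<tau> w S \<longleftrightarrow> (\<exists>n ts. univ S = {..<n} \<and>
     set ts = {(r, t). (r, length t) \<in> \<tau> \<and> t \<in> rel S (r, length t)} \<and>
     w = encode_nats (n # concat (map (\<lambda>(r, t). r # length t # t) ts)))"

definition encodes_signed_graph :: "bool list \<Rightarrow> nat signed_graph \<Rightarrow> bool" where
  "encodes_signed_graph w G \<longleftrightarrow> (\<exists>n es. verts G = {..<n} \<and>
     edges G = (\<lambda>(x, y, s). ({x, y}, s)) ` set es \<and>
     w = encode_nats (n # concat (map (\<lambda>(x, y, s). [x, y, case s of Pos \<Rightarrow> 0 | Neg \<Rightarrow> 1]) es)))"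

definition CSP :: "vocabulary \<Rightarrow> 'a rel_structure \<Rightarrow> language" where
  "CSP \<tau> T = {w. \<exists>S. is_structure \<tau> S \<and> encodes_structure \<tau> w S \<and> (\<exists>h. structure_hom \<tau> S T h)}"

definition ec_Hom :: "'v signed_graph \<Rightarrow> language" where
  "ec_Hom H = {w. \<exists>G. is_signed_graph G \<and> encodes_signed_graph w G \<and> (\<exists>\<phi>. ec_hom G H \<phi>)}"


section \<open>Oracle Turing machines and polynomial-time Turing reductions\<close>

text \<open>
  Deterministic multitape oracle Turing machines with two-way infinite tapes. Tape \<open>0\<close> holds the
  input and tape \<open>1\<close> is the oracle tape; all tapes can be read and written.
\<close>

datatype symbol = Blank | Bit bool | Extra nat

datatype move = Go_Left | Stay | Go_Right

record oracle_tm =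
  num_tapes :: nat
  states :: "nat set"
  alphabet :: "symbol set"
  q_start :: nat
  q_accept :: nat
  q_reject :: nat
  q_query :: nat
  q_yes :: nat
  q_no :: nat
  delta :: "nat \<Rightarrow> symbol list \<Rightarrow> nat \<times> (symbol \<times> move) list"

definition is_oracle_tm :: "oracle_tm \<Rightarrow> bool" where
  "is_oracle_tm M \<longleftrightarrow> 2 \<le> num_tapes M \<and> finite (states M) \<and> finite (alphabet M) \<and>
     {q_start M, q_accept M, q_reject M, q_query M, q_yes M, q_no M} \<subseteq> states M \<and>
     q_accept M \<noteq> q_reject M \<and> q_query M \<notin> {q_accept M, q_reject M} \<and>
     {Blank, Bit False, Bit True} \<subseteq> alphabet M \<and>
     (\<forall>q\<in>states M. \<forall>xs. length xs = num_tapes M \<and> set xs \<subseteq> alphabet M \<longrightarrow>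
        (case delta M q xs of (q', acts) \<Rightarrow>
           q' \<in> states M \<and> length acts = num_tapes M \<and> fst ` set acts \<subseteq> alphabet M))"

text \<open>A tape is its contents together with the head position.\<close>

type_synonym tape = "(int \<Rightarrow> symbol) \<times> int"

type_synonym config = "nat \<times> tape list"

fun head_symbol :: "tape \<Rightarrow> symbol" where
  "head_symbol (f, p) = f p"

fun act :: "symbol \<times> move \<Rightarrow> tape \<Rightarrow> tape" where
  "act (x, m) (f, p) =
     (f(p := x), case m of Go_Left \<Rightarrow> p - 1 | Stay \<Rightarrow> p | Go_Right \<Rightarrow> p + 1)"

text \<open>The word queried is the one starting in cell \<open>0\<close> and ending before the first blank.\<close>

fun holds_word :: "tape \<Rightarrow> bool list \<Rightarrow> bool" where
  "holds_word (f, p) w \<longleftrightarrow> (\<forall>i<length w. f (int i) = Bit (w ! i)) \<and> f (int (length w)) = Blank"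

fun step :: "oracle_tm \<Rightarrow> language \<Rightarrow> config \<Rightarrow> config" where
  "step M B (q, ts) =
     (if q \<in> {q_accept M, q_reject M} then (q, ts)
      else if q = q_query M then
        (if \<exists>w\<in>B. holds_word (ts ! 1) w then q_yes M else q_no M, ts)
      else (case delta M q (map head_symbol ts) of (q', acts) \<Rightarrow> (q', map2 act acts ts)))"

definition blank_tape :: tape where
  "blank_tape = (\<lambda>_. Blank, 0)"

definition input_tape :: "bool list \<Rightarrow> tape" where
  "input_tape w = (\<lambda>i. if 0 \<le> i \<and> nat i < length w then Bit (w ! nat i) else Blank, 0)"

definition init_config :: "oracle_tm \<Rightarrow> bool list \<Rightarrow> config" where
  "init_config M w = (q_start M, input_tape w # replicate (num_tapes M - 1) blank_tape)"

text \<open>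
  Halting configurations are fixed points of \<^const>\<open>step\<close>, so the state reached after \<open>poly p (length w)\<close>
  steps is the verdict of a computation that has halted within that many steps.
\<close>

definition poly_turing_reducible :: "language \<Rightarrow> language \<Rightarrow> bool" where
  "poly_turing_reducible A B \<longleftrightarrow> (\<exists>M. \<exists>p :: nat poly. is_oracle_tm M \<and>
     (\<forall>w. fst ((step M B ^^ poly p (length w)) (init_config M w)) =
            (if w \<in> A then q_accept M else q_reject M)))"

definition poly_equivalent :: "language \<Rightarrow> language \<Rightarrow> bool" where
  "poly_equivalent A B \<longleftrightarrow> poly_turing_reducible A B \<and> poly_turing_reducible B A"

end

theory Submission
  imports Defs "HOL-Library.FuncSet"
begin

text \<open>
  The vertices at the bottom of \<open>H\<close> are the elements \<open>t\<close> of \<open>T\<close>, those at the top the families \<open>r\<close>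
  with one tuple from each nonempty relation; every pair \<open>(t, r)\<close> is joined by a ladder whose edges
  alternate in sign from level to level, so that mapping a vertex to its level is a homomorphism to an
  alternating path. A ladder has a chord on the level belonging to the \<open>p\<close>-th entry of the
  relation \<open>\<sigma>\<close> only if that entry of \<open>r \<sigma>\<close> is \<open>t\<close>. An instance of \<open>Csp(T)\<close> becomes a graph in which
  each tuple is a top vertex joined to its entries by ladders having all chords but those of the other
  positions: such a ladder has to be mapped onto a ladder of \<open>H\<close>, and its chord says that the entry is right.

  Conversely, let \<open>G\<close> be a graph. As signs alternate, the level of one vertex determines the levels in its
  component, and the neighbours of a vertex determine which kind of node it may be mapped to. What
  remains is to choose \<open>t\<close> and \<open>r\<close> for each vertex: along the edges some of the unknown elements and
  entries coincide, and the entries have to form tuples of \<open>T\<close>. This is one query to \<open>Csp(T)\<close> for each vertex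
  of \<open>G\<close> and each of the constantly many levels; the classes of equal unknowns are found by propagating
  labels along edges.
\<close>

section \<open>Structured programs for oracle Turing machines\<close>

text \<open>In each gap between two levels a ladder carries the zigzag \<open>Both\<close>,
  \<open>Down\<close>, \<open>Up\<close>, \<open>Both\<close> known from encodings of constraint
  problems in balanced digraphs: three edges of one sign, with the chord as a shortcut between the
  ends. The zigzag is present in every gap and binds a ladder to a single ladder of the target; a
  chord can only go to a chord, and so tests one entry. Signed graphs lack the orientation on which
  such encodings rest. Alternation replaces it: at a known level the sign of an edge tells whether
  it goes up or down.

  Polynomial time refers to a concrete multitape model. Both reductions are therefore written in a
  loop language that is compiled, through structured programs with a continuation stack, into oracle
  machines. As the language has hardly any arithmetic, comparisons and products become array lookups
  and repeated unary output.

  Empty domains, empty relations and arity 0 are genuine cases: they are why symbols with an empty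
  relation are set apart and why an empty domain has to become a graph without vertices.\<close>

datatype 'r wcom =
    WAct nat "'r \<Rightarrow> symbol \<Rightarrow> 'r \<times> symbol \<times> move"
  | WSeq "'r wcom" "'r wcom"
  | WIf nat "'r \<Rightarrow> symbol \<Rightarrow> bool" "'r wcom" "'r wcom"
  | WWhile nat "'r \<Rightarrow> symbol \<Rightarrow> bool" "'r wcom"
  | WAsk "'r \<Rightarrow> bool \<Rightarrow> 'r"

text \<open>The counter is the exact number of steps of the compiled machine, hence the unit charged
  for every test and every composition: it pays for a change of the control state.\<close>

inductive wexec :: "language \<Rightarrow> 'r wcom \<Rightarrow> 'r \<times> tape list \<Rightarrow> nat \<Rightarrow> 'r \<times> tape list \<Rightarrow> bool"
  for Q :: language where
  WAct: "g r (head_symbol (ts ! i)) = (r', x, m) \<Longrightarrow> i < length ts \<Longrightarrow>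
    wexec Q (WAct i g) (r, ts) 1 (r', ts[i := act (x, m) (ts ! i)])"
| WSeq: "wexec Q a s n s' \<Longrightarrow> wexec Q b s' m s'' \<Longrightarrow> wexec Q (WSeq a b) s (Suc (n + m)) s''"
| WIfT: "P r (head_symbol (ts ! i)) \<Longrightarrow> i < length ts \<Longrightarrow> wexec Q a (r, ts) n s' \<Longrightarrow>
    wexec Q (WIf i P a b) (r, ts) (Suc n) s'"
| WIfF: "\<not> P r (head_symbol (ts ! i)) \<Longrightarrow> i < length ts \<Longrightarrow> wexec Q b (r, ts) n s' \<Longrightarrow>
    wexec Q (WIf i P a b) (r, ts) (Suc n) s'"
| WWhileF: "\<not> P r (head_symbol (ts ! i)) \<Longrightarrow> i < length ts \<Longrightarrow>
    wexec Q (WWhile i P c) (r, ts) 1 (r, ts)"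
| WWhileT: "P r (head_symbol (ts ! i)) \<Longrightarrow> i < length ts \<Longrightarrow> wexec Q c (r, ts) n s' \<Longrightarrow>
    wexec Q (WWhile i P c) s' m s'' \<Longrightarrow> wexec Q (WWhile i P c) (r, ts) (Suc (n + m)) s''"
| WAsk: "head_symbol (ts ! 2) = Blank \<Longrightarrow> 2 < length ts \<Longrightarrow>
    wexec Q (WAsk h) (r, ts) 3 (h r (\<exists>w\<in>Q. holds_word (ts ! 1) w), ts)"

text \<open>Writing back the symbol just read is always allowed: the alphabet of the machine is
  larger than \<open>Al\<close>, and an action has to cope with each of its symbols.\<close>

fun wf_wcom :: "nat \<Rightarrow> 'r set \<Rightarrow> symbol set \<Rightarrow> 'r wcom \<Rightarrow> bool" where
  "wf_wcom k R Al (WAct i g) \<longleftrightarrow> i < k \<and>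
     (\<forall>r\<in>R. \<forall>x. fst (g r x) \<in> R \<and> fst (snd (g r x)) \<in> insert x Al)"
| "wf_wcom k R Al (WSeq a b) \<longleftrightarrow> wf_wcom k R Al a \<and> wf_wcom k R Al b"
| "wf_wcom k R Al (WIf i P a b) \<longleftrightarrow> i < k \<and> wf_wcom k R Al a \<and> wf_wcom k R Al b"
| "wf_wcom k R Al (WWhile i P c) \<longleftrightarrow> i < k \<and> wf_wcom k R Al c"
| "wf_wcom k R Al (WAsk h) \<longleftrightarrow> (\<forall>r\<in>R. \<forall>b. h r b \<in> R)"

lemma wexec_register:
  "wexec Q c s n s' \<Longrightarrow> wf_wcom k R Al c \<Longrightarrow> fst s \<in> R \<Longrightarrow> fst s' \<in> R"
proof (induction rule: wexec.induct)
  case (WAct g r ts i r' x m)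
  from WAct.prems have "\<forall>x. fst (g r x) \<in> R" by simp
  then show ?case using WAct.hyps(1) by (metis fst_conv)
qed auto

text \<open>
  The control states are the continuation stacks of a program; only finitely many of them occur.
\<close>

fun conts :: "'r wcom \<Rightarrow> 'r wcom list \<Rightarrow> 'r wcom list set" where
  "conts (WAct i g) k = {WAct i g # k}"
| "conts (WSeq a b) k = insert (WSeq a b # k) (conts a (b # k) \<union> conts b k)"
| "conts (WIf i P a b) k = insert (WIf i P a b # k) (conts a k \<union> conts b k)"
| "conts (WWhile i P c) k = insert (WWhile i P c # k) (conts c (WWhile i P c # k))"
| "conts (WAsk h) k = {WAsk h # k}"

lemma finite_conts: "finite (conts c k)"
  by (induction c k rule: conts.induct) auto

lemma conts_self: "c # k \<in> conts c k"
  by (cases c) auto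

lemma conts_wf: "s \<in> conts c k \<Longrightarrow> wf_wcom n R Al c \<Longrightarrow> list_all (wf_wcom n R Al) k \<Longrightarrow>
    list_all (wf_wcom n R Al) s"
  by (induction c k arbitrary: s rule: conts.induct) auto

text \<open>Successors regardless of the data: both outcomes of a test are listed, so closure of
  \<open>conts\<close> under \<open>succs\<close> confines the control to finitely many
  stacks.\<close>

fun succs :: "'r wcom list \<Rightarrow> 'r wcom list set" where
  "succs [] = {}"
| "succs (WAct i g # k) = {k}"
| "succs (WSeq a b # k) = {a # b # k}"
| "succs (WIf i P a b # k) = {a # k, b # k}"
| "succs (WWhile i P c # k) = {k, c # WWhile i P c # k}"
| "succs (WAsk h # k) = {k}"

lemma conts_succs: "s \<in> conts c k \<Longrightarrow> t \<in> succs s \<Longrightarrow> t \<in> insert k (conts c k)"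
proof (induction c k arbitrary: s t rule: conts.induct)
  case (2 a b k)
  then show ?case using conts_self[of a "b # k"] conts_self[of b k] by auto
next
  case (3 i P a b k)
  then show ?case using conts_self[of a k] conts_self[of b k] by auto
next
  case (4 i P c k)
  then show ?case using conts_self[of c "WWhile i P c # k"] by auto
qed auto

type_synonym 'r wstate = "'r wcom list \<times> 'r"

definition wstates :: "'r wcom \<Rightarrow> 'r set \<Rightarrow> 'r wstate set" where
  "wstates c R = insert [] (conts c []) \<times> R"

lemma finite_wstates: "finite R \<Longrightarrow> finite (wstates c R)"
  by (simp add: wstates_def finite_conts)

lemma wstates_succs: "(s, r) \<in> wstates c R \<Longrightarrow> t \<in> succs s \<Longrightarrow> r' \<in> R \<Longrightarrow> (t, r') \<in> wstates c R"
  using conts_succs[of s c "[]" t] by (auto simp: wstates_def)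

abbreviation keep :: "symbol list \<Rightarrow> (symbol \<times> move) list" where
  "keep xs \<equiv> map (\<lambda>x. (x, Stay)) xs"

definition delta_act :: "nat \<Rightarrow> symbol list \<Rightarrow> symbol \<times> move \<Rightarrow> (symbol \<times> move) list" where
  "delta_act i xs a = (keep xs)[i := a]"

fun delta_state :: "('r wstate \<Rightarrow> nat) \<Rightarrow> ('r \<Rightarrow> bool) \<Rightarrow> 'r wstate \<Rightarrow> symbol list \<Rightarrow>
    nat \<times> (symbol \<times> move) list" where
  "delta_state f acc ([], r) xs = (if acc r then 0 else 1, keep xs)"
| "delta_state f acc (WAct i g # k, r) xs =
     (case g r (xs ! i) of (r', a) \<Rightarrow> (5 + f (k, r'), delta_act i xs a))"
| "delta_state f acc (WSeq a b # k, r) xs = (5 + f (a # b # k, r), keep xs)"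
| "delta_state f acc (WIf i P a b # k, r) xs =
     (5 + f ((if P r (xs ! i) then a else b) # k, r), keep xs)"
| "delta_state f acc (WWhile i P c # k, r) xs =
     (5 + f (if P r (xs ! i) then c # WWhile i P c # k else k, r), keep xs)"
| "delta_state f acc (WAsk h # k, r) xs =
     (2, delta_act 2 xs (Extra (f (WAsk h # k, r)), Stay))"

text \<open>
  States \<open>0\<close> to \<open>4\<close> are accept, reject, query, yes and no. The auxiliary tape \<open>2\<close> remembers the
  continuation during a query.
\<close>

fun delta_answer :: "('r wstate \<Rightarrow> nat) \<Rightarrow> bool \<Rightarrow> 'r wstate \<Rightarrow> symbol list \<Rightarrow>
    nat \<times> (symbol \<times> move) list" where
  "delta_answer f b (WAsk h # k, r) xs = (5 + f (k, h r b), delta_act 2 xs (Blank, Stay))"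
| "delta_answer f b s xs = (1, keep xs)"

text \<open>The transition function must be total on states and symbols; combinations that no run
  reaches lead to rejection. A symbol that names a stored continuation may coincide with a symbol of
  \<open>Al\<close>. This is harmless, as such names are decoded only on tape 2 and only in the two
  answer states.\<close>

definition machine :: "('r wstate \<Rightarrow> nat) \<Rightarrow> 'r wcom \<Rightarrow> 'r set \<Rightarrow> 'r \<Rightarrow> ('r \<Rightarrow> bool) \<Rightarrow> nat \<Rightarrow> symbol set \<Rightarrow>
    oracle_tm" where
  "machine f c R r0 acc k Al = \<lparr>num_tapes = k,
     states = {..<5} \<union> (\<lambda>s. 5 + f s) ` wstates c R,
     alphabet = {Blank, Bit False, Bit True} \<union> Al \<union> (\<lambda>s. Extra (f s)) ` wstates c R,
     q_start = 5 + f ([c], r0), q_accept = 0, q_reject = 1, q_query = 2, q_yes = 3, q_no = 4,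
     delta = (\<lambda>q xs.
       if 5 \<le> q \<and> q - 5 \<in> f ` wstates c R then
         delta_state f acc (inv_into (wstates c R) f (q - 5)) xs
       else if q \<in> {3, 4} \<and> xs ! 2 \<in> (\<lambda>s. Extra (f s)) ` wstates c R then
         delta_answer f (q = 3) (inv_into (wstates c R) (\<lambda>s. Extra (f s)) (xs ! 2)) xs
       else (1, keep xs))\<rparr>"

lemma delta_act_props:
  assumes "length xs = k" "set xs \<subseteq> Al" "fst a \<in> Al"
  shows "length (delta_act i xs a) = k \<and> fst ` set (delta_act i xs a) \<subseteq> Al"
  using assms set_update_subset_insert[of "keep xs" i a]
  by (fastforce simp: delta_act_def)

lemma wstates_stack:
  "(s, r) \<in> wstates c R \<Longrightarrow> wf_wcom k R Al c \<Longrightarrow> list_all (wf_wcom k R Al) s \<and> r \<in> R"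
  using conts_wf[of s c "[]"] by (auto simp: wstates_def)

lemma wf_wcomD:
  "wf_wcom k R Al (WAct i g) \<Longrightarrow> r \<in> R \<Longrightarrow> g r x = (r', y, m) \<Longrightarrow> r' \<in> R \<and> y \<in> insert x Al \<and> i < k"
  by (metis fst_conv snd_conv wf_wcom.simps(1))

lemma machine_is_oracle_tm:
  assumes "finite R" "finite Al" "inj_on f (wstates c R)" "r0 \<in> R" "3 \<le> k" "wf_wcom k R Al c"
  shows "is_oracle_tm (machine f c R r0 acc k Al)"
proof -
  let ?S = "wstates c R" and ?M = "machine f c R r0 acc k Al"
  have start: "([c], r0) \<in> ?S"
    using assms(4) conts_self[of c "[]"] by (simp add: wstates_def)
  have St: "5 + f s \<in> states ?M" if "s \<in> ?S" for s
    using that by (auto simp: machine_def)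
  have small: "q < 5 \<Longrightarrow> q \<in> states ?M" for q by (simp add: machine_def)
  have keep: "length (keep xs) = k \<and> fst ` set (keep xs) \<subseteq> alphabet ?M"
    if "length xs = k" "set xs \<subseteq> alphabet ?M" for xs
    using that by auto
  have ds: "case delta_state f acc s xs of (q', acts) \<Rightarrow>
           q' \<in> states ?M \<and> length acts = num_tapes ?M \<and> fst ` set acts \<subseteq> alphabet ?M"
    if s: "s \<in> ?S" and xs: "length xs = k" "set xs \<subseteq> alphabet ?M" for s xs
  proof -
    obtain l r where sr: "s = (l, r)" by fastforce
    note wf = wstates_stack[OF s[unfolded sr] assms(6)]
    note sc = wstates_succs[OF s[unfolded sr]]
    have nt: "num_tapes ?M = k" by (simp add: machine_def)
    show ?thesis
    proof (cases l)
      case Nil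
      then show ?thesis using keep[OF xs] nt small by (simp add: sr)
    next
      case (Cons a l')
      show ?thesis
      proof (cases a)
        case (WAct i g)
        obtain r' y m where g: "g r (xs ! i) = (r', y, m)" by (metis prod_cases3)
        have w: "r' \<in> R \<and> y \<in> insert (xs ! i) Al \<and> i < k"
          using wf wf_wcomD[of k R Al i g r "xs ! i" r' y m] g by (auto simp: Cons WAct)
        have "xs ! i \<in> alphabet ?M" "Al \<subseteq> alphabet ?M"
          using xs w nth_mem[of i xs] by (blast, auto simp: machine_def)
        then have "y \<in> alphabet ?M" using w by blast
        then show ?thesis
          using delta_act_props[OF xs, of "(y, m)" i] nt St sc[of l' r'] w by (simp add: sr Cons WAct g)
      next
        case (WSeq b c')
        then show ?thesis using keep[OF xs] nt St sc[of "b # c' # l'" r] wf by (simp add: sr Cons)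
      next
        case (WIf i P b c')
        then show ?thesis using keep[OF xs] nt St sc[of "b # l'" r] sc[of "c' # l'" r] wf
          by (simp add: sr Cons)
      next
        case (WWhile i P b)
        then show ?thesis using keep[OF xs] nt St sc[of l' r] sc[of "b # WWhile i P b # l'" r] wf
          by (simp add: sr Cons)
      next
        case (WAsk h)
        have "Extra (f s) \<in> alphabet ?M" using s by (auto simp: machine_def)
        then show ?thesis
          using delta_act_props[OF xs, of "(Extra (f s), Stay)" 2] nt small by (simp add: sr Cons WAsk)
      qed
    qed
  qed
  have da: "case delta_answer f b s xs of (q', acts) \<Rightarrow>
           q' \<in> states ?M \<and> length acts = num_tapes ?M \<and> fst ` set acts \<subseteq> alphabet ?M"
    if s: "s \<in> ?S" and xs: "length xs = k" "set xs \<subseteq> alphabet ?M" for b s xs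
  proof -
    have nt: "num_tapes ?M = k" by (simp add: machine_def)
    have bl: "Blank \<in> alphabet ?M" by (simp add: machine_def)
    show ?thesis
    proof (cases "(f, b, s, xs)" rule: delta_answer.cases)
      case (1 f' b' h k' r xs')
      have s': "(WAsk h # k', r) \<in> ?S" using s 1 by simp
      have "h r b \<in> R" using wstates_stack[OF s' assms(6)] by simp
      then have "(k', h r b) \<in> ?S" using wstates_succs[OF s', of k' "h r b"] by simp
      then show ?thesis using 1 delta_act_props[OF xs, of "(Blank, Stay)" 2] nt bl St by simp
    qed (use keep[OF xs] nt small in simp_all)
  qed
  have deltas: "case delta ?M q xs of (q', acts) \<Rightarrow>
           q' \<in> states ?M \<and> length acts = num_tapes ?M \<and> fst ` set acts \<subseteq> alphabet ?M"
    if xs: "length xs = k" "set xs \<subseteq> alphabet ?M" for q xs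
  proof -
    have nt: "num_tapes ?M = k" by (simp add: machine_def)
    have dm: "delta ?M q xs = (if 5 \<le> q \<and> q - 5 \<in> f ` wstates c R then
         delta_state f acc (inv_into (wstates c R) f (q - 5)) xs
       else if q \<in> {3, 4} \<and> xs ! 2 \<in> (\<lambda>s. Extra (f s)) ` wstates c R then
         delta_answer f (q = 3) (inv_into (wstates c R) (\<lambda>s. Extra (f s)) (xs ! 2)) xs
       else (1, keep xs))" by (simp add: machine_def)
    consider (a) "5 \<le> q \<and> q - 5 \<in> f ` wstates c R"
      | (b) "\<not> (5 \<le> q \<and> q - 5 \<in> f ` wstates c R)" "q \<in> {3, 4} \<and> xs ! 2 \<in> (\<lambda>s. Extra (f s)) ` wstates c R"
      | (c) "delta ?M q xs = (1, keep xs)" unfolding dm by argo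
    then show ?thesis
    proof cases
      case a
      then have "inv_into ?S f (q - 5) \<in> ?S" by (blast intro: inv_into_into)
      from ds[OF this xs] show ?thesis unfolding dm if_P[OF a] .
    next
      case b
      then have "inv_into ?S (\<lambda>s. Extra (f s)) (xs ! 2) \<in> ?S" by (blast intro: inv_into_into)
      from da[OF this xs] show ?thesis unfolding dm if_not_P[OF b(1)] if_P[OF b(2)] .
    next
      case c
      then show ?thesis using keep[OF xs] nt small by simp
    qed
  qed
  have "num_tapes ?M = k" by (simp add: machine_def)
  then have all: "\<forall>q\<in>states ?M. \<forall>xs. length xs = num_tapes ?M \<and> set xs \<subseteq> alphabet ?M \<longrightarrow>
     (case delta ?M q xs of (q', acts) \<Rightarrow>
           q' \<in> states ?M \<and> length acts = num_tapes ?M \<and> fst ` set acts \<subseteq> alphabet ?M)"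
    using deltas by simp
  have "2 \<le> num_tapes ?M" "finite (states ?M)" "finite (alphabet ?M)"
    "{q_start ?M, q_accept ?M, q_reject ?M, q_query ?M, q_yes ?M, q_no ?M} \<subseteq> states ?M"
    "q_accept ?M \<noteq> q_reject ?M" "q_query ?M \<notin> {q_accept ?M, q_reject ?M}"
    "{Blank, Bit False, Bit True} \<subseteq> alphabet ?M"
    using assms start finite_wstates[OF assms(1)] by (auto simp: machine_def)
  with all show ?thesis unfolding is_oracle_tm_def by blast
qed

section \<open>The machine simulates the structured program step by step\<close>

lemma act_Stay: "act (head_symbol t, Stay) t = t"
  by (cases t) simp

lemma act_keep: "map2 act (keep (map head_symbol ts)) ts = ts"
  by (rule nth_equalityI) (simp_all add: act_Stay)

lemmas act_keeps = act_keep act_keep[unfolded map_map]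

lemma act_delta_act:
  "map2 act (delta_act i (map head_symbol ts) a) ts = ts[i := act a (ts ! i)]"
  by (cases "i < length ts"; rule nth_equalityI)
    (auto simp: delta_act_def act_Stay nth_list_update list_update_beyond)

locale compiled =
  fixes f :: "'r wstate \<Rightarrow> nat" and c :: "'r wcom" and R :: "'r set" and r0 :: 'r and acc :: "'r \<Rightarrow> bool" and k and Al and Q :: language
  assumes inj: "inj_on f (wstates c R)" and wf: "wf_wcom k R Al c"
begin

abbreviation "M \<equiv> machine f c R r0 acc k Al"

lemma step_state:
  assumes "s \<in> wstates c R"
  shows "step M Q (5 + f s, ts) = (case delta_state f acc s (map head_symbol ts) of
    (q, acts) \<Rightarrow> (q, map2 act acts ts))"
proof -
  have "delta M (5 + f s) xs = delta_state f acc s xs" for xs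
    using assms inj by (simp add: machine_def)
  moreover have "5 + f s \<noteq> q_accept M" "5 + f s \<noteq> q_reject M" "5 + f s \<noteq> q_query M"
    by (simp_all add: machine_def)
  ultimately show ?thesis by simp
qed

text \<open>The first step parks the continuation on tape 2 and enters the query state, the second
  is the oracle's, the third reads the continuation and blanks the cell, so that the tapes are as
  before.\<close>

lemma step_ask:
  assumes s: "(WAsk h # l, r) \<in> wstates c R" and ts: "head_symbol (ts ! 2) = Blank" "2 < length ts"
  shows "(step M Q ^^ 3) (5 + f (WAsk h # l, r), ts) =
    (5 + f (l, h r (\<exists>w\<in>Q. holds_word (ts ! 1) w)), ts)"
proof -
  let ?s = "(WAsk h # l, r)" and ?b = "\<exists>w\<in>Q. holds_word (ts ! 1) w"
  let ?q = "if ?b then 3 else 4 :: nat"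
  let ?ts = "ts[2 := act (Extra (f ?s), Stay) (ts ! 2)]"
  have 1: "step M Q (5 + f ?s, ts) = (2, ?ts)"
    by (simp add: step_state[OF s] act_delta_act del: step.simps)
  have "q_accept M = 0" "q_reject M = 1" "q_query M = 2" "q_yes M = 3" "q_no M = 4"
    by (simp_all add: machine_def)
  note q = this
  have plain: "step M Q (q, us) = (case delta M q (map head_symbol us) of
    (q', acts) \<Rightarrow> (q', map2 act acts us))" if "3 \<le> q" for q us
    using that by (simp add: q)
  have 2: "step M Q (2, ?ts) = (?q, ?ts)" by (simp add: q)
  have hs: "head_symbol (?ts ! 2) = Extra (f ?s)" using ts(2) by (cases "ts ! 2") simp
  have inj2: "inj_on (\<lambda>s. Extra (f s)) (wstates c R)" using inj by (auto simp: inj_on_def)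
  have "delta M ?q (map head_symbol ?ts) =
      delta_answer f ?b (inv_into (wstates c R) (\<lambda>s. Extra (f s)) (Extra (f ?s))) (map head_symbol ?ts)"
    using s ts(2) hs by (simp add: machine_def)
  also have "inv_into (wstates c R) (\<lambda>s. Extra (f s)) (Extra (f ?s)) = ?s"
    using inv_into_f_f[OF inj2 s] .
  finally have d: "delta M ?q (map head_symbol ?ts) =
      (5 + f (l, h r ?b), delta_act 2 (map head_symbol ?ts) (Blank, Stay))"
    by simp
  have "step M Q (?q, ?ts) = (5 + f (l, h r ?b), map2 act (delta_act 2 (map head_symbol ?ts) (Blank, Stay)) ?ts)"
    using plain[of ?q ?ts] unfolding d prod.case by simp
  also have "map2 act (delta_act 2 (map head_symbol ?ts) (Blank, Stay)) ?ts = ts"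
    unfolding act_delta_act using ts by (cases "ts ! 2") (auto intro!: nth_equalityI simp: nth_list_update fun_eq_iff)
  finally have 3: "step M Q (?q, ?ts) = (5 + f (l, h r ?b), ts)" .
  show ?thesis using 1 2 3 by (simp add: numeral_3_eq_3 del: step.simps)
qed

text \<open>The stack \<open>l\<close> is arbitrary because the induction enters the parts of a
  program below a longer stack. The inclusion for \<open>conts d l\<close> keeps all intermediate
  control states in the finite set on which \<open>f\<close> is injective.\<close>

lemma run:
  assumes "wexec Q d s n s'" "conts d l \<subseteq> insert [] (conts c [])" "l \<in> insert [] (conts c [])" "fst s \<in> R"
  shows "(step M Q ^^ n) (5 + f (d # l, fst s), snd s) = (5 + f (l, fst s'), snd s')"
  using assms
proof (induction arbitrary: l rule: wexec.induct)
  case (WAct g r ts i r' x m)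
  have "(WAct i g # l, r) \<in> wstates c R" using WAct by (auto simp: wstates_def)
  from step_state[OF this] show ?case using WAct by (simp add: act_delta_act del: step.simps)
next
  case (WSeq a s n s' b m s'')
  have st: "(WSeq a b # l, fst s) \<in> wstates c R" using WSeq by (auto simp: wstates_def)
  have R: "fst s' \<in> R"
  proof (rule wexec_register[OF WSeq.hyps(1) _ WSeq.prems(3)])
    have "list_all (wf_wcom k R Al) (WSeq a b # l)" using wstates_stack[OF st wf] by blast
    then show "wf_wcom k R Al a" by simp
  qed
  have l': "b # l \<in> insert [] (conts c [])" using WSeq.prems(1) conts_self[of b l] by auto
  have "(step M Q ^^ Suc (n + m)) (5 + f (WSeq a b # l, fst s), snd s) =
     (step M Q ^^ (m + n)) (5 + f (a # b # l, fst s), snd s)"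
    by (simp only: funpow.simps funpow_swap1 o_def step_state[OF st] delta_state.simps prod.case act_keep add.commute)
  also have "\<dots> = (step M Q ^^ m) (5 + f (b # l, fst s'), snd s')"
    using WSeq.IH(1)[of "b # l"] WSeq.prems l' by (simp add: funpow_add del: step.simps)
  also have "\<dots> = (5 + f (l, fst s''), snd s'')" using WSeq.IH(2)[of l] WSeq.prems R by simp
  finally show ?case .
next
  case (WIfT P r ts i a n s' b)
  have st: "(WIf i P a b # l, r) \<in> wstates c R" using WIfT by (auto simp: wstates_def)
  show ?case using WIfT step_state[OF st] by (simp only: funpow.simps funpow_swap1 o_def fst_conv snd_conv) (simp add: act_keeps del: step.simps)
next
  case (WIfF P r ts i b n s' a)
  have st: "(WIf i P a b # l, r) \<in> wstates c R" using WIfF by (auto simp: wstates_def)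
  show ?case using WIfF step_state[OF st] by (simp only: funpow.simps funpow_swap1 o_def fst_conv snd_conv) (simp add: act_keeps del: step.simps)
next
  case (WWhileF P r ts i d)
  have st: "(WWhile i P d # l, r) \<in> wstates c R" using WWhileF by (auto simp: wstates_def)
  show ?case using WWhileF step_state[OF st] by (simp add: act_keeps del: step.simps)
next
  case (WWhileT P r ts i d n s' m s'')
  have st: "(WWhile i P d # l, r) \<in> wstates c R" using WWhileT by (auto simp: wstates_def)
  have R: "fst s' \<in> R"
  proof (rule wexec_register[OF WWhileT.hyps(3)])
    have "list_all (wf_wcom k R Al) (WWhile i P d # l)" using wstates_stack[OF st wf] by blast
    then show "wf_wcom k R Al d" by simp
  qed (use WWhileT.prems in simp)
  have l': "WWhile i P d # l \<in> insert [] (conts c [])" using WWhileT.prems(1) by auto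
  have "step M Q (5 + f (WWhile i P d # l, r), ts) = (5 + f (d # WWhile i P d # l, r), ts)"
    using step_state[OF st] WWhileT.hyps(1,2) by (simp add: act_keeps del: step.simps)
  then have "(step M Q ^^ Suc (n + m)) (5 + f (WWhile i P d # l, fst (r, ts)), snd (r, ts)) =
     (step M Q ^^ (m + n)) (5 + f (d # WWhile i P d # l, r), ts)"
    by (simp only: funpow.simps funpow_swap1 o_def fst_conv snd_conv add.commute)
  also have "\<dots> = (step M Q ^^ m) (5 + f (WWhile i P d # l, fst s'), snd s')"
    using WWhileT.IH(1)[of "WWhile i P d # l"] WWhileT.prems l' by (simp add: funpow_add del: step.simps)
  also have "\<dots> = (5 + f (l, fst s''), snd s'')" using WWhileT.IH(2)[of l] WWhileT.prems R by simp
  finally show ?case .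
next
  case (WAsk ts h r)
  have st: "(WAsk h # l, r) \<in> wstates c R" using WAsk by (auto simp: wstates_def)
  from step_ask[OF st WAsk.hyps] show ?case by (simp del: step.simps funpow.simps)
qed

lemma step_halt: "(step M Q ^^ n) (if b then 0 else 1, ts) = (if b then 0 else 1, ts)"
  by (induction n) (simp_all add: machine_def)

text \<open>One step more than the run of the program turns the empty stack into a verdict. Verdicts
  are fixed points of \<open>step\<close>, so every larger number of steps gives the same
  state.\<close>

lemma run_halts:
  assumes "wexec Q c (r0, ts) n (r', ts')" "r0 \<in> R" "Suc n \<le> m"
  shows "fst ((step M Q ^^ m) (5 + f ([c], r0), ts)) = (if acc r' then 0 else 1)"
proof -
  have "(step M Q ^^ n) (5 + f ([c], r0), ts) = (5 + f ([], r'), ts')"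
    using run[OF assms(1), of "[]"] assms(2) by (simp add: subset_insertI)
  moreover have "r' \<in> R" using wexec_register[OF assms(1) wf] assms(2) by simp
  then have "step M Q (5 + f ([], r'), ts') = (if acc r' then 0 else 1, ts')"
    using step_state[of "([], r')" ts'] by (simp add: wstates_def act_keeps del: step.simps)
  ultimately have *: "(step M Q ^^ Suc n) (5 + f ([c], r0), ts) = (if acc r' then 0 else 1, ts')"
    by (simp del: step.simps)
  have m: "m = (m - Suc n) + Suc n" using assms(3) by simp
  show ?thesis by (subst m, subst funpow_add) (simp only: o_def * step_halt fst_conv)
qed

end

theorem poly_turing_reducible_wcom:
  fixes c :: "'r wcom" and p :: "nat poly"
  assumes fin: "finite R" "finite Al" and r0: "r0 \<in> R" and k: "3 \<le> k" and wf: "wf_wcom k R Al c"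
    and exec: "\<And>w. \<exists>n r' ts'. n \<le> poly p (length w) \<and>
      wexec Q c (r0, input_tape w # replicate (k - 1) blank_tape) n (r', ts') \<and> (acc r' \<longleftrightarrow> w \<in> L)"
  shows "poly_turing_reducible L Q"
proof -
  obtain f :: "'r wstate \<Rightarrow> nat" where f: "inj_on f (wstates c R)"
    using finite_imp_inj_to_nat_seg[OF finite_wstates[OF fin(1), of c]] by blast
  interpret compiled f c R r0 acc k Al Q by unfold_locales (fact f, fact wf)
  have "is_oracle_tm M" by (rule machine_is_oracle_tm[OF fin f r0 k wf])
  moreover have "fst ((step M Q ^^ poly (p + 1) (length w)) (init_config M w)) =
            (if w \<in> L then q_accept M else q_reject M)" for w
  proof -
    from exec[of w] obtain n r' ts' where n: "n \<le> poly p (length w)"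
      "wexec Q c (r0, input_tape w # replicate (k - 1) blank_tape) n (r', ts')" "acc r' \<longleftrightarrow> w \<in> L"
      by blast
    have "init_config M w = (5 + f ([c], r0), input_tape w # replicate (k - 1) blank_tape)"
      by (simp add: init_config_def machine_def)
    moreover have "q_accept M = 0" "q_reject M = 1" by (simp_all add: machine_def)
    ultimately show ?thesis
      using run_halts[OF n(2) r0, of "poly (p + 1) (length w)"] n(1,3) by simp
  qed
  ultimately show ?thesis unfolding poly_turing_reducible_def by blast
qed

section \<open>A loop language whose programs run in polynomial time\<close>

text \<open>
  Variables and array indices range over \<open>{0..length w}\<close> for the input word \<open>w\<close>, the register and
  the array cells over finite sets, and the output is write-only until it is asked as a query. All
  loops are bounded by the input length, so every program runs in polynomial time.
\<close>

datatype ('r, 'c) com =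
    Upd "'r \<Rightarrow> 'r"
  | At nat "'r \<Rightarrow> 'c \<Rightarrow> 'r \<times> 'c"
  | Inc nat
  | Zero nat
  | Mov nat nat
  | Emit bool
  | EmitV nat
  | Ask "'r \<Rightarrow> bool \<Rightarrow> 'r"
  | Seq "('r, 'c) com" "('r, 'c) com" (infixr \<open>;;\<close> 60)
  | Cond "'r \<Rightarrow> bool" "('r, 'c) com" "('r, 'c) com"
  | For nat "('r, 'c) com"
  | ForIn "('r, 'c) com" "('r, 'c) com"

record ('r, 'c) mem =
  reg :: 'r
  var :: "nat \<Rightarrow> nat"
  arr :: "nat \<Rightarrow> 'c"
  out :: "bool list"

text \<open>The shape of the loops follows the tapes: a variable tape has the cells 0 to
  \<open>length w\<close>, so \<open>For\<close> makes \<open>length w + 1\<close> rounds, and it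
  leaves its variable at 0 because the compiled loop rewinds the tape.\<close>

primrec sem :: "language \<Rightarrow> bool list \<Rightarrow> ('r, 'c) com \<Rightarrow> ('r, 'c) mem \<Rightarrow> ('r, 'c) mem" where
  "sem Q w (Upd f) = (\<lambda>s. s\<lparr>reg := f (reg s)\<rparr>)"
| "sem Q w (At x f) = (\<lambda>s. case f (reg s) (arr s (var s x)) of (r, c) \<Rightarrow>
     s\<lparr>reg := r, arr := (arr s)(var s x := c)\<rparr>)"
| "sem Q w (Inc x) = (\<lambda>s. s\<lparr>var := (var s)(x := min (Suc (var s x)) (length w))\<rparr>)"
| "sem Q w (Zero x) = (\<lambda>s. s\<lparr>var := (var s)(x := 0)\<rparr>)"
| "sem Q w (Mov y x) = (\<lambda>s. s\<lparr>var := (var s)(y := var s x)\<rparr>)"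
| "sem Q w (Emit b) = (\<lambda>s. s\<lparr>out := out s @ [b]\<rparr>)"
| "sem Q w (EmitV x) = (\<lambda>s. s\<lparr>out := out s @ replicate (var s x) True\<rparr>)"
| "sem Q w (Ask h) = (\<lambda>s. s\<lparr>reg := h (reg s) (out s \<in> Q), out := []\<rparr>)"
| "sem Q w (Seq a b) = (\<lambda>s. sem Q w b (sem Q w a s))"
| "sem Q w (Cond P a b) = (\<lambda>s. if P (reg s) then sem Q w a s else sem Q w b s)"
| "sem Q w (For x c) = (\<lambda>s.
     (\<lambda>s. s\<lparr>var := (var s)(x := 0)\<rparr>)
       (fold (\<lambda>k s. sem Q w c (s\<lparr>var := (var s)(x := k)\<rparr>)) [0..<Suc (length w)] s))"
| "sem Q w (ForIn a b) = fold (\<lambda>i s. if i then sem Q w a s else sem Q w b s) w"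

primrec assigned :: "('r, 'c) com \<Rightarrow> nat set" where
  "assigned (Upd f) = {}"
| "assigned (At x f) = {}"
| "assigned (Inc x) = {x}"
| "assigned (Zero x) = {x}"
| "assigned (Mov y x) = {y}"
| "assigned (Emit b) = {}"
| "assigned (EmitV x) = {}"
| "assigned (Ask h) = {}"
| "assigned (Seq a b) = assigned a \<union> assigned b"
| "assigned (Cond P a b) = assigned a \<union> assigned b"
| "assigned (For x c) = insert x (assigned c)"
| "assigned (ForIn a b) = assigned a \<union> assigned b"

primrec scans_input :: "('r, 'c) com \<Rightarrow> bool" where
  "scans_input (Upd f) = False"
| "scans_input (At x f) = False"
| "scans_input (Inc x) = False"
| "scans_input (Zero x) = False"
| "scans_input (Mov y x) = False"
| "scans_input (Emit b) = False"
| "scans_input (EmitV x) = False"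
| "scans_input (Ask h) = False"
| "scans_input (Seq a b) = (scans_input a \<or> scans_input b)"
| "scans_input (Cond P a b) = (scans_input a \<or> scans_input b)"
| "scans_input (For x c) = scans_input c"
| "scans_input (ForIn a b) = True"

text \<open>These are the demands of the tape layout: copying moves the heads of two variables at
  once, a loop counts with the very head that holds its variable, and a scan occupies the only head
  on the input.\<close>

primrec wf_com :: "nat \<Rightarrow> 'r set \<Rightarrow> 'c set \<Rightarrow> ('r, 'c) com \<Rightarrow> bool" where
  "wf_com nv R \<Gamma> (Upd f) = (\<forall>r\<in>R. f r \<in> R)"
| "wf_com nv R \<Gamma> (At x f) = (x < nv \<and> (\<forall>r\<in>R. \<forall>c\<in>\<Gamma>. f r c \<in> R \<times> \<Gamma>))"
| "wf_com nv R \<Gamma> (Inc x) = (x < nv)"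
| "wf_com nv R \<Gamma> (Zero x) = (x < nv)"
| "wf_com nv R \<Gamma> (Mov y x) = (x < nv \<and> y < nv \<and> x \<noteq> y)"
| "wf_com nv R \<Gamma> (Emit b) = True"
| "wf_com nv R \<Gamma> (EmitV x) = (x < nv)"
| "wf_com nv R \<Gamma> (Ask h) = (\<forall>r\<in>R. \<forall>b. h r b \<in> R)"
| "wf_com nv R \<Gamma> (Seq a b) = (wf_com nv R \<Gamma> a \<and> wf_com nv R \<Gamma> b)"
| "wf_com nv R \<Gamma> (Cond P a b) = (wf_com nv R \<Gamma> a \<and> wf_com nv R \<Gamma> b)"
| "wf_com nv R \<Gamma> (For x c) = (x < nv \<and> x \<notin> assigned c \<and> wf_com nv R \<Gamma> c)"
| "wf_com nv R \<Gamma> (ForIn a b) = (\<not> scans_input a \<and> \<not> scans_input b \<and> wf_com nv R \<Gamma> a \<and> wf_com nv R \<Gamma> b)"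

lemma fold_invariant_upt:
  assumes "P 0 s" "\<And>k s. k < n \<Longrightarrow> P k s \<Longrightarrow> P (Suc k) (f k s)"
  shows "P n (fold f [0..<n] s)"
proof -
  have "m \<le> n \<Longrightarrow> P m (fold f [0..<m] s)" for m
    by (induction m) (use assms in auto)
  then show ?thesis by blast
qed

lemma sem_unassigned: "x \<notin> assigned c \<Longrightarrow> var (sem Q w c s) x = var s x"
proof (induction c arbitrary: s)
  case (For y c)
  have "var (fold (\<lambda>k s. sem Q w c (s\<lparr>var := (var s)(y := k)\<rparr>)) [0..<Suc (length w)] s) x = var s x"
    by (rule fold_invariant_upt[where P = "\<lambda>k t. var t x = var s x"]) (use For in auto)
  with For show ?case by simp
next
  case (ForIn a b)
  have "var (fold (\<lambda>i s. if i then sem Q w a s else sem Q w b s) u s) x = var s x" for u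
    by (induction u arbitrary: s) (use ForIn in auto)
  then show ?case by simp
qed (auto split: prod.splits)

definition ok_mem :: "bool list \<Rightarrow> 'r set \<Rightarrow> 'c set \<Rightarrow> ('r, 'c) mem \<Rightarrow> bool" where
  "ok_mem w R \<Gamma> s \<longleftrightarrow> reg s \<in> R \<and> (\<forall>i. arr s i \<in> \<Gamma>) \<and> (\<forall>x. var s x \<le> length w)"

lemma sem_ok: "wf_com nv R \<Gamma> c \<Longrightarrow> ok_mem w R \<Gamma> s \<Longrightarrow> ok_mem w R \<Gamma> (sem Q w c s)"
proof (induction c arbitrary: s)
  case (At x f)
  then have "f (reg s) (arr s (var s x)) \<in> R \<times> \<Gamma>" by (auto simp: ok_mem_def)
  then have "fst (f (reg s) (arr s (var s x))) \<in> R" "snd (f (reg s) (arr s (var s x))) \<in> \<Gamma>" by auto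
  with At show ?case by (auto simp: ok_mem_def split: prod.splits)
next
  case (For y c)
  have "ok_mem w R \<Gamma> (fold (\<lambda>k s. sem Q w c (s\<lparr>var := (var s)(y := k)\<rparr>)) [0..<Suc (length w)] s)"
    by (rule fold_invariant_upt[where P = "\<lambda>k t. ok_mem w R \<Gamma> t"])
      (use For in \<open>auto intro!: For.IH simp: ok_mem_def\<close>)
  then show ?case by (auto simp: ok_mem_def)
next
  case (ForIn a b)
  have "ok_mem w R \<Gamma> (fold (\<lambda>i s. if i then sem Q w a s else sem Q w b s) u s)" for u
    using ForIn.prems(2) by (induction u arbitrary: s) (use ForIn in auto)
  then show ?case by simp
qed (auto simp: ok_mem_def)

subsection \<open>Tapes\<close>

definition word_cells :: "bool list \<Rightarrow> int \<Rightarrow> symbol" where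
  "word_cells w = (\<lambda>i. if 0 \<le> i \<and> nat i < length w then Bit (w ! nat i) else Blank)"

definition cells :: "nat \<Rightarrow> (nat \<Rightarrow> symbol) \<Rightarrow> int \<Rightarrow> symbol" where
  "cells n a = (\<lambda>i. if 0 \<le> i \<and> nat i \<le> n then a (nat i) else Blank)"

text \<open>A variable is a head position on a tape with \<open>length w + 1\<close> marks; the
  blanks on both sides serve as end markers. The head of the array rests on the blank at -1, and
  tape 2 stays blank for the sake of queries.\<close>

definition raw_tapes :: "nat \<Rightarrow> bool list \<Rightarrow> int \<Rightarrow> tape \<Rightarrow> (nat \<Rightarrow> symbol) \<Rightarrow> int \<Rightarrow> (nat \<Rightarrow> int) \<Rightarrow> tape list" where
  "raw_tapes nv w ip u a ap vp = [(word_cells w, ip), u, blank_tape, (cells (length w) a, ap)] @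
     map (\<lambda>x. (cells (length w) (\<lambda>_. Bit True), vp x)) [0..<nv]"

lemma raw_tapes_nth:
  "raw_tapes nv w ip u a ap vp ! 0 = (word_cells w, ip)"
  "raw_tapes nv w ip u a ap vp ! 1 = u"
  "raw_tapes nv w ip u a ap vp ! Suc 0 = u"
  "raw_tapes nv w ip u a ap vp ! 2 = blank_tape"
  "raw_tapes nv w ip u a ap vp ! 3 = (cells (length w) a, ap)"
  "x < nv \<Longrightarrow> raw_tapes nv w ip u a ap vp ! (4 + x) = (cells (length w) (\<lambda>_. Bit True), vp x)"
  "length (raw_tapes nv w ip u a ap vp) = 4 + nv"
  by (simp_all add: raw_tapes_def numeral_2_eq_2 numeral_3_eq_3 nth_Cons' nth_append)

lemma raw_tapes_update:
  "(raw_tapes nv w ip u a ap vp)[0 := (word_cells w, ip')] = raw_tapes nv w ip' u a ap vp"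
  "(raw_tapes nv w ip u a ap vp)[1 := u'] = raw_tapes nv w ip u' a ap vp"
  "(raw_tapes nv w ip u a ap vp)[Suc 0 := u'] = raw_tapes nv w ip u' a ap vp"
  "(raw_tapes nv w ip u a ap vp)[3 := (cells (length w) a', ap')] = raw_tapes nv w ip u a' ap' vp"
  by (simp_all add: raw_tapes_def numeral_3_eq_3)

lemma raw_tapes_update_var:
  "(raw_tapes nv w ip u a ap vp)[4 + x := (cells (length w) (\<lambda>_. Bit True), p)] =
     raw_tapes nv w ip u a ap (vp(x := p))"
proof -
  have "(map (\<lambda>x. (cells (length w) (\<lambda>_. Bit True), vp x)) [0..<nv])[x := (cells (length w) (\<lambda>_. Bit True), p)] =
     map (\<lambda>y. (cells (length w) (\<lambda>_. Bit True), (vp(x := p)) y)) [0..<nv]"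
    by (rule nth_equalityI) (auto simp: nth_list_update)
  moreover have "4 + x = Suc (Suc (Suc (Suc x)))" by simp
  ultimately show ?thesis by (simp only: raw_tapes_def append_Cons append_Nil list_update.simps nat.case)
qed

definition go_left :: "nat \<Rightarrow> 'r wcom" where
  "go_left i = WAct i (\<lambda>r x. (r, x, Go_Left))"

definition go_right :: "nat \<Rightarrow> 'r wcom" where
  "go_right i = WAct i (\<lambda>r x. (r, x, Go_Right))"

abbreviation while_nonblank :: "nat \<Rightarrow> 'r wcom \<Rightarrow> 'r wcom" where
  "while_nonblank i c \<equiv> WWhile i (\<lambda>r x. x \<noteq> Blank) c"

lemma exec_go_left:
  "i < length ts \<Longrightarrow> ts ! i = (f, p) \<Longrightarrow> wexec Q (go_left i) (r, ts) 1 (r, ts[i := (f, p - 1)])"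
  using wexec.WAct[of "\<lambda>r x. (r, x, Go_Left)" r ts i r "f p" Go_Left Q] by (simp add: go_left_def)

lemma exec_go_right:
  "i < length ts \<Longrightarrow> ts ! i = (f, p) \<Longrightarrow> wexec Q (go_right i) (r, ts) 1 (r, ts[i := (f, p + 1)])"
  using wexec.WAct[of "\<lambda>r x. (r, x, Go_Right)" r ts i r "f p" Go_Right Q] by (simp add: go_right_def)

lemma exec_raw_go:
  "wexec Q (go_left 0) (r, raw_tapes nv w ip u a ap vp) 1 (r, raw_tapes nv w (ip - 1) u a ap vp)"
  "wexec Q (go_right 0) (r, raw_tapes nv w ip u a ap vp) 1 (r, raw_tapes nv w (ip + 1) u a ap vp)"
  "wexec Q (go_left 3) (r, raw_tapes nv w ip u a ap vp) 1 (r, raw_tapes nv w ip u a (ap - 1) vp)"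
  "wexec Q (go_right 3) (r, raw_tapes nv w ip u a ap vp) 1 (r, raw_tapes nv w ip u a (ap + 1) vp)"
  "x < nv \<Longrightarrow> wexec Q (go_left (4 + x)) (r, raw_tapes nv w ip u a ap vp) 1 (r, raw_tapes nv w ip u a ap (vp(x := vp x - 1)))"
  "x < nv \<Longrightarrow> wexec Q (go_right (4 + x)) (r, raw_tapes nv w ip u a ap vp) 1 (r, raw_tapes nv w ip u a ap (vp(x := vp x + 1)))"
proof -
  let ?ts = "raw_tapes nv w ip u a ap vp"
  note n = raw_tapes_nth[where nv = nv and w = w and ip = ip and u = u and a = a and ap = ap and vp = vp] and l = raw_tapes_update raw_tapes_update_var
  show "wexec Q (go_left 0) (r, ?ts) 1 (r, raw_tapes nv w (ip - 1) u a ap vp)"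
    using exec_go_left[OF _ n(1), of Q r] n(7) by (simp add: l)
  show "wexec Q (go_right 0) (r, ?ts) 1 (r, raw_tapes nv w (ip + 1) u a ap vp)"
    using exec_go_right[OF _ n(1), of Q r] n(7) by (simp add: l)
  show "wexec Q (go_left 3) (r, ?ts) 1 (r, raw_tapes nv w ip u a (ap - 1) vp)"
    using exec_go_left[OF _ n(5), of Q r] n(7) by (simp add: l)
  show "wexec Q (go_right 3) (r, ?ts) 1 (r, raw_tapes nv w ip u a (ap + 1) vp)"
    using exec_go_right[OF _ n(5), of Q r] n(7) by (simp add: l)
  assume "x < nv"
  then show "wexec Q (go_left (4 + x)) (r, ?ts) 1 (r, raw_tapes nv w ip u a ap (vp(x := vp x - 1)))"
    "wexec Q (go_right (4 + x)) (r, ?ts) 1 (r, raw_tapes nv w ip u a ap (vp(x := vp x + 1)))"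
    using exec_go_left[OF _ n(6), of x Q r] exec_go_right[OF _ n(6), of x Q r] n(7)
    unfolding l by auto
qed

lemma exec_while_step:
  assumes "P r (head_symbol (ts ! i))" "i < length ts" "wexec Q c (r, ts) n s'" "wexec Q (WWhile i P c) s' m s''"
    "k = Suc (n + m)"
  shows "wexec Q (WWhile i P c) (r, ts) k s''"
  using wexec.WWhileT[OF assms(1-4)] assms(5) by simp

lemma exec_seq:
  assumes "wexec Q a s n s'" "wexec Q b s' m s''" "k = Suc (n + m)"
  shows "wexec Q (WSeq a b) s k s''"
  using wexec.WSeq[OF assms(1,2)] assms(3) by simp

lemma var_head:
  "x < nv \<Longrightarrow> head_symbol (raw_tapes nv w ip u a ap vp ! (4 + x)) \<noteq> Blank \<longleftrightarrow> 0 \<le> vp x \<and> vp x \<le> int (length w)"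
  by (auto simp: raw_tapes_nth cells_def)

lemma arr_head:
  "(\<And>i. a i \<noteq> Blank) \<Longrightarrow>
    head_symbol (raw_tapes nv w ip u a ap vp ! 3) \<noteq> Blank \<longleftrightarrow> 0 \<le> ap \<and> ap \<le> int (length w)"
  by (auto simp: raw_tapes_nth cells_def)

subsection \<open>Walking along tapes\<close>

lemma exec_rewind_var:
  assumes "x < nv" "m \<le> Suc (length w)" "vp x = int m - 1"
  shows "wexec Q (while_nonblank (4 + x) (go_left (4 + x))) (r, raw_tapes nv w ip u a ap vp) (2 * m + 1)
    (r, raw_tapes nv w ip u a ap (vp(x := -1)))"
  using assms
proof (induction m arbitrary: vp)
  case 0
  then have "vp(x := -1) = vp" by auto
  with 0 show ?case using wexec.WWhileF[of "\<lambda>r x. x \<noteq> Blank" r "raw_tapes nv w ip u a ap vp" "4 + x" Q]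
    var_head[of x nv w ip u a ap vp] raw_tapes_nth(7)[of nv w ip u a ap vp] by simp
next
  case (Suc m)
  have "wexec Q (while_nonblank (4 + x) (go_left (4 + x))) (r, raw_tapes nv w ip u a ap (vp(x := vp x - 1)))
    (2 * m + 1) (r, raw_tapes nv w ip u a ap ((vp(x := vp x - 1))(x := -1)))"
    by (rule Suc.IH) (use Suc.prems in auto)
  note IH = this[unfolded fun_upd_upd]
  show ?case
    by (rule exec_while_step[OF _ _ exec_raw_go(5)[OF Suc.prems(1)] IH])
      (use Suc.prems var_head[of x nv w ip u a ap vp] raw_tapes_nth(7)[of nv w ip u a ap vp] in auto)
qed

text \<open>Moving the head of \<open>x\<close> from \<open>m\<close> to -1 takes
  \<open>m + 1\<close> moves, exactly those that bring the array head from -1 to cell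
  \<open>m\<close>.\<close>

definition walk_to :: "nat \<Rightarrow> 'r wcom" where
  "walk_to x = while_nonblank (4 + x) (WSeq (go_left (4 + x)) (go_right 3))"

lemma exec_walk_to_aux:
  assumes "x < nv" "m \<le> Suc (length w)" "vp x = int m - 1"
  shows "wexec Q (walk_to x) (r, raw_tapes nv w ip u a ap vp) (4 * m + 1)
    (r, raw_tapes nv w ip u a (ap + int m) (vp(x := -1)))"
  using assms
proof (induction m arbitrary: vp ap)
  case 0
  then have "vp(x := -1) = vp" by auto
  with 0 show ?case using wexec.WWhileF[of "\<lambda>r x. x \<noteq> Blank" r "raw_tapes nv w ip u a ap vp" "4 + x" Q]
    var_head[of x nv w ip u a ap vp] raw_tapes_nth(7)[of nv w ip u a ap vp] by (simp add: walk_to_def)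
next
  case (Suc m)
  have "wexec Q (walk_to x) (r, raw_tapes nv w ip u a (ap + 1) (vp(x := vp x - 1))) (4 * m + 1)
    (r, raw_tapes nv w ip u a (ap + 1 + int m) ((vp(x := vp x - 1))(x := -1)))"
    by (rule Suc.IH) (use Suc.prems in auto)
  note IH = this[unfolded fun_upd_upd]
  have eq: "ap + int (Suc m) = ap + 1 + int m" by simp
  show ?case unfolding eq
    by (subst walk_to_def, rule exec_while_step[OF _ _ exec_seq[OF exec_raw_go(5)[OF Suc.prems(1)] exec_raw_go(4) refl] IH[unfolded walk_to_def]])
      (use Suc.prems var_head[of x nv w ip u a ap vp] raw_tapes_nth(7)[of nv w ip u a ap vp] in auto)
qed

lemma exec_walk_to:
  assumes "x < nv" "vp x = int m" "m \<le> length w"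
  shows "wexec Q (walk_to x) (r, raw_tapes nv w ip u a (-1) vp) (4 * m + 5)
    (r, raw_tapes nv w ip u a (int m) (vp(x := -1)))"
proof -
  have "wexec Q (walk_to x) (r, raw_tapes nv w ip u a (-1) vp) (4 * Suc m + 1)
    (r, raw_tapes nv w ip u a (-1 + int (Suc m)) (vp(x := -1)))"
    by (rule exec_walk_to_aux) (use assms in auto)
  then show ?thesis by (simp add: add.commute)
qed

text \<open>Reverses \<open>walk_to\<close> and runs the hook \<open>c\<close> once per move;
  copying a variable and printing it in unary are done by counting with this hook.\<close>

definition walk_back :: "nat \<Rightarrow> 'r wcom \<Rightarrow> 'r wcom" where
  "walk_back x c = while_nonblank 3 (WSeq (go_left 3) (WSeq (go_right (4 + x)) c))"

text \<open>The families \<open>u\<close> and \<open>q\<close> give the output tape and the head of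
  a second variable \<open>y\<close> after each number of calls of the hook. One statement thus
  covers array access, copying and printing.\<close>

lemma exec_walk_back:
  fixes vp q :: "nat \<Rightarrow> int" and u :: "nat \<Rightarrow> tape"
  assumes "x < nv" "m \<le> Suc (length w)" "\<And>i. a i \<noteq> Blank"
    and c: "\<And>(vp :: nat \<Rightarrow> int) k ap. k < m \<Longrightarrow> wexec Q c (r, raw_tapes nv w ip (u k) a ap (vp(y := q k))) 1
       (r, raw_tapes nv w ip (u (Suc k)) a ap (vp(y := q (Suc k))))"
    and y: "y \<noteq> x"
  shows "wexec Q (walk_back x c) (r, raw_tapes nv w ip (u 0) a (int m - 1) (vp(y := q 0))) (6 * m + 1)
    (r, raw_tapes nv w ip (u m) a (-1) (vp(y := q m, x := vp x + int m)))"
proof -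
  \<comment> \<open>Induction on the number \<open>k\<close> of moves that remain, so
    \<open>m - k\<close> calls of the hook lie in the past.\<close>
  have "k \<le> m \<Longrightarrow> wexec Q (walk_back x c) (r, raw_tapes nv w ip (u (m - k)) a (int k - 1) (vp(y := q (m - k)))) (6 * k + 1)
    (r, raw_tapes nv w ip (u m) a (-1) (vp(y := q m, x := vp x + int k)))" for k
  proof (induction k arbitrary: vp)
    case 0
    have "vp(y := q m, x := vp x + int 0) = vp(y := q m)" using y by auto
    moreover have "head_symbol (raw_tapes nv w ip (u m) a (-1) (vp(y := q m)) ! 3) = Blank"
      by (simp add: raw_tapes_nth cells_def)
    ultimately show ?case
      unfolding walk_back_def using wexec.WWhileF[of "\<lambda>r x. x \<noteq> Blank" r "raw_tapes nv w ip (u m) a (-1) (vp(y := q m))" 3 Q]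
      by (simp add: raw_tapes_nth(7) del: fun_upd_apply)
  next
    case (Suc k)
    let ?vp = "vp(x := vp x + 1)"
    have k: "Suc (m - Suc k) = m - k" using Suc.prems by simp
    have twist: "?vp(y := z) = vp(y := z, x := vp x + 1)" for z using y by auto
    have final: "?vp(y := q m, x := ?vp x + int k) = vp(y := q m, x := vp x + int (Suc k))"
      using y by auto
    have IH: "wexec Q (walk_back x c) (r, raw_tapes nv w ip (u (m - k)) a (int k - 1) (?vp(y := q (m - k)))) (6 * k + 1)
      (r, raw_tapes nv w ip (u m) a (-1) (vp(y := q m, x := vp x + int (Suc k))))"
      using Suc.IH[of ?vp] Suc.prems unfolding final by linarith
    have c': "wexec Q c (r, raw_tapes nv w ip (u (m - Suc k)) a (int k - 1) (?vp(y := q (m - Suc k)))) 1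
       (r, raw_tapes nv w ip (u (m - k)) a (int k - 1) (?vp(y := q (m - k))))"
      using c[of "m - Suc k" "int k - 1" ?vp] Suc.prems unfolding k by simp
    have 1: "wexec Q (go_left 3) (r, raw_tapes nv w ip (u (m - Suc k)) a (int (Suc k) - 1) (vp(y := q (m - Suc k)))) 1
      (r, raw_tapes nv w ip (u (m - Suc k)) a (int k - 1) (vp(y := q (m - Suc k))))"
      using exec_raw_go(3)[of Q r nv w ip "u (m - Suc k)" a "int (Suc k) - 1"] by simp
    have 2: "wexec Q (go_right (4 + x)) (r, raw_tapes nv w ip (u (m - Suc k)) a (int k - 1) (vp(y := q (m - Suc k)))) 1
      (r, raw_tapes nv w ip (u (m - Suc k)) a (int k - 1) (?vp(y := q (m - Suc k))))"
      using exec_raw_go(6)[OF assms(1), of Q r w ip "u (m - Suc k)" a "int k - 1" "vp(y := q (m - Suc k))"] y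
      unfolding twist by simp
    show ?case
      by (subst walk_back_def, rule exec_while_step[OF _ _ exec_seq[OF 1 exec_seq[OF 2 c' refl] refl] IH[unfolded walk_back_def]])
        (use Suc.prems assms(2) arr_head[where a = a and nv = nv and w = w and ip = ip and u = "u (m - Suc k)" and ap = "int (Suc k) - 1"
            and vp = "vp(y := q (m - Suc k))", OF assms(3)]
          raw_tapes_nth(7)[of nv w ip "u (m - Suc k)" a "int (Suc k) - 1" "vp(y := q (m - Suc k))"] in auto)
  qed
  from this[of m] show ?thesis by simp
qed


subsection \<open>Compilation\<close>

definition nop :: "'r wcom" where
  "nop = WAct 0 (\<lambda>r x. (r, x, Stay))"

definition rewind :: "nat \<Rightarrow> 'r wcom" where
  "rewind i = WSeq (go_left i) (WSeq (while_nonblank i (go_left i)) (go_right i))"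

definition erase :: "'r wcom" where
  "erase = WSeq (go_left 1) (WSeq (while_nonblank 1 (WAct 1 (\<lambda>r x. (r, Blank, Go_Left)))) (go_right 1))"

text \<open>Well-formedness speaks of every symbol under the head; those that encode no array
  content are left alone.\<close>

definition cell_act :: "('c \<Rightarrow> nat) \<Rightarrow> 'c set \<Rightarrow> ('r \<Rightarrow> 'c \<Rightarrow> 'r \<times> 'c) \<Rightarrow> 'r \<Rightarrow> symbol \<Rightarrow> 'r \<times> symbol \<times> move" where
  "cell_act e \<Gamma> f r x = (if x \<in> Extra ` e ` \<Gamma>
     then (case f r (inv_into \<Gamma> (Extra \<circ> e) x) of (r', c) \<Rightarrow> (r', Extra (e c), Stay))
     else (r, x, Stay))"

primrec compile :: "('c \<Rightarrow> nat) \<Rightarrow> 'c set \<Rightarrow> ('r, 'c) com \<Rightarrow> 'r wcom" where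
  "compile e \<Gamma> (Upd f) = WAct 0 (\<lambda>r x. (f r, x, Stay))"
| "compile e \<Gamma> (At x f) = WSeq (walk_to x) (WSeq (WAct 3 (cell_act e \<Gamma> f)) (walk_back x nop))"
| "compile e \<Gamma> (Inc x) = WSeq (go_right (4 + x)) (WIf (4 + x) (\<lambda>r x. x \<noteq> Blank) nop (go_left (4 + x)))"
| "compile e \<Gamma> (Zero x) = rewind (4 + x)"
| "compile e \<Gamma> (Mov y x) = WSeq (walk_to x) (WSeq (go_left (4 + y))
     (WSeq (while_nonblank (4 + y) (go_left (4 + y))) (walk_back x (go_right (4 + y)))))"
| "compile e \<Gamma> (Emit b) = WAct 1 (\<lambda>r x. (r, Bit b, Go_Right))"
| "compile e \<Gamma> (EmitV x) = WSeq (walk_to x) (WSeq (go_left 3) (WSeq (go_right (4 + x))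
     (walk_back x (WAct 1 (\<lambda>r x. (r, Bit True, Go_Right))))))"
| "compile e \<Gamma> (Ask h) = WSeq (WAsk h) erase"
| "compile e \<Gamma> (Seq a b) = WSeq (compile e \<Gamma> a) (compile e \<Gamma> b)"
| "compile e \<Gamma> (Cond P a b) = WIf 0 (\<lambda>r x. P r) (compile e \<Gamma> a) (compile e \<Gamma> b)"
| "compile e \<Gamma> (For x c) = WSeq (rewind (4 + x))
     (WSeq (while_nonblank (4 + x) (WSeq (compile e \<Gamma> c) (go_right (4 + x)))) (rewind (4 + x)))"
| "compile e \<Gamma> (ForIn a b) = WSeq
     (while_nonblank 0 (WSeq (WIf 0 (\<lambda>r x. x = Bit True) (compile e \<Gamma> a) (compile e \<Gamma> b)) (go_right 0)))
     (rewind 0)"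

text \<open>The output is paid for twice when it is written, so that erasing it after a query is free.\<close>

primrec time :: "('r, 'c) com \<Rightarrow> nat poly" where
  "time (Upd f) = 1"
| "time (At x f) = [:20, 20:]"
| "time (Inc x) = [:20, 20:]"
| "time (Zero x) = [:20, 20:]"
| "time (Mov y x) = [:20, 20:]"
| "time (Emit b) = [:20, 20:]"
| "time (EmitV x) = [:20, 20:]"
| "time (Ask h) = [:20, 20:]"
| "time (Seq a b) = time a + time b + 1"
| "time (Cond P a b) = time a + time b + 1"
| "time (For x c) = [:1, 1:] * (time c + [:3:]) + [:20, 20:]"
| "time (ForIn a b) = [:1, 1:] * (time a + time b + [:4:]) + [:20, 20:]"

lemma wf_compile:
  "wf_com nv R \<Gamma> c \<Longrightarrow> wf_wcom (4 + nv) R ({Blank, Bit True, Bit False} \<union> Extra ` e ` \<Gamma>) (compile e \<Gamma> c)"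
proof (induction c)
  case (At x f)
  have "fst (cell_act e \<Gamma> f r y) \<in> R \<and> fst (snd (cell_act e \<Gamma> f r y)) \<in>
     insert y ({Blank, Bit True, Bit False} \<union> Extra ` e ` \<Gamma>)" if "r \<in> R" for r y
  proof (cases "y \<in> Extra ` e ` \<Gamma>")
    case True
    then have "inv_into \<Gamma> (Extra \<circ> e) y \<in> \<Gamma>" by (metis image_comp inv_into_into)
    then have "f r (inv_into \<Gamma> (Extra \<circ> e) y) \<in> R \<times> \<Gamma>" using At that by simp
    then show ?thesis using True by (auto simp: cell_act_def)
  next
    case False
    then show ?thesis using that by (simp add: cell_act_def)
  qed
  then show ?case using At by (simp add: walk_to_def walk_back_def go_left_def go_right_def nop_def)
qed (auto simp: walk_to_def walk_back_def go_left_def go_right_def nop_def rewind_def erase_def)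

section \<open>Correctness and running time of compiled programs\<close>

definition tapes :: "nat \<Rightarrow> bool list \<Rightarrow> ('c \<Rightarrow> nat) \<Rightarrow> int \<Rightarrow> ('r, 'c) mem \<Rightarrow> tape list" where
  "tapes nv w e ip s = raw_tapes nv w ip (word_cells (out s), int (length (out s)))
     (\<lambda>i. Extra (e (arr s i))) (-1) (\<lambda>x. int (var s x))"

lemma word_cells_snoc: "(word_cells u)(int (length u) := Bit b) = word_cells (u @ [b])"
  by (auto simp: word_cells_def fun_eq_iff nth_append)

lemma word_cells_butlast: "(word_cells (u @ [b]))(int (length u) := Blank) = word_cells u"
  by (auto simp: word_cells_def fun_eq_iff nth_append)

lemma holds_word_cells: "holds_word (word_cells u, p) v \<longleftrightarrow> v = u"
proof
  assume h: "holds_word (word_cells u, p) v"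
  have "\<not> length v < length u" using h by (auto simp: word_cells_def)
  moreover have "\<not> length u < length v" using h by (auto simp: word_cells_def)
  ultimately show "v = u" using h by (auto simp: word_cells_def intro!: nth_equalityI)
qed (auto simp: word_cells_def)

lemma exec_write:
  "wexec Q (WAct 1 (\<lambda>r x. (r, Bit b, Go_Right))) (r, raw_tapes nv w ip (word_cells u, int (length u)) a ap vp) 1
     (r, raw_tapes nv w ip (word_cells (u @ [b]), int (length (u @ [b]))) a ap vp)"
  using wexec.WAct[of "\<lambda>r x. (r, Bit b, Go_Right)" r "raw_tapes nv w ip (word_cells u, int (length u)) a ap vp" 1 r "Bit b" Go_Right Q]
  by (simp add: raw_tapes_nth raw_tapes_update word_cells_snoc algebra_simps)

lemma exec_nop: "ts \<noteq> [] \<Longrightarrow> wexec Q nop (r, ts) 1 (r, ts)"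
  using wexec.WAct[of "\<lambda>r x. (r, x, Stay)" r ts 0 r "head_symbol (ts ! 0)" Stay Q]
  by (simp add: nop_def act_Stay)

lemma exec_nop_raw:
  "wexec Q nop (r, raw_tapes nv w ip u a ap vp) 1 (r, raw_tapes nv w ip u a ap vp)"
  by (rule exec_nop) (simp add: raw_tapes_def)

lemma exec_erase:
  "wexec Q erase (r, raw_tapes nv w ip (word_cells u, int (length u)) a ap vp) (2 * length u + 5)
     (r, raw_tapes nv w ip (word_cells [], 0) a ap vp)"
proof -
  have loop: "wexec Q (while_nonblank 1 (WAct 1 (\<lambda>r x. (r, Blank, Go_Left))))
     (r, raw_tapes nv w ip (word_cells u, int (length u) - 1) a ap vp) (2 * length u + 1)
     (r, raw_tapes nv w ip (word_cells [], -1) a ap vp)"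
  proof (induction u rule: rev_induct)
    case Nil
    show ?case using wexec.WWhileF[of "\<lambda>r x. x \<noteq> Blank" r "raw_tapes nv w ip (word_cells [], -1) a ap vp" 1 Q]
      by (simp add: raw_tapes_nth word_cells_def)
  next
    case (snoc b u)
    have 1: "wexec Q (WAct 1 (\<lambda>r x. (r, Blank, Go_Left)))
      (r, raw_tapes nv w ip (word_cells (u @ [b]), int (length (u @ [b])) - 1) a ap vp) 1
      (r, raw_tapes nv w ip (word_cells u, int (length u) - 1) a ap vp)"
      using wexec.WAct[of "\<lambda>r x. (r, Blank, Go_Left)" r
        "raw_tapes nv w ip (word_cells (u @ [b]), int (length (u @ [b])) - 1) a ap vp" 1 r Blank Go_Left Q]
      by (simp add: raw_tapes_nth raw_tapes_update word_cells_butlast)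
    show ?case
      by (rule exec_while_step[OF _ _ 1 snoc.IH]) (auto simp: raw_tapes_nth word_cells_def)
  qed
  have l: "wexec Q (go_left 1) (r, raw_tapes nv w ip (word_cells u, int (length u)) a ap vp) 1
    (r, raw_tapes nv w ip (word_cells u, int (length u) - 1) a ap vp)"
    using exec_go_left[of 1 "raw_tapes nv w ip (word_cells u, int (length u)) a ap vp" "word_cells u" "int (length u)" Q r]
    by (simp add: raw_tapes_nth raw_tapes_update)
  have r: "wexec Q (go_right 1) (r, raw_tapes nv w ip (word_cells [], -1) a ap vp) 1
    (r, raw_tapes nv w ip (word_cells [], 0) a ap vp)"
    using exec_go_right[of 1 "raw_tapes nv w ip (word_cells [], -1) a ap vp" "word_cells []" "-1" Q r]
    by (simp add: raw_tapes_nth raw_tapes_update)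
  show ?thesis unfolding erase_def
    by (rule exec_seq[OF l exec_seq[OF loop r refl]]) simp
qed

lemma exec_rewind:
  assumes "x < nv" "vp x = int m" "m \<le> Suc (length w)"
  shows "wexec Q (rewind (4 + x)) (r, raw_tapes nv w ip u a ap vp) (2 * m + 5)
    (r, raw_tapes nv w ip u a ap (vp(x := 0)))"
proof -
  have 1: "wexec Q (while_nonblank (4 + x) (go_left (4 + x))) (r, raw_tapes nv w ip u a ap (vp(x := vp x - 1)))
    (2 * m + 1) (r, raw_tapes nv w ip u a ap ((vp(x := vp x - 1))(x := -1)))"
    by (rule exec_rewind_var) (use assms in auto)
  have 2: "wexec Q (go_right (4 + x)) (r, raw_tapes nv w ip u a ap ((vp(x := vp x - 1))(x := -1))) 1
    (r, raw_tapes nv w ip u a ap (vp(x := 0)))"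
    using exec_raw_go(6)[OF assms(1), of Q r w ip u a ap "(vp(x := vp x - 1))(x := -1)"] by simp
  show ?thesis unfolding rewind_def
    by (rule exec_seq[OF exec_raw_go(5)[OF assms(1)] exec_seq[OF 1 2 refl]]) simp
qed

lemma exec_rewind_input:
  assumes "m \<le> length w"
  shows "wexec Q (rewind 0) (r, raw_tapes nv w (int m) u a ap vp) (2 * m + 5) (r, raw_tapes nv w 0 u a ap vp)"
proof -
  have 1: "m \<le> length w \<Longrightarrow> wexec Q (while_nonblank 0 (go_left 0)) (r, raw_tapes nv w (int m - 1) u a ap vp)
    (2 * m + 1) (r, raw_tapes nv w (-1) u a ap vp)" for m
  proof (induction m)
    case 0
    then show ?case using wexec.WWhileF[of "\<lambda>r x. x \<noteq> Blank" r "raw_tapes nv w (-1) u a ap vp" 0 Q]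
      by (simp add: raw_tapes_nth word_cells_def)
  next
    case (Suc m)
    have l: "wexec Q (go_left 0) (r, raw_tapes nv w (int (Suc m) - 1) u a ap vp) 1 (r, raw_tapes nv w (int m - 1) u a ap vp)"
      using exec_raw_go(1)[of Q r nv w "int (Suc m) - 1" u a ap vp] by simp
    show ?case
      by (rule exec_while_step[OF _ _ l Suc.IH]) (use Suc.prems in \<open>auto simp: raw_tapes_nth word_cells_def\<close>)
  qed
  have 2: "wexec Q (go_right 0) (r, raw_tapes nv w (-1) u a ap vp) 1 (r, raw_tapes nv w 0 u a ap vp)"
    using exec_raw_go(2)[of Q r nv w "-1" u a ap vp] by simp
  show ?thesis unfolding rewind_def
    by (rule exec_seq[OF exec_raw_go(1) exec_seq[OF 1[OF assms] 2 refl]]) simp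
qed

lemma vars_upd: "(\<lambda>y. int (((var s)(x := k)) y)) = (\<lambda>y. int (var s y))(x := int k)"
  by auto

lemma tapes_set_var:
  "tapes nv w e ip (s\<lparr>var := (var s)(x := k)\<rparr>) = raw_tapes nv w ip (word_cells (out s), int (length (out s)))
     (\<lambda>i. Extra (e (arr s i))) (-1) ((\<lambda>x. int (var s x))(x := int k))"
  unfolding vars_upd[symmetric] tapes_def by simp

lemma exec_cell_act:
  assumes "inj_on e \<Gamma>" "\<forall>i. b i \<in> \<Gamma>" "m \<le> length w" "f r (b m) = (r', c)"
  shows "wexec Q (WAct 3 (cell_act e \<Gamma> f)) (r, raw_tapes nv w ip u (\<lambda>i. Extra (e (b i))) (int m) vp) 1
    (r', raw_tapes nv w ip u (\<lambda>i. Extra (e ((b(m := c)) i))) (int m) vp)"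
proof -
  let ?ts = "raw_tapes nv w ip u (\<lambda>i. Extra (e (b i))) (int m) vp"
  have hd: "head_symbol (?ts ! 3) = Extra (e (b m))"
    using assms(3) by (simp add: raw_tapes_nth cells_def)
  have inj: "inj_on (Extra \<circ> e) \<Gamma>" using assms(1) by (auto simp: inj_on_def)
  have "inv_into \<Gamma> (Extra \<circ> e) (Extra (e (b m))) = b m"
    using inv_into_f_f[OF inj, of "b m"] assms(2) by simp
  then have g: "cell_act e \<Gamma> f r (head_symbol (?ts ! 3)) = (r', Extra (e c), Stay)"
    using assms(2,4) by (simp add: hd cell_act_def)
  have "(cells (length w) (\<lambda>i. Extra (e (b i))))(int m := Extra (e c)) = cells (length w) (\<lambda>i. Extra (e ((b(m := c)) i)))"
    using assms(3) by (auto simp: cells_def fun_eq_iff)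
  then have "?ts[3 := act (Extra (e c), Stay) (?ts ! 3)] =
    raw_tapes nv w ip u (\<lambda>i. Extra (e ((b(m := c)) i))) (int m) vp"
    by (simp only: raw_tapes_nth act.simps move.case raw_tapes_update)
  with wexec.WAct[where g = "cell_act e \<Gamma> f" and r = r and ts = ?ts and i = 3 and Q = Q, OF g]
  show ?thesis by (simp add: raw_tapes_nth(7))
qed

text \<open>Amortised time: twice the length of the output is a potential, raised by writing and
  spent by the erasure after a query. With it the bounds of successive commands simply add
  up.\<close>

definition runs_within where
  "runs_within Q nv w e ip d N s s' \<longleftrightarrow> (\<exists>t. wexec Q d (reg s, tapes nv w e ip s) t (reg s', tapes nv w e ip s') \<and>
     t + 2 * length (out s') \<le> 2 * length (out s) + N)"

lemma runs_withinI:
  assumes "wexec Q d (reg s, tapes nv w e ip s) t (reg s', tapes nv w e ip s')"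
    "t + 2 * length (out s') \<le> 2 * length (out s) + N"
  shows "runs_within Q nv w e ip d N s s'"
  using assms unfolding runs_within_def by blast

lemma exec_compile_basic:
  assumes wf: "wf_com nv R \<Gamma> c" and ok: "ok_mem w R \<Gamma> s" and e: "inj_on e \<Gamma>"
    and basic: "case c of Seq a b \<Rightarrow> False | Cond P a b \<Rightarrow> False | For x a \<Rightarrow> False | ForIn a b \<Rightarrow> False | _ \<Rightarrow> True"
  shows "runs_within Q nv w e ip (compile e \<Gamma> c) (poly (time c) (length w)) s (sem Q w c s)"
proof (cases c)
  case (Upd f)
  let ?ts = "tapes nv w e ip s"
  have "wexec Q (WAct 0 (\<lambda>r x. (f r, x, Stay))) (reg s, ?ts) 1
    (f (reg s), ?ts[0 := act (head_symbol (?ts ! 0), Stay) (?ts ! 0)])"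
    by (rule wexec.WAct) (simp_all add: tapes_def raw_tapes_nth)
  then show ?thesis unfolding Upd by (intro runs_withinI[where t = 1]) (simp_all add: act_Stay tapes_def)
next
  case (At x f)
  have x: "x < nv" "var s x \<le> length w" using wf ok by (auto simp: At ok_mem_def)
  obtain r' c' where f: "f (reg s) (arr s (var s x)) = (r', c')" by fastforce
  let ?vp = "\<lambda>y. int (var s y)" and ?u = "(word_cells (out s), int (length (out s)))" and ?m = "var s x"
  let ?a' = "\<lambda>i. Extra (e (((arr s)(?m := c')) i))"
  have 1: "wexec Q (walk_to x) (reg s, tapes nv w e ip s) (4 * ?m + 5)
    (reg s, raw_tapes nv w ip ?u (\<lambda>i. Extra (e (arr s i))) (int ?m) (?vp(x := -1)))"
    unfolding tapes_def by (rule exec_walk_to) (use x in auto)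
  have 2: "wexec Q (WAct 3 (cell_act e \<Gamma> f)) (reg s, raw_tapes nv w ip ?u (\<lambda>i. Extra (e (arr s i))) (int ?m) (?vp(x := -1))) 1
    (r', raw_tapes nv w ip ?u ?a' (int ?m) (?vp(x := -1)))"
    by (rule exec_cell_act) (use e ok x f in \<open>auto simp: ok_mem_def\<close>)
  \<comment> \<open>No second variable changes here. Any index other than \<open>x\<close> with a
    constant family fits the shape of \<open>exec_walk_back\<close>.\<close>
  obtain y where y: "y \<noteq> x" by (metis n_not_Suc_n)
  have "wexec Q (walk_back x nop) (r', raw_tapes nv w ip ?u ?a' (int (Suc ?m) - 1) ((?vp(x := -1))(y := ?vp y)))
    (6 * Suc ?m + 1) (r', raw_tapes nv w ip ?u ?a' (-1) ((?vp(x := -1))(y := ?vp y, x := (?vp(x := -1)) x + int (Suc ?m))))"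
    by (rule exec_walk_back[where u = "\<lambda>_. ?u" and q = "\<lambda>_. ?vp y"])
      (use x y exec_nop_raw in auto)
  moreover have "(?vp(x := -1))(y := ?vp y, x := (?vp(x := -1)) x + int (Suc ?m)) = ?vp" "(?vp(x := -1))(y := ?vp y) = ?vp(x := -1)"
    using y by auto
  ultimately have 3: "wexec Q (walk_back x nop) (r', raw_tapes nv w ip ?u ?a' (int ?m) (?vp(x := -1)))
    (6 * Suc ?m + 1) (r', raw_tapes nv w ip ?u ?a' (-1) ?vp)" by (simp only:) simp
  have "wexec Q (compile e \<Gamma> c) (reg s, tapes nv w e ip s) (10 * ?m + 15) (r', raw_tapes nv w ip ?u ?a' (-1) ?vp)"
    unfolding At compile.simps by (rule exec_seq[OF 1 exec_seq[OF 2 3 refl]]) simp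
  then show ?thesis unfolding At
    by (intro runs_withinI) (use x f in \<open>auto simp: tapes_def\<close>)
next
  case (Inc x)
  have x: "x < nv" "var s x \<le> length w" using wf ok by (auto simp: Inc ok_mem_def)
  let ?vp = "\<lambda>y. int (var s y)" and ?u = "(word_cells (out s), int (length (out s)))" and ?m = "var s x"
  let ?t = "\<lambda>vp. raw_tapes nv w ip ?u (\<lambda>i. Extra (e (arr s i))) (-1) vp"
  let ?vp' = "?vp(x := ?vp x + 1)"
  have 1: "wexec Q (go_right (4 + x)) (reg s, tapes nv w e ip s) 1 (reg s, ?t ?vp')"
    unfolding tapes_def by (rule exec_raw_go(6)[OF x(1)])
  have 2: "wexec Q (WIf (4 + x) (\<lambda>r x. x \<noteq> Blank) nop (go_left (4 + x))) (reg s, ?t ?vp') 2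
     (reg s, ?t (?vp(x := int (min (Suc ?m) (length w)))))"
  proof (cases "?m < length w")
    case True
    then have "?vp(x := int (min (Suc ?m) (length w))) = ?vp'" by auto
    moreover have "?t ?vp' \<noteq> []" by (simp add: raw_tapes_def)
    ultimately show ?thesis
      using wexec.WIfT[OF _ _ exec_nop[of "?t ?vp'"], of "\<lambda>r x. x \<noteq> Blank" "reg s" "4 + x" Q "go_left (4 + x)"]
        var_head[OF x(1), of w ip ?u "\<lambda>i. Extra (e (arr s i))" "-1" ?vp'] True x
      by (simp add: raw_tapes_nth(7) numeral_2_eq_2)
  next
    case False
    then have "?vp(x := int (min (Suc ?m) (length w))) = ?vp'(x := ?vp' x - 1)" using x by auto
    then show ?thesis
      using wexec.WIfF[OF _ _ exec_raw_go(5)[OF x(1)], of "\<lambda>r x. x \<noteq> Blank" "reg s" w ip ?u "\<lambda>i. Extra (e (arr s i))" "-1" ?vp' "4 + x" Q nop]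
        var_head[OF x(1), of w ip ?u "\<lambda>i. Extra (e (arr s i))" "-1" ?vp'] False x
      by (simp add: raw_tapes_nth(7) numeral_2_eq_2)
  qed
  have "wexec Q (compile e \<Gamma> c) (reg s, tapes nv w e ip s) 4 (reg s, ?t (?vp(x := int (min (Suc ?m) (length w)))))"
    unfolding Inc compile.simps by (rule exec_seq[OF 1 2]) simp
  then show ?thesis unfolding Inc
    by (intro runs_withinI[where t = 4]) (simp only: sem.simps mem.simps tapes_set_var, simp, simp)
next
  case (Zero x)
  have x: "x < nv" "var s x \<le> length w" using wf ok by (auto simp: Zero ok_mem_def)
  show ?thesis unfolding Zero compile.simps
  proof (rule runs_withinI[where t = "2 * var s x + 5"])
    show "wexec Q (rewind (4 + x)) (reg s, tapes nv w e ip s) (2 * var s x + 5)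
      (reg (sem Q w (Zero x) s), tapes nv w e ip (sem Q w (Zero x) s))"
      unfolding sem.simps tapes_set_var tapes_def[of nv w e ip s]
      using exec_rewind[OF x(1), of "\<lambda>y. int (var s y)" "var s x" w] x(2) by simp
  qed (use x in simp)
next
  case (Mov y x)
  have x: "x < nv" "var s x \<le> length w" "y < nv" "var s y \<le> length w" "x \<noteq> y" using wf ok by (auto simp: Mov ok_mem_def)
  let ?vp = "\<lambda>y. int (var s y)" and ?u = "(word_cells (out s), int (length (out s)))" and ?m = "var s x"
  let ?t = "\<lambda>ap vp. raw_tapes nv w ip ?u (\<lambda>i. Extra (e (arr s i))) ap vp"
  let ?vp1 = "?vp(x := -1)"
  let ?vp2 = "?vp1(y := ?vp1 y - 1)"
  have 1: "wexec Q (walk_to x) (reg s, tapes nv w e ip s) (4 * ?m + 5) (reg s, ?t (int ?m) ?vp1)"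
    unfolding tapes_def by (rule exec_walk_to) (use x in auto)
  have 2: "wexec Q (go_left (4 + y)) (reg s, ?t (int ?m) ?vp1) 1 (reg s, ?t (int ?m) ?vp2)"
    by (rule exec_raw_go(5)[OF x(3)])
  have 3: "wexec Q (while_nonblank (4 + y) (go_left (4 + y))) (reg s, ?t (int ?m) ?vp2) (2 * var s y + 1)
      (reg s, ?t (int ?m) (?vp2(y := -1)))"
    by (rule exec_rewind_var) (use x in auto)
  \<comment> \<open>The head of \<open>y\<close> starts at -1, and the \<open>m + 1\<close> moves of
    the walk bring it to \<open>m\<close>.\<close>
  have "wexec Q (walk_back x (go_right (4 + y))) (reg s, ?t (int (Suc ?m) - 1) (?vp1(y := int 0 - 1))) (6 * Suc ?m + 1)
      (reg s, ?t (-1) (?vp1(y := int (Suc ?m) - 1, x := ?vp1 x + int (Suc ?m))))"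
  proof (rule exec_walk_back[where u = "\<lambda>_. ?u" and q = "\<lambda>k. int k - 1"])
    fix vp k ap assume "k < Suc ?m"
    show "wexec Q (go_right (4 + y)) (reg s, ?t ap (vp(y := int k - 1))) 1 (reg s, ?t ap (vp(y := int (Suc k) - 1)))"
      using exec_raw_go(6)[OF x(3), of Q "reg s" w ip ?u "\<lambda>i. Extra (e (arr s i))" ap "vp(y := int k - 1)"] by simp
  qed (use x in auto)
  moreover have "?vp1(y := int (Suc ?m) - 1, x := ?vp1 x + int (Suc ?m)) = ?vp(y := int ?m)" "?vp1(y := int 0 - 1) = ?vp2(y := -1)"
    using x by auto
  ultimately have 4: "wexec Q (walk_back x (go_right (4 + y))) (reg s, ?t (int ?m) (?vp2(y := -1))) (6 * Suc ?m + 1)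
      (reg s, ?t (-1) (?vp(y := int ?m)))" by (simp only:) simp
  have "wexec Q (compile e \<Gamma> c) (reg s, tapes nv w e ip s) (10 * ?m + 2 * var s y + 17) (reg s, ?t (-1) (?vp(y := int ?m)))"
    unfolding Mov compile.simps by (rule exec_seq[OF 1 exec_seq[OF 2 exec_seq[OF 3 4 refl] refl]]) simp
  then have "wexec Q (compile e \<Gamma> c) (reg s, tapes nv w e ip s) (10 * ?m + 2 * var s y + 17)
     (reg (sem Q w c s), tapes nv w e ip (sem Q w c s))"
    unfolding Mov sem.simps tapes_set_var by simp
  then show ?thesis by (rule runs_withinI) (use x in \<open>auto simp: Mov\<close>)
next
  case (Emit b)
  show ?thesis unfolding Emit
    by (rule runs_withinI[where t = 1]) (use exec_write[of Q b "reg s"] in \<open>simp_all add: tapes_def\<close>)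
next
  case (EmitV x)
  have x: "x < nv" "var s x \<le> length w" using wf ok by (auto simp: EmitV ok_mem_def)
  let ?vp = "\<lambda>y. int (var s y)" and ?m = "var s x"
  let ?u = "\<lambda>k. (word_cells (out s @ replicate k True), int (length (out s @ replicate k True)))"
  let ?t = "\<lambda>k ap vp. raw_tapes nv w ip (?u k) (\<lambda>i. Extra (e (arr s i))) ap vp"
  let ?vp1 = "?vp(x := -1)"
  let ?vp2 = "?vp1(x := ?vp1 x + 1)"
  have "wexec Q (walk_to x) (reg s, ?t 0 (-1) ?vp) (4 * ?m + 5) (reg s, ?t 0 (int ?m) ?vp1)"
    by (rule exec_walk_to) (use x in auto)
  then have 1: "wexec Q (walk_to x) (reg s, tapes nv w e ip s) (4 * ?m + 5) (reg s, ?t 0 (int ?m) ?vp1)"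
    by (simp add: tapes_def)
  \<comment> \<open>Both heads are advanced by one cell before the walk; otherwise
    \<open>m + 1\<close> bits would be written instead of \<open>m\<close>.\<close>
  have 2: "wexec Q (go_left 3) (reg s, ?t 0 (int ?m) ?vp1) 1 (reg s, ?t 0 (int ?m - 1) ?vp1)"
    by (rule exec_raw_go(3))
  have 3: "wexec Q (go_right (4 + x)) (reg s, ?t 0 (int ?m - 1) ?vp1) 1 (reg s, ?t 0 (int ?m - 1) ?vp2)"
    by (rule exec_raw_go(6)[OF x(1)])
  obtain y where y: "y \<noteq> x" by (metis n_not_Suc_n)
  have "wexec Q (walk_back x (WAct 1 (\<lambda>r x. (r, Bit True, Go_Right)))) (reg s, ?t 0 (int ?m - 1) (?vp2(y := ?vp y))) (6 * ?m + 1)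
      (reg s, ?t ?m (-1) (?vp2(y := ?vp y, x := ?vp2 x + int ?m)))"
  proof (rule exec_walk_back[where u = ?u and q = "\<lambda>k. ?vp y"])
    fix vp k ap assume "k < ?m"
    show "wexec Q (WAct 1 (\<lambda>r x. (r, Bit True, Go_Right))) (reg s, ?t k ap (vp(y := ?vp y))) 1 (reg s, ?t (Suc k) ap (vp(y := ?vp y)))"
      using exec_write[of Q True "reg s" nv w ip "out s @ replicate k True"] by (simp add: replicate_append_same)
  qed (use x y in auto)
  moreover have "?vp2(y := ?vp y, x := ?vp2 x + int ?m) = ?vp" "?vp2(y := ?vp y) = ?vp2"
    using x y by auto
  ultimately have 4: "wexec Q (walk_back x (WAct 1 (\<lambda>r x. (r, Bit True, Go_Right)))) (reg s, ?t 0 (int ?m - 1) ?vp2) (6 * ?m + 1)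
      (reg s, ?t ?m (-1) ?vp)" by (simp only:)
  have "wexec Q (compile e \<Gamma> c) (reg s, tapes nv w e ip s) (10 * ?m + 11) (reg s, ?t ?m (-1) ?vp)"
    unfolding EmitV compile.simps by (rule exec_seq[OF 1 exec_seq[OF 2 exec_seq[OF 3 4 refl] refl]]) simp
  then show ?thesis unfolding EmitV
    by (intro runs_withinI) (use x in \<open>auto simp: tapes_def\<close>)
next
  case (Ask h)
  have "wexec Q (WAsk h) (reg s, tapes nv w e ip s) 3 (h (reg s) (\<exists>v\<in>Q. holds_word (tapes nv w e ip s ! 1) v), tapes nv w e ip s)"
    by (rule wexec.WAsk) (simp_all add: tapes_def raw_tapes_nth blank_tape_def)
  then have 1: "wexec Q (WAsk h) (reg s, tapes nv w e ip s) 3 (h (reg s) (out s \<in> Q), tapes nv w e ip s)"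
    by (simp add: tapes_def raw_tapes_nth holds_word_cells del: holds_word.simps)
  \<comment> \<open>The part proportional to the output is covered by the potential, since the
    output is empty afterwards.\<close>
  have "wexec Q (compile e \<Gamma> c) (reg s, tapes nv w e ip s) (2 * length (out s) + 9)
     (h (reg s) (out s \<in> Q), tapes nv w e ip (s\<lparr>reg := h (reg s) (out s \<in> Q), out := []\<rparr>))"
    unfolding Ask compile.simps
  proof (rule exec_seq[OF 1])
    show "wexec Q erase (h (reg s) (out s \<in> Q), tapes nv w e ip s) (2 * length (out s) + 5)
       (h (reg s) (out s \<in> Q), tapes nv w e ip (s\<lparr>reg := h (reg s) (out s \<in> Q), out := []\<rparr>))"
      using exec_erase[of Q _ nv w ip "out s"] by (simp add: tapes_def)
  qed simp
  then show ?thesis unfolding Ask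
    by (intro runs_withinI[where t = "2 * length (out s) + 9"]) simp_all
qed (use basic in simp_all)


lemma runs_within_seq:
  assumes "runs_within Q nv w e ip a N s s'" "runs_within Q nv w e ip b M s' s''"
  shows "runs_within Q nv w e ip (WSeq a b) (N + M + 1) s s''"
  using assms unfolding runs_within_def by (fastforce intro: exec_seq)

lemma runs_within_mono: "runs_within Q nv w e ip a N s s' \<Longrightarrow> N \<le> M \<Longrightarrow> runs_within Q nv w e ip a M s s'"
  unfolding runs_within_def by force

lemma runs_within_if:
  assumes "runs_within Q nv w e ip (if P (reg s) (head_symbol (tapes nv w e ip s ! 0)) then a else b) N s s'"
  shows "runs_within Q nv w e ip (WIf 0 P a b) (N + 1) s s'"
proof -
  have l: "0 < length (tapes nv w e ip s)" by (simp add: tapes_def raw_tapes_nth)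
  from assms obtain t where "wexec Q (if P (reg s) (head_symbol (tapes nv w e ip s ! 0)) then a else b)
      (reg s, tapes nv w e ip s) t (reg s', tapes nv w e ip s')"
    "t + 2 * length (out s') \<le> 2 * length (out s) + N" unfolding runs_within_def by blast
  then show ?thesis
    using wexec.WIfT[OF _ l, of P "reg s" Q a t] wexec.WIfF[OF _ l, of P "reg s" Q b t]
    by (cases "P (reg s) (head_symbol (tapes nv w e ip s ! 0))") (auto intro!: runs_withinI[where t = "Suc t"])
qed

text \<open>The body does not assign \<open>x\<close>, so it returns the head of \<open>x\<close> to
  the cell of the current round. A move to the right starts the next round, and the blank behind the
  last mark ends the loop.\<close>

lemma runs_within_for:
  assumes x: "x < nv" "x \<notin> assigned c" and wf: "wf_com nv R \<Gamma> c" and ok: "ok_mem w R \<Gamma> s"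
    and body: "\<And>s. ok_mem w R \<Gamma> s \<Longrightarrow> runs_within Q nv w e ip d N s (sem Q w c s)"
  shows "runs_within Q nv w e ip (WSeq (rewind (4 + x)) (WSeq (while_nonblank (4 + x) (WSeq d (go_right (4 + x)))) (rewind (4 + x))))
    ((length w + 1) * (N + 3) + (20 + length w * 20)) s (sem Q w (For x c) s)"
proof -
  let ?set = "\<lambda>s k. s\<lparr>var := (var s)(x := k)\<rparr>"
  let ?n = "length w"
  define S where "S k = fold (\<lambda>k s. sem Q w c (?set s k)) [0..<k] s" for k
  have S_Suc: "S (Suc k) = sem Q w c (?set (S k) k)" for k by (simp add: S_def)
  have okS: "k \<le> Suc ?n \<Longrightarrow> ok_mem w R \<Gamma> (S k)" for k
  proof (induction k)
    case (Suc k)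
    then show ?case unfolding S_Suc by (intro sem_ok[OF wf]) (auto simp: ok_mem_def)
  qed (use ok in \<open>simp add: S_def\<close>)
  have set_tapes: "tapes nv w e ip (?set s k) = raw_tapes nv w ip (word_cells (out s), int (length (out s)))
     (\<lambda>i. Extra (e (arr s i))) (-1) ((\<lambda>x. int (var s x))(x := int k))" for s k
    by (rule tapes_set_var)
  have rew: "runs_within Q nv w e ip (rewind (4 + x)) (2 * k + 5) (?set s k) (?set s 0)" if "k \<le> Suc ?n" for k s
    using exec_rewind[OF x(1), of "(\<lambda>x. int (var s x))(x := int k)" k w Q "reg s" ip] that
    by (intro runs_withinI[where t = "2 * k + 5"]) (simp_all add: set_tapes)
  have step: "runs_within Q nv w e ip (WSeq d (go_right (4 + x))) (N + 2) (?set (S k) k) (?set (S (Suc k)) (Suc k))"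
    if k: "k \<le> ?n" for k
  proof -
    have 1: "runs_within Q nv w e ip d N (?set (S k) k) (S (Suc k))"
      unfolding S_Suc by (rule body) (use okS[of k] k in \<open>auto simp: ok_mem_def\<close>)
    have "var (S (Suc k)) x = k" unfolding S_Suc using sem_unassigned[OF x(2)] by simp
    then have "runs_within Q nv w e ip (go_right (4 + x)) 1 (S (Suc k)) (?set (S (Suc k)) (Suc k))"
      using exec_raw_go(6)[OF x(1), of Q "reg (S (Suc k))" w ip _ _ "-1" "\<lambda>x. int (var (S (Suc k)) x)"]
      by (intro runs_withinI[where t = 1]) (simp_all add: set_tapes tapes_def[of nv w e ip "S (Suc k)"] add.commute)
    from runs_within_seq[OF 1 this] show ?thesis by simp
  qed
  have loop: "j \<le> Suc ?n \<Longrightarrow> runs_within Q nv w e ip (while_nonblank (4 + x) (WSeq d (go_right (4 + x)))) (j * (N + 3) + 1)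
      (?set (S (Suc ?n - j)) (Suc ?n - j)) (?set (S (Suc ?n)) (Suc ?n))" for j
  proof (induction j)
    case 0
    have "head_symbol (tapes nv w e ip (?set (S (Suc ?n)) (Suc ?n)) ! (4 + x)) = Blank"
      using x(1) by (simp add: set_tapes raw_tapes_nth cells_def)
    moreover have "4 + x < length (tapes nv w e ip (?set (S (Suc ?n)) (Suc ?n)))"
      using x(1) by (simp add: tapes_def raw_tapes_nth(7))
    ultimately have "wexec Q (while_nonblank (4 + x) (WSeq d (go_right (4 + x))))
      (reg (?set (S (Suc ?n)) (Suc ?n)), tapes nv w e ip (?set (S (Suc ?n)) (Suc ?n))) 1
      (reg (?set (S (Suc ?n)) (Suc ?n)), tapes nv w e ip (?set (S (Suc ?n)) (Suc ?n)))"
      by (intro wexec.WWhileF) blast+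
    then show ?case unfolding diff_zero by (rule runs_withinI) simp
  next
    case (Suc j)
    define k where "k = ?n - j"
    have k: "Suc ?n - j = Suc k" "Suc ?n - Suc j = k" "k \<le> ?n" using Suc.prems by (auto simp: k_def)
    from step[OF k(3)] obtain t where t: "wexec Q (WSeq d (go_right (4 + x))) (reg (?set (S k) k), tapes nv w e ip (?set (S k) k)) t
       (reg (?set (S (Suc k)) (Suc k)), tapes nv w e ip (?set (S (Suc k)) (Suc k)))"
       "t + 2 * length (out (S (Suc k))) \<le> 2 * length (out (S k)) + (N + 2)"
      unfolding runs_within_def by auto
    from Suc.IH Suc.prems obtain t' where t': "wexec Q (while_nonblank (4 + x) (WSeq d (go_right (4 + x))))
       (reg (?set (S (Suc k)) (Suc k)), tapes nv w e ip (?set (S (Suc k)) (Suc k))) t'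
       (reg (?set (S (Suc ?n)) (Suc ?n)), tapes nv w e ip (?set (S (Suc ?n)) (Suc ?n)))"
       "t' + 2 * length (out (S (Suc ?n))) \<le> 2 * length (out (S (Suc k))) + (j * (N + 3) + 1)"
      unfolding runs_within_def k by auto
    have "wexec Q (while_nonblank (4 + x) (WSeq d (go_right (4 + x)))) (reg (?set (S k) k), tapes nv w e ip (?set (S k) k)) (Suc (t + t'))
       (reg (?set (S (Suc ?n)) (Suc ?n)), tapes nv w e ip (?set (S (Suc ?n)) (Suc ?n)))"
      by (rule exec_while_step[OF _ _ t(1) t'(1)])
        (use x(1) k(3) in \<open>auto simp: set_tapes raw_tapes_nth cells_def\<close>)
    then show ?case unfolding k by (rule runs_withinI) (use t(2) t'(2) in simp)
  qed
  have vx: "var s x \<le> ?n" using ok by (simp add: ok_mem_def)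
  have "?set s (var s x) = s" by simp
  then have r1: "runs_within Q nv w e ip (rewind (4 + x)) (2 * var s x + 5) s (?set (S 0) 0)"
    using rew[of "var s x" s] vx by (simp add: S_def)
  have l: "runs_within Q nv w e ip (while_nonblank (4 + x) (WSeq d (go_right (4 + x)))) (Suc ?n * (N + 3) + 1)
      (?set (S 0) 0) (?set (S (Suc ?n)) (Suc ?n))"
    using loop[of "Suc ?n"] by simp
  have "sem Q w (For x c) s = ?set (S (Suc ?n)) 0" by (simp add: S_def)
  with runs_within_seq[OF r1 runs_within_seq[OF l rew]]
  show ?thesis by (rule_tac runs_within_mono) (use vx in auto)
qed

lemma runs_within_forin:
  assumes wf: "wf_com nv R \<Gamma> a" "wf_com nv R \<Gamma> b" and ok: "ok_mem w R \<Gamma> s"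
    and a: "\<And>s ip. ok_mem w R \<Gamma> s \<Longrightarrow> runs_within Q nv w e ip d N s (sem Q w a s)"
    and b: "\<And>s ip. ok_mem w R \<Gamma> s \<Longrightarrow> runs_within Q nv w e ip d' M s (sem Q w b s)"
  shows "runs_within Q nv w e 0 (WSeq
     (while_nonblank 0 (WSeq (WIf 0 (\<lambda>r x. x = Bit True) d d') (go_right 0))) (rewind 0))
    ((length w + 1) * (N + M + 4) + (20 + length w * 20)) s (sem Q w (ForIn a b) s)"
proof -
  let ?f = "\<lambda>i s. if i then sem Q w a s else sem Q w b s"
  let ?loop = "while_nonblank 0 (WSeq (WIf 0 (\<lambda>r x. x = Bit True) d d') (go_right 0))"
  have loop: "ok_mem w R \<Gamma> s \<Longrightarrow> w = u @ v \<Longrightarrow> \<exists>t. wexec Q ?loop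
      (reg s, tapes nv w e (int (length u)) s) t (reg (fold ?f v s), tapes nv w e (int (length w)) (fold ?f v s)) \<and>
      t + 2 * length (out (fold ?f v s)) \<le> 2 * length (out s) + (length v * (N + M + 4) + 1)" for u v s
  proof (induction v arbitrary: u s)
    case Nil
    have "head_symbol (tapes nv w e (int (length w)) s ! 0) = Blank"
      by (simp add: tapes_def raw_tapes_nth word_cells_def)
    then have "wexec Q ?loop (reg s, tapes nv w e (int (length w)) s) 1 (reg s, tapes nv w e (int (length w)) s)"
      by (intro wexec.WWhileF) (simp_all add: tapes_def raw_tapes_nth(7))
    then show ?case using Nil by (intro exI[of _ 1]) simp
  next
    case (Cons i v)
    let ?ip = "int (length u)"
    have hd: "head_symbol (tapes nv w e ?ip s ! 0) = Bit i"
      using Cons.prems(2) by (simp add: tapes_def raw_tapes_nth word_cells_def)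
    have ok': "ok_mem w R \<Gamma> (?f i s)" using sem_ok[OF wf(1) Cons.prems(1)] sem_ok[OF wf(2) Cons.prems(1)] by simp
    have "runs_within Q nv w e ?ip (WIf 0 (\<lambda>r x. x = Bit True) d d') (N + M + 1) s (?f i s)"
      by (rule runs_within_if) (use a[OF Cons.prems(1), of ?ip] b[OF Cons.prems(1), of ?ip] in \<open>auto simp: hd intro: runs_within_mono\<close>)
    then obtain t where t: "wexec Q (WIf 0 (\<lambda>r x. x = Bit True) d d') (reg s, tapes nv w e ?ip s) t (reg (?f i s), tapes nv w e ?ip (?f i s))"
      "t + 2 * length (out (?f i s)) \<le> 2 * length (out s) + (N + M + 1)" unfolding runs_within_def by blast
    have g: "wexec Q (go_right 0) (reg (?f i s), tapes nv w e ?ip (?f i s)) 1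
       (reg (?f i s), tapes nv w e (int (length (u @ [i]))) (?f i s))"
      using exec_raw_go(2)[of Q "reg (?f i s)" nv w ?ip] by (simp add: tapes_def add.commute del: One_nat_def)
    obtain t' where t': "wexec Q ?loop (reg (?f i s), tapes nv w e (int (length (u @ [i]))) (?f i s)) t'
         (reg (fold ?f v (?f i s)), tapes nv w e (int (length w)) (fold ?f v (?f i s)))"
      "t' + 2 * length (out (fold ?f v (?f i s))) \<le> 2 * length (out (?f i s)) + (length v * (N + M + 4) + 1)"
      using Cons.IH[OF ok', of "u @ [i]"] Cons.prems(2) by auto
    have "wexec Q ?loop (reg s, tapes nv w e ?ip s) (Suc (Suc (t + 1) + t'))
       (reg (fold ?f v (?f i s)), tapes nv w e (int (length w)) (fold ?f v (?f i s)))"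
      by (rule exec_while_step[OF _ _ exec_seq[OF t(1) g refl] t'(1) refl])
        (simp add: hd, simp add: tapes_def raw_tapes_nth(7))
    then show ?case using t(2) t'(2) by (intro exI[of _ "Suc (Suc (t + 1) + t')"]) simp
  qed
  obtain t where t: "wexec Q ?loop (reg s, tapes nv w e 0 s) t (reg (fold ?f w s), tapes nv w e (int (length w)) (fold ?f w s))"
      "t + 2 * length (out (fold ?f w s)) \<le> 2 * length (out s) + (length w * (N + M + 4) + 1)"
    using loop[OF ok, of "[]" w] by auto
  have r: "wexec Q (rewind 0) (reg (fold ?f w s), tapes nv w e (int (length w)) (fold ?f w s)) (2 * length w + 5)
     (reg (fold ?f w s), tapes nv w e 0 (fold ?f w s))"
    unfolding tapes_def by (rule exec_rewind_input) simp
  show ?thesis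
    by (rule runs_withinI, rule exec_seq[OF t(1)]) (use r t(2) in auto)
qed

text \<open>The body of a scan runs while the input head is somewhere inside the word, so commands
  without scans are treated for every \<open>ip\<close>. A scan itself starts at 0 and rewinds to
  0.\<close>

lemma exec_compile:
  assumes e: "inj_on e \<Gamma>"
  shows "wf_com nv R \<Gamma> c \<Longrightarrow> ok_mem w R \<Gamma> s \<Longrightarrow> (scans_input c \<longrightarrow> ip = 0) \<Longrightarrow>
    runs_within Q nv w e ip (compile e \<Gamma> c) (poly (time c) (length w)) s (sem Q w c s)"
proof (induction c arbitrary: s ip)
  case (Seq a b)
  have "ok_mem w R \<Gamma> (sem Q w a s)" using Seq.prems by (intro sem_ok[of nv]) auto
  then show ?case using runs_within_seq[OF Seq.IH(1)[of s ip] Seq.IH(2)[of "sem Q w a s" ip]] Seq.prems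
    by simp
next
  case (Cond P a b)
  have "runs_within Q nv w e ip (if P (reg s) then compile e \<Gamma> a else compile e \<Gamma> b)
    (poly (time a) (length w) + poly (time b) (length w)) s (sem Q w (Cond P a b) s)"
    using runs_within_mono[OF Cond.IH(1)[of s ip]] runs_within_mono[OF Cond.IH(2)[of s ip]] Cond.prems by simp
  then have "runs_within Q nv w e ip (WIf 0 (\<lambda>r x. P r) (compile e \<Gamma> a) (compile e \<Gamma> b))
    (poly (time a) (length w) + poly (time b) (length w) + 1) s (sem Q w (Cond P a b) s)"
    by (rule runs_within_if)
  then show ?case by simp
next
  case (For x c)
  have "runs_within Q nv w e ip (compile e \<Gamma> c) (poly (time c) (length w)) s (sem Q w c s)" if "ok_mem w R \<Gamma> s" for s
    using For that by simp
  then have "runs_within Q nv w e ip (compile e \<Gamma> (For x c))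
    ((length w + 1) * (poly (time c) (length w) + 3) + (20 + length w * 20)) s (sem Q w (For x c) s)"
    unfolding compile.simps using For.prems by (intro runs_within_for[of x nv c R \<Gamma>]) auto
  then show ?case by (rule runs_within_mono) (simp add: algebra_simps)
next
  case (ForIn a b)
  have "runs_within Q nv w e ip (compile e \<Gamma> a) (poly (time a) (length w)) s (sem Q w a s)"
    "runs_within Q nv w e ip (compile e \<Gamma> b) (poly (time b) (length w)) s (sem Q w b s)"
    if "ok_mem w R \<Gamma> s" for s ip
    using ForIn that by simp_all
  then have "runs_within Q nv w e 0 (compile e \<Gamma> (ForIn a b))
    ((length w + 1) * (poly (time a) (length w) + poly (time b) (length w) + 4) + (20 + length w * 20)) s (sem Q w (ForIn a b) s)"
    unfolding compile.simps using ForIn.prems by (intro runs_within_forin[of nv R \<Gamma> a b]) auto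
  then have "runs_within Q nv w e 0 (compile e \<Gamma> (ForIn a b)) (poly (time (ForIn a b)) (length w)) s (sem Q w (ForIn a b) s)"
    by (rule runs_within_mono) (simp add: algebra_simps)
  with ForIn.prems show ?case by simp
qed ((rule exec_compile_basic[OF _ _ e]; simp)+)

subsection \<open>Initialising the tapes\<close>

text \<open>The input serves as a ruler: one mark for each letter and one more give the cells 0 to
  \<open>length w\<close>. The head ends at -1, where the array head rests; for a variable one move
  to the right follows.\<close>

definition init_tape :: "symbol \<Rightarrow> nat \<Rightarrow> 'r wcom" where
  "init_tape x i = WSeq (while_nonblank 0 (WSeq (go_right 0) (WAct i (\<lambda>r _. (r, x, Go_Right)))))
     (WSeq (WAct i (\<lambda>r _. (r, x, Stay))) (WSeq (while_nonblank i (go_left i)) (rewind 0)))"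

primrec init_vars :: "nat \<Rightarrow> 'r wcom" where
  "init_vars 0 = nop"
| "init_vars (Suc k) = WSeq (init_vars k) (WSeq (init_tape (Bit True) (4 + k)) (go_right (4 + k)))"

lemma exec_go_leftmost:
  assumes "i < length ts" "ts ! i = (f, int m - 1)" "f (-1) = Blank" "\<And>j. j < m \<Longrightarrow> f (int j) \<noteq> Blank"
  shows "wexec Q (while_nonblank i (go_left i)) (r, ts) (2 * m + 1) (r, ts[i := (f, -1)])"
  using assms
proof (induction m arbitrary: ts)
  case 0
  then have "ts[i := (f, -1)] = ts" by (metis list_update_id of_nat_0 diff_0)
  then show ?case using 0 wexec.WWhileF[of "\<lambda>r x. x \<noteq> Blank" r ts i Q] by simp
next
  case (Suc m)
  let ?ts = "ts[i := (f, int (Suc m) - 1 - 1)]"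
  have l: "wexec Q (go_left i) (r, ts) 1 (r, ?ts)" by (rule exec_go_left) (use Suc.prems in auto)
  have IH: "wexec Q (while_nonblank i (go_left i)) (r, ?ts) (2 * m + 1) (r, ?ts[i := (f, -1)])"
    by (rule Suc.IH) (use Suc.prems in auto)
  then show ?case
    by (intro exec_while_step[OF _ _ l IH[unfolded list_update_overwrite]]) (use Suc.prems(4)[of m] Suc.prems in auto)
qed

lemma exec_init_tape:
  assumes i: "i \<noteq> 0" "i < length ts" and ts: "ts ! i = blank_tape" "ts ! 0 = (word_cells w, 0)" and x: "x \<noteq> Blank"
  shows "wexec Q (init_tape x i) (r, ts) (8 * length w + 13) (r, ts[i := (cells (length w) (\<lambda>_. x), -1)])"
proof -
  let ?n = "length w"
  define fill where "fill k = (\<lambda>j. if 0 \<le> j \<and> j < int k then x else Blank)" for k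
  define st where "st k = ts[0 := (word_cells w, int k), i := (fill k, int k)]" for k
  have "0 < length ts" using i by linarith
  then have st_simps: "length (st k) = length ts" "st k ! 0 = (word_cells w, int k)" "st k ! i = (fill k, int k)" for k
    using i by (auto simp: st_def)
  have "fill 0 = (\<lambda>_. Blank)" by (auto simp: fill_def fun_eq_iff)
  moreover have "ts[0 := (word_cells w, 0)] = ts" "ts[i := blank_tape] = ts" using ts by (metis list_update_id)+
  ultimately have st0: "st 0 = ts" by (simp add: st_def blank_tape_def)
  have fill_Suc: "(fill k)(int k := x) = fill (Suc k)" for k by (auto simp: fill_def fun_eq_iff)
  have body: "wexec Q (WSeq (go_right 0) (WAct i (\<lambda>r _. (r, x, Go_Right)))) (r, st k) 3 (r, st (Suc k))" for k
  proof -
    let ?t = "(st k)[0 := (word_cells w, int k + 1)]"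
    have 1: "wexec Q (go_right 0) (r, st k) 1 (r, ?t)" by (rule exec_go_right) (use i in \<open>auto simp: st_simps\<close>)
    have "wexec Q (WAct i (\<lambda>r _. (r, x, Go_Right))) (r, ?t) 1 (r, ?t[i := act (x, Go_Right) (?t ! i)])"
      by (rule wexec.WAct) (use i in \<open>auto simp: st_simps\<close>)
    moreover have "?t[i := act (x, Go_Right) (?t ! i)] = st (Suc k)"
    proof -
      have "?t ! i = (fill k, int k)" using i by (simp add: st_simps)
      then show ?thesis using i(1)
        by (simp add: fill_Suc st_def list_update_swap[of i 0] add.commute)
    qed
    ultimately show ?thesis using exec_seq[OF 1, of "WAct i (\<lambda>r _. (r, x, Go_Right))" 1 "(r, st (Suc k))" 3] by simp
  qed
  have loop: "j \<le> ?n \<Longrightarrow> wexec Q (while_nonblank 0 (WSeq (go_right 0) (WAct i (\<lambda>r _. (r, x, Go_Right))))) (r, st (?n - j)) (4 * j + 1) (r, st ?n)" for j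
  proof (induction j)
    case 0
    then show ?case using i wexec.WWhileF[of "\<lambda>r x. x \<noteq> Blank" r "st ?n" 0 Q] \<open>0 < length ts\<close> by (simp add: st_simps word_cells_def)
  next
    case (Suc j)
    then have k: "?n - j = Suc (?n - Suc j)" by simp
    show ?case
      by (rule exec_while_step[OF _ _ body[of "?n - Suc j", folded k] Suc.IH])
        (use Suc.prems i in \<open>auto simp: st_simps word_cells_def\<close>)
  qed
  have 1: "wexec Q (while_nonblank 0 (WSeq (go_right 0) (WAct i (\<lambda>r _. (r, x, Go_Right))))) (r, ts) (4 * ?n + 1) (r, st ?n)"
    using loop[of ?n] st0 by simp
  let ?t1 = "(st ?n)[i := (fill (Suc ?n), int ?n)]"
  have 2: "wexec Q (WAct i (\<lambda>r _. (r, x, Stay))) (r, st ?n) 1 (r, ?t1)"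
    using wexec.WAct[of "\<lambda>r _. (r, x, Stay)" r "st ?n" i r x Stay Q] i by (simp add: st_simps fill_Suc)
  let ?t2 = "?t1[i := (fill (Suc ?n), -1)]"
  have 3: "wexec Q (while_nonblank i (go_left i)) (r, ?t1) (2 * Suc ?n + 1) (r, ?t2)"
    by (rule exec_go_leftmost) (use i x in \<open>auto simp: st_simps fill_def\<close>)
  let ?t3 = "?t2[0 := (word_cells w, int ?n - 1)]" and ?t4 = "?t2[0 := (word_cells w, -1)]"
  have 4: "wexec Q (go_left 0) (r, ?t2) 1 (r, ?t3)"
    by (rule exec_go_left) (use i in \<open>auto simp: st_simps\<close>)
  have "wexec Q (while_nonblank 0 (go_left 0)) (r, ?t3) (2 * ?n + 1) (r, ?t3[0 := (word_cells w, -1)])"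
    by (rule exec_go_leftmost) (use i \<open>0 < length ts\<close> in \<open>auto simp: st_simps word_cells_def\<close>)
  then have 5: "wexec Q (while_nonblank 0 (go_left 0)) (r, ?t3) (2 * ?n + 1) (r, ?t4)" by simp
  have 6: "wexec Q (go_right 0) (r, ?t4) 1 (r, ?t4[0 := (word_cells w, -1 + 1)])"
    by (rule exec_go_right) (use i \<open>0 < length ts\<close> in \<open>auto simp: st_simps\<close>)
  have "fill (Suc ?n) = cells ?n (\<lambda>_. x)" by (auto simp: fill_def cells_def fun_eq_iff)
  then have end': "?t4[0 := (word_cells w, -1 + 1)] = ts[i := (cells ?n (\<lambda>_. x), -1)]"
    using i(1) ts(2) list_update_id[of ts 0] by (simp add: st_def list_update_swap[of i 0])
  show ?thesis unfolding init_tape_def rewind_def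
    by (rule exec_seq[OF 1 exec_seq[OF 2 exec_seq[OF 3 exec_seq[OF 4 exec_seq[OF 5 6[unfolded end'] refl] refl] refl] refl]]) simp
qed

lemma wf_init_tape: "i < k \<Longrightarrow> x \<in> Al \<Longrightarrow> wf_wcom k R Al (init_tape x i)"
  by (simp add: init_tape_def rewind_def go_left_def go_right_def)

lemma wf_init_vars: "m + 4 \<le> k \<Longrightarrow> Bit True \<in> Al \<Longrightarrow> wf_wcom k R Al (init_vars m)"
  by (induction m) (simp_all add: wf_init_tape go_right_def nop_def)

lemma exec_init_vars:
  fixes r :: 'r
  assumes pre: "length pre = 4" "pre ! 0 = (word_cells w, 0)"
  shows "wexec Q (init_vars k) (r, pre @ replicate (k + j) blank_tape) (k * (8 * length w + 16) + 1)
     (r, pre @ replicate k (cells (length w) (\<lambda>_. Bit True), 0) @ replicate j blank_tape)"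
proof (induction k arbitrary: j)
  case 0
  have "pre \<noteq> []" using pre(1) by auto
  then show ?case using exec_nop[of "pre @ replicate j blank_tape" Q r] by simp
next
  case (Suc k)
  let ?v = "\<lambda>p. (cells (length w) (\<lambda>_. Bit True), p)"
  let ?t = "pre @ replicate k (?v 0) @ replicate (Suc j) blank_tape"
  have 1: "wexec Q (init_vars k) (r, pre @ replicate (Suc k + j) blank_tape) (k * (8 * length w + 16) + 1) (r, ?t)"
    using Suc.IH[of "Suc j"] by simp
  have up: "?t[4 + k := y] = pre @ replicate k (?v 0) @ y # replicate j blank_tape" for y
    using pre(1) by (simp add: list_update_append)
  have nth: "?t ! (4 + k) = blank_tape" "(pre @ replicate k (?v 0) @ y # replicate j blank_tape) ! (4 + k) = y" for y
    using pre(1) by (simp_all add: nth_append)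
  have up2: "(pre @ replicate k (?v 0) @ z # replicate j blank_tape)[4 + k := y] = pre @ replicate k (?v 0) @ y # replicate j blank_tape" for y z
    using pre(1) by (simp add: list_update_append)
  have "?t ! 0 = (word_cells w, 0)" using pre by (simp add: nth_append)
  then have 2: "wexec Q (init_tape (Bit True) (4 + k)) (r, ?t) (8 * length w + 13) (r, ?t[4 + k := ?v (-1)])"
    by (intro exec_init_tape) (use pre nth in auto)
  have "wexec Q (go_right (4 + k)) (r, ?t[4 + k := ?v (-1)]) 1 (r, (?t[4 + k := ?v (-1)])[4 + k := ?v (-1 + 1)])"
    by (rule exec_go_right) (use pre(1) in auto)
  then have 3: "wexec Q (go_right (4 + k)) (r, ?t[4 + k := ?v (-1)]) 1 (r, pre @ replicate (Suc k) (?v 0) @ replicate j blank_tape)"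
    by (simp add: up up2 replicate_app_Cons_same)
  show ?case unfolding init_vars.simps
    by (rule exec_seq[OF 1 exec_seq[OF 2 3 refl]]) simp
qed

definition start :: "'r \<Rightarrow> 'c \<Rightarrow> ('r, 'c) mem" where
  "start r c = \<lparr>reg = r, var = (\<lambda>_. 0), arr = (\<lambda>_. c), out = []\<rparr>"

theorem poly_turing_reducible_com:
  assumes fin: "finite R" "finite \<Gamma>" and r: "r \<in> R" and c0: "c0 \<in> \<Gamma>" and wf: "wf_com nv R \<Gamma> c"
    and acc: "\<And>w. acc (reg (sem Q w c (start r c0))) \<longleftrightarrow> w \<in> L"
  shows "poly_turing_reducible L Q"
proof -
  obtain e :: "'b \<Rightarrow> nat" where e: "inj_on e \<Gamma>"
    using finite_imp_inj_to_nat_seg[OF fin(2)] by blast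
  let ?Al = "{Blank, Bit True, Bit False} \<union> Extra ` e ` \<Gamma>"
  let ?c = "WSeq (init_tape (Extra (e c0)) 3) (WSeq (init_vars nv) (compile e \<Gamma> c))"
  let ?p = "[:20, 8:] + [:nv:] * [:20, 8:] + time c"
  show ?thesis
  proof (rule poly_turing_reducible_wcom[where c = ?c and k = "4 + nv" and p = ?p and acc = acc])
    show "wf_wcom (4 + nv) R ?Al ?c"
      using wf_compile[OF wf, of e] wf_init_tape[of 3 "4 + nv" "Extra (e c0)" ?Al R] wf_init_vars[of nv "4 + nv" ?Al R] c0 by simp
    fix w
    let ?ts = "input_tape w # replicate (4 + nv - 1) blank_tape"
    let ?pre = "[(word_cells w, 0), blank_tape, blank_tape, (cells (length w) (\<lambda>_. Extra (e c0)), -1)]"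
    have ts: "?ts = [(word_cells w, 0), blank_tape, blank_tape, blank_tape] @ replicate nv blank_tape"
      by (simp add: input_tape_def word_cells_def numeral_3_eq_3 numeral_eq_Suc)
    have 1: "wexec Q (init_tape (Extra (e c0)) 3) (r, ?ts) (8 * length w + 13) (r, ?pre @ replicate nv blank_tape)"
    proof -
      have "wexec Q (init_tape (Extra (e c0)) 3) (r, ?ts) (8 * length w + 13) (r, ?ts[3 := (cells (length w) (\<lambda>_. Extra (e c0)), -1)])"
        unfolding ts by (rule exec_init_tape) auto
      then show ?thesis unfolding ts by (simp add: numeral_3_eq_3)
    qed
    have "wexec Q (init_vars nv) (r, ?pre @ replicate (nv + 0) blank_tape) (nv * (8 * length w + 16) + 1)
       (r, ?pre @ replicate nv (cells (length w) (\<lambda>_. Bit True), 0) @ replicate 0 blank_tape)"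
      by (rule exec_init_vars) auto
    moreover have "?pre @ replicate nv (cells (length w) (\<lambda>_. Bit True), 0) @ replicate 0 blank_tape = tapes nv w e 0 (start r c0)"
      by (simp add: tapes_def raw_tapes_def start_def blank_tape_def word_cells_def map_replicate_const)
    ultimately have 2: "wexec Q (init_vars nv) (r, ?pre @ replicate nv blank_tape) (nv * (8 * length w + 16) + 1)
       (r, tapes nv w e 0 (start r c0))" by simp
    have "runs_within Q nv w e 0 (compile e \<Gamma> c) (poly (time c) (length w)) (start r c0) (sem Q w c (start r c0))"
      by (rule exec_compile[OF e wf]) (use r c0 in \<open>auto simp: ok_mem_def start_def\<close>)
    then obtain t where t: "wexec Q (compile e \<Gamma> c) (r, tapes nv w e 0 (start r c0)) t
        (reg (sem Q w c (start r c0)), tapes nv w e 0 (sem Q w c (start r c0)))" "t \<le> poly (time c) (length w)"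
      by (auto simp: runs_within_def start_def)
    show "\<exists>n r' ts'. n \<le> poly ?p (length w) \<and> wexec Q ?c (r, ?ts) n (r', ts') \<and> (acc r' \<longleftrightarrow> w \<in> L)"
      using exec_seq[OF 1 exec_seq[OF 2 t(1) refl] refl] acc[of w] t(2)
      by (intro exI[of _ "Suc (8 * length w + 13 + Suc (nv * (8 * length w + 16) + 1 + t))"]
          exI[of _ "reg (sem Q w c (start r c0))"] exI[of _ "tapes nv w e 0 (sem Q w c (start r c0))"] conjI)
        (simp add: algebra_simps, assumption+)
  qed (use fin r in auto)
qed

section \<open>The signed graph of a template\<close>

datatype kind = Both | Down | Up

datatype ('t, 'r) node = Bot 't | Top 'r | Mid 't 'r nat kind

definition level_sign :: "nat \<Rightarrow> sign" where
  "level_sign j = (if odd j then Pos else Neg)"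

text \<open>The gaps above and below a level have opposite signs, so an edge whose sign is not that
  of the gap above must lead down. Leaving the ladder at either end gives the level 0 or the level
  above the top.\<close>

definition next_level :: "sign \<Rightarrow> nat \<Rightarrow> nat" where
  "next_level s j = (if s = level_sign j then Suc j else j - 1)"

lemma next_level_up: "next_level (level_sign j) j = Suc j"
  by (simp add: next_level_def)

lemma next_level_down: "next_level (level_sign j) (Suc j) = j"
  by (simp add: next_level_def level_sign_def)

text \<open>
  A rung of the ladder between a bottom node \<open>b\<close> at level \<open>1\<close> and a top node \<open>t\<close> at level \<open>h\<close>. A
  node of kind \<open>Down\<close> (\<open>Up\<close>) has neighbours on the level below (above) only.
\<close>

definition rung :: "nat \<Rightarrow> 'v \<Rightarrow> 'v \<Rightarrow> (nat \<Rightarrow> kind \<Rightarrow> 'v) \<Rightarrow> nat \<Rightarrow> kind \<Rightarrow> 'v" where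
  "rung h b t m j kd = (if j = 1 then b else if j = h then t else m j kd)"

definition kinds :: "kind list" where
  "kinds = [Both, Down, Up]"

text \<open>At the two ends \<open>rung\<close> ignores the kind. An end may be read as
  \<open>Up\<close> or \<open>Down\<close> instead of \<open>Both\<close>, so its edges do not
  depend on \<open>chord\<close>.\<close>

definition ladder :: "nat \<Rightarrow> (nat \<Rightarrow> bool) \<Rightarrow> 'v \<Rightarrow> 'v \<Rightarrow> (nat \<Rightarrow> kind \<Rightarrow> 'v) \<Rightarrow> ('v \<times> 'v \<times> sign) list" where
  "ladder h chord b t m = [(rung h b t m j kd, rung h b t m (Suc j) kd', level_sign j).
     j \<leftarrow> [1..<h], kd \<leftarrow> kinds, kd' \<leftarrow> kinds,
     kd \<noteq> Down \<and> kd' \<noteq> Up \<and> (kd = Both \<and> kd' = Both \<longrightarrow> chord j)]"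

lemma set_kinds: "set kinds = UNIV"
  by (auto simp: kinds_def intro: kind.exhaust)

lemma in_ladder:
  "(x, y, s) \<in> set (ladder h chord b t m) \<longleftrightarrow> (\<exists>j kd kd'. 1 \<le> j \<and> j < h \<and> kd \<noteq> Down \<and> kd' \<noteq> Up \<and>
     (kd = Both \<and> kd' = Both \<longrightarrow> chord j) \<and> x = rung h b t m j kd \<and> y = rung h b t m (Suc j) kd' \<and>
     s = level_sign j)"
proof -
  have "(x, y, s) \<in> set (ladder h chord b t m) \<longleftrightarrow> (\<exists>j\<in>{1..<h}. \<exists>kd kd'.
     (x, y, s) \<in> set (if kd \<noteq> Down \<and> kd' \<noteq> Up \<and> (kd = Both \<and> kd' = Both \<longrightarrow> chord j)
        then [(rung h b t m j kd, rung h b t m (Suc j) kd', level_sign j)] else []))"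
    unfolding ladder_def by (simp only: set_concat set_map set_kinds set_upt UN_iff image_image bex_UNIV Un_iff Union_iff bex_simps)
  also have "\<dots> \<longleftrightarrow> (\<exists>j\<in>{1..<h}. \<exists>kd kd'. kd \<noteq> Down \<and> kd' \<noteq> Up \<and> (kd = Both \<and> kd' = Both \<longrightarrow> chord j) \<and>
     (x, y, s) = (rung h b t m j kd, rung h b t m (Suc j) kd', level_sign j))"
    by (intro bex_cong ex_cong1 refl) (simp, argo)
  finally show ?thesis by (simp add: Bex_def conj_assoc)
qed

text \<open>Restricting to symbols with a nonempty relation makes the product of the relations
  inhabited, so the graph has top nodes whenever \<open>T\<close> has an element.\<close>

locale template =
  fixes \<tau> :: vocabulary and T :: "'a rel_structure" and syms :: "(nat \<times> nat) list"
  assumes finite_voc: "finite \<tau>" and structure_T: "is_structure \<tau> T"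
    and set_syms: "set syms = {\<sigma> \<in> \<tau>. rel T \<sigma> \<noteq> {}}" and distinct_syms: "distinct syms"
begin

definition pos :: "((nat \<times> nat) \<times> nat) list" where
  "pos = concat (map (\<lambda>\<sigma>. map (Pair \<sigma>) [0..<snd \<sigma>]) syms)"

definition idx :: "(nat \<times> nat) \<times> nat \<Rightarrow> nat" where
  "idx x = (THE k. k < length pos \<and> pos ! k = x)"

text \<open>The chords that carry information lie at the levels 2 to
  \<open>Suc (length pos)\<close>, and both of their ends are inner nodes. The factor 2 makes the
  height odd, which prevents a ladder from being mapped upside down.\<close>

definition height :: nat where
  "height = 2 * length pos + 3"

lemma set_pos: "set pos = {(\<sigma>, p). \<sigma> \<in> set syms \<and> p < snd \<sigma>}"
  by (auto simp: pos_def)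

lemma distinct_pos: "distinct pos"
proof -
  have "distinct ss \<Longrightarrow> distinct (concat (map (\<lambda>\<sigma>. map (Pair \<sigma>) [0..<snd \<sigma>]) ss))" for ss :: "(nat \<times> nat) list"
    by (induction ss) (auto simp: distinct_map inj_on_def)
  then show ?thesis unfolding pos_def using distinct_syms .
qed

lemma idx_nth: "k < length pos \<Longrightarrow> idx (pos ! k) = k"
  using distinct_pos by (auto simp: idx_def nth_eq_iff_index_eq)

lemma idx_in: "\<sigma> \<in> set syms \<Longrightarrow> p < snd \<sigma> \<Longrightarrow> idx (\<sigma>, p) < length pos \<and> pos ! idx (\<sigma>, p) = (\<sigma>, p)"
  using idx_nth set_pos by (metis (mono_tags, lifting) case_prodI in_set_conv_nth mem_Collect_eq)

text \<open>Extensionality outside of \<open>syms\<close> keeps this set finite.\<close>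

definition tuples :: "(nat \<times> nat \<Rightarrow> 'a list) set" where
  "tuples = (\<Pi>\<^sub>E \<sigma>\<in>set syms. rel T \<sigma>)"

text \<open>Position \<open>k\<close> sits at level \<open>k + 2\<close>. At the levels without a
  position every ladder has its chord, so they distinguish nothing.\<close>

definition chord :: "'a \<Rightarrow> (nat \<times> nat \<Rightarrow> 'a list) \<Rightarrow> nat \<Rightarrow> bool" where
  "chord t r j \<longleftrightarrow> (2 \<le> j \<and> j \<le> Suc (length pos) \<longrightarrow> r (fst (pos ! (j - 2))) ! snd (pos ! (j - 2)) = t)"

abbreviation hrung where
  "hrung t r \<equiv> rung height (Bot t) (Top r) (Mid t r)"

definition tgraph :: "('a, nat \<times> nat \<Rightarrow> 'a list) node signed_graph" where
  "tgraph = \<lparr>verts = {hrung t r j kd | t r j kd. t \<in> univ T \<and> r \<in> tuples \<and> 1 \<le> j \<and> j \<le> height},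
     edges = (\<lambda>(x, y, s). ({x, y}, s)) `
       (\<Union>t\<in>univ T. \<Union>r\<in>tuples. set (ladder height (chord t r) (Bot t) (Top r) (Mid t r)))\<rparr>"

lemma rel_T: "\<sigma> \<in> \<tau> \<Longrightarrow> t \<in> rel T \<sigma> \<Longrightarrow> length t = snd \<sigma> \<and> set t \<subseteq> univ T"
  using structure_T unfolding is_structure_def by (cases \<sigma>) (auto dest!: bspec[where x = \<sigma>])

lemma finite_univ: "finite (univ T)"
  using structure_T by (simp add: is_structure_def)

lemma finite_rel: "\<sigma> \<in> \<tau> \<Longrightarrow> finite (rel T \<sigma>)"
  by (rule finite_subset[OF _ finite_lists_length_eq[OF finite_univ, of "snd \<sigma>"]]) (use rel_T in blast)

lemma finite_tuples: "finite tuples"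
  unfolding tuples_def by (intro finite_PiE finite_set) (simp add: set_syms finite_rel)

lemma tuples_nonempty: "tuples \<noteq> {}"
  unfolding tuples_def by (simp add: PiE_eq_empty_iff set_syms)

lemma tuples_nth: "r \<in> tuples \<Longrightarrow> \<sigma> \<in> set syms \<Longrightarrow> p < snd \<sigma> \<Longrightarrow> r \<sigma> ! p \<in> univ T"
proof -
  assume *: "r \<in> tuples" "\<sigma> \<in> set syms" "p < snd \<sigma>"
  then have "length (r \<sigma>) = snd \<sigma> \<and> set (r \<sigma>) \<subseteq> univ T"
    using rel_T[of \<sigma> "r \<sigma>"] PiE_mem[of r "set syms" "rel T" \<sigma>] unfolding tuples_def set_syms by blast
  then show ?thesis using * nth_mem[of p "r \<sigma>"] by auto
qed

lemma tgraph_edge: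
  "({a, b}, s) \<in> edges tgraph \<longleftrightarrow> (\<exists>t\<in>univ T. \<exists>r\<in>tuples. \<exists>j kd kd'. 1 \<le> j \<and> j < height \<and> kd \<noteq> Down \<and> kd' \<noteq> Up \<and>
     (kd = Both \<and> kd' = Both \<longrightarrow> chord t r j) \<and> {a, b} = {hrung t r j kd, hrung t r (Suc j) kd'} \<and> s = level_sign j)"
proof -
  have "({a, b}, s) \<in> edges tgraph \<longleftrightarrow> (\<exists>t\<in>univ T. \<exists>r\<in>tuples. \<exists>x y.
      (x, y, s) \<in> set (ladder height (chord t r) (Bot t) (Top r) (Mid t r)) \<and> {a, b} = {x, y})"
    unfolding tgraph_def by (force simp: image_iff)
  also have "\<dots> \<longleftrightarrow> (\<exists>t\<in>univ T. \<exists>r\<in>tuples. \<exists>j kd kd'. 1 \<le> j \<and> j < height \<and> kd \<noteq> Down \<and> kd' \<noteq> Up \<and>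
     (kd = Both \<and> kd' = Both \<longrightarrow> chord t r j) \<and> {a, b} = {hrung t r j kd, hrung t r (Suc j) kd'} \<and> s = level_sign j)"
    unfolding in_ladder by (intro bex_cong refl) blast
  finally show ?thesis .
qed

lemma tgraph_signed_graph: "is_signed_graph tgraph"
proof -
  have "verts tgraph \<subseteq> (\<lambda>(t, r, j, kd). hrung t r j kd) ` (univ T \<times> tuples \<times> {..height} \<times> set kinds)"
    by (force simp: tgraph_def set_kinds)
  then have "finite (verts tgraph)"
    by (rule finite_subset) (simp add: finite_univ finite_tuples)
  moreover have "\<exists>x\<in>verts tgraph. \<exists>y\<in>verts tgraph. e = {x, y}" if es: "(e, s) \<in> edges tgraph" for e s
  proof -
    obtain a b where e: "e = {a, b}" using es unfolding tgraph_def by fastforce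
    from es[unfolded e tgraph_edge] obtain t r j kd kd' where "t \<in> univ T" "r \<in> tuples" "1 \<le> j" "j < height"
      "{a, b} = {hrung t r j kd, hrung t r (Suc j) kd'}" by blast
    moreover have "hrung t r j kd \<in> verts tgraph" "hrung t r (Suc j) kd' \<in> verts tgraph"
      using calculation unfolding tgraph_def by fastforce+
    ultimately show ?thesis unfolding e by blast
  qed
  ultimately show ?thesis unfolding is_signed_graph_def by auto
qed

section \<open>The levels of the graph of a template\<close>

primrec level :: "('a, nat \<times> nat \<Rightarrow> 'a list) node \<Rightarrow> nat" where
  "level (Bot t) = 1"
| "level (Top r) = height"
| "level (Mid t r j kd) = j"

lemma height_gt: "2 < height"
  by (simp add: height_def)

lemma level_hrung: "level (hrung t r j kd) = j"
  by (simp add: rung_def)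

lemma edge_levels:
  assumes "({a, b}, s) \<in> edges tgraph"
  shows "1 \<le> level a" "level a \<le> height" "level b = next_level s (level a)"
proof -
  from assms obtain t r j kd kd' where *: "1 \<le> j" "j < height" "{a, b} = {hrung t r j kd, hrung t r (Suc j) kd'}" "s = level_sign j"
    unfolding tgraph_edge by blast
  then show "1 \<le> level a" "level a \<le> height" "level b = next_level s (level a)"
    by (auto simp: doubleton_eq_iff level_hrung next_level_up next_level_down)
qed

lemma edge_up:
  assumes "({a, b}, s) \<in> edges tgraph" "level b = Suc (level a)"
  obtains t r kd kd' where "t \<in> univ T" "r \<in> tuples" "kd \<noteq> Down" "kd' \<noteq> Up"
    "kd = Both \<and> kd' = Both \<longrightarrow> chord t r (level a)" "a = hrung t r (level a) kd" "b = hrung t r (Suc (level a)) kd'"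
    "level a < height" "s = level_sign (level a)"
proof -
  from assms(1) obtain t r j kd kd' where *: "t \<in> univ T" "r \<in> tuples" "j < height" "kd \<noteq> Down" "kd' \<noteq> Up"
    "kd = Both \<and> kd' = Both \<longrightarrow> chord t r j" "{a, b} = {hrung t r j kd, hrung t r (Suc j) kd'}" "s = level_sign j"
    unfolding tgraph_edge by blast
  have "\<not> (a = hrung t r (Suc j) kd' \<and> b = hrung t r j kd)"
    using assms(2) level_hrung[of t r j kd] level_hrung[of t r "Suc j" kd'] by auto
  then have "a = hrung t r j kd \<and> b = hrung t r (Suc j) kd'" using *(7) by (auto simp: doubleton_eq_iff)
  moreover from this have "level a = j" using level_hrung[of t r j kd] by simp
  ultimately show ?thesis using that[of t r kd kd'] * by metis
qed

lemma vert_level: "a \<in> verts tgraph \<Longrightarrow> 1 \<le> level a \<and> level a \<le> height"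
  by (auto simp: tgraph_def level_hrung)

text \<open>An inner node determines its ladder and its kind, whereas a bottom node is shared by all
  families and a top node by all elements.\<close>

lemma hrung_eq:
  assumes "hrung t r j kd = hrung t' r' j kd'"
  shows "j \<noteq> height \<Longrightarrow> t = t'" "j \<noteq> 1 \<Longrightarrow> r = r'" "1 < j \<Longrightarrow> j < height \<Longrightarrow> kd = kd'"
  using assms by (auto simp: rung_def split: if_splits)

end

section \<open>Homomorphisms into the graph of a template\<close>

text \<open>An inner vertex with neighbours on both sides can only go to \<open>Both\<close>. With
  neighbours on one side, \<open>Up\<close> or \<open>Down\<close> is the least demanding choice,
  because the chord condition concerns pairs of \<open>Both\<close> only. An isolated vertex may be
  treated as \<open>Both\<close>.\<close>

definition kind_of :: "nat \<Rightarrow> nat \<Rightarrow> bool \<Rightarrow> bool \<Rightarrow> kind" where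
  "kind_of h j up dn = (if j = 1 \<or> j = h \<or> up = dn then Both else if up then Up else Down)"

context template
begin

text \<open>
  The unknown values: \<open>(u, 0)\<close> is the element and \<open>(u, Suc k)\<close> the \<open>k\<close>-th tuple entry of the
  ladder into which the vertex \<open>u\<close> is mapped. An edge between two vertices of kind \<open>Both\<close> has to
  be mapped to a chord.
\<close>

definition forced :: "nat \<Rightarrow> kind \<Rightarrow> nat \<Rightarrow> nat \<Rightarrow> kind \<Rightarrow> nat \<Rightarrow> bool" where
  "forced j kd \<kappa> j' kd' \<kappa>' \<longleftrightarrow> j' = Suc j \<and> kd = Both \<and> kd' = Both \<and> 2 \<le> j \<and> j \<le> Suc (length pos) \<and> \<kappa> = 0 \<and> \<kappa>' = j - 1"

text \<open>An edge stays on one ladder, so its ends share element and entries. Exempt are the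
  element if an end is at the top and the entries if an end is at the bottom, as these nodes belong
  to many ladders. Listing \<open>forced\<close> in both directions makes the relation
  symmetric.\<close>

definition same_value :: "nat \<Rightarrow> kind \<Rightarrow> nat \<Rightarrow> nat \<Rightarrow> kind \<Rightarrow> nat \<Rightarrow> bool" where
  "same_value j kd \<kappa> j' kd' \<kappa>' \<longleftrightarrow>
     \<kappa> = 0 \<and> \<kappa>' = 0 \<and> j \<noteq> height \<and> j' \<noteq> height \<or>
     \<kappa> = \<kappa>' \<and> 1 \<le> \<kappa> \<and> \<kappa> \<le> length pos \<and> j \<noteq> 1 \<and> j' \<noteq> 1 \<or>
     forced j kd \<kappa> j' kd' \<kappa>' \<or> forced j' kd' \<kappa>' j kd \<kappa>"

end

locale template_instance = template +
  fixes n :: nat and es :: "(nat \<times> nat \<times> sign) list"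
  assumes es_less: "(x, y, s) \<in> set es \<Longrightarrow> x < n \<and> y < n"
begin

definition adj :: "nat \<Rightarrow> nat \<Rightarrow> sign \<Rightarrow> bool" where
  "adj x y s \<longleftrightarrow> (x, y, s) \<in> set es \<or> (y, x, s) \<in> set es"

definition igraph :: "nat signed_graph" where
  "igraph = \<lparr>verts = {..<n}, edges = (\<lambda>(x, y, s). ({x, y}, s)) ` set es\<rparr>"

lemma igraph_edge: "({x, y}, s) \<in> edges igraph \<longleftrightarrow> adj x y s"
  by (force simp: igraph_def adj_def image_iff doubleton_eq_iff)

lemma adj_sym: "adj x y s \<longleftrightarrow> adj y x s"
  by (auto simp: adj_def)

lemma adj_less: "adj x y s \<Longrightarrow> x < n \<and> y < n"
  using es_less by (auto simp: adj_def)

text \<open>A level outside of 1 to \<open>height\<close> can be reached but not left. A walk that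
  falls off is thus visible as a bad level, while only finitely many levels occur.\<close>

definition level_step :: "((nat \<times> nat) \<times> nat \<times> nat) set" where
  "level_step = {((x, j), (y, j')). \<exists>s. adj x y s \<and> 1 \<le> j \<and> j \<le> height \<and> j' = next_level s j}"

definition levels :: "nat \<Rightarrow> nat \<Rightarrow> nat \<Rightarrow> nat set" where
  "levels v i u = {j. ((v, i), (u, j)) \<in> level_step\<^sup>*}"

definition good_levels :: "(nat \<Rightarrow> nat set) \<Rightarrow> bool" where
  "good_levels S \<longleftrightarrow> (\<forall>u. S u \<subseteq> {1..height} \<and> (\<forall>j\<in>S u. \<forall>j'\<in>S u. j = j'))"

definition has_up :: "(nat \<Rightarrow> nat set) \<Rightarrow> nat \<Rightarrow> bool" where
  "has_up S u \<longleftrightarrow> (\<exists>y s. adj u y s \<and> (\<exists>j\<in>S u. Suc j \<in> S y))"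

definition has_down :: "(nat \<Rightarrow> nat set) \<Rightarrow> nat \<Rightarrow> bool" where
  "has_down S u \<longleftrightarrow> (\<exists>y s. adj u y s \<and> (\<exists>j\<in>S y. Suc j \<in> S u))"

definition kind_in :: "(nat \<Rightarrow> nat set) \<Rightarrow> nat \<Rightarrow> nat \<Rightarrow> kind" where
  "kind_in S u j = kind_of height j (has_up S u) (has_down S u)"

definition value_step :: "(nat \<Rightarrow> nat set) \<Rightarrow> ((nat \<times> nat) \<times> nat \<times> nat) set" where
  "value_step S = {((x, \<kappa>), (y, \<kappa>')). \<exists>s. adj x y s \<and>
     (\<exists>j\<in>S x. \<exists>j'\<in>S y. same_value j (kind_in S x j) \<kappa> j' (kind_in S y j') \<kappa>')}"

lemma sym_value_step: "sym (value_step S)"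
  unfolding sym_def value_step_def same_value_def using adj_sym by blast

definition entries :: "(nat \<times> nat \<Rightarrow> 'a) \<Rightarrow> nat \<Rightarrow> nat \<times> nat \<Rightarrow> 'a list" where
  "entries val u \<sigma> = map (\<lambda>p. val (u, Suc (idx (\<sigma>, p)))) [0..<snd \<sigma>]"

text \<open>Values are also demanded for vertices outside the component of the start vertex. Nothing
  relates those, and as the relations are nonempty each such vertex can take any tuples.\<close>

definition solution :: "(nat \<Rightarrow> nat set) \<Rightarrow> (nat \<times> nat \<Rightarrow> 'a) \<Rightarrow> bool" where
  "solution S val \<longleftrightarrow> range val \<subseteq> univ T \<and> (\<forall>(c, c')\<in>value_step S. val c = val c') \<and>
     (\<forall>u<n. \<forall>\<sigma>\<in>set syms. entries val u \<sigma> \<in> rel T \<sigma>)"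

lemma levels_of_hom:
  assumes hom: "ec_hom igraph tgraph \<phi>" and j: "j \<in> levels v (level (\<phi> v)) u"
  shows "j = level (\<phi> u)"
proof -
  from j have "((v, level (\<phi> v)), (u, j)) \<in> level_step\<^sup>*" by (simp add: levels_def)
  then have "snd (u, j) = level (\<phi> (fst (u, j)))"
  proof (induction rule: rtrancl_induct)
    case (step c d)
    then obtain s where s: "adj (fst c) (fst d) s" "snd d = next_level s (snd c)"
      by (auto simp: level_step_def)
    then have "({\<phi> (fst c), \<phi> (fst d)}, s) \<in> edges tgraph"
      using hom by (simp add: ec_hom_def igraph_edge)
    from edge_levels(3)[OF this] s step show ?case by simp
  qed simp
  then show ?thesis by simp
qed

text \<open>The level of \<open>\<phi> v\<close> serves as \<open>i\<close>. The levels propagated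
  from it are those of the images, and the ladder that contains the image of a vertex supplies the
  values of its unknowns.\<close>

lemma solution_of_hom:
  assumes hom: "ec_hom igraph tgraph \<phi>" and v: "v < n"
  shows "\<exists>i\<in>{1..height}. good_levels (levels v i) \<and> (\<exists>val. solution (levels v i) val)"
proof -
  let ?i = "level (\<phi> v)" and ?S = "levels v (level (\<phi> v))"
  have edge: "({\<phi> x, \<phi> y}, s) \<in> edges tgraph" if "adj x y s" for x y s
    using that hom by (simp add: ec_hom_def igraph_edge)
  have vert: "\<phi> u \<in> verts tgraph" if "u < n" for u
    using that hom by (auto simp: ec_hom_def igraph_def)
  have i: "?i \<in> {1..height}" using vert_level[OF vert[OF v]] by simp
  have lev: "j = level (\<phi> u)" if "j \<in> ?S u" for j u
    using levels_of_hom[OF hom that] .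
  have reached: "u < n" if "j \<in> ?S u" for j u
  proof -
    have "((v, ?i), (u, j)) \<in> level_step\<^sup>*" using that by (simp add: levels_def)
    then have "fst (u, j) < n" by (induction rule: rtrancl_induct) (use v adj_less in \<open>auto simp: level_step_def\<close>)
    then show ?thesis by simp
  qed
  have good: "good_levels ?S"
    unfolding good_levels_def using lev reached vert vert_level by (metis atLeastAtMost_iff subsetI)
  \<comment> \<open>Defaults for what a node does not determine: the element at a top node, the
    family at a bottom node, and both for numbers that are not vertices.\<close>
  from vert[OF v] obtain t0 where t0: "t0 \<in> univ T" by (auto simp: tgraph_def)
  obtain r0 where r0: "r0 \<in> tuples" using tuples_nonempty by blast
  define \<alpha> where "\<alpha> u = (case \<phi> u of Bot t \<Rightarrow> t | Mid t r j kd \<Rightarrow> t | Top r \<Rightarrow> t0)" for u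
  define \<beta> where "\<beta> u = (case \<phi> u of Bot t \<Rightarrow> r0 | Mid t r j kd \<Rightarrow> r | Top r \<Rightarrow> r)" for u
  define \<beta>' where "\<beta>' u = (if u < n then \<beta> u else r0)" for u
  have ab: "\<alpha> u \<in> univ T" "\<beta> u \<in> tuples" if "u < n" for u
  proof -
    have "\<phi> u \<in> verts tgraph" using vert that by blast
    then obtain t r j kd where "\<phi> u = hrung t r j kd" "t \<in> univ T" "r \<in> tuples"
      unfolding tgraph_def by auto
    then show "\<alpha> u \<in> univ T" "\<beta> u \<in> tuples" using t0 r0 by (simp_all add: \<alpha>_def \<beta>_def rung_def)
  qed
  have b': "\<beta>' u \<in> tuples" for u using ab r0 by (simp add: \<beta>'_def)
  define val where "val = (\<lambda>(u, \<kappa>). if \<kappa> = 0 then (if u < n then \<alpha> u else t0)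
     else if \<kappa> \<le> length pos then \<beta>' u (fst (pos ! (\<kappa> - 1))) ! snd (pos ! (\<kappa> - 1)) else t0)"
  have range: "range val \<subseteq> univ T"
  proof -
    have "val (u, \<kappa>) \<in> univ T" for u \<kappa>
    proof (cases "1 \<le> \<kappa> \<and> \<kappa> \<le> length pos")
      case True
      then have "pos ! (\<kappa> - 1) \<in> set pos" by (intro nth_mem) auto
      then show ?thesis using tuples_nth[OF b'[of u], of "fst (pos ! (\<kappa> - 1))" "snd (pos ! (\<kappa> - 1))"] True
        unfolding set_pos by (auto simp: val_def)
    qed (use ab t0 in \<open>auto simp: val_def\<close>)
    then show ?thesis by auto
  qed
  have hr: "\<alpha> u = t" if "\<phi> u = hrung t r j kd" "j \<noteq> height" for u t r j kd
    using that by (simp add: \<alpha>_def rung_def split: if_splits)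
  have hr': "\<beta> u = r" if "\<phi> u = hrung t r j kd" "j \<noteq> 1" for u t r j kd
    using that by (simp add: \<beta>_def rung_def split: if_splits)
  \<comment> \<open>With at least one neighbour present, equality of the two flags means neighbours
    above and below, and the image can have neither kind \<open>Down\<close> nor kind
    \<open>Up\<close>.\<close>
  have both: "kd = Both" if kd: "kind_in ?S u j = Both" and j: "j \<in> ?S u" "1 < j" "j < height"
      and u: "\<phi> u = hrung t r j kd" and y: "adj u y s" "j' \<in> ?S y" "j' = Suc j \<or> j = Suc j'" for u t r j kd y s j'
  proof -
    have up: "kd \<noteq> Down" if a: "adj u y s" "Suc j \<in> ?S y" for y s
    proof -
      have "level (\<phi> y) = Suc (level (\<phi> u))" using lev[OF a(2)] lev[OF j(1)] by simp
      from edge_up[OF edge[OF a(1)] this] obtain t' r' kd' where "\<phi> u = hrung t' r' j kd'" "kd' \<noteq> Down"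
        using lev[OF j(1)] by metis
      then show ?thesis using hrung_eq(3)[of t r j kd t' r' kd'] u j by simp
    qed
    have dn: "kd \<noteq> Up" if a: "adj u y s" "j' \<in> ?S y" "j = Suc j'" for y s j'
    proof -
      have l: "level (\<phi> u) = Suc (level (\<phi> y))" using lev[OF a(2)] lev[OF j(1)] a(3) by simp
      have "({\<phi> y, \<phi> u}, s) \<in> edges tgraph" using edge[of y u s] a(1) adj_sym by blast
      from edge_up[OF this l] obtain t' r' kd' where "\<phi> u = hrung t' r' j kd'" "kd' \<noteq> Up"
        using lev[OF j(1)] l by metis
      then show ?thesis using hrung_eq(3)[of t r j kd t' r' kd'] u j by simp
    qed
    have "has_up ?S u = has_down ?S u"
      using kd j by (simp add: kind_in_def kind_of_def split: if_splits)
    moreover have "has_up ?S u \<or> has_down ?S u"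
      using y j unfolding has_up_def has_down_def by blast
    ultimately have "has_up ?S u" "has_down ?S u" by auto
    then have "kd \<noteq> Down" "kd \<noteq> Up"
      using up dn lev j unfolding has_up_def has_down_def by (metis, metis)
    then show ?thesis by (cases kd) auto
  qed
  have forced_val: "val (x, \<kappa>) = val (y, \<kappa>')" if a: "adj x y s" and j: "j \<in> ?S x" "j' \<in> ?S y"
     and f: "forced j (kind_in ?S x j) \<kappa> j' (kind_in ?S y j') \<kappa>'" for x y s j j' \<kappa> \<kappa>'
  proof -
    have f': "j' = Suc j" "2 \<le> j" "j \<le> Suc (length pos)" "\<kappa> = 0" "\<kappa>' = j - 1" using f by (auto simp: forced_def)
    have l: "level (\<phi> y) = Suc (level (\<phi> x))" using lev[OF j(1)] lev[OF j(2)] f' by simp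
    from edge_up[OF edge[OF a] l] obtain t r kd kd' where
      e: "kd = Both \<and> kd' = Both \<longrightarrow> chord t r j" "\<phi> x = hrung t r j kd" "\<phi> y = hrung t r (Suc j) kd'"
      using lev[OF j(1)] by metis
    have h: "Suc j < height" using f' by (simp add: height_def)
    have "kd = Both" using both[OF _ j(1) _ _ e(2) a j(2)] f f' h by (simp add: forced_def)
    moreover have "kd' = Both" using both[of y j' t r kd' x s j] e(3) f f' h a j adj_sym by (simp add: forced_def)
    ultimately have c: "chord t r j" using e(1) by simp
    have "x < n" "y < n" using adj_less[OF a] by auto
    then have "val (x, \<kappa>) = t" "\<beta>' y = r" using f' hr[OF e(2)] hr'[OF e(3)] h by (simp_all add: val_def \<beta>'_def)
    moreover have "val (y, \<kappa>') = \<beta>' y (fst (pos ! (j - 2))) ! snd (pos ! (j - 2))"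
      using f' by (auto simp: val_def numeral_2_eq_2)
    ultimately show ?thesis using c f' unfolding chord_def by auto
  qed
  have eq: "val (x, \<kappa>) = val (y, \<kappa>')" if a: "adj x y s" and j: "j \<in> ?S x" "j' \<in> ?S y"
     and sv: "same_value j (kind_in ?S x j) \<kappa> j' (kind_in ?S y j') \<kappa>'" for x y s j j' \<kappa> \<kappa>'
  proof -
    have xy: "x < n" "y < n" using adj_less[OF a] by auto
    have "level (\<phi> y) = Suc (level (\<phi> x)) \<or> level (\<phi> x) = Suc (level (\<phi> y))"
      using edge_levels[OF edge[OF a]] by (auto simp: next_level_def split: if_splits)
    then obtain t r kd kd' where e: "\<phi> x = hrung t r j kd" "\<phi> y = hrung t r j' kd'"
    proof
      assume "level (\<phi> y) = Suc (level (\<phi> x))"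
      with edge_up[OF edge[OF a] this] show ?thesis using that lev[OF j(1)] lev[OF j(2)] by metis
    next
      assume l: "level (\<phi> x) = Suc (level (\<phi> y))"
      have "({\<phi> y, \<phi> x}, s) \<in> edges tgraph" using edge[OF a] by (simp add: insert_commute)
      from edge_up[OF this l] show ?thesis using that lev[OF j(1)] lev[OF j(2)] l by metis
    qed
    from sv consider "\<kappa> = 0" "\<kappa>' = 0" "j \<noteq> height" "j' \<noteq> height" | "\<kappa> = \<kappa>'" "1 \<le> \<kappa>" "j \<noteq> 1" "j' \<noteq> 1"
      | "forced j (kind_in ?S x j) \<kappa> j' (kind_in ?S y j') \<kappa>'" | "forced j' (kind_in ?S y j') \<kappa>' j (kind_in ?S x j) \<kappa>"
      unfolding same_value_def by blast
    then show ?thesis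
    proof cases
      case 1
      then show ?thesis using hr[OF e(1)] hr[OF e(2)] xy by (simp add: val_def)
    next
      case 2
      then show ?thesis using hr'[OF e(1)] hr'[OF e(2)] xy by (simp add: val_def \<beta>'_def)
    next
      case 3
      then show ?thesis using forced_val[OF a j] by simp
    next
      case 4
      have "adj y x s" using a adj_sym by blast
      then show ?thesis using 4 forced_val[of y x s j' j \<kappa>' \<kappa>] j by simp
    qed
  qed
  have "entries val u \<sigma> \<in> rel T \<sigma>" if "\<sigma> \<in> set syms" for u \<sigma>
  proof -
    have r: "\<beta>' u \<sigma> \<in> rel T \<sigma>" using b'[of u] that by (auto simp: tuples_def)
    then have "length (\<beta>' u \<sigma>) = snd \<sigma>" using rel_T that by (auto simp: set_syms)
    then have "entries val u \<sigma> = \<beta>' u \<sigma>"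
      using idx_in[OF that] by (intro nth_equalityI) (auto simp: entries_def val_def Suc_le_eq)
    then show ?thesis using r by simp
  qed
  then have "solution ?S val"
    using range eq unfolding solution_def value_step_def by blast
  then show ?thesis using i good by blast
qed

definition canonical :: "(nat \<Rightarrow> nat set) \<Rightarrow> (nat \<times> nat \<Rightarrow> 'a) \<Rightarrow> nat \<Rightarrow> ('a, nat \<times> nat \<Rightarrow> 'a list) node" where
  "canonical S val u = hrung (val (u, 0)) (\<lambda>\<sigma>\<in>set syms. entries val u \<sigma>) (the_elem (S u)) (kind_in S u (the_elem (S u)))"

lemma good_singleton: "good_levels S \<Longrightarrow> j \<in> S u \<Longrightarrow> S u = {j}"
  unfolding good_levels_def by blast

lemma good_range: "good_levels S \<Longrightarrow> j \<in> S u \<Longrightarrow> 1 \<le> j \<and> j \<le> height"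
  unfolding good_levels_def by fastforce

text \<open>Both ends can be written with the element of the lower vertex and the family of the
  upper one: where these could disagree with the vertex's own unknowns, the node does not depend on
  them. The edge then lies on one ladder.\<close>

lemma canonical_edge_up:
  assumes good: "good_levels S" and sol: "solution S val" and a: "adj x y s" "s = level_sign j"
    and j: "j \<in> S x" "Suc j \<in> S y"
  shows "({canonical S val x, canonical S val y}, s) \<in> edges tgraph"
proof -
  let ?t = "val (x, 0)" and ?r = "\<lambda>\<sigma>\<in>set syms. entries val y \<sigma>"
  have xy: "x < n" "y < n" using adj_less[OF a(1)] by auto
  have S: "S x = {j}" "S y = {Suc j}" using good_singleton[OF good] j by auto
  have "S x \<subseteq> {1..height}" "S y \<subseteq> {1..height}" using good unfolding good_levels_def by blast+
  then have jh: "1 \<le> j" "Suc j \<le> height" using j by auto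
  have eqs: "val c = val c'" if "(c, c') \<in> value_step S" for c c'
    using sol that unfolding solution_def by blast
  have step: "((x, \<kappa>), (y, \<kappa>')) \<in> value_step S"
    if "same_value j (kind_in S x j) \<kappa> (Suc j) (kind_in S y (Suc j)) \<kappa>'" for \<kappa> \<kappa>'
    using that a(1) j unfolding value_step_def by blast
  have kx: "kind_in S x j \<noteq> Down" if "j \<noteq> 1"
    using a(1) j unfolding kind_in_def kind_of_def has_up_def by auto
  have ky: "kind_in S y (Suc j) \<noteq> Up" if "Suc j \<noteq> height"
    using a(1) j adj_sym unfolding kind_in_def kind_of_def has_down_def by auto
  have cy: "canonical S val y = hrung ?t ?r (Suc j) (kind_in S y (Suc j))"
  proof (cases "Suc j = height")
    case True
    then show ?thesis using height_gt by (simp add: canonical_def S rung_def)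
  next
    case False
    then have "val (x, 0) = val (y, 0)"
      using eqs[OF step[of 0 0]] jh by (simp add: same_value_def)
    then show ?thesis by (simp add: canonical_def S)
  qed
  have cx: "canonical S val x = hrung ?t ?r j (kind_in S x j)"
  proof (cases "j = 1")
    case True
    then show ?thesis by (simp add: canonical_def S rung_def)
  next
    case False
    have "entries val x \<sigma> = entries val y \<sigma>" if "\<sigma> \<in> set syms" for \<sigma>
    proof -
      have "val (x, Suc (idx (\<sigma>, p))) = val (y, Suc (idx (\<sigma>, p)))" if "p < snd \<sigma>" for p
        using eqs[OF step[of "Suc (idx (\<sigma>, p))" "Suc (idx (\<sigma>, p))"]] idx_in[OF \<open>\<sigma> \<in> set syms\<close> that] jh False
        by (simp add: same_value_def Suc_le_eq)
      then show ?thesis by (simp add: entries_def)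
    qed
    then have "(\<lambda>\<sigma>\<in>set syms. entries val x \<sigma>) = ?r" by (simp add: restrict_def fun_eq_iff)
    then show ?thesis by (simp add: canonical_def S)
  qed
  have r: "?r \<in> tuples" using sol xy by (auto simp: tuples_def solution_def)
  have t: "?t \<in> univ T" using sol by (auto simp: solution_def)
  have ch: "chord ?t ?r j" if "kind_in S x j = Both" "kind_in S y (Suc j) = Both"
    unfolding chord_def
  proof
    assume j2: "2 \<le> j \<and> j \<le> Suc (length pos)"
    define k where "k = j - 2"
    have k: "k < length pos" "j - 1 = Suc k" using j2 by (auto simp: k_def)
    have "val (x, 0) = val (y, j - 1)"
      using that j2 by (intro eqs[OF step]) (simp add: same_value_def forced_def)
    moreover obtain \<sigma> p where p: "pos ! k = (\<sigma>, p)" by fastforce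
    moreover have "\<sigma> \<in> set syms" "p < snd \<sigma>" using p k set_pos nth_mem[OF k(1)] by auto
    moreover have "idx (\<sigma>, p) = k" using idx_nth[OF k(1)] p by simp
    ultimately show "?r (fst (pos ! (j - 2))) ! snd (pos ! (j - 2)) = ?t"
      using k by (simp add: entries_def flip: k_def)
  qed
  \<comment> \<open>At an end of the ladder any admissible kind names the node, so
    \<open>kind_in\<close> need not be evaluated there.\<close>
  let ?kx = "if j = 1 then Up else kind_in S x j" and ?ky = "if Suc j = height then Down else kind_in S y (Suc j)"
  have "canonical S val x = hrung ?t ?r j ?kx" "canonical S val y = hrung ?t ?r (Suc j) ?ky"
    unfolding cx cy using height_gt by (simp_all add: rung_def)
  moreover have "?kx \<noteq> Down" "?ky \<noteq> Up" using kx ky by auto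
  moreover have "?kx = Both \<and> ?ky = Both \<longrightarrow> chord ?t ?r j" using ch by auto
  ultimately show ?thesis unfolding tgraph_edge a(2) using r t jh
    by (intro bexI[of _ ?t] bexI[of _ ?r] exI[of _ j] exI[of _ ?kx] exI[of _ ?ky]) auto
qed

text \<open>Solutions found for two vertices of one component may place it at different levels. Each
  component therefore follows the solution of its least vertex throughout.\<close>

lemma hom_of_solutions:
  assumes sol: "\<And>v. v < n \<Longrightarrow> \<exists>i\<in>{1..height}. good_levels (levels v i) \<and> (\<exists>val. solution (levels v i) val)"
  shows "\<exists>\<phi>. ec_hom igraph tgraph \<phi>"
proof -
  define conn where "conn = {(x, y). \<exists>s. adj x y s}\<^sup>*"
  have "sym {(x, y). \<exists>s. adj x y s}" unfolding sym_def using adj_sym by blast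
  then have conn_sym: "(x, y) \<in> conn \<Longrightarrow> (y, x) \<in> conn" for x y
    unfolding conn_def by (rule symD[OF sym_rtrancl])
  have conn_less: "(x, y) \<in> conn \<Longrightarrow> x < n \<Longrightarrow> y < n" for x y
    unfolding conn_def by (induction rule: rtrancl_induct) (use adj_less in auto)
  define rep where "rep u = (LEAST v. (u, v) \<in> conn)" for u
  have rep: "(u, rep u) \<in> conn" for u
    unfolding rep_def by (rule LeastI[of _ u]) (simp add: conn_def)
  have rep_eq: "rep x = rep y" if "(x, y) \<in> conn" for x y
  proof -
    have "(x, v) \<in> conn \<longleftrightarrow> (y, v) \<in> conn" for v
      using that conn_sym[OF that] unfolding conn_def by (meson rtrancl_trans)
    then show ?thesis by (simp add: rep_def)
  qed
  from sol obtain lv val where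
    lv: "lv v \<in> {1..height} \<and> good_levels (levels v (lv v)) \<and> solution (levels v (lv v)) (val v)" if "v < n" for v
    by metis
  define \<phi> where "\<phi> u = canonical (levels (rep u) (lv (rep u))) (val (rep u)) u" for u
  have reached: "\<exists>j. j \<in> levels v (lv v) u" if "(v, u) \<in> conn" "v < n" for u v
    using that(1) unfolding conn_def
  proof (induction rule: rtrancl_induct)
    case base
    then show ?case by (auto simp: levels_def)
  next
    case (step x y)
    then obtain s j where s: "adj x y s" "j \<in> levels v (lv v) x" by blast
    then have "1 \<le> j \<and> j \<le> height" using lv[OF that(2)] good_range by blast
    then have "((x, j), (y, next_level s j)) \<in> level_step" using s by (auto simp: level_step_def)
    then show ?case using s(2) unfolding levels_def by (auto intro: rtrancl_into_rtrancl)
  qed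
  have rep_less: "rep u < n" if "u < n" for u using conn_less[OF rep that] .
  have "({\<phi> x, \<phi> y}, s) \<in> edges tgraph" if a: "adj x y s" for x y s
  proof -
    let ?v = "rep x"
    have xy: "x < n" "y < n" using adj_less[OF a] by auto
    have "(x, y) \<in> conn" using a by (auto simp: conn_def)
    then have rx: "rep y = ?v" using rep_eq by metis
    let ?S = "levels ?v (lv ?v)"
    have S: "good_levels ?S" "solution ?S (val ?v)" using lv[OF rep_less[OF xy(1)]] by auto
    obtain j where j: "j \<in> ?S x" using reached[OF conn_sym[OF rep] rep_less] xy by blast
    then have jh: "1 \<le> j" "j \<le> height" using S good_range by blast+
    have "((x, j), (y, next_level s j)) \<in> level_step" using a jh by (auto simp: level_step_def)
    then have j': "next_level s j \<in> ?S y" using j unfolding levels_def by (auto intro: rtrancl_into_rtrancl)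
    show ?thesis
    proof (cases "s = level_sign j")
      case True
      then have "Suc j \<in> ?S y" using j' by (simp add: next_level_def)
      from canonical_edge_up[OF S a True j this] show ?thesis by (simp add: \<phi>_def rx)
    next
      case False
      then have y: "j - 1 \<in> ?S y" using j' by (simp add: next_level_def)
      \<comment> \<open>Level 0 would be a bad level, so a downward edge starts at level 2 or
        above.\<close>
      then have "1 \<le> j - 1" using S good_range by blast
      then have sx: "Suc (j - 1) = j" "s = level_sign (j - 1)" using False by (auto simp: level_sign_def intro: sign.exhaust split: if_splits)
      have "adj y x s" using a adj_sym by blast
      from canonical_edge_up[OF S this sx(2) y] j sx(1) have "({\<phi> y, \<phi> x}, s) \<in> edges tgraph"
        by (simp add: \<phi>_def rx)
      then show ?thesis by (simp add: insert_commute)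
    qed
  qed
  moreover have "\<phi> u \<in> verts tgraph" if un: "u < n" for u
  proof -
    let ?v = "rep u"
    let ?S = "levels ?v (lv ?v)"
    have S: "good_levels ?S" "solution ?S (val ?v)" using lv[OF rep_less[OF un]] by auto
    obtain j where j: "j \<in> ?S u" using reached[OF conn_sym[OF rep] rep_less] un by blast
    then have "?S u = {j}" "1 \<le> j" "j \<le> height" using S good_singleton good_range by blast+
    moreover have "(\<lambda>\<sigma>\<in>set syms. entries (val ?v) u \<sigma>) \<in> tuples" "val ?v (u, 0) \<in> univ T"
      using S(2) un by (auto simp: tuples_def solution_def)
    ultimately show ?thesis unfolding \<phi>_def canonical_def tgraph_def by fastforce
  qed
  ultimately show ?thesis unfolding ec_hom_def igraph_edge by (intro exI[of _ \<phi>]) (auto simp: igraph_def)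
qed

theorem hom_iff_solutions:
  "(\<exists>\<phi>. ec_hom igraph tgraph \<phi>) \<longleftrightarrow>
     (\<forall>v<n. \<exists>i\<in>{1..height}. good_levels (levels v i) \<and> (\<exists>val. solution (levels v i) val))"
  using solution_of_hom hom_of_solutions by blast

end

section \<open>Relabelling signed graphs\<close>

definition relabel :: "('v \<Rightarrow> 'w) \<Rightarrow> 'v signed_graph \<Rightarrow> 'w signed_graph" where
  "relabel f G = \<lparr>verts = f ` verts G, edges = (\<lambda>(e, s). (f ` e, s)) ` edges G\<rparr>"

lemma relabel_signed_graph:
  assumes "is_signed_graph G"
  shows "is_signed_graph (relabel f G)"
  unfolding is_signed_graph_def
proof (intro conjI ballI)
  show "finite (verts (relabel f G))" using assms by (simp add: relabel_def is_signed_graph_def)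
  fix es assume "es \<in> edges (relabel f G)"
  then obtain e s where e: "(e, s) \<in> edges G" "es = (f ` e, s)" by (auto simp: relabel_def)
  then obtain x y where "x \<in> verts G" "y \<in> verts G" "e = {x, y}"
    using assms unfolding is_signed_graph_def by blast
  then show "case es of (e, s) \<Rightarrow> \<exists>x\<in>verts (relabel f G). \<exists>y\<in>verts (relabel f G). e = {x, y}"
    using e(2) by (auto simp: relabel_def)
qed

lemma relabel_hom_into:
  assumes G: "is_signed_graph G" and inj: "inj_on f (verts G)"
  shows "(\<exists>\<phi>. ec_hom X (relabel f G) \<phi>) \<longleftrightarrow> (\<exists>\<phi>. ec_hom X G \<phi>)"
proof
  assume "\<exists>\<phi>. ec_hom X G \<phi>"
  then obtain \<phi> where \<phi>: "ec_hom X G \<phi>" by blast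
  have "({f (\<phi> x), f (\<phi> y)}, s) \<in> edges (relabel f G)" if "({x, y}, s) \<in> edges X" for x y s
  proof -
    have "({\<phi> x, \<phi> y}, s) \<in> edges G" using \<phi> that by (simp add: ec_hom_def)
    then have "(\<lambda>(e, s). (f ` e, s)) ({\<phi> x, \<phi> y}, s) \<in> (\<lambda>(e, s). (f ` e, s)) ` edges G" by (rule imageI)
    then show ?thesis by (simp add: relabel_def)
  qed
  moreover have "\<phi> ` verts X \<subseteq> verts G" using \<phi> unfolding ec_hom_def by blast
  then have "(f \<circ> \<phi>) ` verts X \<subseteq> verts (relabel f G)" by (auto simp: relabel_def)
  ultimately have "ec_hom X (relabel f G) (f \<circ> \<phi>)" by (simp add: ec_hom_def)
  then show "\<exists>\<phi>. ec_hom X (relabel f G) \<phi>" by blast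
next
  assume "\<exists>\<phi>. ec_hom X (relabel f G) \<phi>"
  then obtain \<phi> where \<phi>: "ec_hom X (relabel f G) \<phi>" by blast
  let ?\<psi> = "inv_into (verts G) f \<circ> \<phi>"
  have "({?\<psi> x, ?\<psi> y}, s) \<in> edges G" if "({x, y}, s) \<in> edges X" for x y s
  proof -
    have "({\<phi> x, \<phi> y}, s) \<in> edges (relabel f G)" using \<phi> that by (simp add: ec_hom_def)
    then obtain e where e: "(e, s) \<in> edges G" "{\<phi> x, \<phi> y} = f ` e" by (auto simp: relabel_def)
    then obtain a b where ab: "a \<in> verts G" "b \<in> verts G" "e = {a, b}"
      using G unfolding is_signed_graph_def by blast
    have "inv_into (verts G) f ` {\<phi> x, \<phi> y} = inv_into (verts G) f ` f ` e" using e(2) by simp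
    also have "\<dots> = e" using ab inj by (simp add: inv_into_f_f)
    finally show ?thesis using e(1) by simp
  qed
  moreover have "\<phi> ` verts X \<subseteq> f ` verts G" using \<phi> unfolding ec_hom_def relabel_def by simp
  then have "?\<psi> ` verts X \<subseteq> verts G" by (auto simp: image_subset_iff intro: inv_into_into)
  ultimately show "\<exists>\<phi>. ec_hom X G \<phi>" unfolding ec_hom_def by blast
qed

lemma relabel_hom_from:
  assumes G: "is_signed_graph G" and inj: "inj_on f (verts G)" and \<phi>: "ec_hom G P \<phi>"
  shows "\<exists>\<phi>. ec_hom (relabel f G) P \<phi>"
proof -
  let ?\<psi> = "\<phi> \<circ> inv_into (verts G) f"
  have "({?\<psi> x, ?\<psi> y}, s) \<in> edges P" if xy: "({x, y}, s) \<in> edges (relabel f G)" for x y s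
  proof -
    obtain e where e: "(e, s) \<in> edges G" "{x, y} = f ` e" using xy by (auto simp: relabel_def)
    then obtain a b where ab: "a \<in> verts G" "b \<in> verts G" "e = {a, b}"
      using G unfolding is_signed_graph_def by blast
    have "inv_into (verts G) f ` {x, y} = inv_into (verts G) f ` f ` e" using e(2) by simp
    also have "\<dots> = e" using ab inj by (simp add: inv_into_f_f)
    finally have *: "{inv_into (verts G) f x, inv_into (verts G) f y} = e" by simp
    have "({\<phi> (inv_into (verts G) f x), \<phi> (inv_into (verts G) f y)}, s) \<in> edges P"
      using \<phi> e(1) unfolding *[symmetric] by (simp add: ec_hom_def)
    then show ?thesis by simp
  qed
  moreover have "\<phi> ` verts G \<subseteq> verts P" using \<phi> unfolding ec_hom_def by blast
  then have "?\<psi> ` verts (relabel f G) \<subseteq> verts P"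
    using inj by (auto simp: relabel_def inv_into_f_f)
  ultimately show ?thesis unfolding ec_hom_def by blast
qed

lemma relabel_bipartite:
  assumes bip: "bipartite G" and inj: "inj_on f (verts G)"
  shows "bipartite (relabel f G)"
proof -
  obtain A B where AB: "A \<union> B = verts G" "A \<inter> B = {}" "\<forall>(e, s)\<in>edges G. \<exists>x\<in>A. \<exists>y\<in>B. e = {x, y}"
    using bip unfolding bipartite_def by (elim exE conjE)
  have "f ` A \<union> f ` B = verts (relabel f G)" using AB(1) by (auto simp: relabel_def)
  moreover have "f ` A \<inter> f ` B = {}"
    using inj_on_image_Int[OF inj, of A B] AB(1,2) by auto
  moreover have "\<exists>x\<in>f ` A. \<exists>y\<in>f ` B. e = {x, y}" if es: "(e, s) \<in> edges (relabel f G)" for e s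
  proof -
    obtain e' where e': "(e', s) \<in> edges G" "e = f ` e'" using es by (auto simp: relabel_def)
    then obtain x y where "x \<in> A" "y \<in> B" "e' = {x, y}" using bspec[OF AB(3) e'(1)] by auto
    then show ?thesis using e'(2) by auto
  qed
  ultimately show ?thesis
    unfolding bipartite_def by (rule_tac exI[of _ "f ` A"], rule_tac exI[of _ "f ` B"]) auto
qed

definition edge_graph :: "nat \<Rightarrow> (nat \<times> nat \<times> sign) list \<Rightarrow> nat signed_graph" where
  "edge_graph n es = \<lparr>verts = {..<n}, edges = (\<lambda>(x, y, s). ({x, y}, s)) ` set es\<rparr>"

lemma edge_graph_edge: "({x, y}, s) \<in> edges (edge_graph n es) \<longleftrightarrow> (\<exists>a b. (a, b, s) \<in> set es \<and> {x, y} = {a, b})"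
proof
  assume "({x, y}, s) \<in> edges (edge_graph n es)"
  then have "({x, y}, s) \<in> (\<lambda>(x, y, s). ({x, y}, s)) ` set es" by (simp only: edge_graph_def signed_graph.simps)
  then obtain e where e: "({x, y}, s) = (\<lambda>(x, y, s). ({x, y}, s)) e" "e \<in> set es" by (rule imageE)
  obtain a b s' where "e = (a, b, s')" by (rule prod_cases3)
  with e show "\<exists>a b. (a, b, s) \<in> set es \<and> {x, y} = {a, b}" by (simp only: prod.case prod.inject) blast
next
  assume "\<exists>a b. (a, b, s) \<in> set es \<and> {x, y} = {a, b}"
  then obtain a b where ab: "(a, b, s) \<in> set es" "{x, y} = {a, b}" by blast
  have "(\<lambda>(x, y, s). ({x, y}, s)) (a, b, s) \<in> (\<lambda>(x, y, s). ({x, y}, s)) ` set es"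
    using ab(1) by (rule imageI)
  then show "({x, y}, s) \<in> edges (edge_graph n es)" by (simp only: edge_graph_def signed_graph.simps prod.case ab(2))
qed

lemma edge_graph_hom:
  "ec_hom (edge_graph n es) H \<phi> \<longleftrightarrow> \<phi> ` {..<n} \<subseteq> verts H \<and> (\<forall>x y s. (x, y, s) \<in> set es \<longrightarrow> ({\<phi> x, \<phi> y}, s) \<in> edges H)"
proof -
  have "verts (edge_graph n es) = {..<n}" by (simp add: edge_graph_def)
  moreover have "(\<forall>x y s. ({x, y}, s) \<in> edges (edge_graph n es) \<longrightarrow> ({\<phi> x, \<phi> y}, s) \<in> edges H) \<longleftrightarrow>
     (\<forall>x y s. (x, y, s) \<in> set es \<longrightarrow> ({\<phi> x, \<phi> y}, s) \<in> edges H)" (is "?l \<longleftrightarrow> ?r")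
  proof
    assume ?l
    then show ?r unfolding edge_graph_edge by blast
  next
    assume r: ?r
    show ?l
    proof (intro allI impI)
      fix x y s assume "({x, y}, s) \<in> edges (edge_graph n es)"
      then obtain a b where ab: "(a, b, s) \<in> set es" "{x, y} = {a, b}" unfolding edge_graph_edge by (elim exE conjE)
      have "{\<phi> x, \<phi> y} = \<phi> ` {x, y}" by simp
      also have "\<dots> = {\<phi> a, \<phi> b}" unfolding ab(2) by simp
      finally show "({\<phi> x, \<phi> y}, s) \<in> edges H" using r ab(1) by simp
    qed
  qed
  ultimately show ?thesis unfolding ec_hom_def by simp
qed

section \<open>Bipartition by parity of the level, and the map to an alternating path\<close>

context template
begin

lemma tgraph_bipartite: "bipartite tgraph"
  unfolding bipartite_def
proof (intro exI conjI)
  let ?A = "{a \<in> verts tgraph. odd (level a)}" and ?B = "{a \<in> verts tgraph. even (level a)}"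
  show "?A \<union> ?B = verts tgraph" "?A \<inter> ?B = {}" by auto
  have "\<exists>x\<in>?A. \<exists>y\<in>?B. e = {x, y}" if es: "(e, s) \<in> edges tgraph" for e s
  proof -
    obtain a b where ab: "a \<in> verts tgraph" "b \<in> verts tgraph" "e = {a, b}"
      using es tgraph_signed_graph unfolding is_signed_graph_def by blast
    have "odd (level a) \<longleftrightarrow> even (level b)"
      using edge_levels[OF es[unfolded ab(3)]] by (auto simp: next_level_def split: if_splits)
    then show ?thesis using ab by (cases "odd (level a)") (auto simp: insert_commute)
  qed
  then show "\<forall>(e, s)\<in>edges tgraph. \<exists>x\<in>?A. \<exists>y\<in>?B. e = {x, y}" by blast
qed

text \<open>Levels count from 1 and list positions from 0; vertex \<open>i\<close> stands for level
  \<open>i + 1\<close>.\<close>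

definition tpath :: "nat signed_graph" where
  "tpath = \<lparr>verts = {..<height}, edges = {({i, Suc i}, level_sign (Suc i)) | i. Suc i < height}\<rparr>"

lemma tpath_alternating: "alternating_path tpath"
  unfolding alternating_path_def
proof (intro exI conjI)
  show "[0..<height] \<noteq> []" using height_gt by simp
  show "edges tpath = {({[0..<height] ! i, [0..<height] ! Suc i}, level_sign (Suc i)) |i. Suc i < length [0..<height]}"
    by (auto simp: tpath_def) force+
qed (auto simp: tpath_def level_sign_def)

lemma hom_to_tpath: "ec_hom tgraph tpath (\<lambda>a. level a - 1)"
  unfolding ec_hom_def
proof (intro conjI allI impI)
  show "(\<lambda>a. level a - 1) ` verts tgraph \<subseteq> verts tpath"
    using vert_level by (fastforce simp: tpath_def)
  have up: "({level a - 1, level b - 1}, s) \<in> edges tpath"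
    if "({a, b}, s) \<in> edges tgraph" "level b = Suc (level a)" for a b s
  proof -
    have "1 \<le> level a" "level a < height" "s = level_sign (level a)"
      using edge_levels(1)[OF that(1)] edge_up[OF that] by blast+
    then show ?thesis using that(2) unfolding tpath_def by (auto intro!: exI[of _ "level a - 1"])
  qed
  fix a b s assume ab: "({a, b}, s) \<in> edges tgraph"
  then consider "level b = Suc (level a)" | "level a = Suc (level b)"
    using edge_levels[OF ab] by (auto simp: next_level_def split: if_splits)
  then show "({level a - 1, level b - 1}, s) \<in> edges tpath"
  proof cases
    case 1
    then show ?thesis using up ab by blast
  next
    case 2
    then show ?thesis using up[of b a s] ab by (simp add: insert_commute)
  qed
qed

section \<open>Ladders force their endpoints\<close>

text \<open>An inner node lies on one ladder only, so a neighbour lies there too; having a neighbour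
  above excludes kind \<open>Down\<close>.\<close>

lemma rung_up:
  assumes "({hrung t r j kd, b}, s) \<in> edges tgraph" "level b = Suc j" "1 < j" "j < height"
  shows "\<exists>kd'. b = hrung t r (Suc j) kd' \<and> kd \<noteq> Down"
proof -
  have l: "level (hrung t r j kd) = j" by (rule level_hrung)
  from edge_up[OF assms(1), unfolded l, OF assms(2)] obtain t' r' kd1 kd' where
    "hrung t r j kd = hrung t' r' j kd1" "b = hrung t' r' (Suc j) kd'" "kd1 \<noteq> Down" by metis
  then show ?thesis using hrung_eq[of t r j kd t' r' kd1] assms(3,4) by auto
qed

lemma rung_down:
  assumes "({a, hrung t r (Suc j) kd}, s) \<in> edges tgraph" "level a = j" "Suc j < height"
  shows "\<exists>kd'. a = hrung t r j kd' \<and> kd \<noteq> Up"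
proof -
  have l: "level (hrung t r (Suc j) kd) = Suc (level a)" using level_hrung assms(2) by simp
  have "1 \<le> level a" using edge_levels(1)[OF assms(1)] .
  moreover from edge_up[OF assms(1) l] obtain t' r' kd1 kd' where
    "a = hrung t' r' j kd1" "hrung t r (Suc j) kd = hrung t' r' (Suc j) kd'" "kd' \<noteq> Up" using assms(2) by metis
  ultimately show ?thesis using hrung_eq[of t r "Suc j" kd t' r' kd'] assms(2,3) by auto
qed

text \<open>The zigzags make the level of the image rise by one in every gap, or fall by one in
  every gap. Only a rise from the very bottom to the very top is possible. Then the zigzags keep the
  image on one ladder, each inner \<open>Both\<close> has neighbours on both sides and goes to a
  \<open>Both\<close>, and a chord must go to a chord.\<close>

lemma ladder_rigid:
  fixes \<psi> :: "'v \<Rightarrow> ('a, nat \<times> nat \<Rightarrow> 'a list) node"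
  assumes hom: "\<And>x y s. (x, y, s) \<in> set (ladder height ch b t m) \<Longrightarrow> ({\<psi> x, \<psi> y}, s) \<in> edges tgraph"
  shows "\<exists>t'\<in>univ T. \<exists>r\<in>tuples. \<psi> b = Bot t' \<and> \<psi> t = Top r \<and>
    (\<forall>j. 2 \<le> j \<and> j \<le> Suc (length pos) \<and> ch j \<longrightarrow> chord t' r j)"
proof -
  define g where "g j kd = \<psi> (rung height b t m j kd)" for j kd
  have e: "({g j kd, g (Suc j) kd'}, level_sign j) \<in> edges tgraph"
    if "1 \<le> j" "j < height" "kd \<noteq> Down" "kd' \<noteq> Up" "kd = Both \<and> kd' = Both \<longrightarrow> ch j" for j kd kd'
    unfolding g_def using that by (intro hom) (auto simp: in_ladder)
  define e0 where "e0 = level (g 1 Both)"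
  have next_back: "next_level s (next_level s l) = l" if "1 \<le> next_level s l" for s l
    using that by (cases s; cases "odd l") (auto simp: next_level_def level_sign_def)
  \<comment> \<open>The first two edges of a zigzag have the same sign, so going along one and back
    along the other returns to the same level.\<close>
  have lev: "level (g (Suc j) kd') = next_level (level_sign j) (level (g j Both))" "level (g j Up) = level (g j Both)"
    if j: "1 \<le> j" "j < height" and kd': "kd' \<in> {Both, Down}" for j kd'
  proof -
    note e1 = edge_levels[OF e[of j Both Down]] and e2 = edge_levels[OF e[of j Up Down]] and e3 = edge_levels[OF e[of j Up Both]]
    have b: "({g (Suc j) Down, g j Up}, level_sign j) \<in> edges tgraph"
      using e[of j Up Down] j by (simp add: insert_commute)
    have d: "level (g (Suc j) Down) = next_level (level_sign j) (level (g j Both))" using e1(3) j by simp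
    have u: "level (g j Up) = next_level (level_sign j) (level (g (Suc j) Down))" using edge_levels(3)[OF b] .
    have "level (g j Up) = level (g j Both)"
      using u d next_back[of "level_sign j" "level (g j Both)"] edge_levels(1)[OF b] by simp
    then show "level (g j Up) = level (g j Both)" "level (g (Suc j) kd') = next_level (level_sign j) (level (g j Both))"
      using e3(3) j d kd' by auto
  qed
  have odd_case: "odd e0 \<Longrightarrow> 1 \<le> j \<Longrightarrow> j \<le> height \<Longrightarrow> level (g j Both) = e0 + (j - 1)" for j
  proof (induction j)
    case (Suc j)
    show ?case
    proof (cases "j = 0")
      case False
      then have "level (g j Both) = e0 + (j - 1)" "level (g (Suc j) Both) = next_level (level_sign j) (level (g j Both))"
        using Suc lev(1)[of j Both] by auto
      moreover have "level_sign j = level_sign (e0 + (j - 1))" using Suc.prems False by (simp add: level_sign_def)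
      ultimately show ?thesis using False by (simp add: next_level_def)
    qed (simp add: e0_def)
  qed simp
  have even_case: "even e0 \<Longrightarrow> 1 \<le> j \<Longrightarrow> j \<le> height \<Longrightarrow> level (g j Both) + (j - 1) = e0" for j
  proof (induction j)
    case (Suc j)
    show ?case
    proof (cases "j = 0")
      case False
      then have l: "level (g j Both) + (j - 1) = e0" "level (g (Suc j) Both) = next_level (level_sign j) (level (g j Both))"
        using Suc lev(1)[of j Both] by auto
      have "odd (level (g j Both)) \<longleftrightarrow> even j" using l(1) Suc.prems(1) False
        by (metis Suc_pred' even_Suc not_gr_zero odd_add)
      then have "level_sign j \<noteq> level_sign (level (g j Both))" by (simp add: level_sign_def)
      then have "level (g (Suc j) Both) = level (g j Both) - 1" using l(2) by (simp add: next_level_def)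
      moreover have "1 \<le> level (g j Both)" using edge_levels(1)[OF e[of j Both Down]] False Suc.prems by simp
      ultimately show ?thesis using l(1) False by simp
    qed (simp add: e0_def)
  qed simp
  have top: "1 \<le> level (g height Both)" "level (g height Both) \<le> height"
  proof -
    have "({g height Both, g (height - 1) Up}, level_sign (height - 1)) \<in> edges tgraph"
      using e[of "height - 1" Up Both] height_gt by (simp add: insert_commute)
    from edge_levels[OF this] show "1 \<le> level (g height Both)" "level (g height Both) \<le> height" by auto
  qed
  have e0h: "1 \<le> e0" "e0 \<le> height" using edge_levels[OF e[of 1 Both Down]] height_gt by (auto simp: e0_def)
  \<comment> \<open>Rising through all gaps leaves room only for \<open>e0 = 1\<close>. Falling
    happens for even \<open>e0\<close> and would need \<open>e0 = height\<close>, which is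
    odd.\<close>
  have "e0 = 1"
  proof (cases "odd e0")
    case True
    then show ?thesis using odd_case[of height] top height_gt e0h by simp
  next
    case False
    then have "e0 = height" using even_case[of height] top height_gt e0h by simp
    then show ?thesis using False by (simp add: height_def)
  qed
  then have l: "level (g j Both) = j" if "1 \<le> j" "j \<le> height" for j
    using odd_case[of j] that by simp
  have lU: "level (g j Up) = j" "level (g (Suc j) Down) = Suc j" if "1 \<le> j" "j < height" for j
    using lev[of j Down] l[of j] that by (auto simp: next_level_up)
  \<comment> \<open>Read as an \<open>Up\<close> rung, the end \<open>b\<close> is joined to the
    \<open>Both\<close> rung of level 2 whatever the chords are.\<close>
  have ee: "({g 1 Up, g (Suc 1) Both}, level_sign 1) \<in> edges tgraph" by (rule e) (use height_gt in auto)
  have "level (g (Suc 1) Both) = Suc (level (g 1 Up))" using l[of "Suc 1"] lU(1)[of 1] height_gt by simp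
  moreover have "level (g 1 Up) = 1" using lU(1)[of 1] height_gt by simp
  ultimately obtain t' r kd1 kd2 where tr: "t' \<in> univ T" "r \<in> tuples"
    "g 1 Up = hrung t' r 1 kd1" "g (Suc 1) Both = hrung t' r (Suc 1) kd2"
    using edge_up[OF ee] by (smt (verit))
  have bot: "\<psi> b = Bot t'" using tr(3) by (simp add: g_def rung_def)
  \<comment> \<open>The zigzag is followed from \<open>Both\<close> up to \<open>Down\<close>, back
    to \<open>Up\<close> and up to the next \<open>Both\<close>; every move stays on the ladder
    already entered.\<close>
  have P: "2 \<le> j \<Longrightarrow> j < height \<Longrightarrow> \<exists>kd. g j Both = hrung t' r j kd" for j
  proof (induction j)
    case (Suc j)
    show ?case
    proof (cases "j = 1")
      case True
      then show ?thesis using tr(4) by auto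
    next
      case False
      then have j: "2 \<le> j" "Suc j < height" using Suc.prems by auto
      then obtain kd where 1: "g j Both = hrung t' r j kd" using Suc.IH by auto
      obtain kd' where 2: "g (Suc j) Down = hrung t' r (Suc j) kd'"
        using rung_up[of t' r j kd "g (Suc j) Down"] e[of j Both Down] lU(2)[of j] j unfolding 1 by auto
      obtain kd'' where 3: "g j Up = hrung t' r j kd''"
        using rung_down[of "g j Up" t' r j kd'] e[of j Up Down] lU(1)[of j] j unfolding 2 by auto
      show ?thesis
        using rung_up[of t' r j kd'' "g (Suc j) Both"] e[of j Up Both] l[of "Suc j"] j unfolding 3 by auto
    qed
  qed simp
  have topr: "\<psi> t = Top r"
  proof -
    let ?j = "height - 1"
    have j: "2 \<le> ?j" "?j < height" "Suc ?j = height" using height_gt by auto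
    obtain kd where 1: "g ?j Both = hrung t' r ?j kd" using P[of ?j] j by auto
    have "\<exists>kd'. g height Down = hrung t' r height kd'"
      using rung_up[of t' r ?j kd "g height Down"] e[of ?j Both Down] lU(2)[of ?j] j unfolding 1 by auto
    then show ?thesis using height_gt by (auto simp: g_def rung_def)
  qed
  have both: "g j Both = hrung t' r j Both" if j: "2 \<le> j" "j < height" for j
  proof -
    obtain kd where 1: "g j Both = hrung t' r j kd" using P[of j] j by auto
    have "kd \<noteq> Down"
      using rung_up[of t' r j kd "g (Suc j) Down"] e[of j Both Down] lU(2)[of j] j unfolding 1 by auto
    moreover have "kd \<noteq> Up"
    proof -
      obtain i where i: "j = Suc i" "1 \<le> i" using j by (metis One_nat_def Suc_1 Suc_le_D Suc_le_mono)
      then show ?thesis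
        using rung_down[of "g i Up" t' r i kd] e[of i Up Both] lU(1)[of i] j 1 by auto
    qed
    ultimately show ?thesis using 1 by (cases kd) auto
  qed
  have "chord t' r j" if j: "2 \<le> j" "j \<le> Suc (length pos)" "ch j" for j
  proof -
    have jh: "Suc j < height" using j by (simp add: height_def)
    have ed: "({hrung t' r j Both, hrung t' r (Suc j) Both}, level_sign j) \<in> edges tgraph"
      using e[of j Both Both] both[of j] both[of "Suc j"] j jh by auto
    have lj: "level (hrung t' r j Both) = j" "level (hrung t' r (Suc j) Both) = Suc j" by (rule level_hrung)+
    from edge_up[OF ed, unfolded lj, OF refl] obtain t1 r1 kd kd' where
      *: "kd = Both \<and> kd' = Both \<longrightarrow> chord t1 r1 j" "hrung t' r j Both = hrung t1 r1 j kd"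
        "hrung t' r (Suc j) Both = hrung t1 r1 (Suc j) kd'" by metis
    show ?thesis using hrung_eq[OF *(2)] hrung_eq[OF *(3)] *(1) j jh by auto
  qed
  then show ?thesis using tr(1,2) bot topr by blast
qed

section \<open>The graph of an instance\<close>

primrec kind_code :: "kind \<Rightarrow> nat" where
  "kind_code Both = 0"
| "kind_code Down = 1"
| "kind_code Up = 2"

definition code_kind :: "nat \<Rightarrow> kind" where
  "code_kind c = (if c = 0 then Both else if c = 1 then Down else Up)"

text \<open>
  Variable \<open>x\<close> becomes the vertex \<open>block * x\<close>; the vertices \<open>block * q + o\<close> with \<open>0 < o < block\<close>
  belong to the \<open>q\<close>-th tuple, \<open>o = 1\<close> being its top.
\<close>

definition block :: nat where
  "block = 2 + length pos * height * 3"

definition offset :: "nat \<Rightarrow> nat \<Rightarrow> kind \<Rightarrow> nat" where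
  "offset p j kd = 2 + (p * height + j) * 3 + kind_code kd"

text \<open>The chords at levels without a position are included, since every ladder of the target
  has them. Among the levels with a position only that of \<open>p\<close> is tested.\<close>

definition gadget :: "nat \<Rightarrow> nat \<times> nat \<Rightarrow> nat \<Rightarrow> nat \<Rightarrow> (nat \<times> nat \<times> sign) list" where
  "gadget q \<sigma> p x = ladder height (\<lambda>j. 2 \<le> j \<and> j \<le> Suc (length pos) \<longrightarrow> j - 2 = idx (\<sigma>, p))
     (block * x) (block * q + 1) (\<lambda>j kd. block * q + offset p j kd)"

definition tuple_edges :: "nat \<Rightarrow> nat \<times> nat list \<Rightarrow> (nat \<times> nat \<times> sign) list" where
  "tuple_edges q rt = concat (map (\<lambda>p. gadget q (fst rt, length (snd rt)) p (snd rt ! p)) [0..<length (snd rt)])"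

primrec instance_edges :: "nat \<Rightarrow> (nat \<times> nat list) list \<Rightarrow> (nat \<times> nat \<times> sign) list" where
  "instance_edges q [] = []"
| "instance_edges q (rt # ts) = tuple_edges q rt @ instance_edges (Suc q) ts"

lemma arity_le: "\<sigma> \<in> set syms \<Longrightarrow> snd \<sigma> \<le> length pos"
proof -
  assume "\<sigma> \<in> set syms"
  then have "Pair \<sigma> ` {..<snd \<sigma>} \<subseteq> set pos" by (auto simp: set_pos)
  then have "card (Pair \<sigma> ` {..<snd \<sigma>}) \<le> card (set pos)" by (intro card_mono) auto
  also have "card (Pair \<sigma> ` {..<snd \<sigma>}) = snd \<sigma>" by (simp add: card_image inj_on_def)
  finally show ?thesis using card_length[of pos] by simp
qed

lemma offset_less:
  assumes "p < length pos" "j < height"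
  shows "offset p j kd < block" "2 \<le> offset p j kd"
proof -
  have "p * height + j < Suc p * height" using assms(2) by simp
  also have "\<dots> \<le> length pos * height" using assms(1) by (intro mult_le_mono1) simp
  finally have "p * height + j < length pos * height" .
  moreover have "kind_code kd \<le> 2" by (cases kd) auto
  moreover have "2 + a * 3 + k < 2 + b * 3" if "a < b" "k \<le> 2" for a b k :: nat using that by linarith
  ultimately show "offset p j kd < block" unfolding offset_def block_def by blast
qed (simp add: offset_def)

lemma offset_decode:
  assumes "j < height"
  shows "(offset p j kd - 2) div 3 div height = p" "(offset p j kd - 2) div 3 mod height = j"
    "code_kind ((offset p j kd - 2) mod 3) = kd"
proof -
  have "(offset p j kd - 2) div 3 = p * height + j" "(offset p j kd - 2) mod 3 = kind_code kd"
    by (cases kd; simp add: offset_def; presburger)+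
  then show "(offset p j kd - 2) div 3 div height = p" "(offset p j kd - 2) div 3 mod height = j"
    "code_kind ((offset p j kd - 2) mod 3) = kd"
    using assms by (cases kd; simp add: code_kind_def)+
qed

lemma in_instance_edges:
  "e \<in> set (instance_edges q ts) \<longleftrightarrow>
     (\<exists>i<length ts. \<exists>p<length (snd (ts ! i)). e \<in> set (gadget (q + i) (fst (ts ! i), length (snd (ts ! i))) p (snd (ts ! i) ! p)))"
proof (induction ts arbitrary: q)
  case (Cons rt ts)
  have "e \<in> set (tuple_edges q rt) \<longleftrightarrow> (\<exists>p<length (snd rt). e \<in> set (gadget q (fst rt, length (snd rt)) p (snd rt ! p)))"
    by (auto simp: tuple_edges_def)
  then show ?case unfolding instance_edges.simps set_append Un_iff Cons.IH by (simp add: Ex_less_Suc2)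
qed simp

definition rel_hom :: "nat \<Rightarrow> (nat \<times> nat list) list \<Rightarrow> (nat \<Rightarrow> 'a) \<Rightarrow> bool" where
  "rel_hom n ts h \<longleftrightarrow> h ` {..<n} \<subseteq> univ T \<and> (\<forall>(r, t)\<in>set ts. map h t \<in> rel T (r, length t))"

text \<open>Every number below \<open>N\<close> needs an image, including those that lie on no edge;
  they go to an arbitrary bottom node. For \<open>n = 0\<close> such a node need not exist, hence
  the condition on \<open>N\<close>.\<close>

lemma instance_hom_of_rel_hom:
  assumes ts: "\<And>r t. (r, t) \<in> set ts \<Longrightarrow> (r, length t) \<in> set syms \<and> set t \<subseteq> {..<n}"
    and h: "rel_hom n ts h" and N: "n = 0 \<longrightarrow> N = 0"
  shows "\<exists>\<phi>. ec_hom (edge_graph N (instance_edges 1 ts)) tgraph \<phi>"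
proof (cases "n = 0")
  case True
  have "instance_edges 1 ts = []"
  proof -
    have "snd (ts ! i) = []" if "i < length ts" for i
      using ts[of "fst (ts ! i)" "snd (ts ! i)"] that True by simp
    then have "\<not> e \<in> set (instance_edges 1 ts)" for e unfolding in_instance_edges by auto
    then show ?thesis by (metis list.set_intros(1) neq_Nil_conv)
  qed
  then show ?thesis using True N by (simp add: edge_graph_hom)
next
  case False
  define a0 where "a0 = h 0"
  have a0: "a0 \<in> univ T" using h False by (auto simp: rel_hom_def a0_def)
  obtain r0 where r0: "r0 \<in> tuples" using tuples_nonempty by blast
  \<comment> \<open>A top node is a whole family of tuples, but a tuple of the instance prescribes
    only the entry at its own symbol; the rest is borrowed from \<open>r0\<close>.\<close>
  define R where "R q = (\<lambda>\<sigma>\<in>set syms. if 1 \<le> q \<and> q \<le> length ts \<and> (fst (ts ! (q - 1)), length (snd (ts ! (q - 1)))) = \<sigma>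
      then map h (snd (ts ! (q - 1))) else r0 \<sigma>)" for q
  have R: "R q \<in> tuples" for q
  proof -
    have "map h (snd (ts ! (q - 1))) \<in> rel T (fst (ts ! (q - 1)), length (snd (ts ! (q - 1))))"
      if "1 \<le> q" "q \<le> length ts"
    proof -
      have "ts ! (q - 1) \<in> set ts" using that by (intro nth_mem) auto
      then show ?thesis using h unfolding rel_hom_def by (auto simp: case_prod_beta)
    qed
    then show ?thesis using r0 unfolding tuples_def R_def by (auto simp: PiE_def Pi_def)
  qed
  define \<phi> where "\<phi> m = (let q = m div block; c = m mod block in
     if c = 0 then (if q < n then Bot (h q) else Bot a0)
     else if c = 1 then Top (R q)
     else let p = (c - 2) div 3 div height; j = (c - 2) div 3 mod height; kd = code_kind ((c - 2) mod 3) in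
       if 1 < j \<and> 1 \<le> q \<and> q \<le> length ts \<and> p < length (snd (ts ! (q - 1))) then Mid (h (snd (ts ! (q - 1)) ! p)) (R q) j kd
       else Bot a0)" for m
  have bv: "Bot a \<in> verts tgraph" if "a \<in> univ T" for a
  proof -
    have "Bot a = hrung a r0 1 Both" by (simp add: rung_def)
    then show ?thesis unfolding tgraph_def using that r0 height_gt by fastforce
  qed
  have tv: "Top (R q) \<in> verts tgraph" for q
  proof -
    have "Top (R q) = hrung a0 (R q) height Both" using height_gt by (simp add: rung_def)
    then show ?thesis unfolding tgraph_def using a0 R[of q] height_gt by fastforce
  qed
  have tsn: "snd (ts ! i) ! p < n" if "i < length ts" "p < length (snd (ts ! i))" for i p
    using ts[of "fst (ts ! i)" "snd (ts ! i)"] nth_mem[OF that(1)] nth_mem[OF that(2)] by auto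
  have hn: "h x \<in> univ T" if "x < n" for x using h that by (auto simp: rel_hom_def)
  have mv: "Mid (h (snd (ts ! (q - 1)) ! p)) (R q) j kd \<in> verts tgraph"
    if "1 < j" "j < height" "1 \<le> q" "q \<le> length ts" "p < length (snd (ts ! (q - 1)))" for q p j kd
  proof -
    have "Mid (h (snd (ts ! (q - 1)) ! p)) (R q) j kd = hrung (h (snd (ts ! (q - 1)) ! p)) (R q) j kd"
      using that by (simp add: rung_def)
    moreover have "h (snd (ts ! (q - 1)) ! p) \<in> univ T" using hn tsn[of "q - 1" p] that by simp
    ultimately show ?thesis unfolding tgraph_def using R[of q] that by fastforce
  qed
  have vert: "\<phi> m \<in> verts tgraph" for m
    using bv tv mv hn a0 height_gt unfolding \<phi>_def Let_def by (auto simp del: split_paired_Ex)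
  have block: "1 < block" by (simp add: block_def)
  have \<phi>_ladder: "\<phi> (rung height (block * x) (block * q + 1) (\<lambda>j kd. block * q + offset p j kd) j kd) =
      hrung (h x) (R q) j kd"
    if x: "x = snd (ts ! (q - 1)) ! p" and q: "1 \<le> q" "q \<le> length ts" and p: "p < length (snd (ts ! (q - 1)))"
      and j: "1 \<le> j" "j \<le> height" for x q p j kd
  proof -
    have i: "q - 1 < length ts" using q by simp
    have pp: "p < length pos"
      using ts[of "fst (ts ! (q - 1))" "snd (ts ! (q - 1))"] nth_mem[OF i] arity_le p by force
    have xn: "x < n" using tsn[OF i p] x by simp
    consider "j = 1" | "j = height" "j \<noteq> 1" | "1 < j" "j < height" using j by linarith
    then show ?thesis
    proof cases
      case 1
      then show ?thesis using block xn by (simp add: rung_def \<phi>_def)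
    next
      case 2
      have "(block * q + 1) div block = q + 1 div block" "(block * q + 1) mod block = 1 mod block"
        using block div_mult_self4[of block q 1] mod_mult_self4[of block q 1] by linarith+
      then have "Suc (block * q) div block = q" "Suc (block * q) mod block = 1" using block by simp_all
      then show ?thesis using 2 by (simp add: rung_def \<phi>_def Let_def)
    next
      case 3
      have "(block * q + offset p j kd) mod block = offset p j kd" "(block * q + offset p j kd) div block = q"
        using offset_less[OF pp 3(2), of kd] block by (simp_all add: div_mult_self4)
      moreover have "offset p j kd \<noteq> 0" "offset p j kd \<noteq> 1" using offset_less(2)[OF pp 3(2), of kd] by linarith+
      ultimately show ?thesis using 3 offset_decode[OF 3(2), of p kd] q p x
        by (simp add: rung_def \<phi>_def Let_def)
    qed
  qed
  have "({\<phi> u, \<phi> v}, s) \<in> edges tgraph" if uv: "(u, v, s) \<in> set (instance_edges 1 ts)" for u v s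
  proof -
    from uv obtain i p where i: "i < length ts" "p < length (snd (ts ! i))"
      "(u, v, s) \<in> set (gadget (1 + i) (fst (ts ! i), length (snd (ts ! i))) p (snd (ts ! i) ! p))"
      unfolding in_instance_edges by blast
    let ?q = "1 + i" and ?\<sigma> = "(fst (ts ! i), length (snd (ts ! i)))" and ?x = "snd (ts ! i) ! p"
    let ?rung = "rung height (block * ?x) (block * ?q + 1) (\<lambda>j kd. block * ?q + offset p j kd)"
    from i(3) obtain j kd kd' where j: "1 \<le> j" "j < height" "kd \<noteq> Down" "kd' \<noteq> Up"
      "kd = Both \<and> kd' = Both \<longrightarrow> (2 \<le> j \<and> j \<le> Suc (length pos) \<longrightarrow> j - 2 = idx (?\<sigma>, p))"
      "u = ?rung j kd" "v = ?rung (Suc j) kd'" "s = level_sign j"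
      unfolding gadget_def in_ladder by blast
    have \<sigma>: "?\<sigma> \<in> set syms" using ts[of "fst (ts ! i)" "snd (ts ! i)"] nth_mem[OF i(1)] by simp
    have uv: "\<phi> u = hrung (h ?x) (R ?q) j kd" "\<phi> v = hrung (h ?x) (R ?q) (Suc j) kd'"
      unfolding j(6,7) by (rule \<phi>_ladder; use i j(1,2) in simp)+
    have "chord (h ?x) (R ?q) j" if "kd = Both \<and> kd' = Both"
      unfolding chord_def
    proof
      assume "2 \<le> j \<and> j \<le> Suc (length pos)"
      then have "pos ! (j - 2) = (?\<sigma>, p)" using j(5) that idx_in[OF \<sigma>, of p] i(2) by auto
      then show "R ?q (fst (pos ! (j - 2))) ! snd (pos ! (j - 2)) = h ?x"
        using \<sigma> i by (simp add: R_def)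
    qed
    then show ?thesis unfolding tgraph_edge uv using R[of ?q] hn[OF tsn[OF i(1,2)]] j by blast
  qed
  then show ?thesis using vert unfolding edge_graph_hom by (intro exI[of _ \<phi>]) auto
qed

text \<open>An instance with elements but without tuples still asks for \<open>T\<close> to be
  nonempty. The graph can express this only by having a vertex, hence the condition on
  \<open>N\<close>.\<close>

lemma rel_hom_of_instance_hom:
  assumes ts: "\<And>r t. (r, t) \<in> set ts \<Longrightarrow> (r, length t) \<in> set syms \<and> set t \<subseteq> {..<n}"
    and \<phi>: "ec_hom (edge_graph N (instance_edges 1 ts)) tgraph \<phi>" and N: "n \<noteq> 0 \<longrightarrow> N \<noteq> 0"
  shows "\<exists>h. rel_hom n ts h"
proof -
  have \<phi>V: "\<phi> ` {..<N} \<subseteq> verts tgraph"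
    and \<phi>E: "\<forall>x y s. (x, y, s) \<in> set (instance_edges 1 ts) \<longrightarrow> ({\<phi> x, \<phi> y}, s) \<in> edges tgraph"
    using \<phi>[unfolded edge_graph_hom] by (rule conjunct1, rule conjunct2)
  have edge: "(x, y, s) \<in> set (instance_edges 1 ts) \<Longrightarrow> ({\<phi> x, \<phi> y}, s) \<in> edges tgraph" for x y s
    by (rule \<phi>E[rule_format])
  have ladder: "\<exists>t'\<in>univ T. \<exists>r\<in>tuples. \<phi> (block * (snd (ts ! i) ! p)) = Bot t' \<and> \<phi> (block * (1 + i) + 1) = Top r \<and>
      r (fst (ts ! i), length (snd (ts ! i))) ! p = t'" if i: "i < length ts" "p < length (snd (ts ! i))" for i p
  proof -
    let ?\<sigma> = "(fst (ts ! i), length (snd (ts ! i)))"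
    have "\<exists>t'\<in>univ T. \<exists>r\<in>tuples. \<phi> (block * (snd (ts ! i) ! p)) = Bot t' \<and> \<phi> (block * (1 + i) + 1) = Top r \<and>
      (\<forall>j. 2 \<le> j \<and> j \<le> Suc (length pos) \<and> (2 \<le> j \<and> j \<le> Suc (length pos) \<longrightarrow> j - 2 = idx (?\<sigma>, p)) \<longrightarrow> chord t' r j)"
      by (rule ladder_rigid[where m = "\<lambda>j kd. block * (1 + i) + offset p j kd"])
        (rule edge, unfold in_instance_edges gadget_def[symmetric], use i in blast)
    then obtain t' r where tr: "t' \<in> univ T" "r \<in> tuples" "\<phi> (block * (snd (ts ! i) ! p)) = Bot t'"
      "\<phi> (block * (1 + i) + 1) = Top r"
      "\<And>j. 2 \<le> j \<Longrightarrow> j \<le> Suc (length pos) \<Longrightarrow> j - 2 = idx (?\<sigma>, p) \<Longrightarrow> chord t' r j" by blast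
    have \<sigma>: "?\<sigma> \<in> set syms" using ts[of "fst (ts ! i)" "snd (ts ! i)"] nth_mem[OF i(1)] by simp
    have k: "idx (?\<sigma>, p) < length pos" "pos ! idx (?\<sigma>, p) = (?\<sigma>, p)" using idx_in[OF \<sigma>, of p] i by auto
    have "chord t' r (idx (?\<sigma>, p) + 2)" by (rule tr(5)) (use k in auto)
    then have "r ?\<sigma> ! p = t'" using k by (simp add: chord_def)
    then show ?thesis using tr(1-4) by blast
  qed
  show ?thesis
  proof (cases "n = 0")
    case True
    \<comment> \<open>Without elements all tuples have arity 0, and a nonempty relation of arity 0
      contains the empty tuple.\<close>
    have "map h t \<in> rel T (r, length t)" if rt: "(r, t) \<in> set ts" for r t and h :: "nat \<Rightarrow> 'a"
    proof -
      have t: "t = []" "(r, length t) \<in> set syms" using ts[OF rt] True by auto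
      then obtain u where "u \<in> rel T (r, length t)" by (auto simp: set_syms)
      moreover from this have "u = []" using rel_T[of "(r, length t)" u] t by (auto simp: set_syms)
      ultimately show ?thesis using t by simp
    qed
    then show ?thesis using True by (auto simp: rel_hom_def)
  next
    case False
    then have "\<phi> 0 \<in> verts tgraph" using N \<phi>V by auto
    then obtain a0 where a0: "a0 \<in> univ T" by (auto simp: tgraph_def)
    \<comment> \<open>Elements that occur in a tuple have a bottom node as image by rigidity of the
      ladders; the image of any other element is free.\<close>
    define h where "h x = (if \<exists>t\<in>univ T. \<phi> (block * x) = Bot t then THE t. \<phi> (block * x) = Bot t else a0)" for x
    have hb: "h x = t" if "\<phi> (block * x) = Bot t" "t \<in> univ T" for x t using that by (auto simp: h_def)
    have hT: "h x \<in> univ T" for x using a0 by (auto simp: h_def)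
    have "map h t \<in> rel T (r, length t)" if rt: "(r, t) \<in> set ts" for r t
    proof -
      obtain i where i: "i < length ts" "ts ! i = (r, t)" using rt by (auto simp: in_set_conv_nth)
      have \<sigma>: "(r, length t) \<in> set syms" using ts[OF rt] by simp
      show ?thesis
      proof (cases "t = []")
        case True
        obtain u where "u \<in> rel T (r, length t)" using \<sigma> by (auto simp: set_syms)
        moreover from this have "u = []" using rel_T[of "(r, length t)" u] True \<sigma> by (auto simp: set_syms)
        ultimately show ?thesis using True by simp
      next
        case False
        then obtain u where u: "u \<in> tuples" "\<phi> (block * (1 + i) + 1) = Top u" using ladder[OF i(1), of 0] i by auto
        have uT: "u (r, length t) \<in> rel T (r, length t)" using u(1) \<sigma> by (auto simp: tuples_def)
        then have "length (u (r, length t)) = length t" using rel_T[of "(r, length t)"] \<sigma> by (auto simp: set_syms)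
        moreover have "h (t ! p) = u (r, length t) ! p" if "p < length t" for p
          using ladder[OF i(1), of p] i that u(2) hb by auto
        ultimately have "map h t = u (r, length t)" by (intro nth_equalityI) auto
        then show ?thesis using uT by simp
      qed
    qed
    then show ?thesis using hT by (auto simp: rel_hom_def)
  qed
qed

lemma instance_edges_less:
  assumes ts: "\<And>r t. (r, t) \<in> set ts \<Longrightarrow> (r, length t) \<in> set syms \<and> set t \<subseteq> {..<n}"
    and N: "n \<le> M" "length ts < M" and e: "(x, y, s) \<in> set (instance_edges 1 ts)"
  shows "x < block * M \<and> y < block * M"
proof -
  from e obtain i p where i: "i < length ts" "p < length (snd (ts ! i))"
      "(x, y, s) \<in> set (gadget (1 + i) (fst (ts ! i), length (snd (ts ! i))) p (snd (ts ! i) ! p))"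
      unfolding in_instance_edges by blast
  let ?x = "snd (ts ! i) ! p"
  have \<sigma>: "(fst (ts ! i), length (snd (ts ! i))) \<in> set syms" "?x < n"
    using ts[of "fst (ts ! i)" "snd (ts ! i)"] nth_mem[OF i(1)] nth_mem[OF i(2)] by auto
  have p: "p < length pos" using arity_le[OF \<sigma>(1)] i(2) by simp
  have block: "1 < block" by (simp add: block_def)
  have b: "block * ?x < block * M" using \<sigma>(2) N block by simp
  have q: "block * (1 + i) + c < block * M" if "c < block" for c
  proof -
    have "block * (1 + i) + c < block * (1 + i) + block" using that by simp
    also have "\<dots> = block * (Suc (1 + i))" by simp
    also have "\<dots> \<le> block * M" using N(2) i(1) by (intro mult_le_mono2) simp
    finally show ?thesis .
  qed
  have "rung height (block * ?x) (block * (1 + i) + 1) (\<lambda>j kd. block * (1 + i) + offset p j kd) j kd < block * M"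
    if "1 \<le> j" "j \<le> height" for j kd
    using b q[of 1] q[of "offset p j kd"] offset_less(1)[OF p, of j kd] block that by (auto simp: rung_def)
  then show ?thesis using i(3) unfolding gadget_def in_ladder by auto
qed

end

section \<open>Encodings\<close>

text \<open>The second component counts the ones after the last \<open>False\<close>. With it every
  word, well-formed or not, has a unique decomposition.\<close>

fun parse :: "nat \<Rightarrow> bool list \<Rightarrow> nat list \<times> nat" where
  "parse c [] = ([], c)"
| "parse c (True # w) = parse (Suc c) w"
| "parse c (False # w) = (case parse 0 w of (ns, m) \<Rightarrow> (c # ns, m))"

lemma encode_nats_simps:
  "encode_nats [] = []"
  "encode_nats (n # ns) = replicate n True @ False # encode_nats ns"
  "encode_nats (ms @ ns) = encode_nats ms @ encode_nats ns"
  by (simp_all add: encode_nats_def)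

lemma parse_replicate: "parse c (replicate k True @ w) = parse (c + k) w"
  by (induction k arbitrary: c) simp_all

lemma parse_encode: "parse 0 (encode_nats ns @ replicate m True) = (ns, m)"
proof (induction ns)
  case Nil
  then show ?case using parse_replicate[of 0 m "[]"] by (simp add: encode_nats_simps)
next
  case (Cons n ns)
  then show ?case by (simp add: encode_nats_simps parse_replicate)
qed

lemma encode_parse: "replicate c True @ w = encode_nats (fst (parse c w)) @ replicate (snd (parse c w)) True"
proof (induction c w rule: parse.induct)
  case (2 c w)
  then show ?case by (simp add: replicate_app_Cons_same)
next
  case (3 c w)
  obtain ns m where p: "parse 0 w = (ns, m)" by fastforce
  then have "w = encode_nats ns @ replicate m True" using 3 by (metis append_Nil fst_conv replicate_0 snd_conv)
  then show ?case using p by (simp add: encode_nats_simps)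
qed (simp add: encode_nats_simps)

lemma word_cases:
  obtains ns m where "w = encode_nats ns @ replicate m True"
  using encode_parse[of 0 w] by auto

lemma encode_nats_eq:
  "encode_nats ns @ replicate m True = encode_nats ns' \<longleftrightarrow> ns = ns' \<and> m = 0"
  using parse_encode[of ns m] parse_encode[of ns' 0] by auto

lemma encode_nats_length: "length ns \<le> length (encode_nats ns)" "k \<in> set ns \<Longrightarrow> k < length (encode_nats ns)"
  by (induction ns) (auto simp: encode_nats_simps)

primrec sign_code :: "sign \<Rightarrow> nat" where
  "sign_code Pos = 0"
| "sign_code Neg = 1"

definition edge_nats :: "(nat \<times> nat \<times> sign) list \<Rightarrow> nat list" where
  "edge_nats es = concat (map (\<lambda>(x, y, s). [x, y, sign_code s]) es)"

definition tuple_nats :: "(nat \<times> nat list) list \<Rightarrow> nat list" where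
  "tuple_nats ts = concat (map (\<lambda>(r, t). r # length t # t) ts)"

lemma edge_nats_simps:
  "edge_nats [] = []" "edge_nats ((x, y, s) # es) = x # y # sign_code s # edge_nats es"
  "edge_nats (es @ es') = edge_nats es @ edge_nats es'"
  by (simp_all add: edge_nats_def)

lemma tuple_nats_simps:
  "tuple_nats [] = []" "tuple_nats ((r, t) # ts) = r # length t # t @ tuple_nats ts"
  by (simp_all add: tuple_nats_def)

lemma sign_code_case: "sign_code s = (case s of Pos \<Rightarrow> 0 | Neg \<Rightarrow> 1)"
  by (cases s) simp_all

lemma edge_nats_inj: "edge_nats es = edge_nats es' \<longleftrightarrow> es = es'"
proof (induction es arbitrary: es')
  case Nil
  show ?case by (cases es'; simp add: edge_nats_def split_beta)
next
  case (Cons e es)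
  obtain x y s where e: "e = (x, y, s)" by (rule prod_cases3)
  show ?case
  proof (cases es')
    case Nil
    then show ?thesis by (simp add: e edge_nats_simps)
  next
    case (Cons e' es'')
    obtain x' y' s' where e': "e' = (x', y', s')" by (rule prod_cases3)
    have "sign_code s = sign_code s' \<longleftrightarrow> s = s'" by (cases s; cases s') simp_all
    then show ?thesis unfolding Cons e e' edge_nats_simps by (simp add: Cons.IH)
  qed
qed

text \<open>The arity in front of each tuple tells where the tuple ends.\<close>

lemma tuple_nats_inj: "tuple_nats ts = tuple_nats ts' \<longleftrightarrow> ts = ts'"
proof (induction ts arbitrary: ts')
  case Nil
  show ?case by (cases ts'; simp add: tuple_nats_def split_beta)
next
  case (Cons e ts)
  obtain r t where e: "e = (r, t)" by (rule prod.exhaust)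
  show ?case
  proof (cases ts')
    case Nil
    then show ?thesis by (simp add: e tuple_nats_simps)
  next
    case (Cons e' ts'')
    obtain r' t' where e': "e' = (r', t')" by (rule prod.exhaust)
    show ?thesis unfolding Cons e e' tuple_nats_simps by (auto simp: Cons.IH)
  qed
qed

text \<open>Stated for the decomposition that every word has, so that a program can be compared with
  it without assuming a well-formed input.\<close>

lemma ec_Hom_word:
  "encode_nats ns @ replicate m True \<in> ec_Hom H \<longleftrightarrow> (\<exists>n es. m = 0 \<and> ns = n # edge_nats es \<and>
     (\<forall>(x, y, s)\<in>set es. x < n \<and> y < n) \<and> (\<exists>\<phi>. ec_hom (edge_graph n es) H \<phi>))" (is "?l \<longleftrightarrow> ?r")
proof
  assume ?l
  then obtain G where G: "is_signed_graph G" "\<exists>\<phi>. ec_hom G H \<phi>"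
    "encodes_signed_graph (encode_nats ns @ replicate m True) G"
    unfolding ec_Hom_def by blast
  from G(3) obtain n es where Ge: "verts G = {..<n}" "edges G = (\<lambda>(x, y, s). ({x, y}, s)) ` set es"
    and w: "encode_nats ns @ replicate m True = encode_nats (n # edge_nats es)"
    unfolding encodes_signed_graph_def edge_nats_def sign_code_case by (elim exE conjE)
  have "G = edge_graph n es" using Ge by (simp add: edge_graph_def)
  moreover have "\<forall>(x, y, s)\<in>set es. x < n \<and> y < n"
  proof clarify
    fix x y s assume xy: "(x, y, s) \<in> set es"
    have "(\<lambda>(x, y, s). ({x, y}, s)) (x, y, s) \<in> edges G" unfolding Ge(2) using xy by (rule imageI)
    then have "({x, y}, s) \<in> edges G" by simp
    then obtain a b where "a \<in> verts G" "b \<in> verts G" "{x, y} = {a, b}" using G(1) unfolding is_signed_graph_def by blast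
    then show "x < n \<and> y < n" unfolding Ge(1) doubleton_eq_iff by auto
  qed
  ultimately show ?r using G(2) w unfolding encode_nats_eq by blast
next
  assume ?r
  then obtain n es where *: "m = 0" "ns = n # edge_nats es" "\<forall>(x, y, s)\<in>set es. x < n \<and> y < n"
    "\<exists>\<phi>. ec_hom (edge_graph n es) H \<phi>" by blast
  have "is_signed_graph (edge_graph n es)"
    unfolding is_signed_graph_def
  proof (intro conjI ballI)
    show "finite (verts (edge_graph n es))" by (simp add: edge_graph_def)
    fix e assume "e \<in> edges (edge_graph n es)"
    then have "e \<in> (\<lambda>(x, y, s). ({x, y}, s)) ` set es" by (simp only: edge_graph_def signed_graph.simps)
    then obtain d where d: "e = (\<lambda>(x, y, s). ({x, y}, s)) d" "d \<in> set es" by (rule imageE)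
    obtain x y s where "d = (x, y, s)" by (rule prod_cases3)
    then show "case e of (e, s) \<Rightarrow> \<exists>x\<in>verts (edge_graph n es). \<exists>y\<in>verts (edge_graph n es). e = {x, y}"
      using d bspec[OF *(3) d(2)] by (auto simp: edge_graph_def)
  qed
  moreover have "encodes_signed_graph (encode_nats ns) (edge_graph n es)"
    unfolding encodes_signed_graph_def
    by (rule exI[of _ n], rule exI[of _ es]) (simp add: edge_graph_def *(2) edge_nats_def sign_code_case)
  ultimately show ?l using *(1,4) unfolding ec_Hom_def by auto
qed

lemma CSP_word:
  "encode_nats ns @ replicate m True \<in> CSP \<tau> T \<longleftrightarrow> (\<exists>n ts. m = 0 \<and> ns = n # tuple_nats ts \<and>
     (\<forall>(r, t)\<in>set ts. (r, length t) \<in> \<tau> \<and> set t \<subseteq> {..<n}) \<and>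
     (\<exists>h. h ` {..<n} \<subseteq> univ T \<and> (\<forall>(r, t)\<in>set ts. map h t \<in> rel T (r, length t))))" (is "?l \<longleftrightarrow> ?r")
proof
  assume ?l
  then obtain S h n ts where S: "is_structure \<tau> S" "structure_hom \<tau> S T h" "univ S = {..<n}"
    "set ts = {(r, t). (r, length t) \<in> \<tau> \<and> t \<in> rel S (r, length t)}"
    and w: "encode_nats ns @ replicate m True = encode_nats (n # tuple_nats ts)"
    unfolding CSP_def encodes_structure_def tuple_nats_def by auto
  have "set t \<subseteq> {..<n} \<and> map h t \<in> rel T (r, length t)" if "(r, t) \<in> set ts" for r t
  proof -
    have rt: "(r, length t) \<in> \<tau>" "t \<in> rel S (r, length t)" using that S(4) by auto
    have "rel S (r, length t) \<subseteq> {u. length u = length t \<and> set u \<subseteq> univ S}"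
      using S(1) rt(1) unfolding is_structure_def by blast
    moreover have "map h t \<in> rel T (r, length t)" using S(2) rt unfolding structure_hom_def by blast
    ultimately show ?thesis using rt(2) S(3) by blast
  qed
  moreover have "h ` {..<n} \<subseteq> univ T" using S(2,3) by (simp add: structure_hom_def)
  moreover have "\<forall>(r, t)\<in>set ts. (r, length t) \<in> \<tau>" using S(4) by auto
  ultimately show ?r using w unfolding encode_nats_eq by (intro exI[of _ n] exI[of _ ts]) auto
next
  assume ?r
  then obtain n ts h where *: "m = 0" "ns = n # tuple_nats ts"
     "\<forall>(r, t)\<in>set ts. (r, length t) \<in> \<tau> \<and> set t \<subseteq> {..<n}" "h ` {..<n} \<subseteq> univ T"
     "\<forall>(r, t)\<in>set ts. map h t \<in> rel T (r, length t)" by blast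
  define S where "S = \<lparr>univ = {..<n}, rel = (\<lambda>(r, a). {t. length t = a \<and> (r, t) \<in> set ts})\<rparr>"
  have "is_structure \<tau> S" using *(3) by (fastforce simp: is_structure_def S_def)
  moreover have "encodes_structure \<tau> (encode_nats ns) S"
    unfolding encodes_structure_def
    by (intro exI[of _ n] exI[of _ ts]) (use *(3) in \<open>auto simp: S_def *(2) tuple_nats_def\<close>)
  moreover have "structure_hom \<tau> S T h" using *(4,5) by (fastforce simp: structure_hom_def S_def)
  ultimately show ?l using *(1) by (auto simp: CSP_def)
qed

section \<open>Scanning the numbers of the input\<close>

text \<open>
  The first component of the register counts the cells of the current number up to the bound
  \<open>b\<close>; variable \<open>0\<close> holds its exact value.
\<close>

definition num_end :: "(nat \<times> 'm, 'c) com \<Rightarrow> (nat \<times> 'm, 'c) com" where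
  "num_end c = (c ;; Zero 0 ;; Upd (\<lambda>(k, m). (0, m)))"

definition num_scan :: "nat \<Rightarrow> (nat \<times> 'm, 'c) com \<Rightarrow> (nat \<times> 'm, 'c) com" where
  "num_scan b c = ForIn (Inc 0 ;; Upd (\<lambda>(k, m). (min (Suc k) b, m))) (num_end c)"

text \<open>The memory after \<open>k\<close> cells of the current number; as an invariant of the
  scan it separates the digit counter from everything that the visits change.\<close>

definition at_num :: "nat \<Rightarrow> nat \<Rightarrow> (nat \<times> 'm, 'c) mem \<Rightarrow> (nat \<times> 'm, 'c) mem" where
  "at_num b k s = s\<lparr>var := (var s)(0 := k), reg := (min k b, snd (reg s))\<rparr>"

definition visit :: "language \<Rightarrow> bool list \<Rightarrow> nat \<Rightarrow> (nat \<times> 'm, 'c) com \<Rightarrow> nat \<Rightarrow> (nat \<times> 'm, 'c) mem \<Rightarrow> (nat \<times> 'm, 'c) mem" where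
  "visit Q w b c k s = at_num b 0 (sem Q w c (at_num b k s))"

text \<open>The unfinished run of \<open>m\<close> ones remains in the counter; for positive
  \<open>b\<close> a nonzero counter at the end reveals a malformed word.\<close>

lemma sem_num_scan:
  assumes w: "w = encode_nats ns @ replicate m True" and s: "at_num b 0 s = s"
  shows "sem Q w (num_scan b c) s = at_num b m (fold (visit Q w b c) ns s)"
proof -
  let ?f = "\<lambda>i s. if i then sem Q w (Inc 0 ;; Upd (\<lambda>(k, m). (min (Suc k) b, m))) s else sem Q w (num_end c) s"
  have trues: "fold ?f (replicate k True) (at_num b l s) = at_num b (l + k) s" if "l + k \<le> length w" for k l s
    using that
  proof (induction k arbitrary: l)
    case (Suc k)
    have "sem Q w (Inc 0 ;; Upd (\<lambda>(k, m). (min (Suc k) b, m))) (at_num b l s) = at_num b (Suc l) s"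
      using Suc.prems by (auto simp: at_num_def)
    then show ?case using Suc.IH[of "Suc l"] Suc.prems by simp
  qed simp
  have fin: "sem Q w (num_end c) (at_num b k s) = visit Q w b c k s" for k s
    by (simp add: num_end_def visit_def at_num_def split: prod.splits)
  have "at_num b 0 s = s \<Longrightarrow> (\<forall>k\<in>set ns. k \<le> length w) \<Longrightarrow> m \<le> length w \<Longrightarrow>
      fold ?f (encode_nats ns @ replicate m True) s = at_num b m (fold (visit Q w b c) ns s)" for ns s
  proof (induction ns arbitrary: s)
    case Nil
    then show ?case using trues[of 0 m s] by (simp add: encode_nats_simps)
  next
    case (Cons k ns)
    have "fold ?f (replicate k True) s = at_num b k s" using trues[of 0 k s] Cons.prems by simp
    moreover have "at_num b 0 (visit Q w b c k s) = visit Q w b c k s" by (simp add: visit_def at_num_def)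
    ultimately show ?case using Cons.IH[of "visit Q w b c k s"] Cons.prems
      by (simp add: encode_nats_simps fin)
  qed
  moreover have "\<forall>k\<in>set ns. k \<le> length w" using encode_nats_length(2)[of _ ns] w by force
  moreover have "m \<le> length w" using w by simp
  ultimately have "fold ?f (encode_nats ns @ replicate m True) s = at_num b m (fold (visit Q w b c) ns s)"
    using s by blast
  then show ?thesis unfolding num_scan_def sem.simps(12) using w by simp
qed

text \<open>Turns comparison with the first number into a lookup: afterwards cell \<open>k\<close>
  knows whether \<open>k\<close> is smaller. The digit counter serves as a flag for having left the
  initial run of ones.\<close>

definition mark_initial :: "('c \<Rightarrow> 'c) \<Rightarrow> (nat \<times> 'm, 'c) com" where
  "mark_initial f = (ForIn (Cond (\<lambda>r. fst r = 0) (At 0 (\<lambda>r c. (r, f c)) ;; Inc 0) (Upd id)) (Upd (\<lambda>(k, m). (1, m))) ;;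
     Zero 0 ;; Upd (\<lambda>(k, m). (0, m)))"

lemma sem_mark_initial:
  assumes s: "var s 0 = 0" "fst (reg s) = 0"
  shows "sem Q w (mark_initial f) s = s\<lparr>var := (var s)(0 := 0), reg := (0, snd (reg s)),
     arr := (\<lambda>u. if u < length (takeWhile id w) then f (arr s u) else arr s u)\<rparr>"
proof -
  let ?f = "\<lambda>i s. if i then sem Q w (Cond (\<lambda>r. fst r = 0) (At 0 (\<lambda>r c. (r, f c)) ;; Inc 0) (Upd id)) s
      else sem Q w (Upd (\<lambda>(k :: nat, m). (1, m))) s"
  have later: "fst (reg s) = 1 \<Longrightarrow> fold ?f u s = s" for u s
    by (induction u arbitrary: s) (auto split: prod.splits)
  have "v 0 = l \<Longrightarrow> l + length u \<le> length w \<Longrightarrow>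
     \<exists>k j. fold ?f u \<lparr>reg = (0, r), var = v, arr = a, out = z\<rparr> = \<lparr>reg = (j, r), var = v(0 := k),
      arr = (\<lambda>i. if l \<le> i \<and> i < l + length (takeWhile id u) then f (a i) else a i), out = z\<rparr>" for u l r v a z
  proof (induction u arbitrary: v a l)
    case Nil
    have "(\<lambda>i. if l \<le> i \<and> i < l + length (takeWhile id []) then f (a i) else a i) = a" by (auto simp: fun_eq_iff)
    moreover have "v(0 := l) = v" using Nil by auto
    ultimately show ?case by (rule_tac exI[of _ l], rule_tac exI[of _ 0]) simp
  next
    case (Cons i u)
    show ?case
    proof (cases i)
      case True
      have step: "?f i \<lparr>reg = (0, r), var = v, arr = a, out = z\<rparr> =
        \<lparr>reg = (0, r), var = v(0 := Suc l), arr = a(l := f (a l)), out = z\<rparr>"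
        using Cons.prems True by simp
      have "\<exists>k j. fold ?f u \<lparr>reg = (0, r), var = v(0 := Suc l), arr = a(l := f (a l)), out = z\<rparr> =
        \<lparr>reg = (j, r), var = (v(0 := Suc l))(0 := k),
          arr = (\<lambda>i. if Suc l \<le> i \<and> i < Suc l + length (takeWhile id u) then f ((a(l := f (a l))) i) else (a(l := f (a l))) i), out = z\<rparr>"
        by (rule Cons.IH) (use Cons.prems in auto)
      moreover have "(\<lambda>i. if Suc l \<le> i \<and> i < Suc l + length (takeWhile id u) then f ((a(l := f (a l))) i) else (a(l := f (a l))) i) =
        (\<lambda>v. if l \<le> v \<and> v < l + length (takeWhile id (i # u)) then f (a v) else a v)"
        using True by (auto simp: fun_eq_iff)
      ultimately show ?thesis unfolding fold_simps step fun_upd_upd by (simp only:)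
    next
      case False
      have "?f i \<lparr>reg = (0, r), var = v, arr = a, out = z\<rparr> = \<lparr>reg = (1, r), var = v, arr = a, out = z\<rparr>"
        using False by simp
      then have "fold ?f (i # u) \<lparr>reg = (0, r), var = v, arr = a, out = z\<rparr> = \<lparr>reg = (1, r), var = v, arr = a, out = z\<rparr>"
        using later[of "\<lparr>reg = (1, r), var = v, arr = a, out = z\<rparr>" u] unfolding fold_simps by simp
      moreover have "(\<lambda>j. if l \<le> j \<and> j < l + length (takeWhile id (i # u)) then f (a j) else a j) = a"
        using False by (auto simp: fun_eq_iff)
      moreover have "v(0 := l) = v" using Cons.prems by auto
      ultimately show ?thesis by (rule_tac exI[of _ l], rule_tac exI[of _ 1]) (simp only:)
    qed
  qed
  from this[of "var s" 0 w "snd (reg s)" "arr s" "out s"] obtain k j where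
    "fold ?f w \<lparr>reg = (0, snd (reg s)), var = var s, arr = arr s, out = out s\<rparr> = \<lparr>reg = (j, snd (reg s)), var = (var s)(0 := k),
      arr = (\<lambda>i. if 0 \<le> i \<and> i < 0 + length (takeWhile id w) then f (arr s i) else arr s i), out = out s\<rparr>"
    using s(1) by auto
  moreover have "s = \<lparr>reg = (0, snd (reg s)), var = var s, arr = arr s, out = out s\<rparr>" using s(2) by (cases s) (auto simp: prod_eq_iff)
  ultimately have "fold ?f w s = \<lparr>reg = (j, snd (reg s)), var = (var s)(0 := k),
      arr = (\<lambda>i. if i < length (takeWhile id w) then f (arr s i) else arr s i), out = out s\<rparr>" by simp
  then show ?thesis unfolding mark_initial_def sem.simps by (cases s) simp
qed

lemma initial_encode: "length (takeWhile id (encode_nats (n # ns) @ u)) = n"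
  by (induction n) (simp_all add: encode_nats_simps)

lemma wf_num_scan:
  "wf_com nv ({..b} \<times> R) \<Gamma> c \<Longrightarrow> 0 < nv \<Longrightarrow> \<not> scans_input c \<Longrightarrow> wf_com nv ({..b} \<times> R) \<Gamma> (num_scan b c)"
  by (auto simp: num_scan_def num_end_def)

lemma wf_mark_initial:
  "(\<And>c. c \<in> \<Gamma> \<Longrightarrow> f c \<in> \<Gamma>) \<Longrightarrow> 0 < nv \<Longrightarrow> 1 \<le> b \<Longrightarrow> wf_com nv ({..b} \<times> R) \<Gamma> (mark_initial f)"
  by (auto simp: mark_initial_def)

section \<open>Writing words\<close>

definition seq_all :: "('r, 'c) com list \<Rightarrow> ('r, 'c) com" where
  "seq_all cs = foldr Seq cs (Upd id)"

lemma sem_seq_all: "sem Q w (seq_all cs) s = fold (sem Q w) cs s"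
  by (induction cs arbitrary: s) (auto simp: seq_all_def)

lemma wf_seq_all: "wf_com nv R \<Gamma> (seq_all cs) \<longleftrightarrow> (\<forall>c\<in>set cs. wf_com nv R \<Gamma> c)"
  by (induction cs) (auto simp: seq_all_def)

lemma scans_seq_all: "scans_input (seq_all cs) \<longleftrightarrow> (\<exists>c\<in>set cs. scans_input c)"
  by (induction cs) (auto simp: seq_all_def)

lemma assigned_seq_all: "assigned (seq_all cs) = (\<Union>c\<in>set cs. assigned c)"
  by (induction cs) (auto simp: seq_all_def)

definition emit_word :: "bool list \<Rightarrow> ('r, 'c) com" where
  "emit_word u = seq_all (map Emit u)"

lemma sem_emit_word: "sem Q w (emit_word u) s = s\<lparr>out := out s @ u\<rparr>"
  unfolding emit_word_def sem_seq_all by (induction u arbitrary: s) auto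

lemma emit_word_props:
  "wf_com nv R \<Gamma> (emit_word u)" "\<not> scans_input (emit_word u)" "assigned (emit_word u) = {}"
  by (auto simp: emit_word_def wf_seq_all scans_seq_all assigned_seq_all)

definition emit_affine :: "nat \<Rightarrow> nat \<times> nat \<Rightarrow> ('r, 'c) com" where
  "emit_affine k vo = (seq_all (replicate k (EmitV (fst vo))) ;; emit_word (replicate (snd vo) True @ [False]))"

lemma sem_emit_affine:
  "sem Q w (emit_affine k vo) s = s\<lparr>out := out s @ encode_nats [k * var s (fst vo) + snd vo]\<rparr>"
proof -
  have "sem Q w (seq_all (replicate k (EmitV v))) s = s\<lparr>out := out s @ replicate (k * var s v) True\<rparr>" for v
    unfolding sem_seq_all by (induction k arbitrary: s) (auto simp: replicate_add)
  then show ?thesis by (simp add: emit_affine_def sem_emit_word encode_nats_simps replicate_add)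
qed

lemma emit_affine_props:
  "wf_com nv R \<Gamma> (emit_affine k vo) \<longleftrightarrow> k = 0 \<or> fst vo < nv" "\<not> scans_input (emit_affine k vo)"
  by (auto simp: emit_affine_def wf_seq_all scans_seq_all emit_word_props)

text \<open>The way to print a size: a loop around a constant word yields a multiple of
  \<open>length w + 1\<close>, which is large enough for both reductions.\<close>

lemma sem_fill: "sem Q w (For x (emit_word u)) s = s\<lparr>var := (var s)(x := 0),
   out := out s @ concat (replicate (Suc (length w)) u)\<rparr>"
proof -
  let ?g = "\<lambda>k s. sem Q w (emit_word u) (s\<lparr>var := (var s)(x := k)\<rparr>)"
  have "\<exists>j. fold ?g [0..<n] s = s\<lparr>var := (var s)(x := j), out := out s @ concat (replicate n u)\<rparr>" for n
  proof (induction n)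
    case 0
    then show ?case by (intro exI[of _ "var s x"]) simp
  next
    case (Suc n)
    then obtain j where j: "fold ?g [0..<n] s = s\<lparr>var := (var s)(x := j), out := out s @ concat (replicate n u)\<rparr>" by blast
    have c: "concat (replicate n u) @ u = concat (replicate (Suc n) u)"
      by (metis concat.simps concat_append append_Nil2 replicate_Suc replicate_append_same)
    have "fold ?g [0..<Suc n] s = ?g n (fold ?g [0..<n] s)" by simp
    also have "\<dots> = ?g n (s\<lparr>var := (var s)(x := j), out := out s @ concat (replicate n u)\<rparr>)" by (simp only: j)
    also have "\<dots> = s\<lparr>var := (var s)(x := n), out := out s @ concat (replicate (Suc n) u)\<rparr>"
      unfolding sem_emit_word c[symmetric] by simp
    finally show ?case by blast
  qed
  then obtain j where "fold ?g [0..<Suc (length w)] s =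
      s\<lparr>var := (var s)(x := j), out := out s @ concat (replicate (Suc (length w)) u)\<rparr>" by blast
  then show ?thesis unfolding sem.simps by simp
qed

section \<open>Reducing the constraint problem to the homomorphism problem\<close>

text \<open>Positions in the input: a number of elements, a relation name, an arity or a tuple entry is next.\<close>

datatype phase = Domain | Name | Arity nat | Entry "nat \<times> nat" nat | Failed

text \<open>Allows a ladder with symbolic vertices to be fixed at compile time and evaluated when it
  is printed.\<close>

lemma map_ladder:
  "ladder h ch (f b) (f t) (\<lambda>j kd. f (m j kd)) = map (\<lambda>(x, y, s). (f x, f y, s)) (ladder h ch b t m)"
proof -
  have r: "rung h (f b) (f t) (\<lambda>j kd. f (m j kd)) j kd = f (rung h b t m j kd)" for j kd
    by (simp add: rung_def)
  show ?thesis by (simp add: ladder_def r map_concat o_def if_distrib cong: if_cong)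
qed

section \<open>A finite automaton for well-formed instances\<close>

context template
begin

text \<open>Exceeds all names and arities of \<open>syms\<close>, so a capped number agrees with one
  of them only if the number itself does. This makes the finite digit counter sufficient.\<close>

definition bound :: nat where
  "bound = Suc (sum_list (map (\<lambda>(r, a). r + a) syms))"

lemma less_bound: "(r, a) \<in> set syms \<Longrightarrow> r < bound \<and> a < bound"
  using member_le_sum_list[of "r + a" "map (\<lambda>(r, a). r + a) syms"] by (force simp: bound_def)

lemma capped: "(min r bound, min a bound) \<in> set syms \<longleftrightarrow> (r, a) \<in> set syms"
  using less_bound[of "min r bound" "min a bound"] less_bound[of r a] by (auto simp: min_def)

text \<open>Failure on symbols outside \<open>syms\<close> includes symbols of the vocabulary whose
  relation in \<open>T\<close> is empty: a tuple there already makes a no-instance. A tuple of arity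
  0 has no entries, so the next name follows at once.\<close>

fun next_phase :: "phase \<Rightarrow> nat \<Rightarrow> bool \<Rightarrow> phase" where
  "next_phase Domain c d = Name"
| "next_phase Name c d = Arity c"
| "next_phase (Arity r) c d = (if (r, c) \<in> set syms then if c = 0 then Name else Entry (r, c) 0 else Failed)"
| "next_phase (Entry \<sigma> p) c d = (if d then if Suc p = snd \<sigma> then Name else Entry \<sigma> (Suc p) else Failed)"
| "next_phase Failed c d = Failed"

abbreviation phase_step :: "nat \<Rightarrow> nat \<Rightarrow> phase \<Rightarrow> phase" where
  "phase_step n k ph \<equiv> next_phase ph (min k bound) (k < n)"

lemma phase_failed: "fold (phase_step n) ns Failed = Failed"
  by (induction ns) auto

lemma phase_entries:
  "p + length t = snd \<sigma> \<Longrightarrow> t \<noteq> [] \<Longrightarrow> set t \<subseteq> {..<n} \<Longrightarrow> fold (phase_step n) t (Entry \<sigma> p) = Name"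
proof (induction t arbitrary: p)
  case (Cons x t)
  then show ?case by (cases t) auto
qed simp

lemma phase_tuple:
  assumes "(r, length t) \<in> set syms" "set t \<subseteq> {..<n}"
  shows "fold (phase_step n) (r # length t # t) Name = Name"
  using phase_entries[of 0 t "(r, length t)" n] assms less_bound[OF assms(1)]
  by (cases "t = []") (auto simp: min_def)

lemma phase_entriesD:
  "fold (phase_step n) ns (Entry \<sigma> p) = Name \<Longrightarrow> p < snd \<sigma> \<Longrightarrow>
    \<exists>t ns'. ns = t @ ns' \<and> p + length t = snd \<sigma> \<and> set t \<subseteq> {..<n} \<and> fold (phase_step n) ns' Name = Name"
proof (induction ns arbitrary: p)
  case (Cons x ns)
  have x: "x < n"
  proof (rule ccontr)
    assume "\<not> x < n"
    then show False using Cons.prems(1) phase_failed by simp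
  qed
  show ?case
  proof (cases "Suc p = snd \<sigma>")
    case True
    then show ?thesis using Cons.prems x by (rule_tac exI[of _ "[x]"], rule_tac exI[of _ ns]) simp
  next
    case False
    then have "fold (phase_step n) ns (Entry \<sigma> (Suc p)) = Name" "Suc p < snd \<sigma>" using Cons.prems x by auto
    from Cons.IH[OF this] obtain t ns' where "ns = t @ ns'" "Suc p + length t = snd \<sigma>" "set t \<subseteq> {..<n}"
      "fold (phase_step n) ns' Name = Name" by blast
    then show ?thesis using x by (rule_tac exI[of _ "x # t"], rule_tac exI[of _ ns']) simp
  qed
qed simp

text \<open>\<open>Failed\<close> is absorbing, so a run that ends in \<open>Name\<close> never
  failed and splits into complete tuples. The induction on the length removes one tuple at a
  time.\<close>

lemma phase_accepts:
  "fold (phase_step n) ns Name = Name \<longleftrightarrow>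
     (\<exists>ts. ns = tuple_nats ts \<and> (\<forall>(r, t)\<in>set ts. (r, length t) \<in> set syms \<and> set t \<subseteq> {..<n}))"
proof
  assume "\<exists>ts. ns = tuple_nats ts \<and> (\<forall>(r, t)\<in>set ts. (r, length t) \<in> set syms \<and> set t \<subseteq> {..<n})"
  then obtain ts where ts: "ns = tuple_nats ts" "\<forall>(r, t)\<in>set ts. (r, length t) \<in> set syms \<and> set t \<subseteq> {..<n}" by blast
  from ts(2) have "fold (phase_step n) (tuple_nats ts) Name = Name"
  proof (induction ts)
    case (Cons rt ts)
    obtain r t where rt: "rt = (r, t)" by fastforce
    have "tuple_nats (rt # ts) = (r # length t # t) @ tuple_nats ts" by (simp add: rt tuple_nats_simps)
    moreover have "fold (phase_step n) (r # length t # t) Name = Name"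
      using Cons.prems by (intro phase_tuple) (auto simp: rt)
    ultimately show ?case using Cons by (simp only: fold_append o_apply) simp
  qed (simp add: tuple_nats_simps)
  then show "fold (phase_step n) ns Name = Name" by (simp add: ts(1))
next
  show "fold (phase_step n) ns Name = Name \<Longrightarrow>
    \<exists>ts. ns = tuple_nats ts \<and> (\<forall>(r, t)\<in>set ts. (r, length t) \<in> set syms \<and> set t \<subseteq> {..<n})"
  proof (induction "length ns" arbitrary: ns rule: less_induct)
    case less
    show ?case
    proof (cases ns)
      case Nil
      then show ?thesis by (intro exI[of _ "[]"]) (simp add: tuple_nats_simps)
    next
      case (Cons r ns1)
      show ?thesis
      proof (cases ns1)
        case Nil
        then show ?thesis using less.prems Cons by simp
      next
        case (Cons a ns2)
        note ns = \<open>ns = r # ns1\<close> Cons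
        have \<sigma>: "(r, a) \<in> set syms"
        proof (rule ccontr)
          assume "(r, a) \<notin> set syms"
          then show False using less.prems phase_failed unfolding ns by (simp add: capped)
        qed
        then have ra: "min r bound = r" "min a bound = a" using less_bound[OF \<sigma>] by auto
        have "\<exists>t ns'. ns2 = t @ ns' \<and> length t = a \<and> set t \<subseteq> {..<n} \<and> fold (phase_step n) ns' Name = Name"
        proof (cases "a = 0")
          case True
          then show ?thesis using less.prems \<sigma> ra unfolding ns by (rule_tac exI[of _ "[]"], rule_tac exI[of _ ns2]) simp
        next
          case False
          then show ?thesis using less.prems \<sigma> ra phase_entriesD[of n ns2 "(r, a)" 0] unfolding ns by simp
        qed
        then obtain t ns' where t: "ns2 = t @ ns'" "length t = a" "set t \<subseteq> {..<n}" "fold (phase_step n) ns' Name = Name"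
          by blast
        from less.hyps[OF _ t(4)] obtain ts where
          "ns' = tuple_nats ts" "\<forall>(r, t)\<in>set ts. (r, length t) \<in> set syms \<and> set t \<subseteq> {..<n}"
          unfolding ns t(1) by auto
        then show ?thesis using \<sigma> t(2,3) unfolding ns t(1)
          by (intro exI[of _ "(r, t) # ts"]) (simp add: tuple_nats_simps)
      qed
    qed
  qed
qed

section \<open>The program that writes the graph of an instance\<close>

type_synonym fwd_reg = "nat \<times> phase \<times> bool"

definition advance :: "(fwd_reg, bool) com" where
  "advance = At 0 (\<lambda>(c, ph, nz) d. ((c, next_phase ph c d, if ph = Domain then 0 < c else nz), d))"

text \<open>A pair of a variable and a constant stands for \<open>block\<close> times the variable
  plus the constant. Variable 0 holds the entry being read and variable 1 the number of the tuple,
  so the gadget is a constant list.\<close>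

definition template_gadget :: "nat \<times> nat \<Rightarrow> nat \<Rightarrow> ((nat \<times> nat) \<times> (nat \<times> nat) \<times> sign) list" where
  "template_gadget \<sigma> p = ladder height (\<lambda>j. 2 \<le> j \<and> j \<le> Suc (length pos) \<longrightarrow> j - 2 = idx (\<sigma>, p))
     (0, 0) (1, 1) (\<lambda>j kd. (1, offset p j kd))"

definition emit_edge :: "(nat \<times> nat) \<times> (nat \<times> nat) \<times> sign \<Rightarrow> (fwd_reg, bool) com" where
  "emit_edge e = (case e of (a, b, s) \<Rightarrow>
     emit_affine block a ;; emit_affine block b ;; emit_word (encode_nats [sign_code s]))"

definition emit_gadget :: "nat \<times> nat \<Rightarrow> nat \<Rightarrow> (fwd_reg, bool) com" where
  "emit_gadget \<sigma> p = seq_all (map emit_edge (template_gadget \<sigma> p))"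

definition emit_any_gadget :: "(fwd_reg, bool) com" where
  "emit_any_gadget = foldr (\<lambda>(\<sigma>, p) c. Cond (\<lambda>(c, ph, nz). ph = Entry \<sigma> p) (emit_gadget \<sigma> p) c) pos (Upd id)"

text \<open>The multiple of \<open>length w + 1\<close> leaves room for all elements and all tuples
  without counting either; surplus vertices are isolated. Only the distinction between zero and
  nonzero must be exact.\<close>

definition emit_size :: "(fwd_reg, bool) com" where
  "emit_size = (Cond (\<lambda>(c, ph, nz). 0 < c) (For 2 (emit_word (replicate block True))) (Upd id) ;; Emit False)"

definition emit_next :: "(fwd_reg, bool) com" where
  "emit_next = (Cond (\<lambda>(c, ph, nz). ph = Domain) emit_size
     (Cond (\<lambda>(c, ph, nz). ph = Name) (Inc 1) emit_any_gadget) ;; advance)"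

text \<open>The first scan only validates, so a graph is printed for well-formed words alone; the
  second scan runs through the same phases and prints. The verdict is left in the phase
  component.\<close>

definition fwd_program :: "(fwd_reg, bool) com" where
  "fwd_program = (mark_initial (\<lambda>_. True) ;; num_scan bound advance ;;
     Cond (\<lambda>(c, ph, nz). c = 0 \<and> ph = Name)
       (Upd (\<lambda>(c, ph, nz). (c, Domain, nz)) ;; num_scan bound emit_next ;;
        Ask (\<lambda>(c, ph, nz) b. (c, if b then Domain else Failed, nz)))
       (Upd (\<lambda>(c, ph, nz). (c, Failed, nz))))"

definition fwd_mem :: "phase \<Rightarrow> bool \<Rightarrow> nat \<Rightarrow> nat \<Rightarrow> bool list \<Rightarrow> (fwd_reg, bool) mem" where
  "fwd_mem ph nz q n z = \<lparr>reg = (0, ph, nz), var = (\<lambda>_. 0)(1 := q), arr = (\<lambda>u. u < n), out = z\<rparr>"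

lemma at_num_mem: "at_num b k (fwd_mem ph nz q n z) =
   \<lparr>reg = (min k b, ph, nz), var = (\<lambda>_. 0)(1 := q, 0 := k), arr = (\<lambda>u. u < n), out = z\<rparr>"
  by (simp add: at_num_def fwd_mem_def)

lemma at_num_0: "at_num b 0 \<lparr>reg = (c, ph, nz), var = (\<lambda>_. 0)(1 := q, 0 := k), arr = (\<lambda>u. u < n), out = z\<rparr> =
   fwd_mem ph nz q n z"
  by (auto simp: at_num_def fun_eq_iff fwd_mem_def)

lemmas at_num_simps = at_num_0 at_num_0[unfolded One_nat_def]

lemma sem_advance: "sem Q w advance \<lparr>reg = (c, ph, nz), var = v, arr = (\<lambda>u. u < n), out = z\<rparr> =
   \<lparr>reg = (c, next_phase ph c (v 0 < n), if ph = Domain then 0 < c else nz), var = v, arr = (\<lambda>u. u < n), out = z\<rparr>"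
proof -
  have "(\<lambda>u. u < n)(v 0 := v 0 < n) = (\<lambda>u. u < n)" by auto
  then show ?thesis by (simp add: advance_def)
qed

lemma visit_advance: "visit Q w bound advance k (fwd_mem ph nz q n z) =
   fwd_mem (phase_step n k ph) (if ph = Domain then 0 < k else nz) q n z"
  unfolding visit_def at_num_mem sem_advance at_num_0 by (simp add: bound_def)

lemma fold_advance: "ph \<noteq> Domain \<Longrightarrow> fold (visit Q w bound advance) ns (fwd_mem ph nz q n z) =
   fwd_mem (fold (phase_step n) ns ph) nz q n z"
proof (induction ns arbitrary: ph)
  case (Cons k ns)
  have "phase_step n k ph \<noteq> Domain" using Cons.prems by (cases ph) auto
  then show ?case using Cons by (simp only: fold_simps visit_advance if_False)
qed simp

lemma sem_emit_gadget:
  "sem Q w (emit_gadget \<sigma> p) s = s\<lparr>out := out s @ encode_nats (edge_nats (gadget (var s 1) \<sigma> p (var s 0)))\<rparr>"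
proof -
  define f where "f = (\<lambda>vo. block * var s (fst vo) + snd vo)"
  have g: "gadget (var s 1) \<sigma> p (var s 0) = map (\<lambda>(x, y, s). (f x, f y, s)) (template_gadget \<sigma> p)"
    unfolding template_gadget_def map_ladder[symmetric] by (simp add: gadget_def f_def)
  have "fold (sem Q w) (map emit_edge es) (s\<lparr>out := z\<rparr>) =
      s\<lparr>out := z @ encode_nats (edge_nats (map (\<lambda>(x, y, s). (f x, f y, s)) es))\<rparr>" for es z
  proof (induction es arbitrary: z)
    case (Cons e es)
    obtain a b t where e: "e = (a, b, t)" by (rule prod_cases3)
    have "sem Q w (emit_edge e) (s\<lparr>out := z\<rparr>) = s\<lparr>out := z @ encode_nats [f a, f b, sign_code t]\<rparr>"
      by (simp add: emit_edge_def e sem_emit_affine sem_emit_word f_def encode_nats_simps)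
    then show ?case using Cons.IH by (simp add: e edge_nats_simps encode_nats_simps)
  qed (simp add: edge_nats_simps encode_nats_simps)
  from this[of "template_gadget \<sigma> p" "out s"] show ?thesis
    unfolding emit_gadget_def sem_seq_all g by simp
qed

lemma sem_emit_any_gadget:
  assumes "fst (snd (reg s)) = Entry \<sigma> p" "(\<sigma>, p) \<in> set pos"
  shows "sem Q w emit_any_gadget s = sem Q w (emit_gadget \<sigma> p) s"
proof -
  have "(\<sigma>, p) \<in> set ps \<Longrightarrow> sem Q w (foldr (\<lambda>(\<sigma>, p) c. Cond (\<lambda>(c, ph, nz). ph = Entry \<sigma> p) (emit_gadget \<sigma> p) c) ps (Upd id)) s =
     sem Q w (emit_gadget \<sigma> p) s" for ps
    by (induction ps) (use assms(1) in \<open>auto split: prod.splits\<close>)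
  then show ?thesis using assms(2) by (simp add: emit_any_gadget_def)
qed

lemma visit_entry:
  assumes "(\<sigma>, p) \<in> set pos"
  shows "visit Q w bound emit_next x (fwd_mem (Entry \<sigma> p) nz q n z) =
    fwd_mem (phase_step n x (Entry \<sigma> p)) nz q n (z @ encode_nats (edge_nats (gadget q \<sigma> p x)))"
proof -
  let ?s = "\<lparr>reg = (min x bound, Entry \<sigma> p, nz), var = (\<lambda>_. 0)(1 := q, 0 := x), arr = (\<lambda>u. u < n), out = z\<rparr> :: (fwd_reg, bool) mem"
  have "sem Q w emit_any_gadget ?s = ?s\<lparr>out := z @ encode_nats (edge_nats (gadget q \<sigma> p x))\<rparr>"
    using sem_emit_any_gadget[OF _ assms, of ?s Q w] by (simp add: sem_emit_gadget)
  then have "sem Q w emit_next ?s = sem Q w advance (?s\<lparr>out := z @ encode_nats (edge_nats (gadget q \<sigma> p x))\<rparr>)"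
    by (simp add: emit_next_def)
  then show ?thesis unfolding visit_def at_num_mem by (simp add: sem_advance at_num_simps)
qed

text \<open>The assumption keeps \<open>Inc\<close> from saturating, so the tuple counter is
  exact.\<close>

lemma visit_name:
  assumes "q < length w"
  shows "visit Q w bound emit_next x (fwd_mem Name nz q n z) = fwd_mem (phase_step n x Name) nz (Suc q) n z"
proof -
  let ?s = "\<lambda>q. \<lparr>reg = (min x bound, Name, nz), var = (\<lambda>_. 0)(1 := q, 0 := x), arr = (\<lambda>u. u < n), out = z\<rparr> :: (fwd_reg, bool) mem"
  have "sem Q w (Inc 1) (?s q) = ?s (Suc q)" using assms by (auto simp: fun_eq_iff)
  then have "sem Q w emit_next (?s q) = sem Q w advance (?s (Suc q))"
    by (simp add: emit_next_def)
  then show ?thesis unfolding visit_def at_num_mem by (simp add: sem_advance at_num_simps)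
qed

lemma visit_arity:
  "visit Q w bound emit_next x (fwd_mem (Arity r) nz q n z) = fwd_mem (phase_step n x (Arity r)) nz q n z"
proof -
  let ?s = "\<lparr>reg = (min x bound, Arity r, nz), var = (\<lambda>_. 0)(1 := q, 0 := x), arr = (\<lambda>u. u < n), out = z\<rparr> :: (fwd_reg, bool) mem"
  have "sem Q w (foldr (\<lambda>(\<sigma>, p) c. Cond (\<lambda>(c, ph, nz). ph = Entry \<sigma> p) (emit_gadget \<sigma> p) c) ps (Upd id)) ?s = ?s" for ps
    by (induction ps) auto
  then have "sem Q w emit_next ?s = sem Q w advance ?s"
    by (simp add: emit_next_def emit_any_gadget_def)
  then show ?thesis unfolding visit_def at_num_mem by (simp add: sem_advance at_num_simps)
qed

lemma visit_domain:
  "visit Q w bound emit_next n (fwd_mem Domain nz 0 n []) =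
    fwd_mem Name (0 < n) 0 n (encode_nats [if n = 0 then 0 else block * Suc (length w)])"
proof -
  let ?s = "\<lambda>z. \<lparr>reg = (min n bound, Domain, nz), var = (\<lambda>_. 0)(1 := 0, 0 := n), arr = (\<lambda>u. u < n), out = z\<rparr> :: (fwd_reg, bool) mem"
  have v: "(\<lambda>_ :: nat. 0 :: nat)(1 := 0, 0 := n, 2 := 0) = (\<lambda>_. 0)(1 := 0, 0 := n)" by (auto simp: fun_eq_iff)
  have c: "concat (replicate k (replicate l True)) = replicate (l * k) True" for k l
    by (induction k) (auto simp: replicate_add)
  have "sem Q w emit_size (?s []) = ?s (encode_nats [if n = 0 then 0 else block * Suc (length w)])"
    using c[of "Suc (length w)" block] v
    by (simp add: emit_size_def sem_fill encode_nats_simps bound_def del: sem.simps(11) replicate_Suc)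
  then have "sem Q w emit_next (?s []) = sem Q w advance (?s (encode_nats [if n = 0 then 0 else block * Suc (length w)]))"
    by (simp add: emit_next_def)
  then show ?thesis unfolding visit_def at_num_mem by (simp add: sem_advance at_num_simps bound_def)
qed

lemma fold_visit_entries:
  assumes \<sigma>: "\<sigma> \<in> set syms" and len: "length t = snd \<sigma>" and n: "set t \<subseteq> {..<n}"
  shows "p < length t \<Longrightarrow> fold (visit Q w bound emit_next) (drop p t) (fwd_mem (Entry \<sigma> p) nz q n z) =
    fwd_mem Name nz q n (z @ encode_nats (edge_nats (concat (map (\<lambda>p. gadget q \<sigma> p (t ! p)) [p..<length t]))))"
proof (induction "length t - p" arbitrary: p z)
  case (Suc d)
  let ?z = "z @ encode_nats (edge_nats (gadget q \<sigma> p (t ! p)))"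
  have "(\<sigma>, p) \<in> set pos" using \<sigma> len Suc.prems by (simp add: set_pos)
  note v = visit_entry[OF this, of Q w "t ! p" nz q n z]
  have tp: "t ! p < n" using n nth_mem[OF Suc.prems] by auto
  have d: "drop p t = t ! p # drop (Suc p) t" using Suc.prems by (simp add: Cons_nth_drop_Suc)
  have u: "[p..<length t] = p # [Suc p..<length t]" using Suc.prems by (simp add: upt_conv_Cons)
  show ?case
  proof (cases "Suc p < length t")
    case True
    have "fold (visit Q w bound emit_next) (drop (Suc p) t) (fwd_mem (Entry \<sigma> (Suc p)) nz q n ?z) =
      fwd_mem Name nz q n (?z @ encode_nats (edge_nats (concat (map (\<lambda>p. gadget q \<sigma> p (t ! p)) [Suc p..<length t]))))"
      by (rule Suc.hyps(1)) (use Suc.hyps(2) True in auto)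
    then show ?thesis unfolding d u fold_simps v using tp True len
      by (simp add: edge_nats_simps encode_nats_simps)
  next
    case False
    then have "Suc p = length t" using Suc.prems by simp
    then show ?thesis unfolding d u fold_simps v using tp len by simp
  qed
qed simp

lemma fold_visit_tuples:
  assumes "\<forall>(r, t)\<in>set ts. (r, length t) \<in> set syms \<and> set t \<subseteq> {..<n}" "q + length ts \<le> length w"
  shows "fold (visit Q w bound emit_next) (tuple_nats ts) (fwd_mem Name nz q n z) =
    fwd_mem Name nz (q + length ts) n (z @ encode_nats (edge_nats (instance_edges (Suc q) ts)))"
  using assms
proof (induction ts arbitrary: q z)
  case (Cons rt ts)
  obtain r t where rt: "rt = (r, t)" by fastforce
  have \<sigma>: "(r, length t) \<in> set syms" "set t \<subseteq> {..<n}" using Cons.prems rt by auto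
  let ?z = "z @ encode_nats (edge_nats (tuple_edges (Suc q) rt))"
  have caps: "min r bound = r" "min (length t) bound = length t" using less_bound[OF \<sigma>(1)] by auto
  have q: "q < length w" using Cons.prems by simp
  have t: "fold (visit Q w bound emit_next) t (fwd_mem (if length t = 0 then Name else Entry (r, length t) 0) nz (Suc q) n z) =
      fwd_mem Name nz (Suc q) n ?z"
  proof (cases "t = []")
    case True
    then show ?thesis by (simp add: rt tuple_edges_def edge_nats_simps encode_nats_simps)
  next
    case False
    then show ?thesis using fold_visit_entries[OF \<sigma>(1) _ \<sigma>(2), of 0 Q w nz "Suc q" z] by (simp add: rt tuple_edges_def)
  qed
  have "fold (visit Q w bound emit_next) (tuple_nats (rt # ts)) (fwd_mem Name nz q n z) =
     fold (visit Q w bound emit_next) (tuple_nats ts) (fold (visit Q w bound emit_next) t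
       (visit Q w bound emit_next (length t) (visit Q w bound emit_next r (fwd_mem Name nz q n z))))"
    by (simp only: rt tuple_nats_simps fold_simps fold_append o_apply)
  also have "visit Q w bound emit_next (length t) (visit Q w bound emit_next r (fwd_mem Name nz q n z)) =
     fwd_mem (if length t = 0 then Name else Entry (r, length t) 0) nz (Suc q) n z"
    unfolding visit_name[OF q] caps next_phase.simps visit_arity using \<sigma>(1) by (simp only: if_True)
  also note t
  also have "fold (visit Q w bound emit_next) (tuple_nats ts) (fwd_mem Name nz (Suc q) n ?z) =
     fwd_mem Name nz (q + length (rt # ts)) n (z @ encode_nats (edge_nats (instance_edges (Suc q) (rt # ts))))"
    using Cons.IH[of "Suc q" ?z] Cons.prems by (simp add: edge_nats_simps encode_nats_simps)
  finally show ?case .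
qed (simp add: tuple_nats_simps edge_nats_simps encode_nats_simps)

section \<open>Finiteness of the registers and correctness of the first reduction\<close>

definition fwd_registers :: "fwd_reg set" where
  "fwd_registers = {..bound} \<times> ({Domain, Name, Failed} \<union> Arity ` {..bound} \<union> (\<lambda>(\<sigma>, p). Entry \<sigma> p) ` set pos) \<times> UNIV"

lemma next_phase_range:
  assumes "ph \<in> {Domain, Name, Failed} \<union> Arity ` {..bound} \<union> (\<lambda>(\<sigma>, p). Entry \<sigma> p) ` set pos" "c \<le> bound"
  shows "next_phase ph c d \<in> {Domain, Name, Failed} \<union> Arity ` {..bound} \<union> (\<lambda>(\<sigma>, p). Entry \<sigma> p) ` set pos"
proof (cases ph)
  case (Arity r)
  then show ?thesis using assms by (force simp: set_pos image_iff)
next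
  case (Entry \<sigma> p)
  then have "(\<sigma>, p) \<in> set pos" using assms(1) by auto
  then have "d \<Longrightarrow> Suc p \<noteq> snd \<sigma> \<Longrightarrow> (\<sigma>, Suc p) \<in> set pos" by (simp add: set_pos)
  moreover have "(a, b) \<in> set pos \<Longrightarrow> Entry a b \<in> (\<lambda>(\<sigma>, p). Entry \<sigma> p) ` set pos" for a b
    by (rule image_eqI[of _ _ "(a, b)"]) auto
  ultimately show ?thesis unfolding Entry by (cases d; cases "Suc p = snd \<sigma>") simp_all
qed (use assms(2) in auto)

lemma template_vars: "(a, b, s) \<in> set (template_gadget \<sigma> p) \<Longrightarrow> fst a < 3 \<and> fst b < 3"
  unfolding template_gadget_def in_ladder rung_def by auto

lemma wf_emit_gadget: "wf_com 3 R \<Gamma> (emit_gadget \<sigma> p) \<and> \<not> scans_input (emit_gadget \<sigma> p)"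
proof -
  have "wf_com 3 R \<Gamma> (emit_edge e) \<and> \<not> scans_input (emit_edge e)" if "e \<in> set (template_gadget \<sigma> p)" for e
    using template_vars[of "fst e" "fst (snd e)" "snd (snd e)" \<sigma> p] that
    by (auto simp: emit_edge_def emit_affine_props emit_word_props split: prod.splits)
  then show ?thesis by (auto simp: emit_gadget_def wf_seq_all scans_seq_all)
qed

lemma wf_fwd_program: "wf_com 3 fwd_registers UNIV fwd_program"
proof -
  let ?R = "({Domain, Name, Failed} \<union> Arity ` {..bound} \<union> (\<lambda>(\<sigma>, p). Entry \<sigma> p) ` set pos) \<times> (UNIV :: bool set)"
  have R: "fwd_registers = {..bound} \<times> ?R" by (auto simp: fwd_registers_def)
  have adv: "wf_com 3 ({..bound} \<times> ?R) UNIV advance \<and> \<not> scans_input advance"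
    using next_phase_range by (auto simp: advance_def)
  have "wf_com 3 ({..bound} \<times> ?R) UNIV (foldr (\<lambda>(\<sigma>, p) c. Cond (\<lambda>(c, ph, nz). ph = Entry \<sigma> p) (emit_gadget \<sigma> p) c) ps (Upd id)) \<and>
     \<not> scans_input (foldr (\<lambda>(\<sigma>, p) c. Cond (\<lambda>(c, ph, nz). ph = Entry \<sigma> p) (emit_gadget \<sigma> p) c) ps (Upd id))" for ps
    by (induction ps) (use wf_emit_gadget in auto)
  then have any: "wf_com 3 ({..bound} \<times> ?R) UNIV emit_any_gadget \<and> \<not> scans_input emit_any_gadget"
    by (simp add: emit_any_gadget_def)
  have nxt: "wf_com 3 ({..bound} \<times> ?R) UNIV emit_next \<and> \<not> scans_input emit_next"
    using adv any by (auto simp: emit_next_def emit_size_def emit_word_props)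
  show ?thesis unfolding R fwd_program_def
    using adv nxt by (auto intro!: wf_num_scan wf_mark_initial simp: bound_def)
qed

lemma finite_fwd_registers: "finite fwd_registers"
  by (simp add: fwd_registers_def)

definition fwd_start :: "(fwd_reg, bool) mem" where
  "fwd_start = start (0, Domain, False) False"

lemma fwd_program_accepts:
  assumes H: "\<And>G :: nat signed_graph. (\<exists>\<phi>. ec_hom G H \<phi>) \<longleftrightarrow> (\<exists>\<phi>. ec_hom G tgraph \<phi>)"
  shows "fst (snd (reg (sem (ec_Hom H) w fwd_program fwd_start))) = Domain \<longleftrightarrow> w \<in> CSP \<tau> T"
proof -
  let ?Q = "ec_Hom H"
  obtain ns m where w: "w = encode_nats ns @ replicate m True" by (rule word_cases)
  define k where "k = length (takeWhile id w)"
  let ?s1 = "fwd_mem Domain False 0 k []"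
  have s1: "sem ?Q w (mark_initial (\<lambda>_. True)) fwd_start = ?s1"
    by (subst sem_mark_initial) (auto simp: fwd_start_def start_def k_def fun_eq_iff fwd_mem_def)
  have at0: "at_num bound 0 (fwd_mem ph nz 0 n z) = fwd_mem ph nz 0 n z" for ph nz n z
    by (auto simp: at_num_def fun_eq_iff fwd_mem_def)
  define s2 where "s2 = fold (visit ?Q w bound advance) ns ?s1"
  have scan1: "sem ?Q w (num_scan bound advance) ?s1 = at_num bound m s2"
    unfolding s2_def by (rule sem_num_scan[OF w at0])
  have s2: "s2 = (case ns of [] \<Rightarrow> ?s1 | n # ns' \<Rightarrow> fwd_mem (fold (phase_step k) ns' Name) (0 < n) 0 k [])"
    unfolding s2_def by (cases ns) (simp_all add: visit_advance fold_advance del: fold_simps(2) add: fold_simps)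
  define valid where "valid \<longleftrightarrow> m = 0 \<and> (\<exists>n ts. ns = n # tuple_nats ts \<and>
     (\<forall>(r, t)\<in>set ts. (r, length t) \<in> set syms \<and> set t \<subseteq> {..<n}))"
  have kn: "k = n" if "ns = n # ns'" for n ns' using that initial_encode[of n ns' "replicate m True"] w by (simp add: k_def)
  have valid: "valid \<longleftrightarrow> (case reg (at_num bound m s2) of (c, ph, nz) \<Rightarrow> c = 0 \<and> ph = Name)"
  proof (cases ns)
    case Nil
    then show ?thesis by (simp add: valid_def s2 at_num_def fwd_mem_def)
  next
    case (Cons n ns')
    then show ?thesis using kn[OF Cons] phase_accepts[of n ns'] by (auto simp: valid_def s2 at_num_def bound_def fwd_mem_def)
  qed
  show ?thesis
  proof (cases valid)
    case False
    \<comment> \<open>In a yes-instance each tuple has an image in \<open>T\<close>, so its symbol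
      has a nonempty relation and the word passes the check.\<close>
    have "w \<notin> CSP \<tau> T"
    proof
      assume "w \<in> CSP \<tau> T"
      then obtain n ts where *: "m = 0" "ns = n # tuple_nats ts" "\<forall>(r, t)\<in>set ts. (r, length t) \<in> \<tau> \<and> set t \<subseteq> {..<n}"
        "\<exists>h. h ` {..<n} \<subseteq> univ T \<and> (\<forall>(r, t)\<in>set ts. map h t \<in> rel T (r, length t))"
        unfolding w CSP_word by blast
      then have "\<forall>(r, t)\<in>set ts. (r, length t) \<in> set syms \<and> set t \<subseteq> {..<n}" unfolding set_syms by blast
      then have valid using * unfolding valid_def by blast
      then show False using False by simp
    qed
    moreover have "fst (snd (reg (sem ?Q w fwd_program fwd_start))) = Failed"
      unfolding fwd_program_def sem.simps s1 scan1 using False valid by (auto split: prod.splits)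
    ultimately show ?thesis by simp
  next
    case True
    then obtain n ts where v: "m = 0" "ns = n # tuple_nats ts"
      "\<forall>(r, t)\<in>set ts. (r, length t) \<in> set syms \<and> set t \<subseteq> {..<n}" unfolding valid_def by blast
    have k: "k = n" using kn v(2) .
    have "s2 = fwd_mem Name (0 < n) 0 n []"
      using v(3) phase_accepts[of n "tuple_nats ts"] by (auto simp: s2 v(2) k)
    then have m2: "at_num bound m s2 = fwd_mem Name (0 < n) 0 n []" using at0 v(1) by simp
    have lt: "length ts \<le> length w"
    proof -
      have "length ts \<le> length (tuple_nats ts)" by (induction ts) (auto simp: tuple_nats_simps)
      then show ?thesis using encode_nats_length(1)[of ns] by (simp add: w v)
    qed
    let ?N = "if n = 0 then 0 else block * Suc (length w)" and ?es = "instance_edges 1 ts"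
    have "fold (visit ?Q w bound emit_next) ns (fwd_mem Domain (0 < n) 0 n []) =
      fwd_mem Name (0 < n) (length ts) n (encode_nats (?N # edge_nats ?es))"
      unfolding v(2) fold_simps visit_domain using fold_visit_tuples[OF v(3), of 0 w ?Q "0 < n"] lt
      by (simp add: encode_nats_simps)
    then have scan2: "sem ?Q w (num_scan bound emit_next) (fwd_mem Domain (0 < n) 0 n []) =
      at_num bound 0 (fwd_mem Name (0 < n) (length ts) n (encode_nats (?N # edge_nats ?es)))"
      using sem_num_scan[OF w at0, of ?Q emit_next] v(1) by simp
    have "fst (snd (reg (sem ?Q w fwd_program fwd_start))) = Domain \<longleftrightarrow> encode_nats (?N # edge_nats ?es) \<in> ?Q"
      unfolding fwd_program_def sem.simps s1 scan1 m2 using scan2 by (simp add: at_num_def fwd_mem_def)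
    also have "\<dots> \<longleftrightarrow> (\<exists>\<phi>. ec_hom (edge_graph ?N ?es) tgraph \<phi>)"
    proof -
      have ts: "(r, length t) \<in> set syms \<and> set t \<subseteq> {..<n}" if "(r, t) \<in> set ts" for r t using v(3) that by blast
      have "x < ?N \<and> y < ?N" if e: "(x, y, s) \<in> set ?es" for x y s
      proof (cases "n = 0")
        case True
        from e obtain i p where i: "i < length ts" "p < length (snd (ts ! i))" unfolding in_instance_edges by blast
        then show ?thesis using ts[of "fst (ts ! i)" "snd (ts ! i)"] nth_mem[OF i(2)] True by auto
      next
        case False
        have "n \<le> Suc (length w)" using encode_nats_length(2)[of n ns] by (simp add: w v)
        then show ?thesis using instance_edges_less[OF ts _ _ e, of "Suc (length w)"] lt False by simp
      qed
      then have "\<forall>(x, y, s)\<in>set ?es. x < ?N \<and> y < ?N" by blast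
      moreover have "encode_nats (?N # edge_nats ?es) = encode_nats (?N # edge_nats ?es) @ replicate 0 True" by simp
      ultimately show ?thesis using ec_Hom_word[of "?N # edge_nats ?es" 0 H] edge_nats_inj H
        by (metis list.inject)
    qed
    also have "\<dots> \<longleftrightarrow> (\<exists>h. rel_hom n ts h)"
    proof -
      have "(r, length t) \<in> set syms \<and> set t \<subseteq> {..<n}" if "(r, t) \<in> set ts" for r t using v(3) that by blast
      note ts = this
      have "n = 0 \<longrightarrow> ?N = 0" "n \<noteq> 0 \<longrightarrow> ?N \<noteq> 0" by (simp_all add: block_def)
      then show ?thesis
        using instance_hom_of_rel_hom[where N = ?N, OF ts] rel_hom_of_instance_hom[where N = ?N, OF ts] by blast
    qed
    also have "\<dots> \<longleftrightarrow> w \<in> CSP \<tau> T"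
    proof
      assume "\<exists>h. rel_hom n ts h"
      moreover have "\<forall>(r, t)\<in>set ts. (r, length t) \<in> \<tau> \<and> set t \<subseteq> {..<n}" using v(3) unfolding set_syms by blast
      ultimately show "w \<in> CSP \<tau> T" unfolding w CSP_word rel_hom_def using v(1,2) by blast
    next
      assume "w \<in> CSP \<tau> T"
      then obtain n' ts' where *: "ns = n' # tuple_nats ts'"
        "\<exists>h. h ` {..<n'} \<subseteq> univ T \<and> (\<forall>(r, t)\<in>set ts'. map h t \<in> rel T (r, length t))"
        unfolding w CSP_word by blast
      then have "n' = n" "ts' = ts" using v(2) tuple_nats_inj by auto
      then show "\<exists>h. rel_hom n ts h" using * unfolding rel_hom_def by blast
    qed
    finally show ?thesis .
  qed
qed

theorem CSP_reducible:
  assumes "\<And>G :: nat signed_graph. (\<exists>\<phi>. ec_hom G H \<phi>) \<longleftrightarrow> (\<exists>\<phi>. ec_hom G tgraph \<phi>)"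
  shows "poly_turing_reducible (CSP \<tau> T) (ec_Hom H)"
  by (rule poly_turing_reducible_com[OF finite_fwd_registers _ _ _ wf_fwd_program,
        where ?c0.0 = False and r = "(0, Domain, False)" and acc = "\<lambda>r. fst (snd r) = Domain"])
    (use fwd_program_accepts[OF assms] in \<open>auto simp: fwd_registers_def fwd_start_def\<close>)

end

section \<open>Propagating labels along edges\<close>

text \<open>\<open>cmark\<close> is the working set of the propagation in progress. Its outcome is
  frozen in \<open>clev\<close> or \<open>cflag\<close>, on which the rules of later propagations
  depend.\<close>

record cell =
  cdom :: bool
  clev :: "nat set"
  cflag :: "nat set"
  cmark :: "nat set"

type_synonym label_rule = "sign \<Rightarrow> nat set \<times> nat set \<Rightarrow> nat \<Rightarrow> nat set \<times> nat set \<Rightarrow> nat \<Rightarrow> bool"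

definition static :: "cell \<Rightarrow> nat set \<times> nat set" where
  "static c = (clev c, cflag c)"

definition spread :: "nat \<Rightarrow> label_rule \<Rightarrow> sign \<Rightarrow> cell \<Rightarrow> cell \<Rightarrow> cell" where
  "spread b R s c d = d\<lparr>cmark := cmark d \<union> {\<kappa>'. \<kappa>' < b \<and> (\<exists>\<kappa>\<in>cmark c. R s (static c) \<kappa> (static d) \<kappa>')}\<rparr>"

text \<open>The second update uses the old content of \<open>y\<close> but builds on the new content
  of \<open>x\<close>; for a loop the first update is therefore not lost.\<close>

definition edge_op :: "(sign \<Rightarrow> 'c \<Rightarrow> 'c \<Rightarrow> 'c) \<Rightarrow> nat \<times> nat \<times> sign \<Rightarrow> (nat \<Rightarrow> 'c) \<Rightarrow> nat \<Rightarrow> 'c" where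
  "edge_op f e A = (case e of (x, y, s) \<Rightarrow>
     let A' = A(y := f s (A x) (A y)) in A'(x := f s (A y) (A' x)))"

definition marks :: "(nat \<Rightarrow> cell) \<Rightarrow> (nat \<times> nat) set" where
  "marks A = {(u, \<kappa>). \<kappa> \<in> cmark (A u)}"

definition rest :: "cell \<Rightarrow> cell" where
  "rest c = c\<lparr>cmark := {}\<rparr>"

lemma rest_spread: "rest (spread b R s c d) = rest d"
  by (simp add: rest_def spread_def)

lemma static_rest: "rest c = rest d \<Longrightarrow> static c = static d"
  by (cases c; cases d) (simp add: rest_def static_def)

lemma cell_eqI: "rest c = rest d \<Longrightarrow> cmark c = cmark d \<Longrightarrow> c = d"
  by (cases c; cases d) (simp add: rest_def)

definition label_step :: "nat \<Rightarrow> label_rule \<Rightarrow> (nat \<times> nat \<times> sign) list \<Rightarrow> (nat \<Rightarrow> cell) \<Rightarrow> ((nat \<times> nat) \<times> nat \<times> nat) set" where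
  "label_step b R es A = {((x, \<kappa>), (y, \<kappa>')). \<exists>s. ((x, y, s) \<in> set es \<or> (y, x, s) \<in> set es) \<and> \<kappa>' < b \<and>
     R s (static (A x)) \<kappa> (static (A y)) \<kappa>'}"

lemma rest_edge_op: "rest (edge_op (spread b R) e A u) = rest (A u)"
  by (auto simp: edge_op_def Let_def rest_spread split: prod.splits)

lemma marks_edge_op:
  assumes "(x, y, s) \<in> set es"
  shows "marks A \<subseteq> marks (edge_op (spread b R) (x, y, s) A)"
    and "marks (edge_op (spread b R) (x, y, s) A) \<subseteq> marks A \<union> label_step b R es A `` marks A"
    and "marks (edge_op (spread b R) (x, y, s) A) \<subseteq> marks A \<union> {x, y} \<times> {..<b}"
    and "marks (edge_op (spread b R) (x, y, s) A) = marks A \<Longrightarrow> label_step b R [(x, y, s)] A `` marks A \<subseteq> marks A"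
proof -
  let ?B = "A(y := spread b R s (A x) (A y))"
  have st: "static (?B x) = static (A x)" by (auto simp: static_def spread_def)
  have e: "edge_op (spread b R) (x, y, s) A = ?B(x := spread b R s (A y) (?B x))"
    by (simp add: edge_op_def Let_def)
  have m: "(u, \<kappa>') \<in> marks (edge_op (spread b R) (x, y, s) A) \<longleftrightarrow> (u, \<kappa>') \<in> marks A \<or>
      u = y \<and> \<kappa>' < b \<and> (\<exists>\<kappa>\<in>cmark (A x). R s (static (A x)) \<kappa> (static (A y)) \<kappa>') \<or>
      u = x \<and> \<kappa>' < b \<and> (\<exists>\<kappa>\<in>cmark (A y). R s (static (A y)) \<kappa> (static (A x)) \<kappa>')" for u \<kappa>'
  proof -
    have y: "cmark (?B u) = cmark (A u) \<union> {\<kappa>'. u = y \<and> \<kappa>' < b \<and> (\<exists>\<kappa>\<in>cmark (A x). R s (static (A x)) \<kappa> (static (A y)) \<kappa>')}" for u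
      by (simp add: spread_def)
    have "cmark (edge_op (spread b R) (x, y, s) A u) = cmark (?B u) \<union>
       {\<kappa>'. u = x \<and> \<kappa>' < b \<and> (\<exists>\<kappa>\<in>cmark (A y). R s (static (A y)) \<kappa> (static (A x)) \<kappa>')}" for u
      unfolding e using st by (simp add: spread_def)
    then show ?thesis unfolding y marks_def by auto
  qed
  show "marks A \<subseteq> marks (edge_op (spread b R) (x, y, s) A)" using m by auto
  show "marks (edge_op (spread b R) (x, y, s) A) \<subseteq> marks A \<union> {x, y} \<times> {..<b}" using m by auto
  show "marks (edge_op (spread b R) (x, y, s) A) \<subseteq> marks A \<union> label_step b R es A `` marks A"
  proof
    fix p assume p: "p \<in> marks (edge_op (spread b R) (x, y, s) A)"
    obtain u \<kappa>' where up: "p = (u, \<kappa>')" by fastforce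
    have xy: "((x, \<kappa>), (y, \<kappa>')) \<in> label_step b R es A" if "\<kappa>' < b" "R s (static (A x)) \<kappa> (static (A y)) \<kappa>'" for \<kappa>
      using that assms unfolding label_step_def by blast
    have yx: "((y, \<kappa>), (x, \<kappa>')) \<in> label_step b R es A" if "\<kappa>' < b" "R s (static (A y)) \<kappa> (static (A x)) \<kappa>'" for \<kappa>
      using that assms unfolding label_step_def by blast
    show "p \<in> marks A \<union> label_step b R es A `` marks A"
      using p[unfolded up m] xy yx unfolding up marks_def by blast
  qed
  assume eq: "marks (edge_op (spread b R) (x, y, s) A) = marks A"
  show "label_step b R [(x, y, s)] A `` marks A \<subseteq> marks A"
  proof
    fix p assume "p \<in> label_step b R [(x, y, s)] A `` marks A"
    then obtain q where q: "q \<in> marks A" "(q, p) \<in> label_step b R [(x, y, s)] A" by blast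
    obtain z \<kappa> where z: "q = (z, \<kappa>)" by fastforce
    obtain u \<kappa>' where u: "p = (u, \<kappa>')" by fastforce
    from q(2) obtain t where t: "(z, u, t) = (x, y, s) \<or> (u, z, t) = (x, y, s)" "\<kappa>' < b"
      "R t (static (A z)) \<kappa> (static (A u)) \<kappa>'" unfolding z u label_step_def by auto
    have "\<kappa> \<in> cmark (A z)" using q(1) by (simp add: z marks_def)
    then show "p \<in> marks A" using m[of u \<kappa>'] t unfolding eq u by auto
  qed
qed

definition pass :: "(sign \<Rightarrow> 'c \<Rightarrow> 'c \<Rightarrow> 'c) \<Rightarrow> (nat \<times> nat \<times> sign) list \<Rightarrow> (nat \<Rightarrow> 'c) \<Rightarrow> nat \<Rightarrow> 'c" where
  "pass f es A = fold (edge_op f) es A"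

lemma label_step_cong: "(\<And>u. rest (A u) = rest (B u)) \<Longrightarrow> label_step b R es A = label_step b R es B"
  using static_rest[of "A _" "B _"] by (simp add: label_step_def)

lemma pass_Cons: "pass f (e # es) A = pass f es (edge_op f e A)"
  by (simp add: pass_def)

lemma rest_pass: "rest (pass (spread b R) es A u) = rest (A u)"
  by (induction es arbitrary: A) (simp add: pass_def, simp add: pass_Cons rest_edge_op)

lemma label_step_edge_op: "label_step b R fs (edge_op (spread b R) e A) = label_step b R fs A"
  by (rule label_step_cong) (rule rest_edge_op)

lemma marks_pass_mono: "marks A \<subseteq> marks (pass (spread b R) es A)"
proof (induction es arbitrary: A)
  case (Cons e es)
  obtain x y s where e: "e = (x, y, s)" by (rule prod_cases3)
  show ?case using marks_edge_op(1)[where x = x and y = y and s = s and es = "[e]" and A = A and b = b and R = R] Cons.IH[of "edge_op (spread b R) e A"]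
    by (simp add: pass_Cons e)
qed (simp add: pass_def)

lemma marks_pass_reach:
  "set es \<subseteq> set fs \<Longrightarrow> marks (pass (spread b R) es A) \<subseteq> (label_step b R fs A)\<^sup>* `` marks A"
proof (induction es arbitrary: A)
  case (Cons e es)
  obtain x y s where e: "e = (x, y, s)" by (rule prod_cases3)
  let ?A = "edge_op (spread b R) e A" and ?r = "label_step b R fs A"
  have "marks ?A \<subseteq> marks A \<union> ?r `` marks A" using marks_edge_op(2)[where x = x and y = y and s = s and es = fs and A = A and b = b and R = R] Cons.prems by (simp add: e)
  then have "?r\<^sup>* `` marks ?A \<subseteq> ?r\<^sup>* `` (marks A \<union> ?r `` marks A)" by blast
  also have "\<dots> \<subseteq> ?r\<^sup>* `` marks A" by (auto intro: converse_rtrancl_into_rtrancl)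
  finally have "?r\<^sup>* `` marks ?A \<subseteq> ?r\<^sup>* `` marks A" .
  then show ?case using Cons.IH[of ?A] Cons.prems by (simp add: pass_Cons label_step_edge_op)
qed (auto simp: pass_def)

lemma marks_pass_bound:
  "(\<And>x y s. (x, y, s) \<in> set es \<Longrightarrow> x < n \<and> y < n) \<Longrightarrow>
    marks (pass (spread b R) es A) \<subseteq> marks A \<union> {..<n} \<times> {..<b}"
proof (induction es arbitrary: A)
  case (Cons e es)
  obtain x y s where e: "e = (x, y, s)" by (rule prod_cases3)
  have "x < n \<and> y < n" using Cons.prems[of x y s] e by simp
  then have "marks (edge_op (spread b R) e A) \<subseteq> marks A \<union> {..<n} \<times> {..<b}"
    using marks_edge_op(3)[where x = x and y = y and s = s and es = "[e]" and A = A and b = b and R = R]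
    unfolding e by force
  moreover have "marks (pass (spread b R) es (edge_op (spread b R) e A)) \<subseteq> marks (edge_op (spread b R) e A) \<union> {..<n} \<times> {..<b}"
    by (rule Cons.IH) (use Cons.prems in auto)
  ultimately show ?case unfolding pass_Cons by blast
qed (simp add: pass_def)

text \<open>Marks only grow during a pass, so an unchanged total means that no single edge changed
  anything.\<close>

lemma marks_pass_closed:
  "marks (pass (spread b R) es A) = marks A \<Longrightarrow> label_step b R es A `` marks A \<subseteq> marks A"
proof (induction es arbitrary: A)
  case Nil
  show ?case by (auto simp: label_step_def)
next
  case (Cons e es)
  obtain x y s where e: "e = (x, y, s)" by (rule prod_cases3)
  let ?A = "edge_op (spread b R) e A"
  have "marks A \<subseteq> marks ?A" using marks_edge_op(1)[where x = x and y = y and s = s and es = "[e]" and A = A and b = b and R = R] by (simp add: e)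
  then have eq: "marks ?A = marks A" using marks_pass_mono[of ?A b R es] Cons.prems unfolding pass_Cons by blast
  then have "label_step b R [e] A `` marks A \<subseteq> marks A" using marks_edge_op(4)[where x = x and y = y and s = s and es = "[e]" and A = A and b = b and R = R] by (simp add: e)
  moreover have "label_step b R es A `` marks A \<subseteq> marks A"
    using Cons.IH[of ?A] Cons.prems eq by (simp add: pass_Cons label_step_edge_op)
  moreover have "label_step b R (e # es) A \<subseteq> label_step b R [e] A \<union> label_step b R es A"
    unfolding label_step_def by (simp only: list.set insert_iff empty_iff) blast
  ultimately show ?case by blast
qed

text \<open>Every strict step adds an element of \<open>B\<close>, so \<open>N + 1\<close> strict
  steps are impossible; \<open>stay\<close> carries an earlier standstill on to
  \<open>N\<close>.\<close>

lemma iterate_fixpoint: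
  fixes X :: "nat \<Rightarrow> 'x set"
  assumes mono: "\<And>k. X k \<subseteq> X (Suc k)" and bound: "\<And>k. X k \<subseteq> X 0 \<union> B" and B: "finite B" "card B \<le> N"
    and stay: "\<And>k. X (Suc k) = X k \<Longrightarrow> X (Suc (Suc k)) = X (Suc k)"
  shows "X (Suc N) = X N"
proof (rule ccontr)
  assume ne: "X (Suc N) \<noteq> X N"
  have strict: "k \<le> N \<Longrightarrow> X (Suc k) \<noteq> X k" for k
  proof
    assume k: "k \<le> N" and eq: "X (Suc k) = X k"
    have "X (Suc (k + j)) = X (k + j)" for j
    proof (induction j)
      case (Suc j)
      then show ?case using stay[of "k + j"] by simp
    qed (simp add: eq)
    from this[of "N - k"] show False using k ne by simp
  qed
  have X0: "X 0 \<subseteq> X k" for k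
  proof (induction k)
    case (Suc k)
    then show ?case using mono[of k] by (rule subset_trans)
  qed simp
  have "k \<le> Suc N \<Longrightarrow> k \<le> card (X k - X 0)" for k
  proof (induction k)
    case (Suc k)
    have "X k - X 0 \<subset> X (Suc k) - X 0" using mono[of k] strict[of k] Suc.prems X0 by blast
    moreover have "finite (X (Suc k) - X 0)" using bound[of "Suc k"] B(1) by (auto intro: finite_subset[of _ B])
    ultimately have "card (X k - X 0) < card (X (Suc k) - X 0)" by (rule psubset_card_mono[rotated])
    then show ?case using Suc by simp
  qed simp
  then have "Suc N \<le> card (X (Suc N) - X 0)" by blast
  also have "\<dots> \<le> card B" using bound[of "Suc N"] B(1) by (intro card_mono) auto
  finally show False using B(2) by simp
qed

text \<open>At most \<open>n * b\<close> marks can be added, so after that many passes nothing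
  changes any more, and an unchanged set is closed under the step relation.\<close>

lemma marks_iterate:
  assumes es: "\<And>x y s. (x, y, s) \<in> set es \<Longrightarrow> x < n \<and> y < n" and N: "n * b \<le> N"
  shows "marks ((pass (spread b R) es ^^ N) A) = (label_step b R es A)\<^sup>* `` marks A"
    "rest ((pass (spread b R) es ^^ N) A u) = rest (A u)"
proof -
  let ?P = "pass (spread b R) es"
  have rest: "rest ((?P ^^ k) A u) = rest (A u)" for k u
    by (induction k) (simp_all add: rest_pass)
  have ls: "label_step b R es ((?P ^^ k) A) = label_step b R es A" for k
    by (rule label_step_cong) (rule rest)
  let ?X = "\<lambda>k. marks ((?P ^^ k) A)"
  have mono: "?X k \<subseteq> ?X (Suc k)" for k using marks_pass_mono by simp
  have bd: "?X k \<subseteq> ?X 0 \<union> {..<n} \<times> {..<b}" for k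
  proof (induction k)
    case (Suc k)
    have "?X (Suc k) \<subseteq> ?X k \<union> {..<n} \<times> {..<b}" using marks_pass_bound[OF es] by simp
    then show ?case using Suc by blast
  qed simp
  have stay: "?X (Suc (Suc k)) = ?X (Suc k)" if "?X (Suc k) = ?X k" for k
  proof -
    have "(?P ^^ Suc k) A u = (?P ^^ k) A u" for u
    proof (rule cell_eqI)
      show "rest ((?P ^^ Suc k) A u) = rest ((?P ^^ k) A u)" unfolding rest ..
      have "{\<kappa>. (u, \<kappa>) \<in> ?X (Suc k)} = {\<kappa>. (u, \<kappa>) \<in> ?X k}" unfolding that ..
      then show "cmark ((?P ^^ Suc k) A u) = cmark ((?P ^^ k) A u)" by (simp only: marks_def mem_Collect_eq prod.case Collect_mem_eq)
    qed
    then have "(?P ^^ Suc k) A = (?P ^^ k) A" by (rule ext)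
    then have "?P ((?P ^^ Suc k) A) = ?P ((?P ^^ k) A)" by (rule arg_cong)
    then show ?thesis by simp
  qed
  have fix': "?X (Suc N) = ?X N"
    by (rule iterate_fixpoint[where B = "{..<n} \<times> {..<b}"]) (use mono bd stay N in \<open>auto simp: card_cartesian_product\<close>)
  have "label_step b R es A `` ?X N \<subseteq> ?X N"
    using marks_pass_closed[of b R es "(?P ^^ N) A"] fix' ls[of N] by simp
  moreover have "?X 0 \<subseteq> ?X k" for k
  proof (induction k)
    case (Suc k)
    then show ?case using mono[of k] by (rule subset_trans)
  qed simp
  from this[of N] have "marks A \<subseteq> ?X N" by simp
  ultimately have "(label_step b R es A)\<^sup>* `` marks A \<subseteq> ?X N"
  proof -
    assume c: "label_step b R es A `` ?X N \<subseteq> ?X N" and i: "marks A \<subseteq> ?X N"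
    have "q \<in> ?X N" if "(p, q) \<in> (label_step b R es A)\<^sup>*" "p \<in> marks A" for p q
      using that(1)
    proof (induction rule: rtrancl_induct)
      case base
      then show ?case using that(2) i by blast
    next
      case (step y z)
      then show ?case using c by blast
    qed
    then show ?thesis by blast
  qed
  moreover have "?X k \<subseteq> (label_step b R es A)\<^sup>* `` marks A" for k
  proof (induction k)
    case (Suc k)
    have "?X (Suc k) \<subseteq> (label_step b R es A)\<^sup>* `` ?X k"
      using marks_pass_reach[of es es b R "(?P ^^ k) A"] ls[of k] by simp
    also have "\<dots> \<subseteq> (label_step b R es A)\<^sup>* `` (label_step b R es A)\<^sup>* `` marks A" using Suc by blast
    also have "\<dots> \<subseteq> (label_step b R es A)\<^sup>* `` marks A" by (auto intro: rtrancl_trans)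
    finally show ?case .
  qed auto
  ultimately show "marks ((?P ^^ N) A) = (label_step b R es A)\<^sup>* `` marks A" by blast
  show "rest ((?P ^^ N) A u) = rest (A u)" by (rule rest)
qed


section \<open>Programs over the vertices and edges of the input graph\<close>

text \<open>
  The register consists of the digit counter of the number scanner, a scratch area for edge scans and
  the remaining flags. The scratch area and the variables \<open>0\<close>, \<open>1\<close> and \<open>2\<close> carry no information between
  commands.
\<close>

datatype gphase = First | Source | Target | Sign | Bad

type_synonym ('c, 'o) greg = "nat \<times> (gphase \<times> 'c \<times> 'c) \<times> 'o"

definition looks :: "'o \<Rightarrow> (nat \<Rightarrow> 'c) \<Rightarrow> bool list \<Rightarrow> (('c, 'o) greg, 'c) mem \<Rightarrow> bool" where
  "looks o' A z s \<longleftrightarrow> fst (reg s) = 0 \<and> snd (snd (reg s)) = o' \<and> var s 0 = 0 \<and> arr s = A \<and> out s = z"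

definition set_phase :: "gphase \<Rightarrow> (('c, 'o) greg, 'c) com" where
  "set_phase p = Upd (\<lambda>(k, (_, t), o'). (k, (p, t), o'))"

definition num_sign :: "nat \<Rightarrow> sign" where
  "num_sign k = (if k = 0 then Pos else Neg)"

text \<open>Only one cell can be reached at a time, so contents travel through the scratch area. The
  cell of \<open>x\<close> is visited twice because its new content depends on the old content at
  \<open>y\<close>.\<close>

definition edge_body :: "(sign \<Rightarrow> 'c \<Rightarrow> 'c \<Rightarrow> 'c) \<Rightarrow> (('c, 'o) greg, 'c) com" where
  "edge_body f = Cond (\<lambda>(k, (p, t), o'). p = Source) (Mov 1 0 ;; set_phase Target)
     (Cond (\<lambda>(k, (p, t), o'). p = Target) (Mov 2 0 ;; set_phase Sign)
       (Cond (\<lambda>(k, (p, t), o'). p = Sign)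
         (At 1 (\<lambda>(k, (p, t1, t2), o') c. ((k, (p, c, t2), o'), c)) ;;
          At 2 (\<lambda>(k, (p, t1, t2), o') c. ((k, (p, t1, c), o'), f (num_sign k) t1 c)) ;;
          At 1 (\<lambda>(k, (p, t1, t2), o') c. ((k, (p, t1, t2), o'), f (num_sign k) t2 c)) ;;
          set_phase Source)
         (set_phase Source)))"

definition edge_pass :: "(sign \<Rightarrow> 'c \<Rightarrow> 'c \<Rightarrow> 'c) \<Rightarrow> (('c, 'o) greg, 'c) com" where
  "edge_pass f = (set_phase First ;; num_scan 2 (edge_body f))"

definition scan_mem :: "gphase \<Rightarrow> 'c \<times> 'c \<Rightarrow> 'o \<Rightarrow> nat \<times> nat \<Rightarrow> (nat \<Rightarrow> nat) \<Rightarrow> (nat \<Rightarrow> 'c) \<Rightarrow> bool list \<Rightarrow> (('c, 'o) greg, 'c) mem" where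
  "scan_mem p t o' xy v A z = \<lparr>reg = (0, (p, t), o'), var = v(0 := 0, 1 := fst xy, 2 := snd xy), arr = A, out = z\<rparr>"

lemma visit_first: "visit Q w 2 (edge_body f) k (scan_mem First t o' xy v A z) = scan_mem Source t o' xy v A z"
  by (cases t) (auto simp: visit_def at_num_def scan_mem_def edge_body_def set_phase_def fun_eq_iff)

lemma visit_source: "visit Q w 2 (edge_body f) k (scan_mem Source t o' (x, y) v A z) = scan_mem Target t o' (k, y) v A z"
  by (cases t) (auto simp: visit_def at_num_def scan_mem_def edge_body_def set_phase_def fun_eq_iff)

lemma visit_target: "visit Q w 2 (edge_body f) k (scan_mem Target t o' (x, y) v A z) = scan_mem Sign t o' (x, k) v A z"
  by (cases t) (auto simp: visit_def at_num_def scan_mem_def edge_body_def set_phase_def fun_eq_iff)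

lemma visit_sign: "visit Q w 2 (edge_body f) (sign_code s) (scan_mem Sign t o' (x, y) v A z) =
   scan_mem Source (A x, A y) o' (x, y) v (edge_op f (x, y, s) A) z"
proof -
  have "num_sign (min (sign_code s) 2) = s" by (cases s) (auto simp: num_sign_def)
  then show ?thesis
    by (cases t) (auto simp: visit_def at_num_def scan_mem_def edge_body_def set_phase_def edge_op_def Let_def fun_eq_iff)
qed

lemma fold_visit_edges:
  "\<exists>t' xy'. fold (visit Q w 2 (edge_body f)) (edge_nats es) (scan_mem Source t o' xy v A z) = scan_mem Source t' o' xy' v (pass f es A) z"
proof (induction es arbitrary: t xy A)
  case Nil
  show ?case unfolding edge_nats_simps fold_simps pass_def id_apply by blast
next
  case (Cons e es)
  obtain x y s where e: "e = (x, y, s)" by (rule prod_cases3)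
  obtain a b where xy: "xy = (a, b)" by (rule prod.exhaust)
  show ?case unfolding e xy edge_nats_simps fold_simps visit_source visit_target visit_sign pass_Cons by (rule Cons.IH)
qed

lemma looks_edge_pass:
  assumes w: "w = encode_nats (n # edge_nats es)" and s: "looks o' A z s"
  shows "looks o' (pass f es A) z (sem Q w (edge_pass f) s)"
proof -
  obtain k p t1 t2 o1 where r: "reg s = (k, (p, t1, t2), o1)" by (metis prod.exhaust)
  define t where "t = (t1, t2)"
  have k: "k = 0" "o1 = o'" using s by (auto simp: looks_def r)
  let ?s = "scan_mem First t o' (var s 1, var s 2) (var s) A z"
  have "sem Q w (set_phase First) s = ?s"
    using s k r by (cases s) (auto simp: set_phase_def scan_mem_def looks_def r t_def fun_eq_iff)
  moreover have "sem Q w (num_scan 2 (edge_body f)) ?s = at_num 2 0 (fold (visit Q w 2 (edge_body f)) (n # edge_nats es) ?s)"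
    by (rule sem_num_scan) (auto simp: w at_num_def scan_mem_def fun_eq_iff)
  moreover obtain t' xy' where "fold (visit Q w 2 (edge_body f)) (n # edge_nats es) ?s = scan_mem Source t' o' xy' (var s) (pass f es A) z"
    using fold_visit_edges[of Q w f es t o' "(var s 1, var s 2)" "var s" A z] unfolding fold_simps visit_first by blast
  ultimately have "sem Q w (edge_pass f) s = at_num 2 0 (scan_mem Source t' o' xy' (var s) (pass f es A) z)"
    by (simp add: edge_pass_def)
  then show ?thesis by (simp add: looks_def at_num_def scan_mem_def)
qed

definition at_cell :: "nat \<Rightarrow> ('o \<Rightarrow> 'c \<Rightarrow> 'o \<times> 'c) \<Rightarrow> (('c, 'o) greg, 'c) com" where
  "at_cell x g = At x (\<lambda>(k, t, o') c. ((k, t, fst (g o' c)), snd (g o' c)))"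

definition upd_flags :: "('o \<Rightarrow> 'o) \<Rightarrow> (('c, 'o) greg, 'c) com" where
  "upd_flags g = Upd (\<lambda>(k, t, o'). (k, t, g o'))"

definition if_flags :: "('o \<Rightarrow> bool) \<Rightarrow> (('c, 'o) greg, 'c) com \<Rightarrow> (('c, 'o) greg, 'c) com \<Rightarrow> (('c, 'o) greg, 'c) com" where
  "if_flags P = Cond (\<lambda>(k, t, o'). P o')"

lemma looks_at_cell:
  "looks o' A z s \<Longrightarrow> looks (fst (g o' (A (var s x)))) (A(var s x := snd (g o' (A (var s x))))) z (sem Q w (at_cell x g) s)"
  by (auto simp: looks_def at_cell_def split: prod.splits)

lemma looks_upd_flags: "looks o' A z s \<Longrightarrow> looks (g o') A z (sem Q w (upd_flags g) s)"
  by (auto simp: looks_def upd_flags_def split: prod.splits)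

lemma sem_if_flags: "looks o' A z s \<Longrightarrow> sem Q w (if_flags P a b) s = (if P o' then sem Q w a s else sem Q w b s)"
  by (auto simp: looks_def if_flags_def split: prod.splits)

lemma looks_emit_word: "looks o' A z s \<Longrightarrow> looks o' A (z @ u) (sem Q w (emit_word u) s)"
  by (simp add: looks_def sem_emit_word)

lemma looks_set_var: "x \<noteq> 0 \<Longrightarrow> looks o' A z (s\<lparr>var := (var s)(x := k)\<rparr>) = looks o' A z s"
  by (simp add: looks_def)

lemma looks_for:
  assumes x: "x \<noteq> 0" and s: "looks (O' 0) (A 0) (Z 0) s"
    and step: "\<And>k s. k \<le> length w \<Longrightarrow> looks (O' k) (A k) (Z k) s \<Longrightarrow> var s x = k \<Longrightarrow>
      looks (O' (Suc k)) (A (Suc k)) (Z (Suc k)) (sem Q w c s)"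
  shows "looks (O' (Suc (length w))) (A (Suc (length w))) (Z (Suc (length w))) (sem Q w (For x c) s)"
proof -
  let ?f = "\<lambda>k s. sem Q w c (s\<lparr>var := (var s)(x := k)\<rparr>)"
  have "looks (O' (Suc (length w))) (A (Suc (length w))) (Z (Suc (length w))) (fold ?f [0..<Suc (length w)] s)"
    by (rule fold_invariant_upt[where P = "\<lambda>k. looks (O' k) (A k) (Z k)"], rule s, rule step)
      (use x in \<open>auto simp: looks_set_var\<close>)
  then show ?thesis unfolding sem.simps using x by (simp add: looks_set_var)
qed

definition map_cells :: "('o \<Rightarrow> 'c \<Rightarrow> 'o) \<Rightarrow> ('c \<Rightarrow> 'c) \<Rightarrow> (('c, 'o) greg, 'c) com" where
  "map_cells h m = For 4 (at_cell 4 (\<lambda>o' c. (h o' c, m c)))"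

lemma looks_map_cells:
  assumes "looks o' A z s"
  shows "looks (fold (\<lambda>u o'. h o' (A u)) [0..<Suc (length w)] o') (\<lambda>u. if u \<le> length w then m (A u) else A u) z
    (sem Q w (map_cells h m) s)"
proof -
  let ?O = "\<lambda>k. fold (\<lambda>u o'. h o' (A u)) [0..<k] o'" and ?A = "\<lambda>k u. if u < k then m (A u) else A u"
  have "looks (?O (Suc (length w))) (?A (Suc (length w))) z (sem Q w (map_cells h m) s)"
    unfolding map_cells_def
  proof (rule looks_for[where Z = "\<lambda>_. z"])
    show "looks (?O 0) (?A 0) z s" using assms by simp
    fix k s assume k: "looks (?O k) (?A k) z s" "var s 4 = k"
    have "(?A k)(k := m (?A k k)) = ?A (Suc k)" by (auto simp: fun_eq_iff)
    then show "looks (?O (Suc k)) (?A (Suc k)) z (sem Q w (at_cell 4 (\<lambda>o' c. (h o' c, m c))) s)"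
      using looks_at_cell[OF k(1), of "\<lambda>o' c. (h o' c, m c)" 4 Q w] k(2) by simp
  qed simp
  then show ?thesis by (simp only: less_Suc_eq_le)
qed

text \<open>A single loop makes \<open>length w + 1\<close> passes, which is enough for one label
  per vertex; hence one loop for each of the \<open>b\<close> labels.\<close>

definition close :: "nat \<Rightarrow> label_rule \<Rightarrow> ((cell, 'o) greg, cell) com" where
  "close b R = seq_all (replicate b (For 5 (edge_pass (spread b R))))"

lemma looks_close:
  assumes w: "w = encode_nats (n # edge_nats es)" and s: "looks o' A z s"
  shows "looks o' ((pass (spread b R) es ^^ (b * Suc (length w))) A) z (sem Q w (close b R) s)"
proof -
  let ?P = "pass (spread b R) es"
  have one: "looks o' ((?P ^^ Suc (length w)) A) z (sem Q w (For 5 (edge_pass (spread b R))) s)" if "looks o' A z s" for A s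
  proof (rule looks_for[where O' = "\<lambda>_. o'" and A = "\<lambda>k. (?P ^^ k) A" and Z = "\<lambda>_. z"])
    show "looks o' ((?P ^^ 0) A) z s" using that by simp
    show "looks o' ((?P ^^ Suc k) A) z (sem Q w (edge_pass (spread b R)) s)" if "looks o' ((?P ^^ k) A) z s" for k s
      unfolding funpow.simps o_apply by (rule looks_edge_pass[OF w that])
  qed simp
  have "looks o' ((?P ^^ (k * Suc (length w))) A) z (fold (sem Q w) (replicate k (For 5 (edge_pass (spread b R)))) s)" for k
    using s
  proof (induction k arbitrary: A s)
    case (Suc k)
    have "(?P ^^ (k * Suc (length w))) ((?P ^^ Suc (length w)) A) = (?P ^^ (Suc k * Suc (length w))) A"
      by (metis add.commute funpow_add mult_Suc o_apply)
    then show ?case using Suc.IH[OF one[OF Suc.prems]] by simp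
  qed simp
  then show ?thesis unfolding close_def sem_seq_all .
qed

lemma assigned_edge_pass: "assigned (edge_pass f) = {0, 1, 2}"
  by (auto simp: edge_pass_def num_scan_def num_end_def edge_body_def set_phase_def)

lemma assigned_programs:
  "assigned (map_cells h m) = {4}" "assigned (close b R) \<subseteq> {0, 1, 2, 5}"
  "assigned (at_cell x g) = {}" "assigned (upd_flags g') = {}" "assigned (if_flags P a b') = assigned a \<union> assigned b'"
  by (auto simp: map_cells_def at_cell_def upd_flags_def if_flags_def close_def assigned_seq_all assigned_edge_pass)

definition gregs :: "'c set \<Rightarrow> 'o set \<Rightarrow> ('c, 'o) greg set" where
  "gregs \<Gamma> R = {..2} \<times> (UNIV \<times> \<Gamma> \<times> \<Gamma>) \<times> R"

lemma wf_edge_pass: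
  assumes "\<And>s c d. c \<in> \<Gamma> \<Longrightarrow> d \<in> \<Gamma> \<Longrightarrow> f s c d \<in> \<Gamma>" "3 \<le> nv"
  shows "wf_com nv (gregs \<Gamma> R) \<Gamma> (edge_pass f)"
proof -
  have "wf_com nv (gregs \<Gamma> R) \<Gamma> (edge_body f)"
    using assms by (auto simp: edge_body_def set_phase_def gregs_def)
  moreover have "\<not> scans_input (edge_body f)" by (simp add: edge_body_def set_phase_def)
  ultimately show ?thesis
    using wf_num_scan[of nv 2 "(UNIV \<times> \<Gamma> \<times> \<Gamma>) \<times> R" \<Gamma> "edge_body f"] assms(2)
    by (auto simp: edge_pass_def set_phase_def gregs_def)
qed

lemma wf_at_cell:
  "(\<And>o' c. o' \<in> R \<Longrightarrow> c \<in> \<Gamma> \<Longrightarrow> g o' c \<in> R \<times> \<Gamma>) \<Longrightarrow> x < nv \<Longrightarrow> wf_com nv (gregs \<Gamma> R) \<Gamma> (at_cell x g)"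
  by (fastforce simp: at_cell_def gregs_def mem_Times_iff)

lemma wf_upd_flags: "(\<And>o'. o' \<in> R \<Longrightarrow> g o' \<in> R) \<Longrightarrow> wf_com nv (gregs \<Gamma> R) \<Gamma> (upd_flags g)"
  by (auto simp: upd_flags_def gregs_def)

lemma wf_if_flags: "wf_com nv R \<Gamma> (if_flags P a b) \<longleftrightarrow> wf_com nv R \<Gamma> a \<and> wf_com nv R \<Gamma> b"
  by (simp add: if_flags_def)

lemma wf_map_cells:
  "(\<And>o' c. o' \<in> R \<Longrightarrow> c \<in> \<Gamma> \<Longrightarrow> h o' c \<in> R \<and> m c \<in> \<Gamma>) \<Longrightarrow> 4 < nv \<Longrightarrow> wf_com nv (gregs \<Gamma> R) \<Gamma> (map_cells h m)"
  unfolding map_cells_def by (auto simp: assigned_programs intro!: wf_at_cell)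

lemma wf_close:
  assumes "\<And>c d s. c \<in> \<Gamma> \<Longrightarrow> d \<in> \<Gamma> \<Longrightarrow> spread b R s c d \<in> \<Gamma>" "5 < nv"
  shows "wf_com nv (gregs \<Gamma> F) \<Gamma> (close b R)"
proof -
  have "wf_com nv (gregs \<Gamma> F) \<Gamma> (edge_pass (spread b R))" by (rule wf_edge_pass) (use assms in auto)
  then show ?thesis using assms(2) by (auto simp: close_def wf_seq_all assigned_edge_pass)
qed

section \<open>Reducing the homomorphism problem to the constraint problem\<close>

record flags =
  found :: bool
  okay :: bool
  good :: bool
  srch :: bool
  sel :: nat

type_synonym rev_com = "((cell, flags) greg, cell) com"

context template
begin

text \<open>Two more than the number of levels: 0 and \<open>height + 1\<close> mark walks that have
  left the ladder. The unknowns of a vertex fit into the same range.\<close>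

definition labels :: nat where
  "labels = height + 2"

definition num_vals :: nat where
  "num_vals = Suc (length pos)"

definition level_rule :: label_rule where
  "level_rule s c \<kappa> d \<kappa>' \<longleftrightarrow> 1 \<le> \<kappa> \<and> \<kappa> \<le> height \<and> \<kappa>' = next_level s \<kappa>"

text \<open>From the mark \<open>0\<close>, the flag \<open>1\<close> records a neighbour one level up, and the flag \<open>2\<close> a neighbour one level down.\<close>

definition flag_rule :: label_rule where
  "flag_rule s c \<kappa> d \<kappa>' \<longleftrightarrow> \<kappa> = 0 \<and>
     (\<kappa>' = 1 \<and> (\<exists>j\<in>fst d. Suc j \<in> fst c) \<or> \<kappa>' = 2 \<and> (\<exists>j\<in>fst c. Suc j \<in> fst d))"

definition value_rule :: label_rule where
  "value_rule s c \<kappa> d \<kappa>' \<longleftrightarrow> (\<exists>j\<in>fst c. \<exists>j'\<in>fst d.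
     same_value j (kind_of height j (1 \<in> snd c) (2 \<in> snd c)) \<kappa> j' (kind_of height j' (1 \<in> snd d) (2 \<in> snd d)) \<kappa>')"

definition emit_sel :: rev_com where
  "emit_sel = seq_all (map (\<lambda>k. if_flags (\<lambda>o'. k < sel o') (Emit True) (Upd id)) [0..<num_vals])"

text \<open>Prints \<open>x * num_vals + \<kappa>\<close> without multiplying: each cell before the
  first marked one contributes \<open>num_vals\<close> ones, the marked one its least mark, and
  later cells nothing.\<close>

definition pick :: "flags \<Rightarrow> cell \<Rightarrow> flags" where
  "pick o' c = (if srch o' then
       if cmark c = {} then o'\<lparr>sel := num_vals\<rparr> else o'\<lparr>srch := False, sel := Min (cmark c)\<rparr>
     else o'\<lparr>sel := 0\<rparr>)"

definition emit_code :: rev_com where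
  "emit_code = (For 4 (at_cell 4 (\<lambda>o' c. (pick o' c, c)) ;; emit_sel) ;; Emit False ;;
     upd_flags (\<lambda>o'. o'\<lparr>srch := True, sel := 0\<rparr>))"

definition emit_class :: "nat \<Rightarrow> rev_com" where
  "emit_class \<kappa> = (at_cell 6 (\<lambda>o' c. (o', c\<lparr>cmark := {\<kappa>}\<rparr>)) ;; close labels value_rule ;; emit_code ;;
     map_cells (\<lambda>o' c. o') (\<lambda>c. c\<lparr>cmark := {}\<rparr>))"

definition emit_tuple :: "nat \<times> nat \<Rightarrow> rev_com" where
  "emit_tuple \<sigma> = (emit_word (encode_nats [fst \<sigma>, snd \<sigma>]) ;;
     seq_all (map (\<lambda>p. emit_class (Suc (idx (\<sigma>, p)))) [0..<snd \<sigma>]))"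

definition emit_tuples :: rev_com where
  "emit_tuples = (at_cell 6 (\<lambda>o' c. (o'\<lparr>srch := cdom c\<rparr>, c)) ;;
     if_flags srch (seq_all (map emit_tuple syms)) (Upd id) ;; upd_flags (\<lambda>o'. o'\<lparr>srch := False\<rparr>))"

text \<open>The domain has a number for every pair of a cell and an unknown. Equality of unknowns is
  not a constraint of the query: a class always appears under one number, its code.\<close>

definition query :: rev_com where
  "query = (For 7 (emit_word (replicate num_vals True)) ;; Emit False ;; For 6 emit_tuples ;;
     Ask (\<lambda>(k, t, o') b. (k, t, o'\<lparr>found := found o' \<or> b\<rparr>)))"

definition single_level :: "nat set \<Rightarrow> bool" where
  "single_level J \<longleftrightarrow> J \<subseteq> {1..height} \<and> (\<forall>j\<in>J. \<forall>j'\<in>J. j = j')"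

text \<open>The order is dictated by the rules: the flags depend on the levels, and the values on
  both. At the end the cells are idle again, ready for the next attempt.\<close>

definition attempt :: "nat \<Rightarrow> rev_com" where
  "attempt i = (at_cell 3 (\<lambda>o' c. (o', c\<lparr>cmark := {i}\<rparr>)) ;; close labels level_rule ;;
     map_cells (\<lambda>o' c. o'\<lparr>good := good o' \<and> single_level (cmark c)\<rparr>) (\<lambda>c. c\<lparr>clev := cmark c, cmark := {0}\<rparr>) ;;
     close 3 flag_rule ;;
     map_cells (\<lambda>o' c. o') (\<lambda>c. c\<lparr>cflag := cmark c, cmark := {}\<rparr>) ;;
     if_flags good query (Upd id) ;;
     map_cells (\<lambda>o' c. o') (\<lambda>c. c\<lparr>clev := {}, cflag := {}, cmark := {}\<rparr>) ;;
     upd_flags (\<lambda>o'. o'\<lparr>good := True\<rparr>))"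

text \<open>\<open>found\<close> is the disjunction over the levels tried for one vertex and
  \<open>okay\<close> the conjunction over the vertices. \<open>srch\<close> carries the test for
  being a vertex from the cell into the register.\<close>

definition attempts :: rev_com where
  "attempts = (at_cell 3 (\<lambda>o' c. (o'\<lparr>srch := cdom c\<rparr>, c)) ;;
     if_flags srch (upd_flags (\<lambda>o'. o'\<lparr>srch := False\<rparr>) ;; seq_all (map attempt [1..<Suc height]) ;;
       upd_flags (\<lambda>o'. o'\<lparr>okay := okay o' \<and> found o', found := False\<rparr>)) (Upd id))"

end

section \<open>Propagation as reachability, and the query as an instance\<close>

context template_instance
begin

definition cells :: "(nat \<Rightarrow> nat set) \<Rightarrow> (nat \<Rightarrow> nat set) \<Rightarrow> (nat \<Rightarrow> nat set) \<Rightarrow> nat \<Rightarrow> cell" where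
  "cells L F M u = \<lparr>cdom = u < n, clev = L u, cflag = F u, cmark = M u\<rparr>"

definition rule_step :: "nat \<Rightarrow> label_rule \<Rightarrow> (nat \<Rightarrow> nat set) \<Rightarrow> (nat \<Rightarrow> nat set) \<Rightarrow> ((nat \<times> nat) \<times> nat \<times> nat) set" where
  "rule_step b R L F = {((x, \<kappa>), (y, \<kappa>')). \<exists>s. adj x y s \<and> \<kappa>' < b \<and> R s (L x, F x) \<kappa> (L y, F y) \<kappa>'}"

definition reach :: "((nat \<times> nat) \<times> nat \<times> nat) set \<Rightarrow> (nat \<Rightarrow> nat set) \<Rightarrow> nat \<Rightarrow> nat set" where
  "reach r M u = {\<kappa>. \<exists>x \<kappa>'. \<kappa>' \<in> M x \<and> ((x, \<kappa>'), (u, \<kappa>)) \<in> r\<^sup>*}"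

lemma reach_single: "reach r (\<lambda>x. if x = v then {i} else {}) u = {\<kappa>. ((v, i), (u, \<kappa>)) \<in> r\<^sup>*}"
proof -
  have "\<kappa>' \<in> (if x = v then {i} else {}) \<longleftrightarrow> x = v \<and> \<kappa>' = i" for x \<kappa>' by simp
  then show ?thesis unfolding reach_def by simp
qed

lemma rule_step_level: "rule_step labels level_rule L F = level_step"
proof -
  have "next_level s \<kappa> < labels" if "\<kappa> \<le> height" for s \<kappa>
    using that by (auto simp: next_level_def labels_def)
  then show ?thesis unfolding rule_step_def level_step_def level_rule_def by blast
qed

lemma same_value_less: "same_value j kd \<kappa> j' kd' \<kappa>' \<Longrightarrow> \<kappa>' < num_vals \<and> \<kappa> < num_vals"
  by (auto simp: same_value_def forced_def num_vals_def)

lemma rule_step_value: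
  assumes "\<And>u. 1 \<in> F u \<longleftrightarrow> has_up S u" "\<And>u. 2 \<in> F u \<longleftrightarrow> has_down S u"
  shows "rule_step labels value_rule S F = value_step S"
proof -
  have "\<kappa>' < labels" if "same_value j kd \<kappa> j' kd' \<kappa>'" for j kd \<kappa> j' kd' \<kappa>'
    using same_value_less[OF that] by (simp add: num_vals_def labels_def height_def)
  then show ?thesis
    unfolding rule_step_def value_step_def value_rule_def kind_in_def fst_conv snd_conv assms by blast
qed

text \<open>The rule leads from label 0 to other labels only, so reachability ends after one step.
  The mark 0 may also be present at numbers that are not vertices, as these have no edges.\<close>

lemma reach_flag:
  assumes "\<And>u. u < n \<Longrightarrow> M u = {0}" "\<And>u. M u \<subseteq> {0}"
  shows "1 \<in> reach (rule_step 3 flag_rule L F) M u \<longleftrightarrow> has_up L u"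
    "2 \<in> reach (rule_step 3 flag_rule L F) M u \<longleftrightarrow> has_down L u"
    "reach (rule_step 3 flag_rule L F) M u \<subseteq> M u \<union> {\<kappa>. u < n}"
proof -
  let ?r = "rule_step 3 flag_rule L F"
  have rs: "((x, \<kappa>), (y, \<kappa>')) \<in> ?r \<longleftrightarrow> (\<exists>s. adj x y s) \<and> \<kappa> = 0 \<and>
     (\<kappa>' = 1 \<and> (\<exists>j\<in>L y. Suc j \<in> L x) \<or> \<kappa>' = 2 \<and> (\<exists>j\<in>L x. Suc j \<in> L y))" for x y \<kappa> \<kappa>'
    unfolding rule_step_def flag_rule_def by auto
  have ends: "snd p = 0 \<and> snd q \<noteq> 0" if "(p, q) \<in> ?r" for p q
  proof -
    obtain x \<kappa> where p: "p = (x, \<kappa>)" by (rule prod.exhaust)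
    obtain y \<kappa>' where q: "q = (y, \<kappa>')" by (rule prod.exhaust)
    from that have "\<kappa> = 0" "\<kappa>' = 1 \<or> \<kappa>' = 2" unfolding p q rs by blast+
    then show ?thesis unfolding p q snd_conv by presburger
  qed
  have star: "(p, q) \<in> ?r\<^sup>* \<longleftrightarrow> q = p \<or> (p, q) \<in> ?r" for p q
  proof
    assume "(p, q) \<in> ?r\<^sup>*"
    then show "q = p \<or> (p, q) \<in> ?r"
      by (induction rule: rtrancl_induct) (use ends in blast)+
  next
    assume "q = p \<or> (p, q) \<in> ?r"
    then show "(p, q) \<in> ?r\<^sup>*" by (elim disjE) (simp_all only: rtrancl.rtrancl_refl r_into_rtrancl)
  qed
  have r: "\<kappa> \<in> reach ?r M u \<longleftrightarrow> (\<kappa> = 0 \<and> 0 \<in> M u) \<or> (\<exists>x. 0 \<in> M x \<and> ((x, 0), (u, \<kappa>)) \<in> ?r)" for \<kappa>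
  proof -
    have z: "\<kappa>' = 0" if "\<kappa>' \<in> M x" for x \<kappa>' using that assms(2)[of x] by auto
    have "\<kappa> \<in> reach ?r M u \<longleftrightarrow> (\<exists>x. 0 \<in> M x \<and> ((x, 0), (u, \<kappa>)) \<in> ?r\<^sup>*)"
    proof
      assume "\<kappa> \<in> reach ?r M u"
      then obtain x \<kappa>' where x: "\<kappa>' \<in> M x" "((x, \<kappa>'), (u, \<kappa>)) \<in> ?r\<^sup>*" unfolding reach_def by blast
      then show "\<exists>x. 0 \<in> M x \<and> ((x, 0), (u, \<kappa>)) \<in> ?r\<^sup>*" using z[OF x(1)] by (intro exI[of _ x]) simp
    qed (unfold reach_def mem_Collect_eq, blast)
    then show ?thesis unfolding star prod.inject by metis
  qed
  have dom: "0 \<in> M x \<and> x < n \<and> u < n" if "adj u x s" for x s using assms(1)[of x] adj_less[OF that] by simp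
  have sym: "(\<exists>s. adj x u s) \<longleftrightarrow> (\<exists>s. adj u x s)" for x using adj_sym[of u x] by blast
  show "1 \<in> reach ?r M u \<longleftrightarrow> has_up L u"
  proof -
    have "1 \<in> reach ?r M u \<longleftrightarrow> (\<exists>x. 0 \<in> M x \<and> (\<exists>s. adj x u s) \<and> (\<exists>j\<in>L u. Suc j \<in> L x))"
      unfolding r rs by simp
    then show ?thesis unfolding sym has_up_def using dom by blast
  qed
  show "2 \<in> reach ?r M u \<longleftrightarrow> has_down L u"
  proof -
    have "2 \<in> reach ?r M u \<longleftrightarrow> (\<exists>x. 0 \<in> M x \<and> (\<exists>s. adj x u s) \<and> (\<exists>j\<in>L x. Suc j \<in> L u))"
      unfolding r rs by simp
    then show ?thesis unfolding sym has_down_def using dom by blast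
  qed
  show "reach ?r M u \<subseteq> M u \<union> {\<kappa>. u < n}"
  proof
    fix \<kappa> assume "\<kappa> \<in> reach ?r M u"
    then consider "\<kappa> = 0" "0 \<in> M u" | x where "((x, 0), (u, \<kappa>)) \<in> ?r" unfolding r by blast
    then show "\<kappa> \<in> M u \<union> {\<kappa>. u < n}"
    proof cases
      case (2 x)
      then obtain s where "adj x u s" unfolding rs by blast
      then show ?thesis using adj_less by simp
    qed simp
  qed
qed

lemma levels_support: "v < n \<Longrightarrow> j \<in> levels v i u \<Longrightarrow> u < n"
  unfolding levels_def mem_Collect_eq
proof (erule rtranclE)
  fix q assume "(q, (u, j)) \<in> level_step"
  then show "u < n" using adj_less by (auto simp: level_step_def)
qed simp

lemma value_star_support: "u < n \<Longrightarrow> ((u, \<kappa>), (x, \<kappa>')) \<in> (value_step S)\<^sup>* \<Longrightarrow> \<kappa> < num_vals \<Longrightarrow> x < n \<and> \<kappa>' < num_vals"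
proof (erule rtranclE)
  fix q assume q: "(q, (x, \<kappa>')) \<in> value_step S"
  obtain y \<kappa>1 where "q = (y, \<kappa>1)" by fastforce
  then show "x < n \<and> \<kappa>' < num_vals" using q adj_less same_value_less unfolding value_step_def by blast
qed simp

text \<open>
  A class of equal values is represented by its member at the first vertex of the class, which is where
  a scan of the cells finds it.
\<close>

definition code_of :: "(nat \<Rightarrow> nat set) \<Rightarrow> nat" where
  "code_of M = (let x = LEAST x. M x \<noteq> {} in x * num_vals + Min (M x))"

definition value_class :: "(nat \<Rightarrow> nat set) \<Rightarrow> nat \<times> nat \<Rightarrow> nat \<Rightarrow> nat set" where
  "value_class S c x = {\<kappa>. (c, (x, \<kappa>)) \<in> (value_step S)\<^sup>*}"

definition code :: "(nat \<Rightarrow> nat set) \<Rightarrow> nat \<times> nat \<Rightarrow> nat" where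
  "code S c = code_of (value_class S c)"

definition query_tuple :: "(nat \<Rightarrow> nat set) \<Rightarrow> nat \<Rightarrow> nat \<times> nat \<Rightarrow> nat \<times> nat list" where
  "query_tuple S u \<sigma> = (fst \<sigma>, map (\<lambda>p. code S (u, Suc (idx (\<sigma>, p)))) [0..<snd \<sigma>])"

definition query_tuples :: "(nat \<Rightarrow> nat set) \<Rightarrow> nat \<Rightarrow> (nat \<times> nat list) list" where
  "query_tuples S k = concat (map (\<lambda>u. if u < n then map (query_tuple S u) syms else []) [0..<k])"

lemma finite_Min_class:
  assumes u: "u < n" "\<kappa> < num_vals" and x: "value_class S (u, \<kappa>) x \<noteq> {}"
  shows "x < n" "Min (value_class S (u, \<kappa>) x) \<in> value_class S (u, \<kappa>) x" "Min (value_class S (u, \<kappa>) x) < num_vals"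
proof -
  have sub: "value_class S (u, \<kappa>) x \<subseteq> {..<num_vals}"
    using value_star_support[OF u(1) _ u(2)] unfolding value_class_def by blast
  then have "finite (value_class S (u, \<kappa>) x)" by (rule finite_subset) simp
  then show M: "Min (value_class S (u, \<kappa>) x) \<in> value_class S (u, \<kappa>) x" using x by (rule Min_in)
  show "x < n" using value_star_support[OF u(1) _ u(2)] x unfolding value_class_def by blast
  show "Min (value_class S (u, \<kappa>) x) < num_vals" using M sub by blast
qed

lemma code_props:
  assumes u: "u < n" "\<kappa> < num_vals"
  shows "code S (u, \<kappa>) div num_vals < n"
    "((u, \<kappa>), (code S (u, \<kappa>) div num_vals, code S (u, \<kappa>) mod num_vals)) \<in> (value_step S)\<^sup>*"
proof -
  let ?M = "value_class S (u, \<kappa>)"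
  define x where "x = (LEAST x. ?M x \<noteq> {})"
  have "?M u \<noteq> {}" by (auto simp: value_class_def)
  then have x: "?M x \<noteq> {}" unfolding x_def by (rule LeastI)
  note m = finite_Min_class[OF u x]
  have c: "code S (u, \<kappa>) = x * num_vals + Min (?M x)" by (simp add: code_def code_of_def x_def Let_def)
  have "code S (u, \<kappa>) div num_vals = x" "code S (u, \<kappa>) mod num_vals = Min (?M x)" using m(3) by (simp_all add: c)
  then show "code S (u, \<kappa>) div num_vals < n"
    "((u, \<kappa>), (code S (u, \<kappa>) div num_vals, code S (u, \<kappa>) mod num_vals)) \<in> (value_step S)\<^sup>*"
    using m(1,2) by (simp_all add: value_class_def)
qed

lemma code_less:
  assumes "u < n" "\<kappa> < num_vals" "n \<le> N"
  shows "code S (u, \<kappa>) < num_vals * N"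
proof -
  have "code S (u, \<kappa>) div num_vals < N" using code_props(1)[OF assms(1,2), of S] assms(3) by simp
  moreover have "0 < num_vals" by (simp add: num_vals_def)
  ultimately show ?thesis by (simp add: div_less_iff_less_mult mult.commute)
qed

lemma code_cong: "(c, c') \<in> value_step S \<Longrightarrow> code S c = code S c'"
proof -
  assume cc: "(c, c') \<in> value_step S"
  then have c'c: "(c', c) \<in> value_step S" using sym_value_step by (meson symE)
  have "value_class S c = value_class S c'"
    unfolding value_class_def by (rule ext) (use cc c'c in \<open>blast intro: converse_rtrancl_into_rtrancl\<close>)
  then show ?thesis by (simp add: code_def)
qed

lemma set_query_tuples: "set (query_tuples S k) = {query_tuple S u \<sigma> | u \<sigma>. u < k \<and> u < n \<and> \<sigma> \<in> set syms}"
proof (intro set_eqI iffI)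
  fix x assume "x \<in> set (query_tuples S k)"
  then obtain u where u: "u < k" "x \<in> set (if u < n then map (query_tuple S u) syms else [])"
    unfolding query_tuples_def by auto
  then have "u < n" by (cases "u < n") auto
  with u have "x \<in> query_tuple S u ` set syms" by simp
  then show "x \<in> {query_tuple S u \<sigma> | u \<sigma>. u < k \<and> u < n \<and> \<sigma> \<in> set syms}" using u(1) \<open>u < n\<close> by blast
next
  fix x assume "x \<in> {query_tuple S u \<sigma> | u \<sigma>. u < k \<and> u < n \<and> \<sigma> \<in> set syms}"
  then obtain u \<sigma> where x: "x = query_tuple S u \<sigma>" and u: "u < k" "u < n" and \<sigma>: "\<sigma> \<in> set syms" by blast
  have "x \<in> set (if u < n then map (query_tuple S u) syms else [])" using u(2) \<sigma> by (simp add: x)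
  then show "x \<in> set (query_tuples S k)" unfolding query_tuples_def set_concat set_map set_upt using u(1) by force
qed

lemma idx_less: "\<sigma> \<in> set syms \<Longrightarrow> p < snd \<sigma> \<Longrightarrow> Suc (idx (\<sigma>, p)) < num_vals"
  using idx_in[of \<sigma> p] by (simp add: num_vals_def)

text \<open>From an assignment of the query, an unknown takes the value at its code, and unknowns
  joined by a step have the same code. Conversely a code decodes to a member of the class, on which
  a solution is constant.\<close>

lemma query_solution:
  assumes N: "n \<le> N" "0 < N"
  shows "(\<exists>h. h ` {..<num_vals * N} \<subseteq> univ T \<and> (\<forall>(r, t)\<in>set (query_tuples S N). map h t \<in> rel T (r, length t)))
     \<longleftrightarrow> (\<exists>val. solution S val)"
proof -
  have tuples: "(\<forall>(r, t)\<in>set (query_tuples S N). map h t \<in> rel T (r, length t)) \<longleftrightarrow>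
      (\<forall>u<n. \<forall>\<sigma>\<in>set syms. map (\<lambda>p. h (code S (u, Suc (idx (\<sigma>, p))))) [0..<snd \<sigma>] \<in> rel T \<sigma>)" for h :: "nat \<Rightarrow> 'a"
  proof -
    have "(\<forall>(r, t)\<in>set (query_tuples S N). map h t \<in> rel T (r, length t)) \<longleftrightarrow>
      (\<forall>u \<sigma>. u < N \<and> u < n \<and> \<sigma> \<in> set syms \<longrightarrow>
        map h (map (\<lambda>p. code S (u, Suc (idx (\<sigma>, p)))) [0..<snd \<sigma>]) \<in> rel T (fst \<sigma>, length (map (\<lambda>p. code S (u, Suc (idx (\<sigma>, p)))) [0..<snd \<sigma>])))"
      unfolding set_query_tuples query_tuple_def by blast
    also have "\<dots> \<longleftrightarrow> (\<forall>u<n. \<forall>\<sigma>\<in>set syms. map (\<lambda>p. h (code S (u, Suc (idx (\<sigma>, p))))) [0..<snd \<sigma>] \<in> rel T \<sigma>)"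
      unfolding length_map length_upt map_map o_def diff_zero prod.collapse using N(1) less_le_trans by blast
    finally show ?thesis .
  qed
  have pos: "0 < num_vals * N" using N(2) by (simp add: num_vals_def)
  show ?thesis
  proof
    assume "\<exists>h. h ` {..<num_vals * N} \<subseteq> univ T \<and> (\<forall>(r, t)\<in>set (query_tuples S N). map h t \<in> rel T (r, length t))"
    then obtain h where h: "h ` {..<num_vals * N} \<subseteq> univ T"
      "\<forall>u<n. \<forall>\<sigma>\<in>set syms. map (\<lambda>p. h (code S (u, Suc (idx (\<sigma>, p))))) [0..<snd \<sigma>] \<in> rel T \<sigma>"
      unfolding tuples by blast
    \<comment> \<open>\<open>val\<close> is total, but only unknowns of the instance are known to
      have a code in the domain. For the others 0 serves, an element because the domain is
      nonempty.\<close>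
    define val where "val c = h (if code S c < num_vals * N then code S c else 0)" for c
    have "solution S val"
      unfolding solution_def
    proof (intro conjI ballI allI impI)
      show "range val \<subseteq> univ T" using h(1) pos by (auto simp: val_def)
      show "case cc of (c, c') \<Rightarrow> val c = val c'" if "cc \<in> value_step S" for cc
      proof -
        obtain c c' where "cc = (c, c')" by (rule prod.exhaust)
        then show ?thesis using code_cong[of c c' S] that by (simp add: val_def)
      qed
      fix u \<sigma> assume u: "u < n" and \<sigma>: "\<sigma> \<in> set syms"
      have "entries val u \<sigma> = map (\<lambda>p. h (code S (u, Suc (idx (\<sigma>, p))))) [0..<snd \<sigma>]"
        unfolding entries_def
      proof (rule map_cong[OF refl])
        fix p assume "p \<in> set [0..<snd \<sigma>]"
        then have "Suc (idx (\<sigma>, p)) < num_vals" using idx_less[OF \<sigma>] by simp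
        from code_less[OF u this N(1), of S] show "val (u, Suc (idx (\<sigma>, p))) = h (code S (u, Suc (idx (\<sigma>, p))))"
          by (simp add: val_def)
      qed
      then show "entries val u \<sigma> \<in> rel T \<sigma>" using h(2) u \<sigma> by simp
    qed
    then show "\<exists>val. solution S val" by blast
  next
    assume "\<exists>val. solution S val"
    then obtain val where val: "solution S val" by blast
    define h where "h m = val (m div num_vals, m mod num_vals)" for m
    have star: "val c = val c'" if "(c, c') \<in> (value_step S)\<^sup>*" for c c'
      using that
    proof (induction rule: rtrancl_induct)
      case (step c1 c2)
      then show ?case using val unfolding solution_def by fastforce
    qed simp
    have "map (\<lambda>p. h (code S (u, Suc (idx (\<sigma>, p))))) [0..<snd \<sigma>] \<in> rel T \<sigma>" if u: "u < n" and \<sigma>: "\<sigma> \<in> set syms" for u \<sigma>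
    proof -
      have "map (\<lambda>p. h (code S (u, Suc (idx (\<sigma>, p))))) [0..<snd \<sigma>] = entries val u \<sigma>"
        unfolding entries_def
      proof (rule map_cong[OF refl])
        fix p assume "p \<in> set [0..<snd \<sigma>]"
        then have "Suc (idx (\<sigma>, p)) < num_vals" using idx_less[OF \<sigma>] by simp
        from star[OF code_props(2)[OF u this, of S]] show "h (code S (u, Suc (idx (\<sigma>, p)))) = val (u, Suc (idx (\<sigma>, p)))"
          by (simp add: h_def)
      qed
      then show ?thesis using val u \<sigma> unfolding solution_def by simp
    qed
    moreover have "h ` {..<num_vals * N} \<subseteq> univ T" using val by (auto simp: h_def solution_def)
    ultimately show "\<exists>h. h ` {..<num_vals * N} \<subseteq> univ T \<and> (\<forall>(r, t)\<in>set (query_tuples S N). map h t \<in> rel T (r, length t))"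
      unfolding tuples by blast
  qed
qed

lemma query_word:
  assumes N: "n \<le> N" "0 < N"
  shows "encode_nats (num_vals * N # tuple_nats (query_tuples S N)) \<in> CSP \<tau> T \<longleftrightarrow> (\<exists>val. solution S val)"
proof -
  let ?ts = "query_tuples S N"
  have ok: "\<forall>(r, t)\<in>set ?ts. (r, length t) \<in> \<tau> \<and> set t \<subseteq> {..<num_vals * N}"
  proof clarify
    fix r t assume "(r, t) \<in> set ?ts"
    then obtain u \<sigma> where *: "u < n" "\<sigma> \<in> set syms" "r = fst \<sigma>" "t = map (\<lambda>p. code S (u, Suc (idx (\<sigma>, p)))) [0..<snd \<sigma>]"
      unfolding set_query_tuples query_tuple_def by blast
    have "code S (u, Suc (idx (\<sigma>, p))) < num_vals * N" if "p < snd \<sigma>" for p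
      by (rule code_less[OF *(1) idx_less[OF *(2) that] N(1)])
    then have "set t \<subseteq> {..<num_vals * N}" unfolding *(4) by auto
    moreover have "(r, length t) = \<sigma>" using *(3,4) by simp
    ultimately show "(r, length t) \<in> \<tau> \<and> set t \<subseteq> {..<num_vals * N}" using *(2) set_syms by auto
  qed
  have "encode_nats (num_vals * N # tuple_nats ?ts) \<in> CSP \<tau> T \<longleftrightarrow>
    (\<exists>h. h ` {..<num_vals * N} \<subseteq> univ T \<and> (\<forall>(r, t)\<in>set ?ts. map h t \<in> rel T (r, length t)))"
    (is "?l \<longleftrightarrow> ?r")
  proof
    assume ?l
    then have "encode_nats (num_vals * N # tuple_nats ?ts) @ replicate 0 True \<in> CSP \<tau> T" by simp
    then obtain n' ts' where *: "num_vals * N # tuple_nats ?ts = n' # tuple_nats ts'"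
      "\<exists>h. h ` {..<n'} \<subseteq> univ T \<and> (\<forall>(r, t)\<in>set ts'. map h t \<in> rel T (r, length t))"
      unfolding CSP_word by blast
    then show ?r using tuple_nats_inj by auto
  next
    assume ?r
    then have "encode_nats (num_vals * N # tuple_nats ?ts) @ replicate 0 True \<in> CSP \<tau> T"
      unfolding CSP_word using ok by blast
    then show ?l by simp
  qed
  then show ?thesis using query_solution[OF N] by simp
qed

end

section \<open>Execution of the queries and of the attempts\<close>

lemma fold_skip: "fold (\<lambda>u o'. o') xs o' = o'"
  by (induction xs) auto

lemma fold_good: "fold (\<lambda>u o'. o'\<lparr>good := good o' \<and> P u\<rparr>) xs o' = o'\<lparr>good := good o' \<and> (\<forall>u\<in>set xs. P u)\<rparr>"
  by (induction xs arbitrary: o') auto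

lemma looks_emit: "looks o' A z s \<Longrightarrow> looks o' A (z @ [b]) (sem Q w (Emit b) s)"
  by (simp add: looks_def)

lemma looks_seq_map:
  assumes "\<And>x s z. x \<in> set xs \<Longrightarrow> looks o' A z s \<Longrightarrow> var s v = u \<Longrightarrow> looks o' A (z @ g x) (sem Q w (c x) s)"
    and "\<And>x. v \<notin> assigned (c x)" and "looks o' A z s" "var s v = u"
  shows "looks o' A (z @ concat (map g xs)) (sem Q w (seq_all (map c xs)) s)"
  using assms
proof (induction xs arbitrary: z s)
  case (Cons x xs)
  have v: "var (sem Q w (c x) s) v = u" using sem_unassigned[OF Cons.prems(2)] Cons.prems(4) by simp
  have l: "looks o' A (z @ g x) (sem Q w (c x) s)" using Cons.prems by simp
  show ?case using Cons.IH[OF _ Cons.prems(2) l v] Cons.prems(1) by (simp add: sem_seq_all)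
qed (simp add: sem_seq_all)

lemma encode_concat: "concat (map (\<lambda>p. encode_nats [f p]) ps) = encode_nats (map f ps)"
  by (induction ps) (simp_all add: encode_nats_simps)

lemma encode_tuples: "concat (map (\<lambda>x. encode_nats (tuple_nats [f x])) xs) = encode_nats (tuple_nats (map f xs))"
proof (induction xs)
  case (Cons x xs)
  have "tuple_nats (map f (x # xs)) = tuple_nats [f x] @ tuple_nats (map f xs)" by (simp add: tuple_nats_def)
  then show ?case using Cons by (simp add: encode_nats_simps)
qed (simp add: tuple_nats_simps encode_nats_simps)

context template
begin

lemma assigned_emit: "assigned (emit_class \<kappa>) \<subseteq> {0, 1, 2, 4, 5}" "assigned (emit_tuple \<sigma>) \<subseteq> {0, 1, 2, 4, 5}"
  "assigned emit_tuples \<subseteq> {0, 1, 2, 4, 5}"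
proof -
  have "assigned emit_sel = {}" by (auto simp: emit_sel_def assigned_seq_all assigned_programs)
  then show c: "assigned (emit_class \<kappa>) \<subseteq> {0, 1, 2, 4, 5}" for \<kappa>
    using assigned_programs(2)[of labels value_rule]
    by (auto simp: emit_class_def emit_code_def assigned_programs)
  then show t: "assigned (emit_tuple \<sigma>) \<subseteq> {0, 1, 2, 4, 5}" for \<sigma>
    by (fastforce simp: emit_tuple_def assigned_seq_all emit_word_props)
  then show "assigned emit_tuples \<subseteq> {0, 1, 2, 4, 5}"
    by (fastforce simp: emit_tuples_def assigned_programs assigned_seq_all)
qed

lemma not_assigned_emit: "6 \<notin> assigned (emit_class \<kappa>)" "6 \<notin> assigned (emit_tuple \<sigma>)"
  using assigned_emit(1)[of \<kappa>] assigned_emit(2)[of \<sigma>] by auto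

lemma assigned_attempt: "assigned (attempt i) \<subseteq> {0, 1, 2, 4, 5, 6, 7}"
  using assigned_emit(3) assigned_programs(2)[of labels level_rule] assigned_programs(2)[of 3 flag_rule]
  unfolding attempt_def query_def by (auto simp: assigned_programs emit_word_props)

end

context template_instance
begin

context
  fixes Q :: language and w :: "bool list"
  assumes w: "w = encode_nats (n # edge_nats es)"
begin

lemma n_le: "n \<le> length w"
  using encode_nats_length(2)[of n "n # edge_nats es"] by (simp add: w)

lemma looks_close_cells:
  assumes "looks o' (cells L F M) z s"
  shows "looks o' (cells L F (reach (rule_step b R L F) M)) z (sem Q w (close b R) s)"
proof -
  let ?A = "(pass (spread b R) es ^^ (b * Suc (length w))) (cells L F M)"
  have N: "n * b \<le> b * Suc (length w)" unfolding mult.commute[of n b] using n_le by (intro mult_le_mono2) simp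
  have st: "label_step b R es (cells L F M) = rule_step b R L F"
    by (simp add: label_step_def rule_step_def adj_def static_def cells_def)
  have "?A u = cells L F (reach (rule_step b R L F) M) u" for u
  proof (rule cell_eqI)
    show "rest (?A u) = rest (cells L F (reach (rule_step b R L F) M) u)"
      using marks_iterate(2)[OF es_less N, where R = R and A = "cells L F M" and u = u] by (simp add: rest_def cells_def)
    have "cmark (?A u) = {\<kappa>. (u, \<kappa>) \<in> marks ?A}" by (simp add: marks_def)
    also have "marks ?A = (rule_step b R L F)\<^sup>* `` marks (cells L F M)"
      using marks_iterate(1)[OF es_less N, where R = R and A = "cells L F M"] by (simp only: st)
    also have "{\<kappa>. (u, \<kappa>) \<in> (rule_step b R L F)\<^sup>* `` marks (cells L F M)} = reach (rule_step b R L F) M u"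
      by (auto simp: reach_def marks_def cells_def)
    also have "\<dots> = cmark (cells L F (reach (rule_step b R L F) M) u)" by (simp add: cells_def)
    finally show "cmark (?A u) = cmark (cells L F (reach (rule_step b R L F) M) u)" .
  qed
  then have "?A = cells L F (reach (rule_step b R L F) M)" by (rule ext)
  then show ?thesis using looks_close[OF w assms, where b = b and R = R and Q = Q] by simp
qed

lemma looks_map_to:
  assumes "looks o' (cells L F M) z s"
    and "\<And>u. u \<le> length w \<Longrightarrow> m (cells L F M u) = cells L' F' M' u"
    and "\<And>u. length w < u \<Longrightarrow> cells L F M u = cells L' F' M' u"
  shows "looks (fold (\<lambda>u o'. h o' (cells L F M u)) [0..<Suc (length w)] o') (cells L' F' M') z (sem Q w (map_cells h m) s)"
proof -
  have "(\<lambda>u. if u \<le> length w then m (cells L F M u) else cells L F M u) = cells L' F' M'"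
    by (rule ext) (use assms(2,3) in auto)
  then show ?thesis using looks_map_cells[OF assms(1), where w = w and h = h and m = m and Q = Q] by simp
qed

lemma looks_emit_sel:
  assumes "looks o' A z s" "sel o' \<le> num_vals"
  shows "looks o' A (z @ replicate (sel o') True) (sem Q w emit_sel s)"
proof -
  define c :: "nat \<Rightarrow> rev_com" where "c k = if_flags (\<lambda>o'. k < sel o') (Emit True) (Upd id)" for k
  have "looks o' A (z @ replicate (min m (sel o')) True)
    (fold (sem Q w) (map c [0..<m]) s)" for m
  proof (induction m)
    case 0
    then show ?case using assms(1) by simp
  next
    case (Suc m)
    let ?s = "fold (sem Q w) (map c [0..<m]) s"
    have "looks o' A (z @ replicate (min (Suc m) (sel o')) True) (sem Q w (c m) ?s)"
    proof (cases "m < sel o'")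
      case True
      then have "min (Suc m) (sel o') = Suc (min m (sel o'))" by simp
      then have eq: "z @ replicate (min (Suc m) (sel o')) True = (z @ replicate (min m (sel o')) True) @ [True]"
        by (simp add: replicate_append_same)
      show ?thesis unfolding eq c_def[of m] sem_if_flags[OF Suc] if_P[OF True] by (rule looks_emit[OF Suc])
    next
      case False
      then have eq: "min (Suc m) (sel o') = min m (sel o')" by simp
      have skip: "sem Q w (Upd id) ?s = ?s" by simp
      show ?thesis unfolding eq c_def[of m] sem_if_flags[OF Suc] if_not_P[OF False] skip by (rule Suc)
    qed
    then show ?case by simp
  qed
  from this[of num_vals] show ?thesis using assms(2) unfolding emit_sel_def sem_seq_all c_def[abs_def] by (simp add: min_absorb2)
qed

lemma looks_emit_code:
  assumes s: "looks o' (cells L F M) z s" and o': "srch o'" "sel o' = 0"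
    and M: "M x \<noteq> {}" "x \<le> length w" "Min (M (LEAST x. M x \<noteq> {})) < num_vals"
  shows "looks o' (cells L F M) (z @ encode_nats [code_of M]) (sem Q w emit_code s)"
proof -
  define x0 where "x0 = (LEAST x. M x \<noteq> {})"
  have x0: "M x0 \<noteq> {}" unfolding x0_def by (rule LeastI, rule M(1))
  have "x0 \<le> x" unfolding x0_def by (rule Least_le, rule M(1))
  then have le: "x0 \<le> length w" using M(2) by simp
  have before: "M k = {}" if "k < x0" for k using not_less_Least[of k "\<lambda>x. M x \<noteq> {}"] that unfolding x0_def by blast
  define c where "c = Min (M x0)"
  have c: "c < num_vals" using M(3) by (simp add: c_def x0_def)
  \<comment> \<open>The flags after \<open>k\<close> cells; together with the output
    \<open>Z k\<close> they distinguish the cells before, at and after the first marked one.\<close>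
  define O1 where "O1 k = (if k = 0 then o' else if k \<le> x0 then o'\<lparr>sel := num_vals\<rparr>
     else if k = Suc x0 then o'\<lparr>srch := False, sel := c\<rparr> else o'\<lparr>srch := False, sel := 0\<rparr>)" for k
  define Z where "Z k = z @ replicate (if k \<le> x0 then k * num_vals else x0 * num_vals + c) True" for k
  let ?A = "cells L F M"
  have pk: "pick (O1 k) (?A k) = O1 (Suc k)" for k
  proof -
    consider "k < x0" | "k = x0" | "x0 < k" by linarith
    then show ?thesis
    proof cases
      case 1
      then show ?thesis using before o' by (auto simp: pick_def O1_def cells_def)
    next
      case 2
      then show ?thesis using x0 o' by (cases k) (auto simp: pick_def O1_def cells_def c_def)
    next
      case 3
      then show ?thesis by (auto simp: pick_def O1_def)
    qed
  qed
  have zk: "Z (Suc k) = Z k @ replicate (sel (O1 (Suc k))) True" "sel (O1 (Suc k)) \<le> num_vals" for k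
    using c by (auto simp: Z_def O1_def replicate_add[symmetric] add.commute)
  have "looks (O1 (Suc (length w))) ?A (Z (Suc (length w))) (sem Q w (For 4 (at_cell 4 (\<lambda>o' c. (pick o' c, c)) ;; emit_sel)) s)"
  proof (rule looks_for[where O' = O1 and A = "\<lambda>_. ?A" and Z = Z])
    show "looks (O1 0) ?A (Z 0) s" using s by (simp add: O1_def Z_def)
    fix k s assume k: "looks (O1 k) ?A (Z k) s" "var s 4 = k"
    have "looks (O1 (Suc k)) ?A (Z k) (sem Q w (at_cell 4 (\<lambda>o' c. (pick o' c, c))) s)"
      using looks_at_cell[OF k(1), of "\<lambda>o' c. (pick o' c, c)" 4 Q w] k(2) pk[of k] by simp
    from looks_emit_sel[OF this zk(2)]
    show "looks (O1 (Suc k)) ?A (Z (Suc k)) (sem Q w (at_cell 4 (\<lambda>o' c. (pick o' c, c)) ;; emit_sel) s)"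
      by (simp add: zk(1))
  qed simp
  moreover have "Z (Suc (length w)) @ [False] = z @ encode_nats [code_of M]"
    using le by (simp add: Z_def code_of_def x0_def c_def Let_def encode_nats_simps)
  ultimately have "looks (O1 (Suc (length w))) ?A (z @ encode_nats [code_of M])
      (sem Q w (Emit False) (sem Q w (For 4 (at_cell 4 (\<lambda>o' c. (pick o' c, c)) ;; emit_sel)) s))"
    by (simp add: looks_def)
  from looks_upd_flags[OF this, of "\<lambda>o'. o'\<lparr>srch := True, sel := 0\<rparr>" Q w]
  show ?thesis using le o' unfolding emit_code_def sem.simps O1_def by (cases o') (auto split: if_splits)
qed

lemma looks_emit_class:
  assumes s: "looks o' (cells S F (\<lambda>_. {})) z s" and o': "srch o'" "sel o' = 0"
    and u: "var s 6 = u" "u < n" "\<kappa> < num_vals"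
    and F: "\<And>u. 1 \<in> F u \<longleftrightarrow> has_up S u" "\<And>u. 2 \<in> F u \<longleftrightarrow> has_down S u"
  shows "looks o' (cells S F (\<lambda>_. {})) (z @ encode_nats [code S (u, \<kappa>)]) (sem Q w (emit_class \<kappa>) s)"
proof -
  let ?I = "\<lambda>x. if x = u then {\<kappa>} else {}" and ?M = "value_class S (u, \<kappa>)"
  let ?g = "\<lambda>(o' :: flags) (c :: cell). (o', c\<lparr>cmark := {\<kappa>}\<rparr>)"
  have c0: "(cells S F (\<lambda>_. {}))(u := (cells S F (\<lambda>_. {}) u)\<lparr>cmark := {\<kappa>}\<rparr>) = cells S F ?I"
    by (auto simp: cells_def fun_eq_iff)
  have 1: "looks o' (cells S F ?I) z (sem Q w (at_cell 6 ?g) s)"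
    using looks_at_cell[OF s, of ?g 6 Q w] unfolding u(1) fst_conv snd_conv c0 .
  have M: "reach (rule_step labels value_rule S F) ?I = ?M"
  proof (rule ext)
    show "reach (rule_step labels value_rule S F) ?I x = ?M x" for x
      unfolding rule_step_value[of F S, OF F] value_class_def by (rule reach_single)
  qed
  have 2: "looks o' (cells S F ?M) z (sem Q w (close labels value_rule) (sem Q w (at_cell 6 ?g) s))"
    using looks_close_cells[OF 1, of labels value_rule] unfolding M .
  have Mu: "?M u \<noteq> {}" by (auto simp: value_class_def)
  have "?M (LEAST x. ?M x \<noteq> {}) \<noteq> {}" by (rule LeastI, rule Mu)
  from looks_emit_code[OF 2 o' Mu _ finite_Min_class(3)[OF u(2,3) this]] u(2) n_le
  have 3: "looks o' (cells S F ?M) (z @ encode_nats [code S (u, \<kappa>)])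
     (sem Q w emit_code (sem Q w (close labels value_rule) (sem Q w (at_cell 6 ?g) s)))"
    by (simp add: code_def)
  \<comment> \<open>The clearing pass ends at cell \<open>length w\<close>; the cells beyond carry
    no marks of the class.\<close>
  have "?M x = {}" if "length w < x" for x
  proof (rule ccontr)
    assume "?M x \<noteq> {}"
    then have "x < n" by (rule finite_Min_class(1)[OF u(2,3)])
    then show False using that n_le by simp
  qed
  then have "looks (fold (\<lambda>u o'. o') [0..<Suc (length w)] o') (cells S F (\<lambda>_. {})) (z @ encode_nats [code S (u, \<kappa>)])
     (sem Q w (map_cells (\<lambda>o' c. o') (\<lambda>c. c\<lparr>cmark := {}\<rparr>))
       (sem Q w emit_code (sem Q w (close labels value_rule) (sem Q w (at_cell 6 ?g) s))))"
    by (intro looks_map_to[OF 3]) (simp_all add: cells_def)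
  then show ?thesis unfolding fold_skip emit_class_def sem.simps .
qed

lemma looks_emit_tuple:
  assumes s: "looks o' (cells S F (\<lambda>_. {})) z s" and o': "srch o'" "sel o' = 0"
    and u: "var s 6 = u" "u < n" and \<sigma>: "\<sigma> \<in> set syms"
    and F: "\<And>u. 1 \<in> F u \<longleftrightarrow> has_up S u" "\<And>u. 2 \<in> F u \<longleftrightarrow> has_down S u"
  shows "looks o' (cells S F (\<lambda>_. {})) (z @ encode_nats (tuple_nats [query_tuple S u \<sigma>])) (sem Q w (emit_tuple \<sigma>) s)"
proof -
  let ?A = "cells S F (\<lambda>_. {})" and ?s = "sem Q w (emit_word (encode_nats [fst \<sigma>, snd \<sigma>])) s"
  have s1: "looks o' ?A (z @ encode_nats [fst \<sigma>, snd \<sigma>]) ?s" by (rule looks_emit_word[OF s])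
  have v: "var ?s 6 = u" using u(1) by (simp add: sem_emit_word)
  have "looks o' ?A ((z @ encode_nats [fst \<sigma>, snd \<sigma>]) @ concat (map (\<lambda>p. encode_nats [code S (u, Suc (idx (\<sigma>, p)))]) [0..<snd \<sigma>]))
     (sem Q w (seq_all (map (\<lambda>p. emit_class (Suc (idx (\<sigma>, p)))) [0..<snd \<sigma>])) ?s)"
  proof (rule looks_seq_map[where v = 6 and u = u])
    fix p s z assume p: "p \<in> set [0..<snd \<sigma>]" and s: "looks o' ?A z s" "var s 6 = u"
    have "Suc (idx (\<sigma>, p)) < num_vals" using idx_less[OF \<sigma>] p by simp
    then show "looks o' ?A (z @ encode_nats [code S (u, Suc (idx (\<sigma>, p)))]) (sem Q w (emit_class (Suc (idx (\<sigma>, p)))) s)"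
      by (rule looks_emit_class[OF s(1) o' s(2) u(2) _ F])
  qed (use s1 v not_assigned_emit in auto)
  moreover have "encode_nats [fst \<sigma>, snd \<sigma>] @ encode_nats (map (\<lambda>p. code S (u, Suc (idx (\<sigma>, p)))) [0..<snd \<sigma>]) =
      encode_nats (tuple_nats [query_tuple S u \<sigma>])"
    by (simp add: query_tuple_def tuple_nats_simps encode_nats_simps)
  ultimately show ?thesis unfolding emit_tuple_def sem.simps encode_concat by simp
qed

lemma looks_emit_tuples:
  assumes s: "looks o' (cells S F (\<lambda>_. {})) z s" and o': "\<not> srch o'" "sel o' = 0" and k: "var s 6 = k"
    and F: "\<And>u. 1 \<in> F u \<longleftrightarrow> has_up S u" "\<And>u. 2 \<in> F u \<longleftrightarrow> has_down S u"
  shows "looks o' (cells S F (\<lambda>_. {})) (z @ encode_nats (tuple_nats (if k < n then map (query_tuple S k) syms else [])))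
    (sem Q w emit_tuples s)"
proof -
  let ?A = "cells S F (\<lambda>_. {})" and ?g = "\<lambda>(o' :: flags) (c :: cell). (o'\<lparr>srch := cdom c\<rparr>, c)"
  let ?s = "sem Q w (at_cell 6 ?g) s" and ?o = "o'\<lparr>srch := k < n\<rparr>"
  have "cdom (?A k) = (k < n)" by (simp add: cells_def)
  then have s1: "looks ?o ?A z ?s" using looks_at_cell[OF s, of ?g 6 Q w] k by simp
  have v: "var ?s 6 = k" using sem_unassigned[of 6 "at_cell 6 ?g"] k by (simp add: assigned_programs)
  let ?z = "z @ encode_nats (tuple_nats (if k < n then map (query_tuple S k) syms else []))"
  let ?s2 = "sem Q w (if_flags srch (seq_all (map emit_tuple syms)) (Upd id)) ?s"
  have "looks ?o ?A ?z ?s2"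
  proof (cases "k < n")
    case True
    have "looks ?o ?A (z @ concat (map (\<lambda>\<sigma>. encode_nats (tuple_nats [query_tuple S k \<sigma>])) syms)) (sem Q w (seq_all (map emit_tuple syms)) ?s)"
    proof (rule looks_seq_map[where v = 6 and u = k])
      fix \<sigma> s z assume \<sigma>: "\<sigma> \<in> set syms" and s: "looks ?o ?A z s" "var s 6 = k"
      show "looks ?o ?A (z @ encode_nats (tuple_nats [query_tuple S k \<sigma>])) (sem Q w (emit_tuple \<sigma>) s)"
        by (rule looks_emit_tuple[OF s(1) _ _ s(2) True \<sigma> F]) (use True o' in auto)
    qed (use s1 v not_assigned_emit in auto)
    then show ?thesis using True unfolding sem_if_flags[OF s1] encode_tuples by simp
  next
    case False
    then show ?thesis using s1 unfolding sem_if_flags[OF s1] by (simp add: tuple_nats_simps encode_nats_simps)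
  qed
  from looks_upd_flags[OF this, of "\<lambda>o'. o'\<lparr>srch := False\<rparr>" Q w]
  show ?thesis unfolding emit_tuples_def sem.simps using o'(1) by (cases o') simp
qed

lemma looks_query:
  assumes s: "looks o' (cells S F (\<lambda>_. {})) [] s" and o': "\<not> srch o'" "sel o' = 0"
    and F: "\<And>u. 1 \<in> F u \<longleftrightarrow> has_up S u" "\<And>u. 2 \<in> F u \<longleftrightarrow> has_down S u"
  shows "looks (o'\<lparr>found := found o' \<or> encode_nats (num_vals * Suc (length w) # tuple_nats (query_tuples S (Suc (length w)))) \<in> Q\<rparr>)
    (cells S F (\<lambda>_. {})) [] (sem Q w query s)"
proof -
  let ?A = "cells S F (\<lambda>_. {})" and ?N = "Suc (length w)"
  let ?s = "sem Q w (Emit False) (sem Q w (For 7 (emit_word (replicate num_vals True))) s)"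
  have c: "concat (replicate N (replicate num_vals True)) = replicate (num_vals * N) True" for N
    by (induction N) (simp_all add: replicate_add)
  have "?s = s\<lparr>var := (var s)(7 := 0), out := out s @ encode_nats [num_vals * ?N]\<rparr>"
    unfolding sem_fill c by (simp add: encode_nats_simps)
  then have s1: "looks o' ?A (encode_nats [num_vals * ?N]) ?s" using s by (simp add: looks_def)
  let ?Z = "\<lambda>k. encode_nats (num_vals * ?N # tuple_nats (query_tuples S k))"
  have "looks o' ?A (?Z ?N) (sem Q w (For 6 emit_tuples) ?s)"
  proof (rule looks_for[where O' = "\<lambda>_. o'" and A = "\<lambda>_. ?A" and Z = ?Z])
    show "looks o' ?A (?Z 0) ?s" using s1 by (simp add: query_tuples_def tuple_nats_simps)
    fix k s assume k: "looks o' ?A (?Z k) s" "var s 6 = k"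
    have "?Z (Suc k) = ?Z k @ encode_nats (tuple_nats (if k < n then map (query_tuple S k) syms else []))"
      by (simp add: query_tuples_def tuple_nats_def encode_nats_simps)
    then show "looks o' ?A (?Z (Suc k)) (sem Q w emit_tuples s)" using looks_emit_tuples[OF k(1) o' k(2) F] by simp
  qed simp
  then show ?thesis unfolding query_def sem.simps(9) by (auto simp: looks_def split: prod.splits)
qed

abbreviation idle :: "nat \<Rightarrow> cell" where
  "idle \<equiv> cells (\<lambda>_. {}) (\<lambda>_. {}) (\<lambda>_. {})"

definition succeeds :: "nat \<Rightarrow> nat \<Rightarrow> bool" where
  "succeeds v i \<longleftrightarrow> good_levels (levels v i) \<and>
     encode_nats (num_vals * Suc (length w) # tuple_nats (query_tuples (levels v i) (Suc (length w)))) \<in> Q"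

lemma looks_attempt:
  assumes s: "looks o' idle [] s" and o': "good o'" "\<not> srch o'" "sel o' = 0" and v: "var s 3 = v" "v < n"
  shows "looks (o'\<lparr>found := found o' \<or> succeeds v i\<rparr>) idle [] (sem Q w (attempt i) s)"
proof -
  define S where "S = levels v i"
  let ?E = "\<lambda>_ :: nat. {} :: nat set"
  \<comment> \<open>The preceding pass over the array puts the mark 0 into every cell up to
    \<open>length w\<close>, also into those from \<open>n\<close> on.\<close>
  let ?I = "\<lambda>x. if x = v then {i} else {}" and ?Z = "\<lambda>u. if u \<le> length w then {0 :: nat} else {}"
  define F where "F = reach (rule_step 3 flag_rule S ?E) ?Z"
  have S: "S u = {}" if "length w < u" for u
    using levels_support[OF v(2), of _ i u] that n_le by (force simp: S_def)
  have flag: "1 \<in> F u \<longleftrightarrow> has_up S u" "2 \<in> F u \<longleftrightarrow> has_down S u" "F u \<subseteq> ?Z u \<union> {\<kappa>. u < n}" for u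
    unfolding F_def by (rule reach_flag; use n_le in simp)+
  have F: "F u = {}" if "length w < u" for u using flag(3)[of u] that n_le by simp
  let ?c1 = "at_cell 3 (\<lambda>o' c. (o', c\<lparr>cmark := {i}\<rparr>)) :: rev_com"
  let ?h = "\<lambda>o' c. o'\<lparr>good := good o' \<and> single_level (cmark c)\<rparr>"
  let ?m1 = "\<lambda>c. c\<lparr>clev := cmark c, cmark := {0}\<rparr>" and ?m2 = "\<lambda>c. c\<lparr>cflag := cmark c, cmark := {}\<rparr>"
  let ?m3 = "\<lambda>c. c\<lparr>clev := {}, cflag := {}, cmark := {}\<rparr>"
  have c0: "idle(v := (idle v)\<lparr>cmark := {i}\<rparr>) = cells ?E ?E ?I" by (auto simp: cells_def fun_eq_iff)
  define s1 where "s1 = sem Q w ?c1 s"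
  have 1: "looks o' (cells ?E ?E ?I) [] s1"
    using looks_at_cell[OF s, of "\<lambda>o' c. (o', c\<lparr>cmark := {i}\<rparr>)" 3 Q w] unfolding s1_def v(1) fst_conv snd_conv c0 .
  define s2 where "s2 = sem Q w (close labels level_rule) s1"
  have "reach (rule_step labels level_rule ?E ?E) ?I = S"
  proof (rule ext)
    show "reach (rule_step labels level_rule ?E ?E) ?I x = S x" for x
      unfolding rule_step_level S_def levels_def by (rule reach_single)
  qed
  then have 2: "looks o' (cells ?E ?E S) [] s2" using looks_close_cells[OF 1, of labels level_rule] by (simp add: s2_def)
  define s3 where "s3 = sem Q w (map_cells ?h ?m1) s2"
  have "looks (fold (\<lambda>u o'. ?h o' (cells ?E ?E S u)) [0..<Suc (length w)] o') (cells S ?E ?Z) [] s3"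
    unfolding s3_def by (rule looks_map_to[OF 2]) (auto simp: cells_def S)
  moreover have "fold (\<lambda>u o'. ?h o' (cells ?E ?E S u)) [0..<Suc (length w)] o' = o'\<lparr>good := good_levels S\<rparr>"
  proof -
    \<comment> \<open>The check inspects only the array; no level is propagated to a number beyond
      it.\<close>
    have "(\<forall>u\<in>set [0..<Suc (length w)]. single_level (S u)) \<longleftrightarrow> (\<forall>u. single_level (S u))"
    proof
      assume a: "\<forall>u\<in>set [0..<Suc (length w)]. single_level (S u)"
      show "\<forall>u. single_level (S u)"
      proof
        fix u show "single_level (S u)"
        proof (cases "length w < u")
          case True
          then show ?thesis by (simp add: S single_level_def)
        next
          case False
          then have "u \<in> set [0..<Suc (length w)]" by auto
          with a show ?thesis by blast
        qed
      qed
    qed simp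
    then show ?thesis unfolding cells_def cell.simps fold_good using o'(1) by (simp add: good_levels_def single_level_def)
  qed
  ultimately have 3: "looks (o'\<lparr>good := good_levels S\<rparr>) (cells S ?E ?Z) [] s3" by (simp only:)
  define s4 where "s4 = sem Q w (close 3 flag_rule) s3"
  have 4: "looks (o'\<lparr>good := good_levels S\<rparr>) (cells S ?E F) [] s4"
    unfolding s4_def F_def by (rule looks_close_cells[OF 3])
  define s5 where "s5 = sem Q w (map_cells (\<lambda>o' c. o') ?m2) s4"
  have "looks (fold (\<lambda>u o'. o') [0..<Suc (length w)] (o'\<lparr>good := good_levels S\<rparr>)) (cells S F ?E) [] s5"
    unfolding s5_def by (rule looks_map_to[OF 4]) (simp_all add: cells_def F)
  then have 5: "looks (o'\<lparr>good := good_levels S\<rparr>) (cells S F ?E) [] s5" unfolding fold_skip .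
  define s6 where "s6 = sem Q w (if_flags good query (Upd id)) s5"
  have 6: "looks (o'\<lparr>good := good_levels S, found := found o' \<or> succeeds v i\<rparr>) (cells S F ?E) [] s6"
  proof (cases "good_levels S")
    case True
    then show ?thesis using looks_query[OF 5 _ _ flag(1,2)] o' unfolding s6_def sem_if_flags[OF 5]
      by (simp add: succeeds_def S_def)
  next
    case False
    then have "s6 = s5" unfolding s6_def sem_if_flags[OF 5] by simp
    then show ?thesis using 5 False by (simp add: succeeds_def S_def)
  qed
  define s7 where "s7 = sem Q w (map_cells (\<lambda>o' c. o') ?m3) s6"
  have "looks (fold (\<lambda>u o'. o') [0..<Suc (length w)] (o'\<lparr>good := good_levels S, found := found o' \<or> succeeds v i\<rparr>)) idle [] s7"
    unfolding s7_def by (rule looks_map_to[OF 6]) (simp_all add: cells_def S F)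
  then have "looks (o'\<lparr>good := good_levels S, found := found o' \<or> succeeds v i\<rparr>) idle [] s7" unfolding fold_skip .
  from looks_upd_flags[OF this, of "\<lambda>o'. o'\<lparr>good := True\<rparr>" Q w]
  moreover have "o'\<lparr>good := good_levels S, found := found o' \<or> succeeds v i\<rparr>\<lparr>good := True\<rparr> = o'\<lparr>found := found o' \<or> succeeds v i\<rparr>"
    using o'(1) by (cases o') simp
  ultimately show ?thesis
    unfolding attempt_def sem.simps s1_def s2_def s3_def s4_def s5_def s6_def s7_def by (simp only:)
qed

definition flag_state :: "bool \<Rightarrow> bool \<Rightarrow> flags" where
  "flag_state f a = \<lparr>found = f, okay = a, good = True, srch = False, sel = 0\<rparr>"

lemma looks_attempt_list:
  "looks (flag_state f a) idle [] s \<Longrightarrow> var s 3 = v \<Longrightarrow> v < n \<Longrightarrow>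
    looks (flag_state (f \<or> (\<exists>i\<in>set is. succeeds v i)) a) idle [] (sem Q w (seq_all (map attempt is)) s)"
proof (induction "is" arbitrary: f s)
  case (Cons i "is")
  have "3 \<notin> assigned (attempt i)" using assigned_attempt[of i] by auto
  then have "var (sem Q w (attempt i) s) 3 = v" using sem_unassigned[of 3 "attempt i" Q w s] Cons.prems(2) by simp
  moreover have "looks (flag_state (f \<or> succeeds v i) a) idle [] (sem Q w (attempt i) s)"
    using looks_attempt[OF Cons.prems(1) _ _ _ Cons.prems(2,3), of i] by (simp add: flag_state_def)
  ultimately show ?case using Cons.IH[of "f \<or> succeeds v i" "sem Q w (attempt i) s"] Cons.prems(3)
    by (simp add: sem_seq_all disj_assoc)
qed (simp add: sem_seq_all)

lemma looks_attempts:
  assumes s: "looks (flag_state False a) idle [] s" "var s 3 = v"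
  shows "looks (flag_state False (a \<and> (v < n \<longrightarrow> (\<exists>i\<in>{1..height}. succeeds v i)))) idle [] (sem Q w attempts s)"
proof -
  let ?g = "\<lambda>(o' :: flags) (c :: cell). (o'\<lparr>srch := cdom c\<rparr>, c)"
  define s1 where "s1 = sem Q w (at_cell 3 ?g) s"
  have "cdom (idle v) = (v < n)" by (simp add: cells_def)
  then have 1: "looks ((flag_state False a)\<lparr>srch := v < n\<rparr>) idle [] s1"
    using looks_at_cell[OF s(1), of ?g 3 Q w] s(2) by (simp add: s1_def)
  have v1: "var s1 3 = v" using sem_unassigned[of 3 "at_cell 3 ?g"] s(2) by (simp add: s1_def assigned_programs)
  show ?thesis
  proof (cases "v < n")
    case False
    then show ?thesis using 1 unfolding attempts_def sem.simps s1_def[symmetric] sem_if_flags[OF 1]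
      by (simp add: flag_state_def)
  next
    case True
    let ?c = "upd_flags (\<lambda>o'. o'\<lparr>srch := False\<rparr>) :: rev_com"
    let ?u = "\<lambda>o'. o'\<lparr>okay := okay o' \<and> found o', found := False\<rparr>"
    have 2: "looks (flag_state False a) idle [] (sem Q w ?c s1)"
      using looks_upd_flags[OF 1, of "\<lambda>o'. o'\<lparr>srch := False\<rparr>" Q w] by (simp add: flag_state_def)
    have v2: "var (sem Q w ?c s1) 3 = v" using sem_unassigned[of 3 ?c] v1 by (simp add: assigned_programs)
    have at: "atLeastLessThan 1 (Suc height) = {1..height}" by auto
    from looks_upd_flags[OF looks_attempt_list[OF 2 v2 True, of "[1..<Suc height]"], of ?u Q w]
    have "looks (flag_state False (a \<and> (\<exists>i\<in>{1..height}. succeeds v i))) idle []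
      (sem Q w (upd_flags ?u) (sem Q w (seq_all (map attempt [1..<Suc height])) (sem Q w ?c s1)))"
      unfolding set_upt at by (simp add: flag_state_def)
    then show ?thesis using True unfolding attempts_def sem.simps s1_def[symmetric] sem_if_flags[OF 1]
      by (simp add: flag_state_def)
  qed
qed

lemma looks_all_attempts:
  assumes "looks (flag_state False True) idle [] s"
  shows "looks (flag_state False (\<forall>v<n. \<exists>i\<in>{1..height}. succeeds v i)) idle [] (sem Q w (For 3 attempts) s)"
proof -
  let ?O = "\<lambda>k. flag_state False (\<forall>v<k. v < n \<longrightarrow> (\<exists>i\<in>{1..height}. succeeds v i))"
  have "looks (?O (Suc (length w))) idle [] (sem Q w (For 3 attempts) s)"
  proof (rule looks_for[where O' = ?O and A = "\<lambda>_. idle" and Z = "\<lambda>_. []"])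
    show "looks (?O 0) idle [] s" using assms by simp
    fix k s assume "looks (?O k) idle [] s" "var s 3 = k"
    from looks_attempts[OF this] show "looks (?O (Suc k)) idle [] (sem Q w attempts s)"
      by (simp only: less_Suc_eq all_simps all_conj_distrib) (auto elim!: back_subst[where P = "\<lambda>a. looks (flag_state False a) _ _ _"])
  qed simp
  moreover have "(\<forall>v<Suc (length w). v < n \<longrightarrow> (\<exists>i\<in>{1..height}. succeeds v i)) \<longleftrightarrow> (\<forall>v<n. \<exists>i\<in>{1..height}. succeeds v i)"
    using n_le by (meson le_imp_less_Suc less_le_trans less_imp_le)
  ultimately show ?thesis by (simp only:)
qed

end

end

section \<open>Recognising well-formed graphs, and the second reduction\<close>

context template
begin

text \<open>Signs are coded by 0 and 1, so a digit counter capped at 2 is enough to detect an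
  illegal sign; endpoints are checked by lookup.\<close>

fun next_gphase :: "gphase \<Rightarrow> nat \<Rightarrow> bool \<Rightarrow> gphase" where
  "next_gphase First k d = Source"
| "next_gphase Source k d = (if d then Target else Bad)"
| "next_gphase Target k d = (if d then Sign else Bad)"
| "next_gphase Sign k d = (if k \<le> 1 then Source else Bad)"
| "next_gphase Bad k d = Bad"

abbreviation gphase_step :: "nat \<Rightarrow> nat \<Rightarrow> gphase \<Rightarrow> gphase" where
  "gphase_step n k p \<equiv> next_gphase p (min k 2) (k < n)"

lemma gphase_bad: "fold (gphase_step n) ns Bad = Bad"
  by (induction ns) auto

lemma gphase_edge: "fold (gphase_step n) (x # y # k # ns) Source = Source \<longleftrightarrow>
    x < n \<and> y < n \<and> k \<le> 1 \<and> fold (gphase_step n) ns Source = Source"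
  by (auto simp: gphase_bad)

lemma gphase_accepts:
  "fold (gphase_step n) ns Source = Source \<longleftrightarrow> (\<exists>es. ns = edge_nats es \<and> (\<forall>(x, y, s)\<in>set es. x < n \<and> y < n))"
proof
  assume "\<exists>es. ns = edge_nats es \<and> (\<forall>(x, y, s)\<in>set es. x < n \<and> y < n)"
  then obtain es where es: "ns = edge_nats es" "\<forall>(x, y, s)\<in>set es. x < n \<and> y < n" by blast
  from es(2) have "fold (gphase_step n) (edge_nats es) Source = Source"
  proof (induction es)
    case (Cons e es)
    obtain x y s where e: "e = (x, y, s)" by (rule prod_cases3)
    have "sign_code s \<le> 1" by (cases s) simp_all
    moreover have "x < n \<and> y < n" "\<forall>(x, y, s)\<in>set es. x < n \<and> y < n" using Cons.prems by (simp_all add: e)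
    ultimately show ?case using Cons.IH unfolding e edge_nats_simps gphase_edge by blast
  qed (simp add: edge_nats_simps)
  then show "fold (gphase_step n) ns Source = Source" by (simp add: es(1))
next
  show "fold (gphase_step n) ns Source = Source \<Longrightarrow> \<exists>es. ns = edge_nats es \<and> (\<forall>(x, y, s)\<in>set es. x < n \<and> y < n)"
  proof (induction "length ns" arbitrary: ns rule: less_induct)
    case less
    consider "ns = []" | x where "ns = [x]" | x y where "ns = [x, y]" | x y k ns' where "ns = x # y # k # ns'"
      by (metis list.exhaust)
    then show ?case
    proof cases
      case 1
      then show ?thesis by (intro exI[of _ "[]"]) (simp add: edge_nats_simps)
    next
      case (2 x)
      then show ?thesis using less.prems by (simp split: if_splits)
    next
      case (3 x y)
      then show ?thesis using less.prems by (simp split: if_splits)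
    next
      case (4 x y k ns')
      have xy: "x < n" "y < n" "k \<le> 1" "fold (gphase_step n) ns' Source = Source"
        using less.prems unfolding 4 gphase_edge by blast+
      have "length ns' < length ns" by (simp add: 4)
      from less.hyps[OF this xy(4)] obtain es where es: "ns' = edge_nats es" "\<forall>(x, y, s)\<in>set es. x < n \<and> y < n" by blast
      have "\<exists>s. k = sign_code s"
      proof (cases "k = 0")
        case True
        then show ?thesis by (intro exI[of _ Pos]) simp
      next
        case False
        then show ?thesis using xy(3) by (intro exI[of _ Neg]) simp
      qed
      then obtain s where "k = sign_code s" by blast
      then show ?thesis using xy es by (intro exI[of _ "(x, y, s) # es"]) (simp add: 4 edge_nats_simps)
    qed
  qed
qed

definition check :: rev_com where
  "check = At 0 (\<lambda>(k, (p, t), o') c. ((k, (next_gphase p k (cdom c), t), o'), c))"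

definition well_formed :: "(cell, flags) greg \<Rightarrow> bool" where
  "well_formed r \<longleftrightarrow> fst r = 0 \<and> fst (fst (snd r)) = Source"

text \<open>\<open>okay\<close> is false at the start, so malformed words are rejected; for the
  others it becomes true, the neutral value of the conjunction over the vertices.\<close>

definition rev_program :: rev_com where
  "rev_program = (mark_initial (\<lambda>c. c\<lparr>cdom := True\<rparr>) ;; num_scan 2 check ;;
     Cond well_formed
       (upd_flags (\<lambda>o'. o'\<lparr>okay := True\<rparr>) ;; For 3 attempts) (Upd id))"

definition blank_cell :: cell where
  "blank_cell = \<lparr>cdom = False, clev = {}, cflag = {}, cmark = {}\<rparr>"

definition check_mem :: "gphase \<Rightarrow> nat \<Rightarrow> ((cell, flags) greg, cell) mem" where
  "check_mem p n = \<lparr>reg = (0, (p, blank_cell, blank_cell), \<lparr>found = False, okay = False, good = True, srch = False, sel = 0\<rparr>),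
     var = \<lambda>_. 0, arr = (\<lambda>u. blank_cell\<lparr>cdom := u < n\<rparr>), out = []\<rparr>"

lemma visit_check: "visit Q w 2 check k (check_mem p n) = check_mem (gphase_step n k p) n"
  by (auto simp: visit_def at_num_def check_mem_def check_def fun_eq_iff blank_cell_def)

lemma fold_visit_check: "fold (visit Q w 2 check) ns (check_mem p n) = check_mem (fold (gphase_step n) ns p) n"
  by (induction ns arbitrary: p) (simp_all only: fold_simps visit_check)

definition rev_start :: "((cell, flags) greg, cell) mem" where
  "rev_start = start (0, (First, blank_cell, blank_cell), \<lparr>found = False, okay = False, good = True, srch = False, sel = 0\<rparr>) blank_cell"

lemma rev_program_accepts:
  assumes H: "\<And>G :: nat signed_graph. (\<exists>\<phi>. ec_hom G H \<phi>) \<longleftrightarrow> (\<exists>\<phi>. ec_hom G tgraph \<phi>)"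
  shows "okay (snd (snd (reg (sem (CSP \<tau> T) w rev_program rev_start)))) \<longleftrightarrow> w \<in> ec_Hom H"
proof -
  let ?Q = "CSP \<tau> T"
  obtain ns m where w: "w = encode_nats ns @ replicate m True" by (rule word_cases)
  define k where "k = length (takeWhile id w)"
  have s1: "sem ?Q w (mark_initial (\<lambda>c. c\<lparr>cdom := True\<rparr>)) rev_start = check_mem First k"
    by (subst sem_mark_initial) (auto simp: rev_start_def start_def k_def fun_eq_iff check_mem_def blank_cell_def)
  define s2 where "s2 = check_mem (fold (gphase_step k) ns First) k"
  have "at_num 2 0 (check_mem First k) = check_mem First k"
    by (auto simp: at_num_def fun_eq_iff check_mem_def)
  from sem_num_scan[OF w this, of ?Q check]
  have scan: "sem ?Q w (num_scan 2 check) (check_mem First k) = at_num 2 m s2"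
    unfolding fold_visit_check s2_def .
  have kn: "k = n" if "ns = n # ns'" for n ns' using that initial_encode[of n ns' "replicate m True"] w by (simp add: k_def)
  define valid where "valid \<longleftrightarrow> m = 0 \<and> (\<exists>n es. ns = n # edge_nats es \<and> (\<forall>(x, y, s)\<in>set es. x < n \<and> y < n))"
  have valid: "well_formed (reg (at_num 2 m s2)) \<longleftrightarrow> valid"
  proof (cases ns)
    case Nil
    then show ?thesis by (simp add: valid_def well_formed_def s2_def at_num_def check_mem_def)
  next
    case (Cons n ns')
    have "fold (gphase_step k) ns First = fold (gphase_step n) ns' Source" by (simp add: Cons kn[OF Cons])
    then show ?thesis using gphase_accepts[of n ns'] by (auto simp: valid_def Cons well_formed_def s2_def at_num_def check_mem_def)
  qed
  show ?thesis
  proof (cases valid)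
    case False
    then have "sem ?Q w rev_program rev_start = at_num 2 m s2"
      unfolding rev_program_def sem.simps(9,10) s1 scan valid by (simp add: id_def)
    then have "\<not> okay (snd (snd (reg (sem ?Q w rev_program rev_start))))" by (simp add: at_num_def s2_def check_mem_def)
    moreover have "w \<notin> ec_Hom H" unfolding w ec_Hom_word using False unfolding valid_def by blast
    ultimately show ?thesis by blast
  next
    case True
    then obtain n es where v: "m = 0" "ns = n # edge_nats es" "\<forall>(x, y, s)\<in>set es. x < n \<and> y < n" unfolding valid_def by blast
    interpret template_instance \<tau> T syms n es by unfold_locales (use v(3) in blast)
    have w': "w = encode_nats (n # edge_nats es)" by (simp add: w v)
    have k: "k = n" using kn[OF v(2)] .
    have "fold (gphase_step k) ns First = Source"
      using gphase_accepts[of n "edge_nats es"] v(3) by (auto simp: v(2) k)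
    then have s2: "at_num 2 m s2 = check_mem Source n"
      by (auto simp: s2_def k v(1) at_num_def fun_eq_iff check_mem_def)
    have wf: "well_formed (reg (check_mem Source n))" by (simp add: well_formed_def check_mem_def)
    let ?s = "sem ?Q w (upd_flags (\<lambda>o'. o'\<lparr>okay := True\<rparr>)) (check_mem Source n)"
    have "looks (flag_state False False) idle [] (check_mem Source n)"
      by (simp add: looks_def check_mem_def flag_state_def cells_def[abs_def] blank_cell_def)
    from looks_upd_flags[OF this, of "\<lambda>o'. o'\<lparr>okay := True\<rparr>" ?Q w]
    have "looks (flag_state False True) idle [] ?s" by (simp add: flag_state_def)
    from looks_all_attempts[OF w' this]
    have "okay (snd (snd (reg (sem ?Q w (For 3 attempts) ?s)))) \<longleftrightarrow> (\<forall>v<n. \<exists>i\<in>{1..height}. succeeds ?Q w v i)"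
      by (simp add: looks_def flag_state_def)
    moreover have "sem ?Q w rev_program rev_start = sem ?Q w (For 3 attempts) ?s"
      unfolding rev_program_def sem.simps(9,10) s1 scan s2 if_P[OF wf] ..
    moreover have "succeeds ?Q w v i \<longleftrightarrow> good_levels (levels v i) \<and> (\<exists>val. solution (levels v i) val)" for v i
    proof -
      have "n \<le> Suc (length w)" using n_le[OF w'] by simp
      then show ?thesis unfolding succeeds_def[OF w'] using query_word[of "Suc (length w)" "levels v i"] by simp
    qed
    ultimately have "okay (snd (snd (reg (sem ?Q w rev_program rev_start)))) \<longleftrightarrow> (\<exists>\<phi>. ec_hom igraph tgraph \<phi>)"
      unfolding hom_iff_solutions by simp
    also have "\<dots> \<longleftrightarrow> (\<exists>\<phi>. ec_hom (edge_graph n es) H \<phi>)"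
      unfolding H by (simp add: igraph_def edge_graph_def)
    also have "\<dots> \<longleftrightarrow> w \<in> ec_Hom H"
    proof
      assume "\<exists>\<phi>. ec_hom (edge_graph n es) H \<phi>"
      then show "w \<in> ec_Hom H" unfolding w ec_Hom_word using v by blast
    next
      assume "w \<in> ec_Hom H"
      then obtain n' es' where *: "ns = n' # edge_nats es'" "\<exists>\<phi>. ec_hom (edge_graph n' es') H \<phi>"
        unfolding w ec_Hom_word by blast
      then have "n' = n" "es' = es" using v(2) edge_nats_inj by auto
      then show "\<exists>\<phi>. ec_hom (edge_graph n es) H \<phi>" using * by simp
    qed
    finally show ?thesis .
  qed
qed

section \<open>Finiteness of the cells and registers of the second reduction\<close>

definition rev_cells :: "cell set" where
  "rev_cells = {c. clev c \<subseteq> {..<labels} \<and> cflag c \<subseteq> {..<labels} \<and> cmark c \<subseteq> {..<labels}}"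

definition rev_flags :: "flags set" where
  "rev_flags = {o'. sel o' \<le> labels}"

lemma finite_rev_cells: "finite rev_cells"
proof -
  have "rev_cells \<subseteq> (\<lambda>(a, b, c, d). \<lparr>cdom = a, clev = b, cflag = c, cmark = d\<rparr>) `
     (UNIV \<times> Pow {..<labels} \<times> Pow {..<labels} \<times> Pow {..<labels})"
  proof
    fix c assume "c \<in> rev_cells"
    then show "c \<in> (\<lambda>(a, b, c, d). \<lparr>cdom = a, clev = b, cflag = c, cmark = d\<rparr>) `
      (UNIV \<times> Pow {..<labels} \<times> Pow {..<labels} \<times> Pow {..<labels})"
      by (intro image_eqI[of _ _ "(cdom c, clev c, cflag c, cmark c)"]) (auto simp: rev_cells_def)
  qed
  then show ?thesis by (rule finite_subset) simp
qed

lemma finite_rev_flags: "finite rev_flags"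
proof -
  have "rev_flags \<subseteq> (\<lambda>(a, b, c, d, e). \<lparr>found = a, okay = b, good = c, srch = d, sel = e\<rparr>) `
     (UNIV \<times> UNIV \<times> UNIV \<times> UNIV \<times> {..labels})"
  proof
    fix c assume "c \<in> rev_flags"
    then show "c \<in> (\<lambda>(a, b, c, d, e). \<lparr>found = a, okay = b, good = c, srch = d, sel = e\<rparr>) `
     (UNIV \<times> UNIV \<times> UNIV \<times> UNIV \<times> {..labels})"
      by (intro image_eqI[of _ _ "(found c, okay c, good c, srch c, sel c)"]) (auto simp: rev_flags_def)
  qed
  then show ?thesis by (rule finite_subset) simp
qed

lemma finite_gphase: "finite (UNIV :: gphase set)"
proof -
  have "(UNIV :: gphase set) \<subseteq> {First, Source, Target, Sign, Bad}"
  proof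
    fix p :: gphase show "p \<in> {First, Source, Target, Sign, Bad}" by (cases p) simp_all
  qed
  then show ?thesis by (rule finite_subset) simp
qed

abbreviation rev_regs :: "(cell, flags) greg set" where
  "rev_regs \<equiv> gregs rev_cells rev_flags"

lemma finite_rev_regs: "finite rev_regs"
  by (simp add: gregs_def finite_rev_cells finite_rev_flags finite_gphase)

lemma label_bounds: "3 \<le> labels" "num_vals \<le> labels" "height < labels"
  by (simp_all add: labels_def num_vals_def height_def)

lemma pick_flags: "o' \<in> rev_flags \<Longrightarrow> c \<in> rev_cells \<Longrightarrow> pick o' c \<in> rev_flags"
proof -
  assume o': "o' \<in> rev_flags" and c: "c \<in> rev_cells"
  have "Min (cmark c) \<le> labels" if "cmark c \<noteq> {}"
  proof -
    have "cmark c \<subseteq> {..<labels}" using c by (simp add: rev_cells_def)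
    then have "Min (cmark c) < labels" using Min_in[OF finite_subset[OF _ finite_lessThan] that] by blast
    then show ?thesis by simp
  qed
  then show ?thesis using o' label_bounds by (auto simp: pick_def rev_flags_def)
qed

lemma wf_closes: "b \<le> labels \<Longrightarrow> wf_com 8 rev_regs rev_cells (close b R)"
  by (rule wf_close) (auto simp: spread_def rev_cells_def)

lemma wf_emit: "wf_com 8 rev_regs rev_cells emit_tuples"
proof -
  have "wf_com 8 rev_regs rev_cells emit_sel" "assigned emit_sel = {}"
    by (auto simp: emit_sel_def wf_seq_all wf_if_flags assigned_seq_all assigned_programs)
  then have code: "wf_com 8 rev_regs rev_cells emit_code"
    unfolding emit_code_def by (auto simp: assigned_programs rev_flags_def intro!: wf_at_cell wf_upd_flags pick_flags[unfolded rev_flags_def, simplified])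
  have "wf_com 8 rev_regs rev_cells (emit_class \<kappa>)" if "\<kappa> < num_vals" for \<kappa>
    unfolding emit_class_def using code wf_closes[of labels value_rule] that label_bounds
    by (auto simp: rev_cells_def intro!: wf_at_cell wf_map_cells)
  then have "wf_com 8 rev_regs rev_cells (emit_tuple \<sigma>)" if "\<sigma> \<in> set syms" for \<sigma>
    using idx_in[OF that] by (auto simp: emit_tuple_def wf_seq_all emit_word_props num_vals_def)
  then show ?thesis unfolding emit_tuples_def
    by (auto simp: wf_seq_all wf_if_flags rev_flags_def intro!: wf_at_cell wf_upd_flags)
qed

lemma wf_attempts: "wf_com 8 rev_regs rev_cells attempts"
proof -
  have "6 \<notin> assigned emit_tuples" using assigned_emit(3) by auto
  moreover have "wf_com 8 rev_regs rev_cells (Ask (\<lambda>(k, t, o') b. (k, t, o'\<lparr>found := found o' \<or> b\<rparr>)))"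
    by (auto simp: gregs_def rev_flags_def)
  ultimately have "wf_com 8 rev_regs rev_cells query"
    unfolding query_def using wf_emit by (simp add: emit_word_props)
  then have "wf_com 8 rev_regs rev_cells (attempt i)" if "i \<in> set [1..<Suc height]" for i
    unfolding attempt_def using that label_bounds wf_closes[of labels level_rule] wf_closes[of 3 flag_rule]
    by (auto simp: wf_if_flags rev_cells_def rev_flags_def intro!: wf_at_cell wf_upd_flags wf_map_cells)
  then show ?thesis unfolding attempts_def
    by (auto simp: wf_seq_all wf_if_flags rev_flags_def intro!: wf_at_cell wf_upd_flags)
qed

lemma wf_rev_program: "wf_com 8 rev_regs rev_cells rev_program"
proof -
  have 3: "3 \<notin> assigned attempts"
    using assigned_attempt by (fastforce simp: attempts_def assigned_programs assigned_seq_all)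
  have "wf_com 8 rev_regs rev_cells (mark_initial (\<lambda>c. c\<lparr>cdom := True\<rparr>))"
    unfolding gregs_def by (rule wf_mark_initial) (auto simp: rev_cells_def)
  moreover have "wf_com 8 rev_regs rev_cells (num_scan 2 check)"
    unfolding gregs_def by (rule wf_num_scan) (auto simp: check_def)
  ultimately show ?thesis unfolding rev_program_def using wf_attempts 3
    by (auto simp: rev_flags_def intro!: wf_upd_flags)
qed

theorem ec_Hom_reducible:
  assumes "\<And>G :: nat signed_graph. (\<exists>\<phi>. ec_hom G H \<phi>) \<longleftrightarrow> (\<exists>\<phi>. ec_hom G tgraph \<phi>)"
  shows "poly_turing_reducible (ec_Hom H) (CSP \<tau> T)"
proof -
  let ?r = "(0, (First, blank_cell, blank_cell), \<lparr>found = False, okay = False, good = True, srch = False, sel = 0\<rparr>)"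
  have r: "?r \<in> rev_regs" "blank_cell \<in> rev_cells"
    by (simp_all add: gregs_def rev_cells_def rev_flags_def blank_cell_def)
  show ?thesis
    by (rule poly_turing_reducible_com[OF finite_rev_regs finite_rev_cells r wf_rev_program,
          where acc = "\<lambda>r. okay (snd (snd r))"])
      (rule rev_program_accepts[OF assms, unfolded rev_start_def])
qed

end

theorem theorem3p1:
  fixes \<tau> :: vocabulary and T :: "'a rel_structure"
  assumes "finite \<tau>" and "is_structure \<tau> T"
  shows "\<exists>H :: nat signed_graph. is_signed_graph H \<and>
           poly_equivalent (ec_Hom H) (CSP \<tau> T) \<and>
           bipartite H \<and>
           (\<exists>P :: nat signed_graph. alternating_path P \<and> (\<exists>\<phi>. ec_hom H P \<phi>))"
proof -
  have "finite {\<sigma> \<in> \<tau>. rel T \<sigma> \<noteq> {}}" using assms(1) by simp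
  from finite_distinct_list[OF this] obtain syms where "set syms = {\<sigma> \<in> \<tau>. rel T \<sigma> \<noteq> {}}" "distinct syms"
    by (elim exE conjE)
  with assms interpret template \<tau> T syms by unfold_locales
  have "finite (verts tgraph)" using tgraph_signed_graph by (simp add: is_signed_graph_def)
  \<comment> \<open>The nodes contain elements and tuples of \<open>T\<close>; a renaming turns them
    into natural numbers and leaves the existence of homomorphisms unchanged.\<close>
  then obtain f :: "_ \<Rightarrow> nat" where f: "inj_on f (verts tgraph)"
    using finite_imp_inj_to_nat_seg by metis
  let ?H = "relabel f tgraph"
  have hom: "(\<exists>\<phi>. ec_hom G ?H \<phi>) \<longleftrightarrow> (\<exists>\<phi>. ec_hom G tgraph \<phi>)" for G :: "nat signed_graph"
    by (rule relabel_hom_into[OF tgraph_signed_graph f])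
  show ?thesis
  proof (rule exI[of _ ?H], intro conjI)
    show "is_signed_graph ?H" by (rule relabel_signed_graph[OF tgraph_signed_graph])
    show "poly_equivalent (ec_Hom ?H) (CSP \<tau> T)"
      unfolding poly_equivalent_def by (rule conjI[OF ec_Hom_reducible[OF hom] CSP_reducible[OF hom]])
    show "bipartite ?H" using relabel_bipartite[OF tgraph_bipartite f] .
    show "\<exists>P :: nat signed_graph. alternating_path P \<and> (\<exists>\<phi>. ec_hom ?H P \<phi>)"
      by (rule exI[of _ tpath], rule conjI[OF tpath_alternating relabel_hom_from[OF tgraph_signed_graph f hom_to_tpath]])
  qed
qed

end
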